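(* Let $G$ be a finite group and let $k$ be a field whose characteristic divides the order of $G$. Let $f: M \to N$ be an irreducible map with $M$ and $N$ non-projective indecomposables in $\mathrm{stmod}(kG)$, and let $(\mathcal{P},\mathcal{I})$ be a projective class on $\mathrm{StMod}(kG)$. If $M$ and $N$ have finite lengths with respect to $(\mathcal{P},\mathcal{I})$, then \[ \mathrm{len}_{\mathcal{P}}(M)-1 \le \mathrm{len}_{\mathcal{P}}(N) \le \mathrm{len}_{\mathcal{P}}(M)+1 . \] In particular, for $M$ indecomposable and non-projective in $\mathrm{stmod}(kG)$ with finite length, and $S$ any non-zero (in $\mathrm{StMod}(kG)$) summand of the heart $H(M)$, we have \[ \mathrm{len}_{\mathcal{P}}(M)-1 \le \mathrm{len}_{\mathcal{P}}(S) \le \mathrm{len}_{\mathcal{P}}(M)+1 . \]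
   Context: $\mathrm{StMod}(kG)$ is the stable module category (left $kG$-modules, with maps modulo those factoring through a projective), a triangulated category with desuspension $\Omega M$ the kernel of a surjection from a projective onto $M$, and $\Sigma=\Omega^{-1}$; $\mathrm{stmod}(kG)$ is the full subcategory of modules stably isomorphic to finitely generated ones. A map $\lambda:M\to N$ in $\mathrm{StMod}(kG)$ is irreducible if it is not split monic or split epic, and for any factorization $\lambda=\nu\circ\mu$, either $\mu$ is split monic or $\nu$ is split epic. A triangle $X\xrightarrow{\alpha}Y\xrightarrow{\beta}Z\xrightarrow{\gamma}\Sigma X$ is an Auslander-Reiten triangle if $\gamma\ne0$, any map $X\to Y'$ that is not split monic factors through $\alpha$, and any map $Y'\to Z$ that is not split epic factors through $\beta$. For each indecomposable non-projective $M\in\mathrm{stmod}(kG)$ there is an Auslander-Reiten triangle $\Omega^2M\to H(M)\to M\to\Omega M$, unique up to isomorphism, and $H(M)$ is called the heart of $M$. A (stable) projective class in a triangulated category $\mathbb{T}$ consists of a class $\mathcal{P}$ of objects and a class $\mathcal{I}$ of morphisms such that: (i) $\mathcal{P}$ consists of exactly the objects $P$ such that every composite $P\to X\to Y$ is zero for each $X\to Y$ in $\mathcal{I}$; (ii) $\mathcal{I}$ consists of exactly the maps $X\to Y$ such that every composite $P\to X\to Y$ is zero for each $P\in\mathcal{P}$; (iii) for each $X$ in $\mathbb{T}$ there is a cofibre sequence (distinguished triangle) $P\to X\to Y$ with $P\in\mathcal{P}$ and $X\to Y$ in $\mathcal{I}$; and $\mathcal{P}$ (equivalently $\mathcal{I}$)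 is closed under suspension and desuspension. $\mathcal{I}^n$ is the ideal of all $n$-fold composites of maps in $\mathcal{I}$, with $\mathcal{I}^0$ all maps. $\mathcal{P}_0$ consists of all zero objects, $\mathcal{P}_1=\mathcal{P}$, and $X\in\mathcal{P}_n$ iff $X$ is a retract of an object $Y$ in a cofibre sequence $P\to Y\to Q$ with $P\in\mathcal{P}$ and $Q\in\mathcal{P}_{n-1}$. The length $\mathrm{len}_{\mathcal{P}}(X)$ is the smallest $n$ with $X\in\mathcal{P}_n$, if it exists (equivalently, the smallest $n$ such that every map in $\mathcal{I}^n$ with domain $X$ is zero). *)

theory Defs
  imports "HOL-Algebra.Module" "HOL-Algebra.AbelCoset" "HOL-Library.Equipollence"
begin

section \<open>Rings and left modules\<close>

definition ring_char :: "('k, 'x) ring_scheme \<Rightarrow> nat" where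
  "ring_char K =
    (if \<exists>n::nat. n > 0 \<and> [n] \<cdot>\<^bsub>K\<^esub> \<one>\<^bsub>K\<^esub> = \<zero>\<^bsub>K\<^esub>
     then LEAST n::nat. n > 0 \<and> [n] \<cdot>\<^bsub>K\<^esub> \<one>\<^bsub>K\<^esub> = \<zero>\<^bsub>K\<^esub> else 0)"

text \<open>The group algebra of a finite group: the function \<open>f\<close> stands for the formal sum
  of the \<open>f x\<close> times \<open>x\<close>, so multiplication is convolution.\<close>

definition group_algebra ::
    "('k, 'x) ring_scheme \<Rightarrow> ('g, 'y) monoid_scheme \<Rightarrow> ('g \<Rightarrow> 'k) ring" where
  "group_algebra K G =
    \<lparr> carrier = carrier G \<rightarrow>\<^sub>E carrier K,
      mult = (\<lambda>f g. \<lambda>x\<in>carrier G.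
                finsum K (\<lambda>y. f y \<otimes>\<^bsub>K\<^esub> g (inv\<^bsub>G\<^esub> y \<otimes>\<^bsub>G\<^esub> x)) (carrier G)),
      one = (\<lambda>x\<in>carrier G. if x = \<one>\<^bsub>G\<^esub> then \<one>\<^bsub>K\<^esub> else \<zero>\<^bsub>K\<^esub>),
      zero = (\<lambda>x\<in>carrier G. \<zero>\<^bsub>K\<^esub>),
      add = (\<lambda>f g. \<lambda>x\<in>carrier G. f x \<oplus>\<^bsub>K\<^esub> g x) \<rparr>"

text \<open>The library locale \<^locale>\<open>module\<close> requires a commutative ring of scalars; the axioms
  below are the same ones over an arbitrary ring.  The underlying record of \<open>M\<close> is that of the
  library, whose \<open>mult\<close> and \<open>one\<close> fields play no role.\<close>

locale left_module = R?: ring + M?: abelian_group M for M (structure) +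
  assumes smult_closed:
      "\<lbrakk>a \<in> carrier R; x \<in> carrier M\<rbrakk> \<Longrightarrow> a \<odot>\<^bsub>M\<^esub> x \<in> carrier M"
    and smult_l_distr:
      "\<lbrakk>a \<in> carrier R; b \<in> carrier R; x \<in> carrier M\<rbrakk> \<Longrightarrow>
       (a \<oplus> b) \<odot>\<^bsub>M\<^esub> x = a \<odot>\<^bsub>M\<^esub> x \<oplus>\<^bsub>M\<^esub> b \<odot>\<^bsub>M\<^esub> x"
    and smult_r_distr:
      "\<lbrakk>a \<in> carrier R; x \<in> carrier M; y \<in> carrier M\<rbrakk> \<Longrightarrow>
       a \<odot>\<^bsub>M\<^esub> (x \<oplus>\<^bsub>M\<^esub> y) = a \<odot>\<^bsub>M\<^esub> x \<oplus>\<^bsub>M\<^esub> a \<odot>\<^bsub>M\<^esub> y"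
    and smult_assoc:
      "\<lbrakk>a \<in> carrier R; b \<in> carrier R; x \<in> carrier M\<rbrakk> \<Longrightarrow>
       (a \<otimes> b) \<odot>\<^bsub>M\<^esub> x = a \<odot>\<^bsub>M\<^esub> (b \<odot>\<^bsub>M\<^esub> x)"
    and smult_one:
      "x \<in> carrier M \<Longrightarrow> \<one> \<odot>\<^bsub>M\<^esub> x = x"

text \<open>The type \<open>'u\<close> plays the role of a universe of sets: modules are carried by subsets of
  \<open>'u\<close> of smaller cardinality than \<open>'u\<close>.  If the cardinality of \<open>'u\<close> is inaccessible, these are,
  up to isomorphism, all modules in the corresponding Grothendieck universe.\<close>

definition lmod :: "('r, 'x) ring_scheme \<Rightarrow> ('r, 'u) module set" where
  "lmod R = {M. left_module R M \<and> carrier M \<prec> (UNIV :: 'u set)}"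

definition mod_hom ::
    "('r, 'x) ring_scheme \<Rightarrow> ('r, 'u) module \<Rightarrow> ('r, 'u) module \<Rightarrow> ('u \<Rightarrow> 'u) set" where
  "mod_hom R M N = {f \<in> carrier M \<rightarrow>\<^sub>E carrier N.
     (\<forall>x\<in>carrier M. \<forall>y\<in>carrier M. f (x \<oplus>\<^bsub>M\<^esub> y) = f x \<oplus>\<^bsub>N\<^esub> f y) \<and>
     (\<forall>a\<in>carrier R. \<forall>x\<in>carrier M. f (a \<odot>\<^bsub>M\<^esub> x) = a \<odot>\<^bsub>N\<^esub> f x)}"

definition fin_gen :: "('r, 'x) ring_scheme \<Rightarrow> ('r, 'u) module \<Rightarrow> bool" where
  "fin_gen R M \<longleftrightarrow> (\<exists>A \<subseteq> carrier M. finite A \<and>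
     (\<forall>m\<in>carrier M. \<exists>c\<in>A \<rightarrow> carrier R. m = finsum M (\<lambda>a. c a \<odot>\<^bsub>M\<^esub> a) A))"

definition projective :: "('r, 'x) ring_scheme \<Rightarrow> ('r, 'u) module \<Rightarrow> bool" where
  "projective R P \<longleftrightarrow> P \<in> lmod R \<and>
     (\<forall>M\<in>lmod R. \<forall>N\<in>lmod R. \<forall>q\<in>mod_hom R M N. q ` carrier M = carrier N \<longrightarrow>
       (\<forall>f\<in>mod_hom R P N. \<exists>g\<in>mod_hom R P M. \<forall>x\<in>carrier P. q (g x) = f x))"

definition short_exact ::
    "('r, 'x) ring_scheme \<Rightarrow> ('r, 'u) module \<Rightarrow> ('r, 'u) module \<Rightarrow> ('r, 'u) module \<Rightarrow>
     ('u \<Rightarrow> 'u) \<Rightarrow> ('u \<Rightarrow> 'u) \<Rightarrow> bool" where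
  "short_exact R X Y Z a b \<longleftrightarrow>
     a \<in> mod_hom R X Y \<and> b \<in> mod_hom R Y Z \<and>
     inj_on a (carrier X) \<and> a ` carrier X = a_kernel Y Z b \<and> b ` carrier Y = carrier Z"

section \<open>Categories with suspension and triangles\<close>

record ('o, 'm) tri_cat =
  Obj :: "'o set"
  Arr :: "'m set"
  Dom :: "'m \<Rightarrow> 'o"
  Cod :: "'m \<Rightarrow> 'o"
  Ident :: "'o \<Rightarrow> 'm"
  Comp :: "'m \<Rightarrow> 'm \<Rightarrow> 'm" (infixl \<open>\<bullet>\<index>\<close> 70)
  Zero :: "'o \<Rightarrow> 'o \<Rightarrow> 'm"
  Add :: "'m \<Rightarrow> 'm \<Rightarrow> 'm" (infixl \<open>\<boxplus>\<index>\<close> 65)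
  Susp :: "'o \<Rightarrow> 'o"
  SuspArr :: "'m \<Rightarrow> 'm"
  Desusp :: "'o \<Rightarrow> 'o"
  Tri :: "('m \<times> 'm \<times> 'm) set"

definition Hom :: "('o, 'm, 'z) tri_cat_scheme \<Rightarrow> 'o \<Rightarrow> 'o \<Rightarrow> 'm set" where
  "Hom T X Y = {f \<in> Arr T. Dom T f = X \<and> Cod T f = Y}"

definition full_subcat ::
    "('o, 'm, 'z) tri_cat_scheme \<Rightarrow> 'o set \<Rightarrow> ('o, 'm, 'z) tri_cat_scheme" where
  "full_subcat T S = T\<lparr> Obj := S, Arr := {f \<in> Arr T. Dom T f \<in> S \<and> Cod T f \<in> S} \<rparr>"

definition zero_object :: "('o, 'm, 'z) tri_cat_scheme \<Rightarrow> 'o \<Rightarrow> bool" where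
  "zero_object T X \<longleftrightarrow> X \<in> Obj T \<and>
     (\<forall>Y\<in>Obj T. (\<exists>!f. f \<in> Hom T X Y) \<and> (\<exists>!f. f \<in> Hom T Y X))"

definition split_mono :: "('o, 'm, 'z) tri_cat_scheme \<Rightarrow> 'm \<Rightarrow> bool" where
  "split_mono T f \<longleftrightarrow> (\<exists>r\<in>Hom T (Cod T f) (Dom T f). r \<bullet>\<^bsub>T\<^esub> f = Ident T (Dom T f))"

definition split_epi :: "('o, 'm, 'z) tri_cat_scheme \<Rightarrow> 'm \<Rightarrow> bool" where
  "split_epi T f \<longleftrightarrow> (\<exists>s\<in>Hom T (Cod T f) (Dom T f). f \<bullet>\<^bsub>T\<^esub> s = Ident T (Cod T f))"

definition isos :: "('o, 'm, 'z) tri_cat_scheme \<Rightarrow> 'o \<Rightarrow> 'o \<Rightarrow> 'm set" where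
  "isos T X Y = {f \<in> Hom T X Y. \<exists>g\<in>Hom T Y X.
     g \<bullet>\<^bsub>T\<^esub> f = Ident T X \<and> f \<bullet>\<^bsub>T\<^esub> g = Ident T Y}"

definition retract_of :: "('o, 'm, 'z) tri_cat_scheme \<Rightarrow> 'o \<Rightarrow> 'o \<Rightarrow> bool" where
  "retract_of T X Y \<longleftrightarrow> X \<in> Obj T \<and> Y \<in> Obj T \<and>
     (\<exists>i\<in>Hom T X Y. \<exists>r\<in>Hom T Y X. r \<bullet>\<^bsub>T\<^esub> i = Ident T X)"

definition is_biproduct :: "('o, 'm, 'z) tri_cat_scheme \<Rightarrow> 'o \<Rightarrow> 'o \<Rightarrow> 'o \<Rightarrow> bool" where
  "is_biproduct T X A B \<longleftrightarrow> X \<in> Obj T \<and> A \<in> Obj T \<and> B \<in> Obj T \<and>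
     (\<exists>i\<in>Hom T A X. \<exists>p\<in>Hom T X A. \<exists>j\<in>Hom T B X. \<exists>q\<in>Hom T X B.
        p \<bullet>\<^bsub>T\<^esub> i = Ident T A \<and> q \<bullet>\<^bsub>T\<^esub> j = Ident T B \<and>
        q \<bullet>\<^bsub>T\<^esub> i = Zero T A B \<and> p \<bullet>\<^bsub>T\<^esub> j = Zero T B A \<and>
        (i \<bullet>\<^bsub>T\<^esub> p) \<boxplus>\<^bsub>T\<^esub> (j \<bullet>\<^bsub>T\<^esub> q) = Ident T X)"

definition is_summand :: "('o, 'm, 'z) tri_cat_scheme \<Rightarrow> 'o \<Rightarrow> 'o \<Rightarrow> bool" where
  "is_summand T S X \<longleftrightarrow> (\<exists>S'. is_biproduct T X S S')"

definition indecomposable :: "('o, 'm, 'z) tri_cat_scheme \<Rightarrow> 'o \<Rightarrow> bool" where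
  "indecomposable T X \<longleftrightarrow> X \<in> Obj T \<and> \<not> zero_object T X \<and>
     (\<forall>A B. is_biproduct T X A B \<longrightarrow> zero_object T A \<or> zero_object T B)"

definition irreducible_map :: "('o, 'm, 'z) tri_cat_scheme \<Rightarrow> 'm \<Rightarrow> bool" where
  "irreducible_map T f \<longleftrightarrow> f \<in> Arr T \<and> \<not> split_mono T f \<and> \<not> split_epi T f \<and>
     (\<forall>\<mu>\<in>Arr T. \<forall>\<nu>\<in>Arr T.
        Dom T \<mu> = Dom T f \<and> Cod T \<mu> = Dom T \<nu> \<and> Cod T \<nu> = Cod T f \<and> f = \<nu> \<bullet>\<^bsub>T\<^esub> \<mu> \<longrightarrow>
        split_mono T \<mu> \<or> split_epi T \<nu>)"

definition triangle_shape :: "('o, 'm, 'z) tri_cat_scheme \<Rightarrow> 'm \<times> 'm \<times> 'm \<Rightarrow> bool" where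
  "triangle_shape T t \<longleftrightarrow> (case t of (\<alpha>, \<beta>, \<gamma>) \<Rightarrow>
     \<alpha> \<in> Arr T \<and> \<beta> \<in> Arr T \<and> \<gamma> \<in> Arr T \<and>
     Cod T \<alpha> = Dom T \<beta> \<and> Cod T \<beta> = Dom T \<gamma> \<and> Cod T \<gamma> = Susp T (Dom T \<alpha>))"

definition iso_triangles ::
    "('o, 'm, 'z) tri_cat_scheme \<Rightarrow> 'm \<times> 'm \<times> 'm \<Rightarrow> 'm \<times> 'm \<times> 'm \<Rightarrow> bool" where
  "iso_triangles T t t' \<longleftrightarrow> triangle_shape T t \<and> triangle_shape T t' \<and>
     (case t of (\<alpha>, \<beta>, \<gamma>) \<Rightarrow> case t' of (\<alpha>', \<beta>', \<gamma>') \<Rightarrow>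
        \<exists>u\<in>isos T (Dom T \<alpha>) (Dom T \<alpha>'). \<exists>v\<in>isos T (Cod T \<alpha>) (Cod T \<alpha>').
        \<exists>w\<in>isos T (Cod T \<beta>) (Cod T \<beta>').
          \<alpha>' \<bullet>\<^bsub>T\<^esub> u = v \<bullet>\<^bsub>T\<^esub> \<alpha> \<and> \<beta>' \<bullet>\<^bsub>T\<^esub> v = w \<bullet>\<^bsub>T\<^esub> \<beta> \<and> \<gamma>' \<bullet>\<^bsub>T\<^esub> w = SuspArr T u \<bullet>\<^bsub>T\<^esub> \<gamma>)"

definition AR_triangle :: "('o, 'm, 'z) tri_cat_scheme \<Rightarrow> 'm \<times> 'm \<times> 'm \<Rightarrow> bool" where
  "AR_triangle T t \<longleftrightarrow> t \<in> Tri T \<and> (case t of (\<alpha>, \<beta>, \<gamma>) \<Rightarrow>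
     \<gamma> \<noteq> Zero T (Dom T \<gamma>) (Cod T \<gamma>) \<and>
     (\<forall>g\<in>Arr T. Dom T g = Dom T \<alpha> \<and> \<not> split_mono T g \<longrightarrow>
        (\<exists>h\<in>Hom T (Cod T \<alpha>) (Cod T g). g = h \<bullet>\<^bsub>T\<^esub> \<alpha>)) \<and>
     (\<forall>g\<in>Arr T. Cod T g = Cod T \<beta> \<and> \<not> split_epi T g \<longrightarrow>
        (\<exists>h\<in>Hom T (Dom T g) (Dom T \<beta>). g = \<beta> \<bullet>\<^bsub>T\<^esub> h)))"

text \<open>The third map of the triangle below lands in the suspension of the second desuspension of
  \<open>M\<close>, which is canonically isomorphic to the desuspension of \<open>M\<close>.\<close>

definition is_heart :: "('o, 'm, 'z) tri_cat_scheme \<Rightarrow> 'o \<Rightarrow> 'o \<Rightarrow> bool" where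
  "is_heart T M H \<longleftrightarrow> (\<exists>\<alpha> \<beta> \<gamma>. AR_triangle T (\<alpha>, \<beta>, \<gamma>) \<and>
     \<alpha> \<in> Hom T (Desusp T (Desusp T M)) H \<and> \<beta> \<in> Hom T H M)"

definition projective_class ::
    "('o, 'm, 'z) tri_cat_scheme \<Rightarrow> 'o set \<Rightarrow> 'm set \<Rightarrow> bool" where
  "projective_class T \<P> \<I> \<longleftrightarrow>
     \<P> = {P \<in> Obj T. \<forall>g\<in>\<I>. \<forall>h\<in>Hom T P (Dom T g). g \<bullet>\<^bsub>T\<^esub> h = Zero T P (Cod T g)} \<and>
     \<I> = {g \<in> Arr T. \<forall>P\<in>\<P>. \<forall>h\<in>Hom T P (Dom T g). g \<bullet>\<^bsub>T\<^esub> h = Zero T P (Cod T g)} \<and>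
     (\<forall>X\<in>Obj T. \<exists>p g w. (p, g, w) \<in> Tri T \<and> Dom T p \<in> \<P> \<and> Cod T p = X \<and> g \<in> \<I>) \<and>
     (\<forall>P\<in>\<P>. Susp T P \<in> \<P> \<and> Desusp T P \<in> \<P>)"

fun proj_level :: "('o, 'm, 'z) tri_cat_scheme \<Rightarrow> 'o set \<Rightarrow> nat \<Rightarrow> 'o set" where
  "proj_level T \<P> 0 = {X. zero_object T X}"
| "proj_level T \<P> (Suc 0) = \<P>"
| "proj_level T \<P> (Suc (Suc n)) = {X. \<exists>p q w.
     (p, q, w) \<in> Tri T \<and> Dom T p \<in> \<P> \<and> Cod T q \<in> proj_level T \<P> (Suc n) \<and>
     retract_of T X (Cod T p)}"

definition finite_len :: "('o, 'm, 'z) tri_cat_scheme \<Rightarrow> 'o set \<Rightarrow> 'o \<Rightarrow> bool" where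
  "finite_len T \<P> X \<longleftrightarrow> (\<exists>n. X \<in> proj_level T \<P> n)"

text \<open>Only meaningful for objects of finite length.\<close>

definition len :: "('o, 'm, 'z) tri_cat_scheme \<Rightarrow> 'o set \<Rightarrow> 'o \<Rightarrow> nat" where
  "len T \<P> X = (LEAST n. X \<in> proj_level T \<P> n)"

section \<open>The stable module category\<close>

definition stably_equal ::
    "('r, 'x) ring_scheme \<Rightarrow> ('r, 'u) module \<Rightarrow> ('r, 'u) module \<Rightarrow>
     ('u \<Rightarrow> 'u) \<Rightarrow> ('u \<Rightarrow> 'u) \<Rightarrow> bool" where
  "stably_equal R M N f g \<longleftrightarrow> (\<exists>P. projective R P \<and>
     (\<exists>a\<in>mod_hom R M P. \<exists>b\<in>mod_hom R P N. \<forall>x\<in>carrier M. f x \<ominus>\<^bsub>N\<^esub> g x = b (a x)))"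

text \<open>A map in the stable category is a triple of domain, codomain and an equivalence class of
  homomorphisms.\<close>

type_synonym ('r, 'u) stable_map = "('r, 'u) module \<times> ('r, 'u) module \<times> ('u \<Rightarrow> 'u) set"

definition stable_class ::
    "('r, 'x) ring_scheme \<Rightarrow> ('r, 'u) module \<Rightarrow> ('r, 'u) module \<Rightarrow> ('u \<Rightarrow> 'u) \<Rightarrow>
     ('r, 'u) stable_map" where
  "stable_class R M N f = (M, N, {g \<in> mod_hom R M N. stably_equal R M N f g})"

text \<open>The desuspension is the kernel of a chosen surjection from a projective.  The suspension
  is inverse to it: \<open>susp_data R M\<close> is a chosen exact sequence \<open>M \<rightarrow> P \<rightarrow> S\<close> with \<open>P\<close>
  projective, exhibiting \<open>M\<close> as a desuspension of \<open>S\<close>.  Such a sequence exists for every module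
  over the group algebra of a finite group over a field.\<close>

definition proj_surj ::
    "('r, 'x) ring_scheme \<Rightarrow> ('r, 'u) module \<Rightarrow> ('r, 'u) module \<times> ('u \<Rightarrow> 'u)" where
  "proj_surj R M = (SOME (P, q). projective R P \<and> q \<in> mod_hom R P M \<and>
     q ` carrier P = carrier M)"

definition Omega :: "('r, 'x) ring_scheme \<Rightarrow> ('r, 'u) module \<Rightarrow> ('r, 'u) module" where
  "Omega R M = (case proj_surj R M of (P, q) \<Rightarrow> P\<lparr> carrier := a_kernel P M q \<rparr>)"

definition susp_data ::
    "('r, 'x) ring_scheme \<Rightarrow> ('r, 'u) module \<Rightarrow>
     ('r, 'u) module \<times> ('r, 'u) module \<times> ('u \<Rightarrow> 'u) \<times> ('u \<Rightarrow> 'u)" where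
  "susp_data R M = (SOME (P, S, i, q). projective R P \<and> S \<in> lmod R \<and> short_exact R M P S i q)"

definition Sigma_mod :: "('r, 'x) ring_scheme \<Rightarrow> ('r, 'u) module \<Rightarrow> ('r, 'u) module" where
  "Sigma_mod R M = (case susp_data R M of (P, S, i, q) \<Rightarrow> S)"

text \<open>The sets of homomorphisms in the next two definitions are full stable equivalence classes,
  being closed under stable equality and independent of the choices of representative and of
  extension \<open>g\<close>.\<close>

definition Sigma_map ::
    "('r, 'x) ring_scheme \<Rightarrow> ('r, 'u) stable_map \<Rightarrow> ('r, 'u) stable_map" where
  "Sigma_map R f = (case f of (X, Y, F) \<Rightarrow>
     case susp_data R X of (P, S, i, q) \<Rightarrow>
     case susp_data R Y of (P', S', i', q') \<Rightarrow>
       (S, S', {h \<in> mod_hom R S S'. \<exists>f\<in>F. \<exists>g\<in>mod_hom R P P'.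
          (\<forall>x\<in>carrier X. g (i x) = i' (f x)) \<and> (\<forall>y\<in>carrier P. h (q y) = q' (g y))}))"

definition connecting_map ::
    "('r, 'x) ring_scheme \<Rightarrow> ('r, 'u) module \<Rightarrow> ('r, 'u) module \<Rightarrow> ('r, 'u) module \<Rightarrow>
     ('u \<Rightarrow> 'u) \<Rightarrow> ('u \<Rightarrow> 'u) \<Rightarrow> ('r, 'u) stable_map" where
  "connecting_map R X Y Z a b = (case susp_data R X of (P, S, i, q) \<Rightarrow>
     (Z, S, {h \<in> mod_hom R Z S. \<exists>g\<in>mod_hom R Y P.
        (\<forall>x\<in>carrier X. g (a x) = i x) \<and> (\<forall>y\<in>carrier Y. h (b y) = q (g y))}))"

definition StMod_pre ::
    "('r, 'x) ring_scheme \<Rightarrow> (('r, 'u) module, ('r, 'u) stable_map) tri_cat" where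
  "StMod_pre R =
    \<lparr> Obj = lmod R,
      Arr = {stable_class R M N f | M N f. M \<in> lmod R \<and> N \<in> lmod R \<and> f \<in> mod_hom R M N},
      Dom = (\<lambda>(M, N, F). M),
      Cod = (\<lambda>(M, N, F). N),
      Ident = (\<lambda>M. stable_class R M M (\<lambda>x\<in>carrier M. x)),
      Comp = (\<lambda>(M', L, B) (M, N, A). (M, L, {h \<in> mod_hom R M L.
                \<exists>f\<in>A. \<exists>g\<in>B. stably_equal R M L (compose (carrier M) g f) h})),
      Zero = (\<lambda>M N. stable_class R M N (\<lambda>x\<in>carrier M. \<zero>\<^bsub>N\<^esub>)),
      Add = (\<lambda>(M, N, A) (M', N', B). (M, N, {h \<in> mod_hom R M N.
                \<exists>f\<in>A. \<exists>g\<in>B. stably_equal R M N (\<lambda>x\<in>carrier M. f x \<oplus>\<^bsub>N\<^esub> g x) h})),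
      Susp = Sigma_mod R,
      SuspArr = Sigma_map R,
      Desusp = Omega R,
      Tri = {} \<rparr>"

text \<open>Distinguished triangles are those isomorphic to the ones induced by short exact sequences
  of modules.  (The opposite sign convention for connecting maps gives an isomorphic triangulated
  category and the same triangles up to the sign of the third map.)\<close>

definition StMod ::
    "('r, 'x) ring_scheme \<Rightarrow> (('r, 'u) module, ('r, 'u) stable_map) tri_cat" where
  "StMod R = (StMod_pre R)\<lparr> Tri := {t. \<exists>X\<in>lmod R. \<exists>Y\<in>lmod R. \<exists>Z\<in>lmod R. \<exists>a b.
     short_exact R X Y Z a b \<and>
     iso_triangles (StMod_pre R) t
       (stable_class R X Y a, stable_class R Y Z b, connecting_map R X Y Z a b)} \<rparr>"

definition stmod ::
    "('r, 'x) ring_scheme \<Rightarrow> (('r, 'u) module, ('r, 'u) stable_map) tri_cat" where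
  "stmod R = full_subcat (StMod R)
     {M \<in> lmod R. \<exists>N\<in>lmod R. fin_gen R N \<and> isos (StMod R) M N \<noteq> {}}"

end

theory Submission
imports Defs
begin

text \<open>Everything happens with honest homomorphisms of modules. A homomorphism factors through a
  projective module exactly when it is a trace: a sum over the group of the conjugates of a linear
  map. So stable equality means equality up to traces, and lifting problems become linear algebra.

  For an irreducible \<open>f : M \<rightarrow> N\<close> let \<open>M\<close> have length \<open>m\<close>. Since \<open>f\<close> is not split monic, there is a
  non-split extension \<open>M \<rightarrow> W \<rightarrow> X\<close> along which \<open>f\<close> extends and in which \<open>X\<close> is a double suspension
  of \<open>M\<close>, hence again of length at most \<open>m\<close>. For finite dimensional modules this is Tate duality, and
  it is proved here by hand: a linear functional that separates the identity from the maps through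
  \<open>f\<close> and from the traces is represented, by nondegeneracy of the trace form, by a linear map \<open>w\<close>
  whose trace over the group vanishes, and \<open>w\<close> describes the extension. A non-split extension
  of modules of length \<open>m\<close> has a middle term of length up to \<open>2 m\<close>; but filtering \<open>X\<close> by
  modules of the projective class, one finds the first stage at which the extension fails to split,
  and there it can be replaced by one whose middle term \<open>W'\<close> has length at most \<open>m + 1\<close>. So \<open>f\<close>
  factors as \<open>M \<rightarrow> W' \<rightarrow> N\<close> with the first map not split monic. By irreducibility the second is split
  epic, and \<open>N\<close> has length at most \<open>m + 1\<close>. The other inequality is dual.

  For the heart, take a short exact sequence \<open>A \<rightarrow> B \<rightarrow> Z\<close> that represents the Auslander-Reiten
  triangle. The same filtration argument bounds the length of \<open>B\<close>. For a nonzero summand \<open>S\<close> of \<open>B\<close>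
  the map \<open>S \<rightarrow> Z\<close> is not split monic, so it factors as \<open>S \<rightarrow> W' \<rightarrow> Z\<close> with \<open>W'\<close> of length at most
  one more than that of \<open>S\<close>; the almost split property forces \<open>W' \<rightarrow> Z\<close> to be split epic. Here \<open>S\<close> may
  be decomposable, so this is not a consequence of the first part.

  Duality needs stable retracts of finite dimensional modules; this property passes to extensions and
  desuspensions, so it reaches the summands of the heart. The main steps are
  \<open>not_split_mono_detected\<close>, \<open>extension_from_class_out\<close>, \<open>factorization_through_higher_level_out\<close>, their
  duals, and \<open>almost_split_summand_level\<close>.\<close>

text \<open>Modules are records, and most formulas below mention several of them; writing the record
  in square brackets after the operation keeps these formulas readable.\<close>

abbreviation add_in ("(_ \<oplus>[_]/ _)" [65, 0, 66] 65) where "x \<oplus>[M] y \<equiv> x \<oplus>\<^bsub>M\<^esub> y"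
abbreviation minus_in ("(_ \<ominus>[_]/ _)" [65, 0, 66] 65) where "x \<ominus>[M] y \<equiv> x \<ominus>\<^bsub>M\<^esub> y"
abbreviation uminus_in ("(\<ominus>[_]/ _)" [0, 81] 80) where "\<ominus>[M] x \<equiv> \<ominus>\<^bsub>M\<^esub> x"
abbreviation zero_in ("\<zero>[_]") where "\<zero>[M] \<equiv> \<zero>\<^bsub>M\<^esub>"
abbreviation smult_in ("(_ \<odot>[_]/ _)" [70, 0, 71] 70) where "a \<odot>[M] x \<equiv> a \<odot>\<^bsub>M\<^esub> x"
abbreviation mult_in ("(_ \<otimes>[_]/ _)" [70, 0, 71] 70) where "a \<otimes>[R] b \<equiv> a \<otimes>\<^bsub>R\<^esub> b"
abbreviation one_in ("\<one>[_]") where "\<one>[R] \<equiv> \<one>\<^bsub>R\<^esub>"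
abbreviation inv_in ("(inv[_]/ _)" [0, 81] 80) where "inv[G] g \<equiv> inv\<^bsub>G\<^esub> g"
abbreviation comp_in ("(_ \<bullet>[_]/ _)" [70, 0, 71] 70) where "g \<bullet>[T] f \<equiv> g \<bullet>\<^bsub>T\<^esub> f"


context abelian_group begin

lemma neg_zero [simp]: "\<ominus> \<zero> = \<zero>"
 using l_neg[OF zero_closed] by simp

lemmas abelian_group_simprules [algebra abelian_group "zero G" "add G" "a_inv G" "a_minus G"] =
 a_closed zero_closed a_inv_closed minus_closed a_assoc l_zero r_zero a_comm a_lcomm
 l_neg r_neg r_neg1 r_neg2 minus_add minus_minus neg_zero minus_eq

lemma diff_eq_zero_iff: "x \<in> carrier G ==> y \<in> carrier G ==> x \<ominus> y = \<zero> \<longleftrightarrow> x = y"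
 by (metis a_inv_closed minus_eq minus_equality minus_minus r_neg)

lemma diff_eq_iff:
 "x \<in> carrier G ==> y \<in> carrier G ==> z \<in> carrier G ==> x \<ominus> y = z \<longleftrightarrow> x = z \<oplus> y"
 by (auto simp: minus_eq a_assoc l_neg r_neg)

lemma add_eq_add_diff:
 assumes "a \<in> carrier G" "b \<in> carrier G" "c \<in> carrier G" "d \<in> carrier G" "a \<oplus> b = c \<oplus> d"
 shows "a \<ominus> c = d \<ominus> b"
proof -
 have "a \<ominus> c = (a \<oplus> b) \<ominus> b \<ominus> c" using assms(1-4) by algebra
 also have "... = d \<ominus> b" using assms(1-4) unfolding assms(5) by algebra
 finally show ?thesis .
qed

end

text \<open>Homomorphisms as functions that need not be restricted to the carrier, so that they
  compose as functions. The definition serves modules over the group algebra and vector spaces alike.\<close>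

definition mhom :: "('r, 'x) ring_scheme => ('r, 'a) module => ('r, 'b) module => ('a => 'b) => bool" where
 "mhom R M N f \<longleftrightarrow> f \<in> carrier M \<rightarrow> carrier N &
   (\<forall>x\<in>carrier M. \<forall>y\<in>carrier M. f (x \<oplus>[M] y) = f x \<oplus>[N] f y) &
   (\<forall>a\<in>carrier R. \<forall>x\<in>carrier M. f (a \<odot>[M] x) = a \<odot>[N] f x)"

lemma mhomI:
 assumes "!!x. x \<in> carrier M ==> f x \<in> carrier N"
  and "!!x y. [|x \<in> carrier M; y \<in> carrier M|] ==> f (x \<oplus>[M] y) = f x \<oplus>[N] f y"
  and "!!a x. [|a \<in> carrier R; x \<in> carrier M|] ==> f (a \<odot>[M] x) = a \<odot>[N] f x"
 shows "mhom R M N f"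
 using assms by (auto simp: mhom_def)

lemma mhom_closed: "mhom R M N f ==> x \<in> carrier M ==> f x \<in> carrier N"
 and mhom_add: "mhom R M N f ==> x \<in> carrier M ==> y \<in> carrier M ==> f (x \<oplus>[M] y) = f x \<oplus>[N] f y"
 and mhom_smult: "mhom R M N f ==> a \<in> carrier R ==> x \<in> carrier M ==> f (a \<odot>[M] x) = a \<odot>[N] f x"
 by (auto simp: mhom_def)

lemma left_moduleI:
 assumes "ring R" "abelian_group M"
  and "!!a x. [|a \<in> carrier R; x \<in> carrier M|] ==> a \<odot>[M] x \<in> carrier M"
  and "!!a b x. [|a \<in> carrier R; b \<in> carrier R; x \<in> carrier M|] ==>
    (a \<oplus>[R] b) \<odot>[M] x = a \<odot>[M] x \<oplus>[M] b \<odot>[M] x"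
  and "!!a x y. [|a \<in> carrier R; x \<in> carrier M; y \<in> carrier M|] ==>
    a \<odot>[M] (x \<oplus>[M] y) = a \<odot>[M] x \<oplus>[M] a \<odot>[M] y"
  and "!!a b x. [|a \<in> carrier R; b \<in> carrier R; x \<in> carrier M|] ==>
    (a \<otimes>[R] b) \<odot>[M] x = a \<odot>[M] (b \<odot>[M] x)"
  and "!!x. x \<in> carrier M ==> \<one>[R] \<odot>[M] x = x"
 shows "left_module R M"
 using assms by (auto simp: left_module_def left_module_axioms_def)

context left_module begin

lemma smult_zero_r: "a \<in> carrier R ==> a \<odot>[M] \<zero>[M] = \<zero>[M]"
 by (metis M.add.l_cancel_one' M.zero_closed smult_closed smult_r_distr M.l_zero)

lemma smult_zero_l: "x \<in> carrier M ==> \<zero>[R] \<odot>[M] x = \<zero>[M]"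
 by (metis M.add.l_cancel_one' R.zero_closed smult_closed smult_l_distr R.l_zero)

lemma smult_minus_r:
 assumes "a \<in> carrier R" "x \<in> carrier M"
 shows "a \<odot>[M] (\<ominus>[M] x) = \<ominus>[M] (a \<odot>[M] x)"
proof -
 have "a \<odot>[M] (\<ominus>[M] x) \<oplus>[M] a \<odot>[M] x = \<zero>[M]"
  using assms smult_r_distr[of a "\<ominus>[M] x" x] by (simp add: M.l_neg smult_zero_r)
 thus ?thesis using assms by (metis M.minus_equality smult_closed M.a_inv_closed)
qed

lemma smult_minus_one:
 assumes "x \<in> carrier M"
 shows "(\<ominus>[R] \<one>[R]) \<odot>[M] x = \<ominus>[M] x"
proof -
 have "(\<ominus>[R] \<one>[R]) \<odot>[M] x \<oplus>[M] x = \<zero>[M]"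
  using assms smult_l_distr[of "\<ominus>[R] \<one>[R]" "\<one>[R]" x] by (simp add: R.l_neg smult_zero_l smult_one)
 thus ?thesis using assms by (metis M.minus_equality smult_closed R.a_inv_closed R.one_closed)
qed

lemma smult_finsum_r:
 assumes "a \<in> carrier R" "f \<in> A \<rightarrow> carrier M"
 shows "a \<odot>[M] finsum M f A = finsum M (%i. a \<odot>[M] f i) A"
 using assms(2)
proof (induct A rule: infinite_finite_induct)
 case (insert x F)
 then show ?case using assms(1)
  by (simp add: M.finsum_insert smult_r_distr smult_closed Pi_iff)
qed (use assms(1) smult_zero_r in auto)

lemma smult_finsum_l:
 assumes "x \<in> carrier M" "f \<in> A \<rightarrow> carrier R"
 shows "finsum R f A \<odot>[M] x = finsum M (%i. f i \<odot>[M] x) A"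
 using assms(2)
proof (induct A rule: infinite_finite_induct)
 case (insert y F)
 then show ?case using assms(1)
  by (simp add: M.finsum_insert R.finsum_insert smult_l_distr smult_closed Pi_iff)
qed (use assms(1) smult_zero_l in auto)

end

lemma mhom_zero:
 assumes "left_module R M" "left_module R N" "mhom R M N f"
 shows "f \<zero>[M] = \<zero>[N]"
proof -
 interpret M: left_module R M by fact
 interpret N: left_module R N by fact
 have "f (\<zero>[M] \<oplus>[M] \<zero>[M]) = f \<zero>[M] \<oplus>[N] f \<zero>[M]"
  using assms by (intro mhom_add) auto
 thus ?thesis using mhom_closed[OF assms(3)]
  by (metis M.M.l_zero M.M.zero_closed N.M.add.l_cancel_one')
qed

lemma mhom_minus:
 assumes "left_module R M" "left_module R N" "mhom R M N f" "x \<in> carrier M"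
 shows "f (\<ominus>[M] x) = \<ominus>[N] f x"
proof -
 interpret M: left_module R M by fact
 interpret N: left_module R N by fact
 have "f (\<ominus>[M] x) = f ((\<ominus>[R] \<one>[R]) \<odot>[M] x)" using assms by (simp add: M.smult_minus_one)
 also have "... = (\<ominus>[R] \<one>[R]) \<odot>[N] f x" using assms by (simp add: mhom_smult)
 also have "... = \<ominus>[N] f x" using assms by (simp add: N.smult_minus_one mhom_closed)
 finally show ?thesis .
qed

lemma mhom_finsum:
 assumes "left_module R M" "left_module R N" "mhom R M N f" "g \<in> A \<rightarrow> carrier M"
 shows "f (finsum M g A) = finsum N (%i. f (g i)) A"
proof -
 interpret M: left_module R M by fact
 interpret N: left_module R N by fact
 show ?thesis using assms(4)
 proof (induct A rule: infinite_finite_induct)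
  case (insert x F)
  then show ?case
   using mhom_closed[OF assms(3)] mhom_add[OF assms(3)]
   by (simp add: M.finsum_insert N.finsum_insert Pi_iff)
 qed (use mhom_zero[OF assms(1-3)] in auto)
qed

lemma mhom_comp: "mhom R M N f ==> mhom R N L g ==> mhom R M L (%x. g (f x))"
 by (auto simp: mhom_def Pi_iff)

lemma mhom_id: "mhom R M M (%x. x)"
 by (auto simp: mhom_def)

lemma mhom_const_zero:
 assumes "left_module R N" shows "mhom R M N (%x. \<zero>[N])"
proof -
 interpret N: left_module R N by fact
 show ?thesis by (auto simp: mhom_def N.smult_zero_r)
qed

lemma mhom_sum:
 assumes "left_module R N" "mhom R M N f" "mhom R M N g"
 shows "mhom R M N (%x. f x \<oplus>[N] g x)"
proof -
 interpret N: left_module R N by fact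
 show ?thesis using assms(2,3)
  by (intro mhomI) (auto simp: mhom_closed mhom_add mhom_smult N.smult_r_distr N.M.a_ac)
qed

lemma mhom_neg:
 assumes "left_module R N" "mhom R M N f"
 shows "mhom R M N (%x. \<ominus>[N] f x)"
proof -
 interpret N: left_module R N by fact
 show ?thesis using assms(2)
  by (intro mhomI) (auto simp: mhom_closed mhom_add mhom_smult N.smult_minus_r N.M.minus_add)
qed

lemma mhom_cong:
 assumes "mhom R M N f" "!!x. x \<in> carrier M ==> f x = g x" "left_module R M"
 shows "mhom R M N g"
proof -
 interpret M: left_module R M by fact
 show ?thesis
  by (rule mhomI)
   (simp_all add: assms(2)[symmetric] M.smult_closed mhom_closed[OF assms(1)]
    mhom_add[OF assms(1)] mhom_smult[OF assms(1)])
qed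

section \<open>Linear algebra over a field\<close>

definition subsp :: "('k, 'x) ring_scheme => ('k, 'v) module => 'v set => bool" where
 "subsp K V U \<longleftrightarrow> U \<subseteq> carrier V & \<zero>[V] \<in> U & (\<forall>x\<in>U. \<forall>y\<in>U. x \<oplus>[V] y \<in> U) &
   (\<forall>c\<in>carrier K. \<forall>x\<in>U. c \<odot>[V] x \<in> U)"

lemma subsp_neg:
 assumes "left_module K V" "subsp K V U" "x \<in> U"
 shows "\<ominus>[V] x \<in> U"
proof -
 interpret left_module K V by fact
 have "(\<ominus>[K] \<one>[K]) \<odot>[V] x \<in> U" using assms(2,3) by (auto simp: subsp_def)
 thus ?thesis using assms(2,3) by (auto simp: subsp_def smult_minus_one subset_iff)
qed

lemma subsp_minus:
 assumes "left_module K V" "subsp K V U" "x \<in> U" "y \<in> U"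
 shows "x \<ominus>[V] y \<in> U"
 using assms subsp_neg[of K V U y] by (auto simp: a_minus_def subsp_def)

lemma subsp_add_line:
 assumes "left_module K V" "subsp K V U" "x \<in> carrier V"
 shows "subsp K V {u \<oplus>[V] c \<odot>[V] x | u c. u \<in> U & c \<in> carrier K}" (is "subsp K V ?L")
  and "U \<subseteq> {u \<oplus>[V] c \<odot>[V] x | u c. u \<in> U & c \<in> carrier K}"
  and "x \<in> {u \<oplus>[V] c \<odot>[V] x | u c. u \<in> U & c \<in> carrier K}"
proof -
 interpret left_module K V by fact
 have U: "U \<subseteq> carrier V" "\<zero>[V] \<in> U" using assms by (auto simp: subsp_def)
 show sub: "U \<subseteq> ?L"
 proof
  fix u assume "u \<in> U"
  hence "u = u \<oplus>[V] \<zero>[K] \<odot>[V] x" using U assms(3) by (auto simp: smult_zero_l)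
  thus "u \<in> ?L" using \<open>u \<in> U\<close> by blast
 qed
 have "x = \<zero>[V] \<oplus>[V] \<one>[K] \<odot>[V] x" using assms(3) by (simp add: smult_one)
 thus "x \<in> ?L" using U(2) by blast
 show "subsp K V ?L" unfolding subsp_def
 proof (intro conjI ballI)
  show "?L \<subseteq> carrier V" using U assms(3) by (auto simp: smult_closed subset_iff)
  show "\<zero>[V] \<in> ?L" using sub U by auto
 next
  fix y z assume "y \<in> ?L" "z \<in> ?L"
  then obtain u c u' c' where *: "y = u \<oplus>[V] c \<odot>[V] x" "z = u' \<oplus>[V] c' \<odot>[V] x"
   "u \<in> U" "u' \<in> U" "c \<in> carrier K" "c' \<in> carrier K" by blast
  have "y \<oplus>[V] z = (u \<oplus>[V] u') \<oplus>[V] (c \<oplus>[K] c') \<odot>[V] x"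
   using * U(1) assms(3) by (simp add: smult_l_distr smult_closed subset_iff M.a_ac)
  moreover have "u \<oplus>[V] u' \<in> U" "c \<oplus>[K] c' \<in> carrier K" using * assms(2) by (auto simp: subsp_def)
  ultimately show "y \<oplus>[V] z \<in> ?L" by blast
 next
  fix a y assume a: "a \<in> carrier K" and "y \<in> ?L"
  then obtain u c where *: "y = u \<oplus>[V] c \<odot>[V] x" "u \<in> U" "c \<in> carrier K" by blast
  have "a \<odot>[V] y = (a \<odot>[V] u) \<oplus>[V] (a \<otimes>[K] c) \<odot>[V] x"
   using * a U(1) assms(3) by (simp add: smult_r_distr smult_assoc smult_closed subset_iff)
  moreover have "a \<odot>[V] u \<in> U" "a \<otimes>[K] c \<in> carrier K" using * a assms(2) by (auto simp: subsp_def)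
  ultimately show "a \<odot>[V] y \<in> ?L" by blast
 qed
qed

text \<open>Zorn's lemma, applied to partial projections onto the subspace; a maximal one is defined
  everywhere, since it extends along any further vector. Dimensions of the spaces are arbitrary.\<close>

lemma linear_projection_exists:
 assumes K: "field K" and V: "left_module K V" and U: "subsp K V U"
 shows "\<exists>p. mhom K V V p & (\<forall>x\<in>carrier V. p x \<in> U) & (\<forall>u\<in>U. p u = u)"
proof -
 interpret K: field K by fact
 interpret left_module K V by fact
 have UV: "U \<subseteq> carrier V" "\<zero>[V] \<in> U" using U by (auto simp: subsp_def)
 define \<C> where "\<C> = {C. subsp K V C & C \<inter> U = {\<zero>[V]}}"
 have "\<exists>C\<in>\<C>. \<forall>X\<in>\<C>. C \<subseteq> X --> X = C"
 proof (rule subset_Zorn_nonempty)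
  have "{\<zero>[V]} \<in> \<C>" using UV by (auto simp: \<C>_def subsp_def smult_zero_r)
  thus "\<C> ~= {}" by auto
 next
  fix C assume C: "C ~= {}" "subset.chain \<C> C"
  have mem: "!!X. X \<in> C ==> subsp K V X & X \<inter> U = {\<zero>[V]}" using C(2) by (auto simp: \<C>_def subset.chain_def)
  have "subsp K V (\<Union>C)"
   unfolding subsp_def
  proof (intro conjI ballI)
   show "\<Union>C \<subseteq> carrier V" using mem unfolding subsp_def by blast
   show "\<zero>[V] \<in> \<Union>C" using C(1) mem by (auto simp: subsp_def)
   fix x y assume "x \<in> \<Union>C" "y \<in> \<Union>C"
   then obtain X Y where "X \<in> C" "Y \<in> C" "x \<in> X" "y \<in> Y" by auto
   moreover have "X \<subseteq> Y \<or> Y \<subseteq> X" using C(2) \<open>X \<in> C\<close> \<open>Y \<in> C\<close> by (auto simp: subset.chain_def)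
   ultimately obtain Z where "Z \<in> C" "x \<in> Z" "y \<in> Z" by auto
   thus "x \<oplus>[V] y \<in> \<Union>C" using mem[of Z] by (auto simp: subsp_def)
  next
   fix c x assume "c \<in> carrier K" "x \<in> \<Union>C"
   thus "c \<odot>[V] x \<in> \<Union>C" using mem by (auto simp: subsp_def)
  qed
  moreover have "\<Union>C \<inter> U = {\<zero>[V]}" using mem C(1) by blast
  ultimately show "\<Union>C \<in> \<C>" by (simp add: \<C>_def)
 qed
 then obtain C where C: "subsp K V C" "C \<inter> U = {\<zero>[V]}"
  and max: "!!X. subsp K V X ==> X \<inter> U = {\<zero>[V]} ==> C \<subseteq> X ==> X = C"
  by (auto simp: \<C>_def)
 have CV: "C \<subseteq> carrier V" "\<zero>[V] \<in> C" using C by (auto simp: subsp_def)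
 have ex: "\<exists>u\<in>U. \<exists>c\<in>C. v = u \<oplus>[V] c" if v: "v \<in> carrier V" for v
 proof (rule ccontr)
  assume no: "~ ?thesis"
  let ?L = "{u \<oplus>[V] c \<odot>[V] v | u c. u \<in> C & c \<in> carrier K}"
  note L = subsp_add_line[OF V C(1) v]
  have "?L \<inter> U = {\<zero>[V]}"
  proof (intro equalityI subsetI)
   fix y assume "y \<in> ?L \<inter> U"
   then obtain u c where *: "y = u \<oplus>[V] c \<odot>[V] v" "u \<in> C" "c \<in> carrier K" "y \<in> U" by blast
   have cl: "u \<in> carrier V" "y \<in> carrier V" using * CV UV by auto
   show "y \<in> {\<zero>[V]}"
   proof (cases "c = \<zero>[K]")
    case True
    hence "y = u" using * cl v by (simp add: smult_zero_l)
    thus ?thesis using * C by blast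
   next
    case False
    hence i: "inv\<^bsub>K\<^esub> c \<in> carrier K" "inv\<^bsub>K\<^esub> c \<otimes>[K] c = \<one>[K]" using *(3) K.field_Units by auto
    have "v = inv\<^bsub>K\<^esub> c \<odot>[V] (c \<odot>[V] v)"
     using i *(3) v by (simp add: smult_assoc[symmetric] smult_one)
    also have "c \<odot>[V] v = y \<ominus>[V] u" using * cl v smult_closed[OF *(3) v]
     by (simp add: M.minus_eq M.a_ac M.r_neg1 M.r_neg2)
    also have "inv\<^bsub>K\<^esub> c \<odot>[V] (y \<ominus>[V] u) = inv\<^bsub>K\<^esub> c \<odot>[V] y \<oplus>[V] inv\<^bsub>K\<^esub> c \<odot>[V] (\<ominus>[V] u)"
     using cl i by (simp add: a_minus_def smult_r_distr)
    finally have "v = inv\<^bsub>K\<^esub> c \<odot>[V] y \<oplus>[V] inv\<^bsub>K\<^esub> c \<odot>[V] (\<ominus>[V] u)" .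
    moreover have "inv\<^bsub>K\<^esub> c \<odot>[V] y \<in> U" using U * i by (auto simp: subsp_def)
    moreover have "inv\<^bsub>K\<^esub> c \<odot>[V] (\<ominus>[V] u) \<in> C" using C(1) * i subsp_neg[OF V C(1)] by (auto simp: subsp_def)
    ultimately have False using no by blast
    thus ?thesis ..
   qed
  next
   fix y assume "y \<in> {\<zero>[V]}"
   thus "y \<in> ?L \<inter> U" using L(2) CV UV by auto
  qed
  hence "?L = C" using max[OF L(1) _ L(2)] by simp
  hence "v \<in> C" using L(3) by simp
  hence "v = \<zero>[V] \<oplus>[V] v" "v \<in> C" using v by auto
  thus False using no UV by blast
 qed
 have uniq: "u = u'" if "u \<in> U" "u' \<in> U" "c \<in> C" "c' \<in> C" "u \<oplus>[V] c = u' \<oplus>[V] c'" for u u' c c'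
 proof -
  have cl: "u \<in> carrier V" "u' \<in> carrier V" "c \<in> carrier V" "c' \<in> carrier V" using that UV CV by auto
  have "u \<ominus>[V] u' = c' \<ominus>[V] c" using that(5) cl by (intro M.add_eq_add_diff)
  moreover have "u \<ominus>[V] u' \<in> U" "c' \<ominus>[V] c \<in> C" using subsp_minus V U C that by metis+
  ultimately have "u \<ominus>[V] u' = \<zero>[V]" using C(2) by auto
  thus ?thesis using cl by (simp add: M.diff_eq_zero_iff)
 qed
 define p where "p = (%v. SOME u. u \<in> U & (\<exists>c\<in>C. v = u \<oplus>[V] c))"
 have p: "p v \<in> U & (\<exists>c\<in>C. v = p v \<oplus>[V] c)" if "v \<in> carrier V" for v
  unfolding p_def by (rule someI_ex) (use ex[OF that] in blast)
 have pU: "p v \<in> U" if "v \<in> carrier V" for v using p[OF that] by blast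
 have pe: "p v = u" if "u \<in> U" "c \<in> C" "v = u \<oplus>[V] c" for u c v
 proof -
  have "v \<in> carrier V" using that UV CV by auto
  thus ?thesis using p[of v] uniq that by metis
 qed
 have "mhom K V V p"
 proof (rule mhomI)
  fix x assume "x \<in> carrier V" thus "p x \<in> carrier V" using pU UV by blast
 next
  fix x y assume xy: "x \<in> carrier V" "y \<in> carrier V"
  obtain c d where cd: "c \<in> C" "x = p x \<oplus>[V] c" "d \<in> C" "y = p y \<oplus>[V] d" using p[OF xy(1)] p[OF xy(2)] by blast
  have cl: "p x \<in> carrier V" "p y \<in> carrier V" "c \<in> carrier V" "d \<in> carrier V" using pU xy UV CV cd(1,3) by auto
  have "x \<oplus>[V] y = (p x \<oplus>[V] c) \<oplus>[V] (p y \<oplus>[V] d)" by (rule arg_cong2[OF cd(2) cd(4)])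
  also have "... = (p x \<oplus>[V] p y) \<oplus>[V] (c \<oplus>[V] d)" using cl by (simp add: M.a_ac)
  finally have eq: "x \<oplus>[V] y = (p x \<oplus>[V] p y) \<oplus>[V] (c \<oplus>[V] d)" .
  show "p (x \<oplus>[V] y) = p x \<oplus>[V] p y"
   by (rule pe[OF _ _ eq]) (use pU xy cd(1,3) U C(1) in \<open>unfold subsp_def, blast+\<close>)
 next
  fix a x assume ax: "a \<in> carrier K" "x \<in> carrier V"
  obtain c where c: "c \<in> C" "x = p x \<oplus>[V] c" using p[OF ax(2)] by blast
  have cl: "p x \<in> carrier V" "c \<in> carrier V" using pU ax UV CV c(1) by auto
  have "a \<odot>[V] x = a \<odot>[V] (p x \<oplus>[V] c)" by (rule arg_cong[OF c(2)])
  also have "... = a \<odot>[V] p x \<oplus>[V] a \<odot>[V] c" using cl ax by (simp add: smult_r_distr)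
  finally have eq: "a \<odot>[V] x = a \<odot>[V] p x \<oplus>[V] a \<odot>[V] c" .
  show "p (a \<odot>[V] x) = a \<odot>[V] p x"
   by (rule pe[OF _ _ eq]) (use pU ax c(1) U C(1) in \<open>unfold subsp_def, blast+\<close>)
 qed
 moreover have "p u = u" if "u \<in> U" for u
  by (rule pe[OF that CV(2)]) (use that UV in auto)
 ultimately show ?thesis using pU by blast
qed

lemma linear_retraction_exists:
 assumes K: "field K" and V: "left_module K V" and W: "left_module K W" and f: "mhom K V W f" "inj_on f (carrier V)"
 shows "\<exists>r. mhom K W V r & (\<forall>x\<in>carrier V. r (f x) = x)"
proof -
 interpret V: left_module K V by fact
 interpret W: left_module K W by fact
 have "subsp K W (f ` carrier V)" unfolding subsp_def
 proof (intro conjI ballI)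
  show "f ` carrier V \<subseteq> carrier W" using f by (auto simp: mhom_closed)
  show "\<zero>[W] \<in> f ` carrier V" using mhom_zero[OF V W f(1)] by (metis V.M.zero_closed imageI)
 next
  fix x y assume "x \<in> f ` carrier V" "y \<in> f ` carrier V"
  then show "x \<oplus>[W] y \<in> f ` carrier V"
   using mhom_add[OF f(1)] by (metis (no_types, lifting) V.M.a_closed image_iff)
 next
  fix c x assume "c \<in> carrier K" "x \<in> f ` carrier V"
  then show "c \<odot>[W] x \<in> f ` carrier V"
   using mhom_smult[OF f(1)] by (metis (no_types, lifting) V.smult_closed image_iff)
 qed
 then obtain p where p: "mhom K W W p" "!!x. x \<in> carrier W ==> p x \<in> f ` carrier V" "!!u. u \<in> f ` carrier V ==> p u = u"
  using linear_projection_exists[OF K W] by blast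
 let ?g = "inv_into (carrier V) f"
 have g: "?g (f x) = x" if "x \<in> carrier V" for x using f(2) that by simp
 have gi: "f (?g y) = y" "?g y \<in> carrier V" if "y \<in> f ` carrier V" for y
  using that by (auto simp: f_inv_into_f inv_into_into)
 have "mhom K W V (%x. ?g (p x))"
 proof (rule mhomI)
  fix x assume "x \<in> carrier W" thus "?g (p x) \<in> carrier V" using p gi by auto
 next
  fix x y assume xy: "x \<in> carrier W" "y \<in> carrier W"
  obtain a b where ab: "a \<in> carrier V" "p x = f a" "b \<in> carrier V" "p y = f b" using p(2) xy by blast
  have "p (x \<oplus>[W] y) = f (a \<oplus>[V] b)" using ab xy p(1) f(1) by (simp add: mhom_add)
  thus "?g (p (x \<oplus>[W] y)) = ?g (p x) \<oplus>[V] ?g (p y)" using ab g by simp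
 next
  fix c x assume cx: "c \<in> carrier K" "x \<in> carrier W"
  obtain a where ab: "a \<in> carrier V" "p x = f a" using p(2) cx by blast
  have "p (c \<odot>[W] x) = f (c \<odot>[V] a)" using ab cx p(1) f(1) by (simp add: mhom_smult)
  thus "?g (p (c \<odot>[W] x)) = c \<odot>[V] ?g (p x)" using ab g cx V.smult_closed by simp
 qed
 moreover have "?g (p (f x)) = x" if "x \<in> carrier V" for x using that p(3) g by simp
 ultimately show ?thesis by blast
qed

lemma linear_section_exists:
 assumes K: "field K" and V: "left_module K V" and W: "left_module K W" and f: "mhom K V W f" "f ` carrier V = carrier W"
 shows "\<exists>s. mhom K W V s & (\<forall>x\<in>carrier W. f (s x) = x)"
proof -
 interpret V: left_module K V by fact
 interpret W: left_module K W by fact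
 let ?U = "{x \<in> carrier V. f x = \<zero>[W]}"
 have "subsp K V ?U"
  using f(1) by (auto simp: subsp_def mhom_zero[OF V W] mhom_add mhom_smult V.smult_closed W.smult_zero_r)
 then obtain p where p: "mhom K V V p" "!!x. x \<in> carrier V ==> p x \<in> ?U" "!!u. u \<in> ?U ==> p u = u"
  using linear_projection_exists[OF K V] by blast
 \<comment> \<open>The complement of the kernel, as the image of the complementary projection.\<close>
 define q where "q = (%x. x \<oplus>[V] (\<ominus>[V] p x))"
 have q: "mhom K V V q" unfolding q_def by (intro mhom_sum mhom_neg mhom_id p V)
 have fq: "f (q x) = f x" if "x \<in> carrier V" for x
  using that p f(1) mhom_closed[OF p(1)] mhom_closed[OF f(1)]
  by (simp add: q_def mhom_add mhom_minus[OF V W f(1)])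
 have q_eq: "q x = q y" if xy: "x \<in> carrier V" "y \<in> carrier V" "f x = f y" for x y
 proof -
  have "x \<ominus>[V] y \<in> ?U" using xy f(1) mhom_closed[OF f(1)]
   by (simp add: a_minus_def mhom_add mhom_minus[OF V W f(1)] W.M.r_neg)
  hence "p (x \<ominus>[V] y) = x \<ominus>[V] y" using p(3) by auto
  hence "q (x \<ominus>[V] y) = \<zero>[V]" using xy by (simp add: q_def V.M.r_neg)
  hence "q x \<ominus>[V] q y = \<zero>[V]" using xy q by (simp add: a_minus_def mhom_add mhom_minus[OF V V q])
  thus ?thesis using xy mhom_closed[OF q] by (simp add: V.M.diff_eq_zero_iff)
 qed
 define s where "s = (%y. q (inv_into (carrier V) f y))"
 have iv: "inv_into (carrier V) f y \<in> carrier V" "f (inv_into (carrier V) f y) = y" if "y \<in> carrier W" for y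
  using that f(2) by (auto simp: f_inv_into_f inv_into_into)
 have s: "s (f x) = q x" if "x \<in> carrier V" for x
  unfolding s_def using that iv[of "f x"] mhom_closed[OF f(1)] by (intro q_eq) auto
 have "mhom K W V s"
 proof (rule mhomI)
  fix x assume "x \<in> carrier W" thus "s x \<in> carrier V" using iv mhom_closed[OF q] by (auto simp: s_def)
 next
  fix x y assume "x \<in> carrier W" "y \<in> carrier W"
  then obtain a b where ab: "a \<in> carrier V" "x = f a" "b \<in> carrier V" "y = f b" using f(2) by blast
  thus "s (x \<oplus>[W] y) = s x \<oplus>[V] s y"
   using s[of "a \<oplus>[V] b"] s q f(1) by (simp add: mhom_add)
 next
  fix c x assume "c \<in> carrier K" "x \<in> carrier W"
  then obtain a where ab: "a \<in> carrier V" "x = f a" "c \<in> carrier K" using f(2) by blast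
  thus "s (c \<odot>[W] x) = c \<odot>[V] s x"
   using s[of "c \<odot>[V] a"] s q f(1) by (simp add: mhom_smult V.smult_closed)
 qed
 moreover have "f (s x) = x" if "x \<in> carrier W" for x
  using that fq iv by (simp add: s_def)
 ultimately show ?thesis by blast
qed

definition scalars :: "('k, 'x) ring_scheme => ('k, 'k) module" where
 "scalars K = \<lparr> carrier = carrier K, mult = mult K, one = one K, zero = zero K, add = add K, smult = mult K \<rparr>"

lemma scalars_simps [simp]:
 "carrier (scalars K) = carrier K" "add (scalars K) = add K" "zero (scalars K) = zero K"
 "smult (scalars K) = mult K"
 by (simp_all add: scalars_def)

lemma left_module_scalars:
 assumes "ring K" shows "left_module K (scalars K)"
proof -
 interpret ring K by fact
 have "abelian_group (scalars K)"
  by (rule abelian_groupI) (auto simp: a_ac intro: add.l_inv_ex)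
 thus ?thesis
  by (intro left_moduleI) (auto simp: ring_axioms l_distr r_distr m_assoc)
qed

text \<open>Project onto the subspace enlarged by the line through \<open>x\<close>, then read off the coefficient of \<open>x\<close>.\<close>

lemma separating_functional_exists:
 assumes K: "field K" and V: "left_module K V" and U: "subsp K V U" and x: "x \<in> carrier V" "x \<notin> U"
 shows "\<exists>l. mhom K V (scalars K) l & (\<forall>u\<in>U. l u = \<zero>[K]) & l x = \<one>[K]"
proof -
 interpret K: field K by fact
 interpret left_module K V by fact
 have S: "left_module K (scalars K)" by (rule left_module_scalars) unfold_locales
 have UV: "U \<subseteq> carrier V" using U by (auto simp: subsp_def)
 obtain p where p: "mhom K V V p" "!!x. x \<in> carrier V ==> p x \<in> U" "!!u. u \<in> U ==> p u = u"
  using linear_projection_exists[OF K V U] by blast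
 define q where "q = (%x. x \<oplus>[V] (\<ominus>[V] p x))"
 have q: "mhom K V V q" unfolding q_def by (intro mhom_sum mhom_neg mhom_id p V)
 have qU: "q u = \<zero>[V]" if "u \<in> U" for u using that UV p(3) by (auto simp: q_def M.r_neg)
 have qx: "q x ~= \<zero>[V]"
 proof
  assume "q x = \<zero>[V]"
  hence "x = p x" using x(1) p(2)[OF x(1)] UV M.diff_eq_zero_iff[of x "p x"]
   by (auto simp: q_def a_minus_def)
  thus False using p(2)[OF x(1)] x(2) by simp
 qed
 have qc: "q x \<in> carrier V" using q x(1) by (rule mhom_closed)
 have line: "mhom K (scalars K) V (%c. c \<odot>[V] q x)"
  by (rule mhomI) (use qc in \<open>auto simp: smult_closed smult_l_distr smult_assoc\<close>)
 have "inj_on (%c. c \<odot>[V] q x) (carrier (scalars K))"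
 proof (rule inj_onI)
  fix c d assume cd: "c \<in> carrier (scalars K)" "d \<in> carrier (scalars K)" "c \<odot>[V] q x = d \<odot>[V] q x"
  have "(c \<ominus>[K] d) \<odot>[V] q x = c \<odot>[V] q x \<oplus>[V] (\<ominus>[K] d) \<odot>[V] q x"
   using cd qc by (simp add: a_minus_def smult_l_distr)
  also have "... = (d \<oplus>[K] (\<ominus>[K] d)) \<odot>[V] q x" using cd qc by (simp add: smult_l_distr)
  finally have z: "(c \<ominus>[K] d) \<odot>[V] q x = \<zero>[V]" using cd qc by (simp add: K.r_neg smult_zero_l)
  show "c = d"
  proof (rule ccontr)
   assume "c ~= d"
   hence u: "c \<ominus>[K] d \<in> Units K" using cd by (simp add: K.field_Units K.diff_eq_zero_iff)
   hence "q x = inv\<^bsub>K\<^esub> (c \<ominus>[K] d) \<odot>[V] ((c \<ominus>[K] d) \<odot>[V] q x)"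
    using cd qc by (simp add: smult_assoc[symmetric] smult_one)
   thus False using z qx u by (simp add: smult_zero_r)
  qed
 qed
 then obtain r where r: "mhom K V (scalars K) r" "!!c. c \<in> carrier K ==> r (c \<odot>[V] q x) = c"
  using linear_retraction_exists[OF K S V line] by auto
 have "r (q x) = \<one>[K]" using r(2)[of "\<one>[K]"] qc by (simp add: smult_one)
 thus ?thesis using mhom_comp[OF q r(1)] qU mhom_zero[OF V S r(1)] by auto
qed

section \<open>The group algebra\<close>

text \<open>In this locale \<open>sm\<close> is multiplication by scalars, \<open>ga\<close> the action of group elements, \<open>vs\<close> the underlying
  vector space and \<open>kl\<close> linearity over the field.\<close>

locale kG = K: field K + G: group G
 for K :: "('k, 'x) ring_scheme" and G :: "('g, 'y) monoid_scheme" +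
 assumes finG: "finite (carrier G)"
begin

abbreviation "R \<equiv> group_algebra K G"
abbreviation gmult (infixl "\<cdot>" 70) where "g \<cdot> h \<equiv> g \<otimes>[G] h"

text \<open>The basis element of the group algebra at a group element.\<close>

definition dl :: "'g => 'g => 'k" where
 "dl g = (\<lambda>x\<in>carrier G. if x = g then \<one>[K] else \<zero>[K])"
definition scal :: "'k => 'g => 'k" where
 "scal c = (\<lambda>x\<in>carrier G. if x = \<one>[G] then c else \<zero>[K])"

lemma R_carrier: "carrier R = carrier G \<rightarrow>\<^sub>E carrier K"
 and R_add: "a \<oplus>[R] b = (\<lambda>x\<in>carrier G. a x \<oplus>[K] b x)"
 and R_zero: "\<zero>[R] = (\<lambda>x\<in>carrier G. \<zero>[K])"
 and R_one: "\<one>[R] = dl \<one>[G]"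
 and R_mult: "a \<otimes>[R] b = (\<lambda>x\<in>carrier G.
        finsum K (%y. a y \<otimes>[K] b (inv[G] y \<cdot> x)) (carrier G))"
 by (simp_all add: group_algebra_def dl_def)

lemma R_eval: "a \<in> carrier R ==> x \<in> carrier G ==> a x \<in> carrier K"
 by (auto simp: R_carrier)

lemma R_eqI: "[|a \<in> carrier R; b \<in> carrier R; !!x. x \<in> carrier G ==> a x = b x|] ==> a = b"
 unfolding R_carrier by (rule PiE_ext)

lemma dl_closed [simp, intro]: "dl g \<in> carrier R"
 and scal_closed [simp, intro]: "c \<in> carrier K ==> scal c \<in> carrier R"
 by (auto simp: R_carrier dl_def scal_def)

lemma R_mult_closed [intro, simp]: "a \<in> carrier R ==> b \<in> carrier R ==> a \<otimes>[R] b \<in> carrier R"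
 unfolding R_mult by (subst R_carrier) (auto simp: R_eval intro!: K.finsum_closed)

lemma K_finsum_single:
 assumes "h \<in> carrier G" "f h \<in> carrier K" "!!y. y \<in> carrier G ==> y ~= h ==> f y = \<zero>[K]"
 shows "finsum K f (carrier G) = f h"
proof -
 have "finsum K f (carrier G) = finsum K (%j. if h = j then f j else \<zero>[K]) (carrier G)"
  by (rule K.finsum_cong') (use assms in auto)
 also have "... = f h"
 proof -
  have "finsum K (%j. if h = j then f j else \<zero>[K]) (carrier G) =
     finsum K (%j. if h = j then (%_. f h) j else \<zero>[K]) (carrier G)"
   by (rule K.finsum_cong') (use assms in auto)
  also have "... = f h" by (rule K.finsum_singleton) (use assms finG in auto)
  finally show ?thesis .
 qed
 finally show ?thesis .
qed

lemma dl_mult_eval: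
 assumes "g \<in> carrier G" "b \<in> carrier R" "x \<in> carrier G"
 shows "(dl g \<otimes>[R] b) x = b (inv[G] g \<cdot> x)"
proof -
 have "(dl g \<otimes>[R] b) x = dl g g \<otimes>[K] b (inv[G] g \<cdot> x)"
  unfolding R_mult restrict_apply'[OF assms(3)]
  by (rule K_finsum_single) (use assms in \<open>auto simp: dl_def R_eval\<close>)
 thus ?thesis using assms by (simp add: dl_def R_eval)
qed

lemma scal_mult_eval:
 assumes "c \<in> carrier K" "b \<in> carrier R" "x \<in> carrier G"
 shows "(scal c \<otimes>[R] b) x = c \<otimes>[K] b x"
proof -
 have "(scal c \<otimes>[R] b) x = scal c \<one>[G] \<otimes>[K] b (inv[G] \<one>[G] \<cdot> x)"
  unfolding R_mult restrict_apply'[OF assms(3)]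
  by (rule K_finsum_single) (use assms in \<open>auto simp: scal_def R_eval\<close>)
 thus ?thesis using assms by (simp add: scal_def)
qed

lemma mult_dl_eval:
 assumes "g \<in> carrier G" "a \<in> carrier R" "x \<in> carrier G"
 shows "(a \<otimes>[R] dl g) x = a (x \<cdot> inv[G] g)"
proof -
 have *: "inv[G] y \<cdot> x = g \<longleftrightarrow> y = x \<cdot> inv[G] g" if "y \<in> carrier G" for y
  using that assms by (metis G.inv_closed G.inv_solve_left G.inv_solve_right G.m_closed)
 have "(a \<otimes>[R] dl g) x = a (x \<cdot> inv[G] g) \<otimes>[K] dl g (inv[G] (x \<cdot> inv[G] g) \<cdot> x)"
  unfolding R_mult restrict_apply'[OF assms(3)]
  by (rule K_finsum_single) (use assms in \<open>auto simp: dl_def R_eval *\<close>)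
 thus ?thesis using assms * by (simp add: dl_def R_eval)
qed

lemma mult_scal_eval:
 assumes "c \<in> carrier K" "a \<in> carrier R" "x \<in> carrier G"
 shows "(a \<otimes>[R] scal c) x = a x \<otimes>[K] c"
proof -
 have *: "inv[G] y \<cdot> x = \<one>[G] \<longleftrightarrow> y = x" if "y \<in> carrier G" for y
  using that assms by (metis G.inv_closed G.l_inv G.inv_comm G.inv_inv G.inv_equality)
 have "(a \<otimes>[R] scal c) x = a x \<otimes>[K] scal c (inv[G] x \<cdot> x)"
  unfolding R_mult restrict_apply'[OF assms(3)]
  by (rule K_finsum_single) (use assms in \<open>auto simp: scal_def R_eval *\<close>)
 thus ?thesis using assms by (simp add: scal_def)
qed

lemma dl_mult_dl: "g \<in> carrier G ==> h \<in> carrier G ==> dl g \<otimes>[R] dl h = dl (g \<cdot> h)"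
proof (rule R_eqI)
 fix x assume a: "g \<in> carrier G" "h \<in> carrier G" "x \<in> carrier G"
 have "inv[G] g \<cdot> x = h \<longleftrightarrow> x = g \<cdot> h" using a by (metis G.inv_closed G.inv_solve_left')
 thus "(dl g \<otimes>[R] dl h) x = dl (g \<cdot> h) x" using a by (simp add: dl_mult_eval) (simp add: dl_def)
qed auto

lemma scal_mult_scal: "c \<in> carrier K ==> d \<in> carrier K ==> scal c \<otimes>[R] scal d = scal (c \<otimes>[K] d)"
 by (rule R_eqI) (auto simp: scal_mult_eval, auto simp: scal_def)

lemma scal_central: "c \<in> carrier K ==> a \<in> carrier R ==> scal c \<otimes>[R] a = a \<otimes>[R] scal c"
 by (rule R_eqI) (auto simp: scal_mult_eval mult_scal_eval K.m_comm R_eval)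

lemma scal_add: "c \<in> carrier K ==> d \<in> carrier K ==> scal (c \<oplus>[K] d) = scal c \<oplus>[R] scal d"
 by (auto simp: R_add scal_def restrict_def fun_eq_iff)

lemma scal_one: "scal \<one>[K] = \<one>[R]"
 by (simp add: R_one scal_def dl_def)

lemma R_finsum_eval:
 assumes "ring R" "f \<in> A \<rightarrow> carrier R" "x \<in> carrier G"
 shows "finsum R f A x = finsum K (%i. f i x) A"
proof -
 interpret R: ring R by fact
 show ?thesis using assms(2)
 proof (induct A rule: infinite_finite_induct)
  case (insert y F)
  then show ?case using assms(3)
   by (simp add: R.finsum_insert K.finsum_insert Pi_iff R_eval) (simp add: R_add)
 qed (use assms(3) in \<open>auto simp: R_zero\<close>)
qed

lemma R_decomp:
 assumes "ring R" "a \<in> carrier R"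
 shows "a = finsum R (%g. scal (a g) \<otimes>[R] dl g) (carrier G)"
proof -
 interpret R: ring R by fact
 have cl: "(%g. scal (a g) \<otimes>[R] dl g) \<in> carrier G \<rightarrow> carrier R" using assms by (auto simp: R_eval)
 show ?thesis
 proof (rule R_eqI[OF assms(2) R.finsum_closed[OF cl]])
  fix x assume x: "x \<in> carrier G"
  have "finsum K (%g. (scal (a g) \<otimes>[R] dl g) x) (carrier G) = (scal (a x) \<otimes>[R] dl x) x"
   using x assms by (intro K_finsum_single) (auto simp: scal_mult_eval R_eval, auto simp: dl_def R_eval)
  thus "a x = finsum R (%g. scal (a g) \<otimes>[R] dl g) (carrier G) x"
   using x assms by (simp add: R_finsum_eval[OF assms(1) cl x] scal_mult_eval R_eval) (simp add: dl_def R_eval)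
 qed
qed

section \<open>Modules over the group algebra\<close>

abbreviation md :: "('g => 'k, 'a) module => bool" where "md M \<equiv> left_module R M"
abbreviation hom :: "('g => 'k, 'a) module => ('g => 'k, 'b) module => ('a => 'b) => bool" where
 "hom M N f \<equiv> mhom R M N f"

definition sm :: "('g => 'k, 'a) module => 'k => 'a => 'a" where "sm M c x = scal c \<odot>[M] x"
definition ga :: "('g => 'k, 'a) module => 'g => 'a => 'a" where "ga M g x = dl g \<odot>[M] x"
definition vs :: "('g => 'k, 'a) module => ('k, 'a) module" where
 "vs M = \<lparr> carrier = carrier M, mult = mult M, one = one M, zero = zero M, add = add M, smult = sm M \<rparr>"

abbreviation kl :: "('g => 'k, 'a) module => ('g => 'k, 'b) module => ('a => 'b) => bool" where
 "kl M N u \<equiv> mhom K (vs M) (vs N) u"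

lemma vs_simps [simp]: "carrier (vs M) = carrier M" "add (vs M) = add M" "zero (vs M) = zero M"
  "smult (vs M) = sm M"
 by (simp_all add: vs_def)

lemma finsum_vs [simp]: "finsum (vs M) = finsum M"
 by (intro ext) (simp add: finsum_def finprod_def)

lemma a_inv_vs [simp]: "a_inv (vs M) = a_inv M"
 by (intro ext) (simp add: a_inv_def m_inv_def)

lemma md_ab: "md M ==> abelian_group M"
 and md_ring: "md M ==> ring R"
 by (auto simp: left_module_def)

lemma
 assumes "md M"
 shows md_add [simp, intro]: "x \<in> carrier M ==> y \<in> carrier M ==> x \<oplus>[M] y \<in> carrier M"
  and md_zero [simp, intro]: "\<zero>[M] \<in> carrier M"
  and md_neg [simp, intro]: "x \<in> carrier M ==> \<ominus>[M] x \<in> carrier M"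
  and md_minus [simp, intro]: "x \<in> carrier M ==> y \<in> carrier M ==> x \<ominus>[M] y \<in> carrier M"
  and md_smult [simp, intro]: "a \<in> carrier R ==> x \<in> carrier M ==> a \<odot>[M] x \<in> carrier M"
  and md_ga [simp, intro]: "x \<in> carrier M ==> ga M g x \<in> carrier M"
  and md_sm [simp, intro]: "c \<in> carrier K ==> x \<in> carrier M ==> sm M c x \<in> carrier M"
  and md_finsum [intro]: "f \<in> A \<rightarrow> carrier M ==> finsum M f A \<in> carrier M"
proof -
 interpret left_module R M by fact
 show "x \<in> carrier M ==> y \<in> carrier M ==> x \<oplus>[M] y \<in> carrier M"
  "\<zero>[M] \<in> carrier M" "x \<in> carrier M ==> \<ominus>[M] x \<in> carrier M"
  "x \<in> carrier M ==> y \<in> carrier M ==> x \<ominus>[M] y \<in> carrier M"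
  "a \<in> carrier R ==> x \<in> carrier M ==> a \<odot>[M] x \<in> carrier M"
  "x \<in> carrier M ==> ga M g x \<in> carrier M"
  "c \<in> carrier K ==> x \<in> carrier M ==> sm M c x \<in> carrier M"
  "f \<in> A \<rightarrow> carrier M ==> finsum M f A \<in> carrier M"
  by (auto simp: ga_def sm_def smult_closed M.finsum_closed)
qed

lemma left_module_vs:
 assumes "md M" shows "left_module K (vs M)"
proof -
 interpret left_module R M by fact
 have "abelian_group (vs M)"
  by (rule abelian_groupI) (auto simp: M.a_ac intro: M.add.l_inv_ex)
 thus ?thesis
  by (intro left_moduleI)
   (auto simp: K.ring_axioms sm_def smult_closed scal_add smult_l_distr smult_r_distr
    scal_mult_scal[symmetric] smult_assoc scal_one smult_one)
qed

lemma
 assumes "md M"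
 shows ga_add: "x \<in> carrier M ==> y \<in> carrier M ==> ga M g (x \<oplus>[M] y) = ga M g x \<oplus>[M] ga M g y"
  and ga_sm: "c \<in> carrier K ==> x \<in> carrier M ==> ga M g (sm M c x) = sm M c (ga M g x)"
  and ga_ga: "g \<in> carrier G ==> h \<in> carrier G ==> x \<in> carrier M ==> ga M g (ga M h x) = ga M (g \<cdot> h) x"
  and ga_one: "x \<in> carrier M ==> ga M \<one>[G] x = x"
  and smult_sm: "c \<in> carrier K ==> a \<in> carrier R ==> x \<in> carrier M ==> a \<odot>[M] sm M c x = sm M c (a \<odot>[M] x)"
  and ga_zero [simp]: "ga M g \<zero>[M] = \<zero>[M]"
  and sm_zero [simp]: "c \<in> carrier K ==> sm M c \<zero>[M] = \<zero>[M]"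
  and zero_sm [simp]: "x \<in> carrier M ==> sm M \<zero>[K] x = \<zero>[M]"
  and one_sm [simp]: "x \<in> carrier M ==> sm M \<one>[K] x = x"
  and smult_zero [simp]: "a \<in> carrier R ==> a \<odot>[M] \<zero>[M] = \<zero>[M]"
  and ga_neg: "x \<in> carrier M ==> ga M g (\<ominus>[M] x) = \<ominus>[M] ga M g x"
proof -
 interpret left_module R M by fact
 show "x \<in> carrier M ==> y \<in> carrier M ==> ga M g (x \<oplus>[M] y) = ga M g x \<oplus>[M] ga M g y"
  by (simp add: ga_def smult_r_distr)
 show 1: "c \<in> carrier K ==> a \<in> carrier R ==> x \<in> carrier M ==> a \<odot>[M] sm M c x = sm M c (a \<odot>[M] x)" for a
  by (simp add: sm_def smult_assoc[symmetric] scal_central)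
 show "c \<in> carrier K ==> x \<in> carrier M ==> ga M g (sm M c x) = sm M c (ga M g x)"
  by (simp add: ga_def 1)
 show "g \<in> carrier G ==> h \<in> carrier G ==> x \<in> carrier M ==> ga M g (ga M h x) = ga M (g \<cdot> h) x"
  by (simp add: ga_def smult_assoc[symmetric] dl_mult_dl)
 show "x \<in> carrier M ==> ga M \<one>[G] x = x" by (simp add: ga_def R_one[symmetric] smult_one)
 show "ga M g \<zero>[M] = \<zero>[M]" "a \<in> carrier R ==> a \<odot>[M] \<zero>[M] = \<zero>[M]"
  "c \<in> carrier K ==> sm M c \<zero>[M] = \<zero>[M]" by (simp_all add: ga_def sm_def smult_zero_r)
 show "x \<in> carrier M ==> sm M \<zero>[K] x = \<zero>[M]"
  using left_module.smult_zero_l[OF left_module_vs[OF assms]] by simp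
 show "x \<in> carrier M ==> sm M \<one>[K] x = x" by (simp add: sm_def scal_one smult_one)
 show "x \<in> carrier M ==> ga M g (\<ominus>[M] x) = \<ominus>[M] ga M g x" by (simp add: ga_def smult_minus_r)
qed

lemma smult_decomp:
 assumes "md M" "a \<in> carrier R" "x \<in> carrier M"
 shows "a \<odot>[M] x = finsum M (%g. sm M (a g) (ga M g x)) (carrier G)"
proof -
 interpret left_module R M by fact
 have cl: "(%g. scal (a g) \<otimes>[R] dl g) \<in> carrier G \<rightarrow> carrier R" using assms by (auto simp: R_eval)
 have "a \<odot>[M] x = finsum R (%g. scal (a g) \<otimes>[R] dl g) (carrier G) \<odot>[M] x"
  using R_decomp[OF R.ring_axioms assms(2)] by simp
 also have "... = finsum M (%g. (scal (a g) \<otimes>[R] dl g) \<odot>[M] x) (carrier G)"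
  by (rule smult_finsum_l[OF assms(3) cl])
 also have "... = finsum M (%g. sm M (a g) (ga M g x)) (carrier G)"
  by (rule M.finsum_cong') (use assms in \<open>auto simp: sm_def ga_def smult_assoc R_eval smult_closed\<close>)
 finally show ?thesis .
qed

lemma hom_kl: "hom M N f ==> kl M N f"
 by (auto simp: mhom_def sm_def)

lemma hom_ga: "hom M N f ==> x \<in> carrier M ==> f (ga M g x) = ga N g (f x)"
 by (simp add: mhom_def ga_def)

lemmas kl_closed = mhom_closed[of K "vs M" "vs N" for M N, simplified]
lemmas kl_add = mhom_add[of K "vs M" "vs N" for M N, simplified]
lemmas kl_sm = mhom_smult[of K "vs M" "vs N" for M N, simplified]

lemma kl_finsum:
 assumes "md M" "md N" "kl M N f" "g \<in> A \<rightarrow> carrier M"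
 shows "f (finsum M g A) = finsum N (%i. f (g i)) A"
 using mhom_finsum[OF left_module_vs left_module_vs assms(3)] assms by simp

lemma kl_zero: "md M ==> md N ==> kl M N f ==> f \<zero>[M] = \<zero>[N]"
 using mhom_zero[OF left_module_vs left_module_vs] by fastforce

lemma kl_minus: "md M ==> md N ==> kl M N f ==> x \<in> carrier M ==> f (\<ominus>[M] x) = \<ominus>[N] f x"
 using mhom_minus[OF left_module_vs left_module_vs] by fastforce

lemma klI:
 assumes "!!x. x \<in> carrier M ==> f x \<in> carrier N"
  and "!!x y. [|x \<in> carrier M; y \<in> carrier M|] ==> f (x \<oplus>[M] y) = f x \<oplus>[N] f y"
  and "!!a x. [|a \<in> carrier K; x \<in> carrier M|] ==> f (sm M a x) = sm N a (f x)"
 shows "kl M N f"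
 by (rule mhomI) (simp_all add: assms)

lemma kl_sum: "md N ==> kl M N f ==> kl M N g ==> kl M N (%x. f x \<oplus>[N] g x)"
 using mhom_sum[OF left_module_vs] by fastforce

lemma kl_neg: "md N ==> kl M N f ==> kl M N (%x. \<ominus>[N] f x)"
 using mhom_neg[OF left_module_vs] by fastforce

lemma kl_const_zero: "md N ==> kl M N (%x. \<zero>[N])"
 using mhom_const_zero[OF left_module_vs] by fastforce

lemma kl_cong:
 assumes "md M" "kl M N f" "!!x. x \<in> carrier M ==> f x = g x"
 shows "kl M N g"
 by (rule mhom_cong[OF assms(2) _ left_module_vs[OF assms(1)]]) (simp add: assms(3))

lemma kl_comp: "kl M N f ==> kl N L g ==> kl M L (%x. g (f x))"
 by (rule mhom_comp)

lemma kl_ga: "md M ==> kl M M (ga M g)"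
 by (rule klI) (auto simp: ga_add ga_sm)

lemma kl_fin_sum:
 assumes "md N" "!!i. i \<in> A ==> kl M N (f i)" "md M"
 shows "kl M N (%x. finsum N (%i. f i x) A)"
proof -
 interpret N: left_module R N by fact
 show ?thesis using assms(2)
 proof (induct A rule: infinite_finite_induct)
  case (insert y F)
  have "kl M N (%x. f y x \<oplus>[N] finsum N (%i. f i x) F)"
   using insert by (intro kl_sum assms(1)) auto
  thus ?case
  proof (rule kl_cong[OF assms(3)])
   fix x assume "x \<in> carrier M"
   thus "f y x \<oplus>[N] finsum N (%i. f i x) F = finsum N (%i. f i x) (insert y F)"
    using insert kl_closed[OF insert(4)] by (subst N.M.finsum_insert) auto
  qed
 qed (simp_all add: kl_const_zero[OF assms(1)])
qed

lemma homI_kl: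
 assumes M: "md M" "md N" and f: "kl M N f" and eq: "!!g x. g \<in> carrier G ==> x \<in> carrier M ==> f (ga M g x) = ga N g (f x)"
 shows "hom M N f"
proof (rule mhomI)
 interpret M: left_module R M by fact
 interpret N: left_module R N by fact
 fix a x assume a: "a \<in> carrier R" "x \<in> carrier M"
 have av: "a g \<in> carrier K" if "g \<in> carrier G" for g using R_eval[OF a(1) that] .
 have "f (a \<odot>[M] x) = f (finsum M (%g. sm M (a g) (ga M g x)) (carrier G))" by (rule arg_cong[OF smult_decomp[OF M(1) a]])
 also have "... = finsum N (%g. f (sm M (a g) (ga M g x))) (carrier G)"
  by (rule kl_finsum[OF M f]) (use a M av in auto)
 also have "... = finsum N (%g. sm N (a g) (ga N g (f x))) (carrier G)"
  by (rule N.M.finsum_cong') (use a M f av in \<open>auto simp: kl_sm[OF f] kl_closed[OF f] eq\<close>)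
 also have "... = a \<odot>[N] f x" by (rule smult_decomp[OF M(2) a(1) kl_closed[OF f a(2)], symmetric])
 finally show "f (a \<odot>[M] x) = a \<odot>[N] f x" .
qed (use f in \<open>auto simp: kl_closed kl_add\<close>)

section \<open>Traces of linear maps\<close>

text \<open>The sum of the conjugates of a linear map, the norm of the group acting on linear maps.\<close>

definition tr :: "('g => 'k, 'a) module => ('g => 'k, 'b) module => ('a => 'b) => 'a => 'b" where
 "tr M N u x = finsum N (%g. ga N g (u (ga M (inv[G] g) x))) (carrier G)"

lemma tr_closed [intro]: "md M ==> md N ==> kl M N u ==> x \<in> carrier M ==> tr M N u x \<in> carrier N"
 unfolding tr_def by (intro md_finsum) (auto simp: kl_closed)

lemma tr_hom:
 assumes M: "md M" "md N" and u: "kl M N u"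
 shows "hom M N (tr M N u)"
proof (rule homI_kl[OF M])
 interpret N: left_module R N by fact
 show "kl M N (tr M N u)"
 proof -
  have "kl M N (%x. ga N g (u (ga M (inv[G] g) x)))" for g
   by (rule kl_comp[OF kl_comp[OF kl_ga[OF M(1)] u] kl_ga[OF M(2)]])
  thus ?thesis unfolding tr_def[abs_def] by (intro kl_fin_sum M)
 qed
 fix h x assume h: "h \<in> carrier G" "x \<in> carrier M"
 have "tr M N u (ga M h x) = finsum N (%g. ga N g (u (ga M (inv[G] g \<cdot> h) x))) (carrier G)"
  unfolding tr_def by (rule N.M.finsum_cong') (use M u h in \<open>auto simp: ga_ga kl_closed\<close>)
 also have "... = finsum N (%g. ga N g (u (ga M (inv[G] g \<cdot> h) x))) ((%g. h \<cdot> g) ` carrier G)"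
  using G.surj_const_mult[OF h(1)] by simp
 also have "... = finsum N (%g. ga N (h \<cdot> g) (u (ga M (inv[G] (h \<cdot> g) \<cdot> h) x))) (carrier G)"
  by (rule N.M.finsum_reindex) (use M u h G.inj_on_cmult[OF h(1)] in \<open>auto simp: kl_closed\<close>)
 also have "... = finsum N (%g. ga N h (ga N g (u (ga M (inv[G] g) x)))) (carrier G)"
  by (rule N.M.finsum_cong') (use M u h in \<open>auto simp: ga_ga kl_closed G.inv_mult_group G.m_assoc\<close>)
 also have "... = ga N h (tr M N u x)"
  unfolding tr_def ga_def[of N h] by (rule N.smult_finsum_r[symmetric]) (use M u h in \<open>auto simp: kl_closed\<close>)
 finally show "tr M N u (ga M h x) = ga N h (tr M N u x)" .
qed

lemma hom_tr:
 assumes "md M" "md N" "md L" "kl M N u" "hom N L h" "x \<in> carrier M"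
 shows "h (tr M N u x) = tr M L (%y. h (u y)) x"
proof -
 interpret L: left_module R L by fact
 have "h (tr M N u x) = finsum L (%g. h (ga N g (u (ga M (inv[G] g) x)))) (carrier G)"
  unfolding tr_def by (rule mhom_finsum[OF assms(2,3,5)]) (use assms in \<open>auto simp: kl_closed\<close>)
 also have "... = tr M L (%y. h (u y)) x"
  unfolding tr_def by (rule L.M.finsum_cong') (use assms in \<open>auto simp: kl_closed hom_ga mhom_closed\<close>)
 finally show ?thesis .
qed

lemma tr_comp_hom:
 assumes "md M" "md N" "md L" "hom M N h" "kl N L u" "x \<in> carrier M"
 shows "tr N L u (h x) = tr M L (%y. u (h y)) x"
proof -
 interpret L: left_module R L by fact
 show ?thesis unfolding tr_def
  by (rule L.M.finsum_cong') (use assms in \<open>auto simp: kl_closed mhom_closed hom_ga\<close>)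
qed

lemma tr_cong:
 assumes "md M" "md N" "kl M N u" "!!x. x \<in> carrier M ==> u x = v x" "x \<in> carrier M"
 shows "tr M N u x = tr M N v x"
proof -
 interpret N: left_module R N by fact
 show ?thesis unfolding tr_def
  by (rule N.M.finsum_cong') (use assms(1-3,5) in \<open>auto simp: kl_closed assms(4)[symmetric]\<close>)
qed

lemma tr_sum:
 assumes "md M" "md N" "kl M N u" "kl M N v" "x \<in> carrier M"
 shows "tr M N (%x. u x \<oplus>[N] v x) x = tr M N u x \<oplus>[N] tr M N v x"
proof -
 interpret N: left_module R N by fact
 have "tr M N (%x. u x \<oplus>[N] v x) x =
   finsum N (%g. ga N g (u (ga M (inv[G] g) x)) \<oplus>[N] ga N g (v (ga M (inv[G] g) x))) (carrier G)"
  unfolding tr_def by (rule N.M.finsum_cong') (use assms in \<open>auto simp: kl_closed ga_add\<close>)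
 also have "... = tr M N u x \<oplus>[N] tr M N v x"
  unfolding tr_def by (rule N.M.finsum_addf) (use assms in \<open>auto simp: kl_closed\<close>)
 finally show ?thesis .
qed

lemma tr_neg:
 assumes "md M" "md N" "kl M N u" "x \<in> carrier M"
 shows "tr M N (%x. \<ominus>[N] u x) x = \<ominus>[N] tr M N u x"
 using hom_tr[OF assms(1,2,2,3) mhom_neg[OF assms(2) mhom_id] assms(4)] by simp

end

section \<open>Coinduced modules\<close>

context kG begin

definition reg :: "('g => 'k, 'g => 'k) module" where
 "reg = \<lparr> carrier = carrier R, mult = mult R, one = one R, zero = zero R, add = add R, smult = mult R \<rparr>"

lemma reg_simps [simp]: "carrier reg = carrier R" "add reg = add R" "zero reg = zero R" "smult reg = mult R"
 by (simp_all add: reg_def)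

lemma reg_md:
 assumes "ring R" shows "md reg"
proof -
 interpret R: ring R by fact
 have "abelian_group reg"
  by (rule abelian_groupI) (auto simp: R.a_ac intro: R.add.l_inv_ex)
 thus ?thesis
  by (intro left_moduleI) (auto simp: R.ring_axioms R.l_distr R.r_distr R.m_assoc)
qed

text \<open>Coinduction along the inclusion of the field, as linear maps out of the group algebra.
  It replaces free modules: it is projective, each module embeds in its coinduced module and is a quotient of it.\<close>

definition coind :: "('g => 'k, 'a) module => ('g => 'k, ('g => 'k) => 'a) module" where
 "coind M = \<lparr> carrier = {\<phi> \<in> extensional (carrier R). kl reg M \<phi>}, mult = undefined, one = undefined,
   zero = (\<lambda>r\<in>carrier R. \<zero>[M]), add = (%\<phi> \<psi>. \<lambda>r\<in>carrier R. \<phi> r \<oplus>[M] \<psi> r),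
   smult = (%a \<phi>. \<lambda>r\<in>carrier R. \<phi> (r \<otimes>[R] a)) \<rparr>"

lemma coind_carrier: "\<phi> \<in> carrier (coind M) \<longleftrightarrow> \<phi> \<in> extensional (carrier R) & kl reg M \<phi>"
 and coind_add: "\<phi> \<oplus>[coind M] \<psi> = (\<lambda>r\<in>carrier R. \<phi> r \<oplus>[M] \<psi> r)"
 and coind_zero: "\<zero>[coind M] = (\<lambda>r\<in>carrier R. \<zero>[M])"
 and coind_smult: "a \<odot>[coind M] \<phi> = (\<lambda>r\<in>carrier R. \<phi> (r \<otimes>[R] a))"
 by (simp_all add: coind_def)

lemma coind_eval: "\<phi> \<in> carrier (coind M) ==> r \<in> carrier R ==> \<phi> r \<in> carrier M"
 using kl_closed[of reg M \<phi> r] by (simp add: coind_carrier)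

lemma coind_eqI:
 assumes "\<phi> \<in> carrier (coind M)" "\<psi> \<in> carrier (coind M)" "!!r. r \<in> carrier R ==> \<phi> r = \<psi> r"
 shows "\<phi> = \<psi>"
 using assms by (intro extensionalityI[of _ "carrier R"]) (auto simp: coind_carrier)

lemma restrict_coind:
 assumes "md M" "kl reg M \<phi>"
 shows "(\<lambda>r\<in>carrier R. \<phi> r) \<in> carrier (coind M)"
 unfolding coind_carrier
 by (intro conjI restrict_extensional kl_cong[OF reg_md[OF md_ring[OF assms(1)]] assms(2)]) simp

lemma reg_right_mult:
 assumes "ring R" "a \<in> carrier R" shows "kl reg reg (%r. r \<otimes>[R] a)"
proof -
 interpret R: ring R by fact
 show ?thesis by (rule klI) (use assms(2) in \<open>auto simp: sm_def R.l_distr R.m_assoc\<close>)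
qed

lemma coind_md:
 assumes M: "md M" shows "md (coind M)"
proof -
 interpret M: left_module R M by fact
 note rg = reg_md[OF M.R.ring_axioms]
 note kl = coind_carrier[THEN iffD1, THEN conjunct2]
 have add: "\<phi> \<oplus>[coind M] \<psi> \<in> carrier (coind M)" if "\<phi> \<in> carrier (coind M)" "\<psi> \<in> carrier (coind M)" for \<phi> \<psi>
  unfolding coind_add by (rule restrict_coind[OF M]) (intro kl_sum M kl that)
 have zero: "\<zero>[coind M] \<in> carrier (coind M)"
  unfolding coind_zero by (rule restrict_coind[OF M]) (intro kl_const_zero M)
 have neg: "(\<lambda>r\<in>carrier R. \<ominus>[M] \<phi> r) \<in> carrier (coind M)" if "\<phi> \<in> carrier (coind M)" for \<phi>
  by (rule restrict_coind[OF M]) (intro kl_neg M kl that)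
 have smult: "a \<odot>[coind M] \<phi> \<in> carrier (coind M)" if "\<phi> \<in> carrier (coind M)" "a \<in> carrier R" for \<phi> a
  unfolding coind_smult
  by (rule restrict_coind[OF M]) (rule kl_comp[OF reg_right_mult[OF M.R.ring_axioms that(2)] kl[OF that(1)]])
 have "abelian_group (coind M)"
 proof (rule abelian_groupI)
  fix \<phi> assume p: "\<phi> \<in> carrier (coind M)"
  have "(\<lambda>r\<in>carrier R. \<ominus>[M] \<phi> r) \<oplus>[coind M] \<phi> = \<zero>[coind M]"
   unfolding coind_add coind_zero by (rule restrict_ext) (simp add: M.M.l_neg coind_eval[OF p])
  thus "\<exists>\<psi>\<in>carrier (coind M). \<psi> \<oplus>[coind M] \<phi> = \<zero>[coind M]" using neg[OF p] by blast
  show "\<zero>[coind M] \<oplus>[coind M] \<phi> = \<phi>"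
   by (rule coind_eqI[OF add[OF zero p] p]) (simp add: coind_add coind_zero coind_eval[OF p])
 next
  fix x y z assume a: "x \<in> carrier (coind M)" "y \<in> carrier (coind M)" "z \<in> carrier (coind M)"
  show "x \<oplus>[coind M] y \<oplus>[coind M] z = x \<oplus>[coind M] (y \<oplus>[coind M] z)"
   unfolding coind_add by (rule restrict_ext) (simp add: coind_eval[OF a(1)] coind_eval[OF a(2)] coind_eval[OF a(3)] M.M.a_assoc)
 next
  fix x y assume a: "x \<in> carrier (coind M)" "y \<in> carrier (coind M)"
  show "x \<oplus>[coind M] y = y \<oplus>[coind M] x"
   unfolding coind_add by (rule restrict_ext) (simp add: coind_eval[OF a(1)] coind_eval[OF a(2)] M.M.a_comm)
 qed (use add zero in auto)
 thus ?thesis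
 proof (rule left_moduleI[OF M.R.ring_axioms])
  fix a x assume "a \<in> carrier R" "x \<in> carrier (coind M)" thus "a \<odot>[coind M] x \<in> carrier (coind M)" by (rule smult[rotated])
 next
  fix a b x assume a: "a \<in> carrier R" "b \<in> carrier R" "x \<in> carrier (coind M)"
  show "(a \<oplus>[R] b) \<odot>[coind M] x = a \<odot>[coind M] x \<oplus>[coind M] b \<odot>[coind M] x"
   unfolding coind_add coind_smult
   by (rule restrict_ext) (use a kl_add[OF kl[OF a(3)]] in \<open>simp add: M.R.r_distr\<close>)
  show "(a \<otimes>[R] b) \<odot>[coind M] x = a \<odot>[coind M] (b \<odot>[coind M] x)"
   unfolding coind_smult by (rule restrict_ext) (use a in \<open>simp add: M.R.m_assoc\<close>)
 next
  fix a x y assume a: "a \<in> carrier R" "x \<in> carrier (coind M)" "y \<in> carrier (coind M)"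
  show "a \<odot>[coind M] (x \<oplus>[coind M] y) = a \<odot>[coind M] x \<oplus>[coind M] a \<odot>[coind M] y"
   unfolding coind_add coind_smult by (rule restrict_ext) (use a in simp)
 next
  fix x assume a: "x \<in> carrier (coind M)"
  show "\<one>[R] \<odot>[coind M] x = x"
   by (rule coind_eqI[OF smult[OF a M.R.one_closed] a]) (simp add: coind_smult)
 qed
qed

lemma coind_finsum:
 assumes "md M" "f \<in> A \<rightarrow> carrier (coind M)" "r \<in> carrier R"
 shows "finsum (coind M) f A r = finsum M (%i. f i r) A"
proof -
 interpret M: left_module R M by fact
 interpret C: left_module R "coind M" by (rule coind_md) fact
 show ?thesis using assms(2)
 proof (induct A rule: infinite_finite_induct)
  case (insert y F)
  have "finsum (coind M) f (insert y F) r = f y r \<oplus>[M] finsum (coind M) f F r"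
   using insert assms(3) by (subst C.M.finsum_insert) (auto simp: coind_add)
  also have "... = finsum M (%i. f i r) (insert y F)"
   using insert assms(3) by (subst M.M.finsum_insert) (auto intro: coind_eval)
  finally show ?case .
 qed (use assms(3) in \<open>auto simp: coind_zero\<close>)
qed

definition coind_unit :: "('g => 'k, 'a) module => 'a => ('g => 'k) => 'a" where
 "coind_unit M m = (\<lambda>r\<in>carrier R. r \<odot>[M] m)"
definition coind_counit :: "('g => 'k, 'a) module => (('g => 'k) => 'a) => 'a" where
 "coind_counit M = tr (coind M) M (%\<phi>. \<phi> \<one>[R])"
definition coeff_map :: "('g => 'k, 'a) module => 'g => 'a => ('g => 'k) => 'a" where
 "coeff_map M y n = (\<lambda>r\<in>carrier R. sm M (r y) n)"

lemma unit_closed: "md M ==> m \<in> carrier M ==> coind_unit M m \<in> carrier (coind M)"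
proof -
 assume a: "md M" "m \<in> carrier M"
 interpret M: left_module R M by fact
 show ?thesis
  unfolding coind_unit_def using a
  by (intro restrict_coind klI) (auto simp: M.smult_l_distr, auto simp: sm_def M.smult_assoc)
qed

lemma unit_hom: "md M ==> hom M (coind M) (coind_unit M)"
proof -
 assume a: "md M"
 interpret M: left_module R M by fact
 show ?thesis
 proof (rule mhomI)
  fix x y assume "x \<in> carrier M" "y \<in> carrier M"
  thus "coind_unit M (x \<oplus>[M] y) = coind_unit M x \<oplus>[coind M] coind_unit M y"
   unfolding coind_unit_def coind_add by (intro restrict_ext) (simp add: M.smult_r_distr)
 next
  fix b x assume "b \<in> carrier R" "x \<in> carrier M"
  thus "coind_unit M (b \<odot>[M] x) = b \<odot>[coind M] coind_unit M x"
   unfolding coind_unit_def coind_smult by (intro restrict_ext) (simp add: M.smult_assoc)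
 qed (simp add: unit_closed a)
qed

lemma unit_one: "md M ==> m \<in> carrier M ==> coind_unit M m \<one>[R] = m"
 by (simp add: coind_unit_def R_one) (simp add: ga_one flip: ga_def)

lemma ev_kl: "md M ==> r \<in> carrier R ==> kl (coind M) M (%\<phi>. \<phi> r)"
proof (rule klI)
 fix c x assume a: "md M" "r \<in> carrier R" "c \<in> carrier K" "x \<in> carrier (coind M)"
 interpret M: left_module R M by fact
 have "r \<otimes>[R] scal c = scal c \<otimes>[R] r" using a scal_central by simp
 thus "sm (coind M) c x r = sm M c (x r)"
  using a kl_sm[of reg M x c r] by (simp add: coind_carrier sm_def coind_smult)
qed (auto intro: coind_eval simp: coind_add)

lemma one_R_closed [simp]: "\<one>[R] \<in> carrier R" by (simp add: R_one)

lemma counit_hom: "md M ==> hom (coind M) M (coind_counit M)"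
 unfolding coind_counit_def by (intro tr_hom coind_md ev_kl) auto

lemma ga_coind: "r \<in> carrier R ==> ga (coind M) g \<phi> r = \<phi> (r \<otimes>[R] dl g)"
 by (simp add: ga_def coind_smult)

lemma counit_eq:
 assumes "md M" "\<phi> \<in> carrier (coind M)"
 shows "coind_counit M \<phi> = finsum M (%g. ga M g (\<phi> (dl (inv[G] g)))) (carrier G)"
proof -
 interpret M: left_module R M by fact
 show ?thesis
  unfolding coind_counit_def tr_def
  by (rule M.M.finsum_cong') (use assms(1) coind_eval[OF assms(2)] in \<open>auto simp: ga_coind intro!: md_ga\<close>)
qed

lemma coeff_map_closed: "md M ==> y \<in> carrier G ==> n \<in> carrier M ==> coeff_map M y n \<in> carrier (coind M)"
proof -
 assume a: "md M" "y \<in> carrier G" "n \<in> carrier M"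
 interpret V: left_module K "vs M" by (rule left_module_vs) fact
 have l: "sm M (b \<oplus>[K] c) n = sm M b n \<oplus>[M] sm M c n" if "b \<in> carrier K" "c \<in> carrier K" for b c
  using V.smult_l_distr[OF that] a by simp
 have m: "sm M (b \<otimes>[K] c) n = sm M b (sm M c n)" if "b \<in> carrier K" "c \<in> carrier K" for b c
  using V.smult_assoc[OF that] a by simp
 show ?thesis
  unfolding coeff_map_def using a
  by (intro restrict_coind klI) (auto simp: R_eval R_add l sm_def[of reg] scal_mult_eval m)
qed

lemma coeff_map_kl: "md M ==> y \<in> carrier G ==> kl M (coind M) (coeff_map M y)"
proof (rule klI)
 assume a: "md M" "y \<in> carrier G"
 interpret M: left_module R M by fact
 interpret V: left_module K "vs M" by (rule left_module_vs) fact
 fix x z assume "x \<in> carrier M" "z \<in> carrier M"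
 thus "coeff_map M y (x \<oplus>[M] z) = coeff_map M y x \<oplus>[coind M] coeff_map M y z"
  unfolding coeff_map_def coind_add using a V.smult_r_distr
  by (intro restrict_ext) (simp add: R_eval)
next
 assume a: "md M" "y \<in> carrier G"
 interpret M: left_module R M by fact
 interpret V: left_module K "vs M" by (rule left_module_vs) fact
 have m: "sm M (b \<otimes>[K] c) n = sm M b (sm M c n)" if "b \<in> carrier K" "c \<in> carrier K" "n \<in> carrier M" for b c n
  using V.smult_assoc[OF that(1,2)] that a by simp
 fix c x assume c: "c \<in> carrier K" "x \<in> carrier M"
 show "coeff_map M y (sm M c x) = sm (coind M) c (coeff_map M y x)"
  unfolding coeff_map_def sm_def[of "coind M"] coind_smult using a c
  by (intro restrict_ext) (simp add: R_eval mult_scal_eval m)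
qed (auto simp: coeff_map_closed)

lemma kl_eval:
 assumes M: "md M" and phi: "kl reg M \<phi>" "r \<in> carrier R"
 shows "\<phi> r = finsum M (%g. sm M (r g) (\<phi> (dl g))) (carrier G)"
proof -
 interpret M: left_module R M by fact
 note rg = reg_md[OF M.R.ring_axioms]
 have fs: "finsum reg = finsum R" by (intro ext) (simp add: finsum_def finprod_def)
 have cl: "(%g. scal (r g) \<otimes>[R] dl g) \<in> carrier G \<rightarrow> carrier reg" using phi by (auto simp: R_eval)
 have "\<phi> r = \<phi> (finsum reg (%g. scal (r g) \<otimes>[R] dl g) (carrier G))"
  unfolding fs by (rule arg_cong[OF R_decomp[OF M.R.ring_axioms phi(2)]])
 also have "... = finsum M (%g. \<phi> (scal (r g) \<otimes>[R] dl g)) (carrier G)"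
  by (rule kl_finsum[OF rg M phi(1) cl])
 also have "... = finsum M (%g. sm M (r g) (\<phi> (dl g))) (carrier G)"
 proof (rule M.M.finsum_cong'[OF refl])
  show "(%g. sm M (r g) (\<phi> (dl g))) \<in> carrier G \<rightarrow> carrier M"
   using kl_closed[OF phi(1)] phi(2) M by (auto simp: R_eval)
  fix g assume "g \<in> carrier G"
  thus "\<phi> (scal (r g) \<otimes>[R] dl g) = sm M (r g) (\<phi> (dl g))"
   using kl_sm[OF phi(1), of "r g" "dl g"] phi(2) by (simp add: sm_def[of reg] R_eval)
 qed
 finally show ?thesis .
qed

text \<open>Every map into a coinduced module that is adjoint to a linear map is a trace.\<close>

lemma tr_coeff_map:
 assumes M: "md M" and N: "md N" and v: "kl M N v" and y: "y \<in> carrier G" and m: "m \<in> carrier M" and r: "r \<in> carrier R"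
 shows "tr M (coind N) (%x. coeff_map N y (v x)) m r = v (ga M (inv[G] y) (r \<odot>[M] m))"
proof -
 interpret M: left_module R M by fact
 interpret N: left_module R N by fact
 have vc: "!!x. x \<in> carrier M ==> v x \<in> carrier N" using kl_closed[OF v] .
 let ?s = "%h. ga (coind N) h (coeff_map N y (v (ga M (inv[G] h) m)))"
 have cl: "?s \<in> carrier G \<rightarrow> carrier (coind N)"
  by (auto intro!: md_ga coind_md coeff_map_closed vc N M y m)
 have "tr M (coind N) (%x. coeff_map N y (v x)) m r = finsum N (%h. ?s h r) (carrier G)"
  unfolding tr_def by (rule coind_finsum[OF N cl r])
 also have "... = finsum N (%h. sm N (r (y \<cdot> inv[G] h)) (v (ga M (inv[G] h) m))) (carrier G)"
  by (rule N.M.finsum_cong'[OF refl])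
   (use y r in \<open>auto intro!: md_sm N vc md_ga M m R_eval[OF r] simp: ga_coind coeff_map_def mult_dl_eval\<close>)
 also have "... = finsum N (%h. sm N (r (y \<cdot> inv[G] h)) (v (ga M (inv[G] h) m))) ((%x. inv[G] x \<cdot> y) ` carrier G)"
 proof -
  have "x \<in> (%x. inv[G] x \<cdot> y) ` carrier G" if "x \<in> carrier G" for x
   using that y by (intro image_eqI[of _ _ "y \<cdot> inv[G] x"]) (auto simp: G.inv_mult_group G.m_assoc)
  hence "(%x. inv[G] x \<cdot> y) ` carrier G = carrier G" using y by auto
  thus ?thesis by simp
 qed
 also have "... = finsum N (%x. sm N (r (y \<cdot> inv[G] (inv[G] x \<cdot> y))) (v (ga M (inv[G] (inv[G] x \<cdot> y)) m))) (carrier G)"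
 proof (rule N.M.finsum_reindex)
  show "inj_on (%x. inv[G] x \<cdot> y) (carrier G)" using y by (auto intro!: inj_onI)
  show "(%h. sm N (r (y \<cdot> inv[G] h)) (v (ga M (inv[G] h) m))) \<in> (%x. inv[G] x \<cdot> y) ` carrier G \<rightarrow> carrier N"
   using y r by (auto intro!: md_sm N vc md_ga M m R_eval[OF r])
 qed
 also have "... = finsum N (%x. v (ga M (inv[G] y) (sm M (r x) (ga M x m)))) (carrier G)"
 proof (rule N.M.finsum_cong'[OF refl])
  show "(%x. v (ga M (inv[G] y) (sm M (r x) (ga M x m)))) \<in> carrier G \<rightarrow> carrier N"
   using y r by (auto intro!: md_sm N vc md_ga M m R_eval[OF r])
  fix x assume x: "x \<in> carrier G"
  have e: "y \<cdot> inv[G] (inv[G] x \<cdot> y) = x" "inv[G] (inv[G] x \<cdot> y) = inv[G] y \<cdot> x"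
   using x y by (simp_all add: G.inv_mult_group flip: G.m_assoc)
  have e': "y \<cdot> (inv[G] y \<cdot> x) = x" using x y by (simp flip: G.m_assoc)
  have rx: "r x \<in> carrier K" using r x by (rule R_eval)
  show "sm N (r (y \<cdot> inv[G] (inv[G] x \<cdot> y))) (v (ga M (inv[G] (inv[G] x \<cdot> y)) m)) = v (ga M (inv[G] y) (sm M (r x) (ga M x m)))"
   unfolding e using M m rx x y by (simp add: ga_sm kl_sm[OF v] ga_ga e')
 qed
 also have "... = v (ga M (inv[G] y) (finsum M (%x. sm M (r x) (ga M x m)) (carrier G)))"
  by (rule kl_finsum[OF M N kl_comp[OF kl_ga[OF M] v], symmetric]) (use r in \<open>auto intro!: md_sm M md_ga m R_eval[OF r]\<close>)
 also have "... = v (ga M (inv[G] y) (r \<odot>[M] m))"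
  by (simp add: smult_decomp[OF M r m])
 finally show ?thesis .
qed

text \<open>The identity of a coinduced module is a trace; this is what makes it projective.\<close>

lemma coind_id_trace:
 assumes M: "md M" and phi: "\<phi> \<in> carrier (coind M)"
 shows "tr (coind M) (coind M) (%\<psi>. coeff_map M \<one>[G] (\<psi> \<one>[R])) \<phi> = \<phi>"
proof (rule coind_eqI)
 interpret M: left_module R M by fact
 note C = coind_md[OF M]
 have v: "kl (coind M) M (%\<psi>. \<psi> \<one>[R])" by (rule ev_kl[OF M]) simp
 show "tr (coind M) (coind M) (%\<psi>. coeff_map M \<one>[G] (\<psi> \<one>[R])) \<phi> \<in> carrier (coind M)"
  by (rule tr_closed[OF C C kl_comp[OF v coeff_map_kl[OF M]] phi]) simp
 fix r assume r: "r \<in> carrier R"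
 show "tr (coind M) (coind M) (%\<psi>. coeff_map M \<one>[G] (\<psi> \<one>[R])) \<phi> r = \<phi> r"
  unfolding tr_coeff_map[OF C M v G.one_closed phi r]
  using ga_one[OF C md_smult[OF C r phi]] r by (simp add: coind_smult)
qed (rule phi)

definition coind_map :: "('g => 'k, 'a) module => ('a => 'b) => (('g => 'k) => 'a) => ('g => 'k) => 'b" where
 "coind_map M u \<phi> = (\<lambda>r\<in>carrier R. u (\<phi> r))"

lemma coind_map_hom:
 assumes M: "md M" and N: "md N" and u: "kl M N u"
 shows "hom (coind M) (coind N) (coind_map M u)"
proof (rule mhomI)
 interpret M: left_module R M by fact
 fix x assume x: "x \<in> carrier (coind M)"
 show "coind_map M u x \<in> carrier (coind N)"
  unfolding coind_map_def using x by (intro restrict_coind[OF N] kl_comp[OF _ u]) (simp add: coind_carrier)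
next
 fix x y assume x: "x \<in> carrier (coind M)" "y \<in> carrier (coind M)"
 show "coind_map M u (x \<oplus>[coind M] y) = coind_map M u x \<oplus>[coind N] coind_map M u y"
  unfolding coind_map_def coind_add
  by (rule restrict_ext) (simp add: kl_add[OF u] coind_eval[OF x(1)] coind_eval[OF x(2)])
next
 interpret M: left_module R M by fact
 fix a x assume x: "a \<in> carrier R" "x \<in> carrier (coind M)"
 show "coind_map M u (a \<odot>[coind M] x) = a \<odot>[coind N] coind_map M u x"
  unfolding coind_map_def coind_smult by (rule restrict_ext) (simp add: x)
qed

lemma counit_coind_map_unit:
 assumes M: "md M" and N: "md N" and u: "kl M N u" and x: "x \<in> carrier M"
 shows "coind_counit N (coind_map M u (coind_unit M x)) = tr M N u x"
proof -
 interpret N: left_module R N by fact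
 have "coind_map M u (coind_unit M x) \<in> carrier (coind N)"
  by (rule mhom_closed[OF coind_map_hom[OF M N u] unit_closed[OF M x]])
 note * = counit_eq[OF N this]
 show ?thesis unfolding * tr_def
  by (rule N.M.finsum_cong'[OF refl])
   (use M N x kl_closed[OF u] in \<open>auto simp: coind_map_def coind_unit_def ga_def[symmetric]\<close>)
qed

lemma dl_apply: "x \<in> carrier G ==> dl g x = (if x = g then \<one>[K] else \<zero>[K])"
 by (simp add: dl_def)

lemma counit_coeff_map:
 assumes M: "md M" and n: "n \<in> carrier M" and y: "y \<in> carrier G"
 shows "coind_counit M (coeff_map M y n) = ga M (inv[G] y) n"
proof -
 interpret M: left_module R M by fact
 have e: "y = inv[G] g \<longleftrightarrow> g = inv[G] y" if "g \<in> carrier G" for g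
  using that y by auto
 have "coind_counit M (coeff_map M y n) = finsum M (%g. ga M g (coeff_map M y n (dl (inv[G] g)))) (carrier G)"
  by (rule counit_eq[OF M coeff_map_closed[OF M y n]])
 also have "... = finsum M (%g. if inv[G] y = g then (%_. ga M (inv[G] y) n) g else \<zero>[M]) (carrier G)"
  by (rule M.M.finsum_cong'[OF refl])
   (use M n y in \<open>auto simp: coeff_map_def dl_apply e split: if_splits\<close>)
 also have "... = ga M (inv[G] y) n"
  by (rule M.M.finsum_singleton) (use M n y finG in auto)
 finally show ?thesis .
qed

lemma counit_surj:
 assumes M: "md M" and n: "n \<in> carrier M"
 shows "coind_counit M (coeff_map M \<one>[G] n) = n"
 using counit_coeff_map[OF M n G.one_closed] M n by (simp add: ga_one)

section \<open>Stably trivial homomorphisms\<close>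

text \<open>By Higman's criterion these are the maps that factor through a projective module.\<close>

definition sz :: "('g => 'k, 'a) module => ('g => 'k, 'b) module => ('a => 'b) => bool" where
 "sz M N t \<longleftrightarrow> (\<exists>u. kl M N u & (\<forall>x\<in>carrier M. t x = tr M N u x))"

definition st :: "('g => 'k, 'a) module => ('g => 'k, 'b) module => ('a => 'b) => ('a => 'b) => bool" where
 "st M N f g \<longleftrightarrow> (\<exists>t. sz M N t & (\<forall>x\<in>carrier M. f x = g x \<oplus>[N] t x))"

lemma sz_hom: "md M ==> md N ==> sz M N t ==> hom M N t"
 unfolding sz_def using mhom_cong[OF tr_hom] by metis

lemma sz_cong: "sz M N t ==> (!!x. x \<in> carrier M ==> s x = t x) ==> sz M N s"
 by (auto simp: sz_def)

lemma sz_tr: "kl M N u ==> sz M N (tr M N u)"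
 by (auto simp: sz_def)

lemma sz_zero:
 assumes "md M" "md N" shows "sz M N (%x. \<zero>[N])"
proof -
 interpret N: left_module R N by fact
 show ?thesis unfolding sz_def
  by (rule exI[of _ "%x. \<zero>[N]"]) (use assms in \<open>simp add: kl_const_zero tr_def N.M.finsum_zero\<close>)
qed

lemma sz_sum:
 assumes "md M" "md N" "sz M N s" "sz M N t" shows "sz M N (%x. s x \<oplus>[N] t x)"
proof -
 obtain u v where "kl M N u" "\<forall>x\<in>carrier M. s x = tr M N u x" "kl M N v" "\<forall>x\<in>carrier M. t x = tr M N v x"
  using assms(3,4) by (auto simp: sz_def)
 thus ?thesis unfolding sz_def
  by (intro exI[of _ "%x. u x \<oplus>[N] v x"]) (simp add: kl_sum assms(2) tr_sum[OF assms(1,2)])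
qed

lemma sz_neg:
 assumes "md M" "md N" "sz M N t" shows "sz M N (%x. \<ominus>[N] t x)"
proof -
 obtain v where "kl M N v" "\<forall>x\<in>carrier M. t x = tr M N v x"
  using assms(3) by (auto simp: sz_def)
 thus ?thesis unfolding sz_def
  by (intro exI[of _ "%x. \<ominus>[N] v x"]) (simp add: kl_neg assms(2) tr_neg[OF assms(1,2)])
qed

lemma sz_post:
 assumes "md M" "md N" "md L" "sz M N t" "hom N L h" shows "sz M L (%x. h (t x))"
proof -
 obtain v where "kl M N v" "\<forall>x\<in>carrier M. t x = tr M N v x"
  using assms(4) by (auto simp: sz_def)
 thus ?thesis unfolding sz_def
  by (intro exI[of _ "%x. h (v x)"]) (simp add: kl_comp[OF _ hom_kl[OF assms(5)]] hom_tr[OF assms(1-3) _ assms(5)])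
qed

lemma sz_pre:
 assumes "md M" "md N" "md L" "hom M N h" "sz N L t" shows "sz M L (%x. t (h x))"
proof -
 obtain v where "kl N L v" "\<forall>x\<in>carrier N. t x = tr N L v x"
  using assms(5) by (auto simp: sz_def)
 thus ?thesis unfolding sz_def
  by (intro exI[of _ "%x. v (h x)"])
   (simp add: kl_comp[OF hom_kl[OF assms(4)]] tr_comp_hom[OF assms(1-4)] mhom_closed[OF assms(4)])
qed

text \<open>A trace extends along any injection: compose the linear map with a linear retraction.\<close>

lemma sz_extend:
 assumes A: "md A" and E: "md E" and Y: "md Y" and a: "hom A E a" "inj_on a (carrier A)" and t: "sz A Y t"
 shows "\<exists>t'. hom E Y t' & sz E Y t' & (\<forall>x\<in>carrier A. t' (a x) = t x)"
proof -
 obtain v where v: "kl A Y v" "!!x. x \<in> carrier A ==> t x = tr A Y v x" using t by (auto simp: sz_def)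
 obtain r where r: "kl E A r" "!!x. x \<in> carrier A ==> r (a x) = x"
  using linear_retraction_exists[OF K.field_axioms left_module_vs[OF A] left_module_vs[OF E] hom_kl[OF a(1)]] a(2) by auto
 have vr: "kl E Y (%x. v (r x))" using kl_comp[OF r(1) v(1)] .
 have "tr E Y (%x. v (r x)) (a x) = t x" if x: "x \<in> carrier A" for x
 proof -
  have "tr E Y (%x. v (r x)) (a x) = tr A Y (%x. v (r (a x))) x"
   by (rule tr_comp_hom[OF A E Y a(1) vr x])
  also have "... = tr A Y v x"
   by (rule tr_cong[OF A Y kl_comp[OF hom_kl[OF a(1)] vr] _ x]) (simp add: r(2))
  finally show ?thesis using v(2)[OF x] by simp
 qed
 thus ?thesis using tr_hom[OF E Y vr] sz_tr[OF vr] by blast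
qed

text \<open>A trace lifts along any surjection: compose the linear map with a linear section.\<close>

lemma sz_lift:
 assumes E: "md E" and B: "md B" and Y: "md Y" and b: "hom E B b" "b ` carrier E = carrier B" and t: "sz Y B t"
 shows "\<exists>t'. hom Y E t' & sz Y E t' & (\<forall>x\<in>carrier Y. b (t' x) = t x)"
proof -
 obtain v where v: "kl Y B v" "!!x. x \<in> carrier Y ==> t x = tr Y B v x" using t by (auto simp: sz_def)
 obtain s where s: "kl B E s" "!!x. x \<in> carrier B ==> b (s x) = x"
  using linear_section_exists[OF K.field_axioms left_module_vs[OF E] left_module_vs[OF B] hom_kl[OF b(1)]] b(2) by auto
 have vs: "kl Y E (%x. s (v x))" using kl_comp[OF v(1) s(1)] .
 have "b (tr Y E (%x. s (v x)) x) = t x" if x: "x \<in> carrier Y" for x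
 proof -
  have "b (tr Y E (%x. s (v x)) x) = tr Y B (%x. b (s (v x))) x"
   by (rule hom_tr[OF Y E B vs b(1) x])
  also have "... = tr Y B v x"
   by (rule tr_cong[OF Y B kl_comp[OF vs hom_kl[OF b(1)]] _ x]) (simp add: s(2) kl_closed[OF v(1)])
  finally show ?thesis using v(2)[OF x] by simp
 qed
 thus ?thesis using tr_hom[OF Y E vs] sz_tr[OF vs] by blast
qed

end

context kG begin

lemma st_closed: "md M ==> md N ==> sz M N t ==> x \<in> carrier M ==> t x \<in> carrier N"
 using mhom_closed[OF sz_hom] .

lemma st_refl: "md M ==> md N ==> hom M N f ==> st M N f f"
proof -
 assume a: "md M" "md N" "hom M N f"
 interpret N: left_module R N by fact
 show ?thesis unfolding st_def
  by (rule exI[of _ "%x. \<zero>[N]"]) (use a in \<open>simp add: sz_zero mhom_closed\<close>)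
qed

lemma st_cong: "st M N f g ==> (!!x. x \<in> carrier M ==> f x = f' x) ==> (!!x. x \<in> carrier M ==> g x = g' x) ==> st M N f' g'"
 by (auto simp: st_def)

lemma st_eqI: "md M ==> md N ==> hom M N f ==> (!!x. x \<in> carrier M ==> f x = g x) ==> st M N f g"
 using st_refl st_cong by metis

lemma st_sym:
 assumes "md M" "md N" "hom M N g" "st M N f g" shows "st M N g f"
proof -
 interpret N: left_module R N by fact
 obtain t where t: "sz M N t" "!!x. x \<in> carrier M ==> f x = g x \<oplus>[N] t x" using assms(4) by (auto simp: st_def)
 have "g x = f x \<oplus>[N] (\<ominus>[N] t x)" if "x \<in> carrier M" for x
  using t(2)[OF that] mhom_closed[OF assms(3) that] st_closed[OF assms(1,2) t(1) that]
  by (simp add: N.M.a_assoc N.M.r_neg)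
 thus ?thesis using sz_neg[OF assms(1,2) t(1)] by (auto simp: st_def)
qed

lemma st_trans:
 assumes "md M" "md N" "hom M N h" "st M N f g" "st M N g h" shows "st M N f h"
proof -
 interpret N: left_module R N by fact
 obtain t where t: "sz M N t" "!!x. x \<in> carrier M ==> f x = g x \<oplus>[N] t x" using assms(4) by (auto simp: st_def)
 obtain s where s: "sz M N s" "!!x. x \<in> carrier M ==> g x = h x \<oplus>[N] s x" using assms(5) by (auto simp: st_def)
 have "f x = h x \<oplus>[N] (s x \<oplus>[N] t x)" if "x \<in> carrier M" for x
  using t(2)[OF that] s(2)[OF that] mhom_closed[OF assms(3) that] st_closed[OF assms(1,2) t(1) that] st_closed[OF assms(1,2) s(1) that]
  by (simp add: N.M.a_assoc)
 thus ?thesis using sz_sum[OF assms(1,2) s(1) t(1)] by (auto simp: st_def)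
qed

lemma st_post:
 assumes "md M" "md N" "md L" "hom M N g" "st M N f g" "hom N L h"
 shows "st M L (%x. h (f x)) (%x. h (g x))"
proof -
 obtain t where t: "sz M N t" "!!x. x \<in> carrier M ==> f x = g x \<oplus>[N] t x" using assms(5) by (auto simp: st_def)
 have "h (f x) = h (g x) \<oplus>[L] h (t x)" if "x \<in> carrier M" for x
  using t(2)[OF that] mhom_add[OF assms(6) mhom_closed[OF assms(4) that] st_closed[OF assms(1,2) t(1) that]] by simp
 thus ?thesis using sz_post[OF assms(1-3) t(1) assms(6)] by (auto simp: st_def)
qed

lemma st_pre:
 assumes "md M" "md N" "md L" "hom M N h" "st N L f g"
 shows "st M L (%x. f (h x)) (%x. g (h x))"
proof -
 obtain t where t: "sz N L t" "!!x. x \<in> carrier N ==> f x = g x \<oplus>[L] t x" using assms(5) by (auto simp: st_def)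
 show ?thesis unfolding st_def
  by (rule exI[of _ "%x. t (h x)"]) (use t sz_pre[OF assms(1-4) t(1)] mhom_closed[OF assms(4)] in simp)
qed

lemma st_comp:
 assumes "md M" "md N" "md L" "hom M N f'" "hom N L g" "hom N L g'" "st M N f f'" "st N L g g'"
 shows "st M L (%x. g (f x)) (%x. g' (f' x))"
 by (rule st_trans[OF assms(1,3) mhom_comp[OF assms(4,6)] st_post[OF assms(1-4,7,5)] st_pre[OF assms(1-4,8)]])

lemma st_add:
 assumes "md M" "md N" "hom M N f'" "hom M N g'" "st M N f f'" "st M N g g'"
 shows "st M N (%x. f x \<oplus>[N] g x) (%x. f' x \<oplus>[N] g' x)"
proof -
 interpret N: left_module R N by fact
 obtain t where t: "sz M N t" "!!x. x \<in> carrier M ==> f x = f' x \<oplus>[N] t x" using assms(5) by (auto simp: st_def)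
 obtain s where s: "sz M N s" "!!x. x \<in> carrier M ==> g x = g' x \<oplus>[N] s x" using assms(6) by (auto simp: st_def)
 have "f x \<oplus>[N] g x = f' x \<oplus>[N] g' x \<oplus>[N] (t x \<oplus>[N] s x)" if x: "x \<in> carrier M" for x
  using mhom_closed[OF assms(3) x] mhom_closed[OF assms(4) x] st_closed[OF assms(1,2) t(1) x] st_closed[OF assms(1,2) s(1) x]
  by (simp add: t(2)[OF x] s(2)[OF x] N.M.a_ac)
 thus ?thesis using sz_sum[OF assms(1,2) t(1) s(1)] by (auto simp: st_def)
qed

lemma sz_st:
 assumes "md M" "md N" "st M N f g" "sz M N g" shows "sz M N f"
proof -
 obtain t where t: "sz M N t" "!!x. x \<in> carrier M ==> f x = g x \<oplus>[N] t x" using assms(3) by (auto simp: st_def)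
 show ?thesis by (rule sz_cong[OF sz_sum[OF assms(1,2,4) t(1)] t(2)])
qed

lemma st_zero_iff:
 assumes "md M" "md N" shows "st M N f (%x. \<zero>[N]) \<longleftrightarrow> sz M N f"
proof
 assume "st M N f (%x. \<zero>[N])" thus "sz M N f" by (rule sz_st[OF assms _ sz_zero[OF assms]])
next
 interpret N: left_module R N by fact
 assume s: "sz M N f"
 show "st M N f (%x. \<zero>[N])" unfolding st_def
  by (rule exI[of _ f]) (use s st_closed[OF assms s] in simp)
qed

lemma st_diff:
 assumes "md M" "md N" "hom M N f" "hom M N g"
 shows "st M N f g \<longleftrightarrow> sz M N (%x. f x \<ominus>[N] g x)"
proof -
 interpret N: left_module R N by fact
 note c = mhom_closed[OF assms(3)] mhom_closed[OF assms(4)]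
 show ?thesis
 proof
  assume "st M N f g"
  then obtain t where t: "sz M N t" "!!x. x \<in> carrier M ==> f x = g x \<oplus>[N] t x" by (auto simp: st_def)
  show "sz M N (%x. f x \<ominus>[N] g x)"
   by (rule sz_cong[OF t(1)]) (use c st_closed[OF assms(1,2) t(1)] in \<open>simp add: N.M.diff_eq_iff t(2) N.M.a_comm\<close>)
 next
  assume s: "sz M N (%x. f x \<ominus>[N] g x)"
  have "f x = g x \<oplus>[N] (f x \<ominus>[N] g x)" if x: "x \<in> carrier M" for x using c[OF x] by algebra
  thus "st M N f g" using s unfolding st_def by blast
 qed
qed

section \<open>Constructions of modules\<close>

text \<open>A homomorphic image of a module is a module.\<close>

lemma md_image:
 fixes E :: "('g => 'k, 'a) module" and Q :: "('g => 'k, 'b) module"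
 assumes E: "md E" and q: "q ` carrier E = carrier Q" "q \<zero>[E] = \<zero>[Q]"
  and add: "!!x y. x \<in> carrier E ==> y \<in> carrier E ==> q (x \<oplus>[E] y) = q x \<oplus>[Q] q y"
  and sm: "!!a x. a \<in> carrier R ==> x \<in> carrier E ==> q (a \<odot>[E] x) = a \<odot>[Q] q x"
 shows "md Q" and "hom E Q q"
proof -
 interpret E: left_module R E by fact
 have ex: "\<exists>x\<in>carrier E. y = q x" if "y \<in> carrier Q" for y using that q(1) by blast
 have qc: "q x \<in> carrier Q" if "x \<in> carrier E" for x using that q(1) by blast
 have ab: "abelian_group Q"
 proof (rule abelian_groupI)
  fix x y assume "x \<in> carrier Q" "y \<in> carrier Q"
  then obtain a b where "a \<in> carrier E" "b \<in> carrier E" "x = q a" "y = q b" using ex by metis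
  thus "x \<oplus>[Q] y \<in> carrier Q" "x \<oplus>[Q] y = y \<oplus>[Q] x"
   using add[of a b] add[of b a] qc[of "a \<oplus>[E] b"] by (auto simp: E.M.a_comm)
 next
  show "\<zero>[Q] \<in> carrier Q" using qc[OF E.M.zero_closed] q(2) by simp
 next
  fix x y z assume "x \<in> carrier Q" "y \<in> carrier Q" "z \<in> carrier Q"
  then obtain a b c where "a \<in> carrier E" "b \<in> carrier E" "c \<in> carrier E" "x = q a" "y = q b" "z = q c" using ex by metis
  thus "x \<oplus>[Q] y \<oplus>[Q] z = x \<oplus>[Q] (y \<oplus>[Q] z)" by (simp flip: add add: E.M.a_assoc)
 next
  fix x assume "x \<in> carrier Q"
  then obtain a where a: "a \<in> carrier E" "x = q a" using ex by metis
  thus "\<zero>[Q] \<oplus>[Q] x = x" by (simp flip: add q(2))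
  have "q (\<ominus>[E] a) \<oplus>[Q] x = \<zero>[Q]" using a by (simp flip: add q(2) add: E.M.l_neg)
  thus "\<exists>y\<in>carrier Q. y \<oplus>[Q] x = \<zero>[Q]" using qc[of "\<ominus>[E] a"] a by blast
 qed
 show "md Q"
 proof (rule left_moduleI[OF E.R.ring_axioms ab])
  fix a x assume a: "a \<in> carrier R" "x \<in> carrier Q"
  then obtain e where "e \<in> carrier E" "x = q e" using ex by metis
  thus "a \<odot>[Q] x \<in> carrier Q" using a by (simp flip: sm add: qc E.smult_closed)
 next
  fix a b x assume a: "a \<in> carrier R" "b \<in> carrier R" "x \<in> carrier Q"
  then obtain e where e: "e \<in> carrier E" "x = q e" using ex by metis
  show "(a \<oplus>[R] b) \<odot>[Q] x = a \<odot>[Q] x \<oplus>[Q] b \<odot>[Q] x"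
   using a e by (simp flip: sm add add: E.smult_closed E.smult_l_distr)
  show "(a \<otimes>[R] b) \<odot>[Q] x = a \<odot>[Q] (b \<odot>[Q] x)"
   using a e by (simp flip: sm add: E.smult_closed E.smult_assoc)
 next
  fix a x y assume a: "a \<in> carrier R" "x \<in> carrier Q" "y \<in> carrier Q"
  then obtain e f where e: "e \<in> carrier E" "x = q e" "f \<in> carrier E" "y = q f" using ex by metis
  show "a \<odot>[Q] (x \<oplus>[Q] y) = a \<odot>[Q] x \<oplus>[Q] a \<odot>[Q] y"
   using a e by (simp flip: sm add add: E.smult_closed E.smult_r_distr)
 next
  fix x assume "x \<in> carrier Q"
  then obtain e where e: "e \<in> carrier E" "x = q e" using ex by metis
  thus "\<one>[R] \<odot>[Q] x = x" by (simp flip: sm add: E.smult_one)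
 qed
 show "hom E Q q" by (rule mhomI) (auto simp: qc add sm)
qed

definition submod :: "('g => 'k, 'a) module => 'a set => bool" where
 "submod E U \<longleftrightarrow> U \<subseteq> carrier E & \<zero>[E] \<in> U & (\<forall>x\<in>U. \<forall>y\<in>U. x \<oplus>[E] y \<in> U) & (\<forall>a\<in>carrier R. \<forall>x\<in>U. a \<odot>[E] x \<in> U)"

lemma submod_md:
 assumes E: "md E" and U: "submod E U"
 shows "md (E\<lparr>carrier := U\<rparr>)" "hom (E\<lparr>carrier := U\<rparr>) E (%x. x)"
proof -
 interpret E: left_module R E by fact
 let ?S = "E\<lparr>carrier := U\<rparr>"
 have Uc: "x \<in> carrier E" if "x \<in> U" for x using that U by (auto simp: submod_def)
 have neg: "\<ominus>[E] x \<in> U" if "x \<in> U" for x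
  using that U E.smult_minus_one[OF Uc[OF that]] E.R.a_inv_closed[OF E.R.one_closed] unfolding submod_def by metis
 have ab: "abelian_group ?S"
 proof (rule abelian_groupI)
  fix x assume x: "x \<in> carrier ?S"
  thus "\<exists>y\<in>carrier ?S. y \<oplus>[?S] x = \<zero>[?S]"
   using neg[of x] Uc[of x] by (intro bexI[of _ "\<ominus>[E] x"]) (auto simp: E.M.l_neg)
 qed (use U in \<open>auto simp: submod_def E.M.a_ac Uc\<close>)
 show "md ?S"
  by (rule left_moduleI[OF E.R.ring_axioms ab])
   (use U in \<open>auto simp: submod_def E.smult_l_distr E.smult_r_distr E.smult_assoc E.smult_one Uc\<close>)
 show "hom ?S E (%x. x)" by (rule mhomI) (auto simp: Uc)
qed

definition dprod :: "('g => 'k, 'a) module => ('g => 'k, 'b) module => ('g => 'k, 'a \<times> 'b) module" where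
 "dprod A B = \<lparr> carrier = carrier A \<times> carrier B, mult = undefined, one = undefined, zero = (\<zero>[A], \<zero>[B]),
   add = (%x y. (fst x \<oplus>[A] fst y, snd x \<oplus>[B] snd y)), smult = (%a x. (a \<odot>[A] fst x, a \<odot>[B] snd x)) \<rparr>"

lemma dprod_simps [simp]: "carrier (dprod A B) = carrier A \<times> carrier B" "\<zero>[dprod A B] = (\<zero>[A], \<zero>[B])"
 "x \<oplus>[dprod A B] y = (fst x \<oplus>[A] fst y, snd x \<oplus>[B] snd y)" "a \<odot>[dprod A B] x = (a \<odot>[A] fst x, a \<odot>[B] snd x)"
 by (simp_all add: dprod_def)

lemma dprod_md:
 assumes A: "md A" and B: "md B" shows "md (dprod A B)"
proof -
 interpret A: left_module R A by fact
 interpret B: left_module R B by fact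
 have ab: "abelian_group (dprod A B)"
 proof (rule abelian_groupI)
  fix x assume x: "x \<in> carrier (dprod A B)"
  thus "\<exists>y\<in>carrier (dprod A B). y \<oplus>[dprod A B] x = \<zero>[dprod A B]"
   by (intro bexI[of _ "(\<ominus>[A] fst x, \<ominus>[B] snd x)"]) (auto simp: A.M.l_neg B.M.l_neg)
 qed (auto simp: A.M.a_ac B.M.a_ac)
 show ?thesis
  by (rule left_moduleI[OF A.R.ring_axioms ab])
   (auto simp: A.smult_l_distr A.smult_r_distr A.smult_assoc A.smult_one
    B.smult_l_distr B.smult_r_distr B.smult_assoc B.smult_one A.smult_closed B.smult_closed)
qed

abbreviation lmd :: "('g => 'k, 'u) module => bool" where "lmd M \<equiv> M \<in> lmod R"

lemma lm_md: "lmd M ==> md M" by (simp add: lmod_def)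

lemma transport:
 fixes M :: "('g => 'k, 'a) module"
 assumes M: "md M" and c: "carrier M \<prec> (UNIV :: 'u set)"
 shows "\<exists>(N :: ('g => 'k, 'u) module) \<phi> \<psi>. lmd N & hom M N \<phi> & hom N M \<psi> &
  (\<forall>x\<in>carrier M. \<psi> (\<phi> x) = x) & (\<forall>y\<in>carrier N. \<phi> (\<psi> y) = y)"
proof -
 obtain \<phi> :: "'a => 'u" where inj: "inj_on \<phi> (carrier M)"
  using c by (auto simp: lesspoll_def lepoll_def)
 define \<psi> where "\<psi> = inv_into (carrier M) \<phi>"
 have ps: "\<psi> (\<phi> x) = x" if "x \<in> carrier M" for x using inj that by (simp add: \<psi>_def)
 define N :: "('g => 'k, 'u) module" where "N = \<lparr> carrier = \<phi> ` carrier M, mult = undefined, one = undefined,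
  zero = \<phi> \<zero>[M], add = (%x y. \<phi> (\<psi> x \<oplus>[M] \<psi> y)), smult = (%a x. \<phi> (a \<odot>[M] \<psi> x)) \<rparr>"
 have N: "md N" "hom M N \<phi>"
  by (rule md_image[OF M, where q = \<phi>]; simp add: N_def ps)+
 have "carrier N \<prec> (UNIV :: 'u set)"
  using lesspoll_trans1[OF image_lepoll c] by (simp add: N_def)
 hence "lmd N" using N(1) by (simp add: lmod_def)
 moreover have "hom N M \<psi>"
  by (rule mhomI) (auto simp: N_def ps M)
 ultimately show ?thesis using N(2) ps by (intro exI[of _ N] exI[of _ \<phi>] exI[of _ \<psi>]) (auto simp: N_def)
qed

lemma lm_subset:
 fixes E :: "('g => 'k, 'u) module"
 assumes "lmd E" "U \<subseteq> carrier E" shows "U \<prec> (UNIV :: 'u set)"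
proof -
 have "carrier E \<prec> (UNIV :: 'u set)" using assms(1) by (simp add: lmod_def)
 thus ?thesis by (rule lesspoll_trans1[OF subset_imp_lepoll[OF assms(2)]])
qed

lemma lm_submod: "lmd E ==> submod E U ==> lmd (E\<lparr>carrier := U\<rparr>)"
 using submod_md(1)[OF lm_md, of E U] lm_subset[of E U] by (simp add: lmod_def submod_def)

lemma quotient_exists:
 fixes E :: "('g => 'k, 'u) module"
 assumes E: "lmd E" and U: "submod E U"
 shows "\<exists>(Q :: ('g => 'k, 'u) module) q. lmd Q & hom E Q q & q ` carrier E = carrier Q &
  (\<forall>x\<in>carrier E. q x = \<zero>[Q] \<longleftrightarrow> x \<in> U)"
proof -
 note mE = lm_md[OF E]
 interpret E: left_module R E by (rule mE)
 have Uc: "x \<in> carrier E" if "x \<in> U" for x using that U by (auto simp: submod_def)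
 have U0: "\<zero>[E] \<in> U" and Ua: "!!x y. x \<in> U ==> y \<in> U ==> x \<oplus>[E] y \<in> U" and Us: "!!a x. a \<in> carrier R ==> x \<in> U ==> a \<odot>[E] x \<in> U"
  using U by (auto simp: submod_def)
 have neg: "\<ominus>[E] x \<in> U" if "x \<in> U" for x
  using Us[OF E.R.a_inv_closed[OF E.R.one_closed] that] E.smult_minus_one[OF Uc[OF that]] by simp
 define q where "q = (%x. SOME y. y \<in> carrier E & y \<ominus>[E] x \<in> U)"
 have q: "q x \<in> carrier E & q x \<ominus>[E] x \<in> U" if "x \<in> carrier E" for x
  unfolding q_def by (rule someI[of _ x]) (use that U0 in \<open>simp add: E.M.minus_eq E.M.r_neg\<close>)
 have qc: "q x \<in> carrier E" if "x \<in> carrier E" for x using q[OF that] by simp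
 have q_eq: "q x = q y" if "x \<in> carrier E" "y \<in> carrier E" "x \<ominus>[E] y \<in> U" for x y
 proof -
  have "z \<ominus>[E] x \<in> U \<longleftrightarrow> z \<ominus>[E] y \<in> U" if z: "z \<in> carrier E" for z
  proof
   assume "z \<ominus>[E] x \<in> U"
   from Ua[OF this \<open>x \<ominus>[E] y \<in> U\<close>] have "(z \<ominus>[E] x) \<oplus>[E] (x \<ominus>[E] y) \<in> U" .
   also have "(z \<ominus>[E] x) \<oplus>[E] (x \<ominus>[E] y) = z \<ominus>[E] y" using that(1) \<open>x \<in> carrier E\<close> \<open>y \<in> carrier E\<close> z by algebra
   finally show "z \<ominus>[E] y \<in> U" .
  next
   assume "z \<ominus>[E] y \<in> U"
   from Ua[OF this neg[OF \<open>x \<ominus>[E] y \<in> U\<close>]] have "(z \<ominus>[E] y) \<oplus>[E] (\<ominus>[E] (x \<ominus>[E] y)) \<in> U" .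
   also have "(z \<ominus>[E] y) \<oplus>[E] (\<ominus>[E] (x \<ominus>[E] y)) = z \<ominus>[E] x" using \<open>x \<in> carrier E\<close> \<open>y \<in> carrier E\<close> z by algebra
   finally show "z \<ominus>[E] x \<in> U" .
  qed
  thus ?thesis unfolding q_def by (metis (no_types, lifting))
 qed
 define Q :: "('g => 'k, 'u) module" where "Q = \<lparr> carrier = q ` carrier E, mult = undefined, one = undefined,
  zero = q \<zero>[E], add = (%x y. q (x \<oplus>[E] y)), smult = (%a x. q (a \<odot>[E] x)) \<rparr>"
 have swap: "x \<ominus>[E] y \<in> U" if "y \<ominus>[E] x \<in> U" "x \<in> carrier E" "y \<in> carrier E" for x y
  using neg[OF that(1)] that(2,3) by (simp add: E.M.minus_eq E.M.minus_add E.M.a_comm)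
 have Qa: "q (x \<oplus>[E] y) = q x \<oplus>[Q] q y" if xy: "x \<in> carrier E" "y \<in> carrier E" for x y
 proof -
  have "(q x \<oplus>[E] q y) \<ominus>[E] (x \<oplus>[E] y) = (q x \<ominus>[E] x) \<oplus>[E] (q y \<ominus>[E] y)"
   using xy qc[OF xy(1)] qc[OF xy(2)] by algebra
  hence "(q x \<oplus>[E] q y) \<ominus>[E] (x \<oplus>[E] y) \<in> U" using Ua q xy by simp
  hence "q (q x \<oplus>[E] q y) = q (x \<oplus>[E] y)" by (intro q_eq) (use xy qc in auto)
  thus ?thesis by (simp add: Q_def)
 qed
 have Qs: "q (a \<odot>[E] x) = a \<odot>[Q] q x" if xy: "a \<in> carrier R" "x \<in> carrier E" for a x
 proof -
  have "a \<odot>[E] q x \<ominus>[E] a \<odot>[E] x = a \<odot>[E] (q x \<ominus>[E] x)"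
   using xy qc[OF xy(2)] by (simp add: E.M.minus_eq E.smult_r_distr E.smult_minus_r)
  hence "a \<odot>[E] q x \<ominus>[E] a \<odot>[E] x \<in> U" using Us q xy by simp
  hence "q (a \<odot>[E] q x) = q (a \<odot>[E] x)" by (intro q_eq) (use xy qc E.smult_closed in auto)
  thus ?thesis by (simp add: Q_def)
 qed
 have Q0: "q ` carrier E = carrier Q" "q \<zero>[E] = \<zero>[Q]" by (simp_all add: Q_def)
 have Q: "md Q" "hom E Q q" using md_image[OF mE Q0 Qa Qs] by blast+
 have "carrier Q \<subseteq> carrier E" by (auto simp: Q_def qc)
 hence "carrier Q \<prec> (UNIV :: 'u set)"
  by (rule lm_subset[OF E])
 hence "lmd Q" using Q by (simp add: lmod_def)
 moreover have "q x = \<zero>[Q] \<longleftrightarrow> x \<in> U" if x: "x \<in> carrier E" for x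
 proof
  assume "q x = \<zero>[Q]"
  hence *: "q x = q \<zero>[E]" by (simp add: Q_def)
  have "q \<zero>[E] \<ominus>[E] \<zero>[E] \<in> U" "x \<ominus>[E] q x \<in> U" using q[OF E.M.zero_closed] swap q[OF x] qc x by auto
  from Ua[OF this(2,1)] have "(x \<ominus>[E] q x) \<oplus>[E] (q x \<ominus>[E] \<zero>[E]) \<in> U" using * by simp
  also have "(x \<ominus>[E] q x) \<oplus>[E] (q x \<ominus>[E] \<zero>[E]) = x" using x qc[OF x] by algebra
  finally show "x \<in> U" .
 next
  assume "x \<in> U"
  hence "q x = q \<zero>[E]" by (intro q_eq) (use x in \<open>auto simp: E.M.minus_eq E.M.neg_zero\<close>)
  thus "q x = \<zero>[Q]" by (simp add: Q_def)
 qed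
 ultimately show ?thesis using Q(2) by (intro exI[of _ Q] exI[of _ q]) (auto simp: Q_def)
qed

end

context kG begin

section \<open>Short exact sequences\<close>

lemma factor_through_surjection:
 assumes "left_module S E" "left_module S B" "left_module S T"
  and b: "mhom S E B b" "b ` carrier E = carrier B" and t: "mhom S E T t"
  and k: "!!x. x \<in> carrier E ==> b x = \<zero>[B] ==> t x = \<zero>[T]"
 shows "\<exists>t'. mhom S B T t' & (\<forall>x\<in>carrier E. t' (b x) = t x)"
proof -
 interpret E: left_module S E by fact
 interpret B: left_module S B by fact
 interpret T: left_module S T by fact
 define s where "s = inv_into (carrier E) b"
 have s: "s y \<in> carrier E" "b (s y) = y" if "y \<in> carrier B" for y
  using that b(2) by (auto simp: s_def inv_into_into f_inv_into_f)
 have eq: "t x = t y" if "x \<in> carrier E" "y \<in> carrier E" "b x = b y" for x y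
 proof -
  have "b (x \<ominus>[E] y) = \<zero>[B]" using that b mhom_closed[OF b(1)]
   by (simp add: a_minus_def mhom_add[OF b(1)] mhom_minus[OF assms(1,2) b(1)] B.M.r_neg)
  hence "t (x \<ominus>[E] y) = \<zero>[T]" by (rule k[rotated]) (use that in simp)
  hence "t x \<ominus>[T] t y = \<zero>[T]" using that
   by (simp add: a_minus_def mhom_add[OF t(1)] mhom_minus[OF assms(1,3) t(1)])
  thus ?thesis using that mhom_closed[OF t] by (simp add: T.M.diff_eq_zero_iff)
 qed
 have st: "t (s (b x)) = t x" if "x \<in> carrier E" for x
  using that s[of "b x"] mhom_closed[OF b(1)] by (intro eq) auto
 have "mhom S B T (%y. t (s y))"
 proof (rule mhomI)
  fix x assume "x \<in> carrier B" thus "t (s x) \<in> carrier T" using s mhom_closed[OF t] by blast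
 next
  fix x y assume xy: "x \<in> carrier B" "y \<in> carrier B"
  have "t (s (x \<oplus>[B] y)) = t (s x \<oplus>[E] s y)"
   by (rule eq) (use xy s in \<open>auto simp: mhom_add[OF b(1)]\<close>)
  thus "t (s (x \<oplus>[B] y)) = t (s x) \<oplus>[T] t (s y)" using xy s mhom_add[OF t] by simp
 next
  fix a x assume xy: "a \<in> carrier S" "x \<in> carrier B"
  have "t (s (a \<odot>[B] x)) = t (a \<odot>[E] s x)"
   by (rule eq) (use xy s in \<open>auto simp: mhom_smult[OF b(1)] E.smult_closed B.smult_closed\<close>)
  thus "t (s (a \<odot>[B] x)) = a \<odot>[T] t (s x)" using xy s mhom_smult[OF t] by simp
 qed
 thus ?thesis using st by blast
qed

lemma factor_through_injection:
 assumes "left_module S A" "left_module S E" "left_module S T"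
  and a: "mhom S A E a" "inj_on a (carrier A)" and t: "mhom S T E t"
  and k: "!!x. x \<in> carrier T ==> \<exists>y\<in>carrier A. t x = a y"
 shows "\<exists>t'. mhom S T A t' & (\<forall>x\<in>carrier T. a (t' x) = t x)"
proof -
 interpret A: left_module S A by fact
 interpret T: left_module S T by fact
 define t' where "t' = (%x. inv_into (carrier A) a (t x))"
 have t': "t' x \<in> carrier A" "a (t' x) = t x" if "x \<in> carrier T" for x
 proof -
  have "t x \<in> a ` carrier A" using k[OF that] by blast
  thus "t' x \<in> carrier A" "a (t' x) = t x" by (auto simp: t'_def f_inv_into_f intro: inv_into_into)
 qed
 have "mhom S T A t'"
 proof (rule mhomI)
  fix x y assume xy: "x \<in> carrier T" "y \<in> carrier T"
  show "t' (x \<oplus>[T] y) = t' x \<oplus>[A] t' y"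
   by (rule inj_onD[OF a(2)]) (use xy t' in \<open>auto simp: mhom_add[OF a(1)] mhom_add[OF t]\<close>)
 next
  fix c x assume xy: "c \<in> carrier S" "x \<in> carrier T"
  show "t' (c \<odot>[T] x) = c \<odot>[A] t' x"
   by (rule inj_onD[OF a(2)]) (use xy t' in \<open>auto simp: mhom_smult[OF a(1)] mhom_smult[OF t] A.smult_closed T.smult_closed\<close>)
 qed (use t' in auto)
 thus ?thesis using t'(2) by blast
qed

end

locale kGU = kG K G
 for K :: "('k, 'x) ring_scheme" and G :: "('g, 'y) monoid_scheme" +
 fixes U :: "'u itself"
 assumes infU: "infinite (UNIV :: 'u set)"
begin

abbreviation lm :: "('g => 'k, 'u) module => bool" where "lm M \<equiv> M \<in> lmod R"

definition ses :: "('g => 'k, 'u) module => ('g => 'k, 'u) module => ('g => 'k, 'u) module =>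
  ('u => 'u) => ('u => 'u) => bool" where
 "ses A E B a b \<longleftrightarrow> lm A & lm E & lm B & hom A E a & hom E B b & inj_on a (carrier A) &
   (\<forall>x\<in>carrier A. b (a x) = \<zero>[B]) & (\<forall>x\<in>carrier E. b x = \<zero>[B] --> (\<exists>y\<in>carrier A. x = a y)) &
   b ` carrier E = carrier B"

lemma sesD:
 assumes "ses A E B a b"
 shows "lm A" "lm E" "lm B" "md A" "md E" "md B" "hom A E a" "hom E B b" "inj_on a (carrier A)"
  "!!x. x \<in> carrier A ==> b (a x) = \<zero>[B]" "!!x. x \<in> carrier E ==> b x = \<zero>[B] ==> \<exists>y\<in>carrier A. x = a y"
  "b ` carrier E = carrier B" "!!y. y \<in> carrier B ==> \<exists>x\<in>carrier E. b x = y"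
  "!!x. x \<in> carrier A ==> a x \<in> carrier E" "!!x. x \<in> carrier E ==> b x \<in> carrier B"
proof -
 have im: "b ` carrier E = carrier B" using assms by (simp add: ses_def)
 show "\<exists>x\<in>carrier E. b x = y" if "y \<in> carrier B" for y using that unfolding im[symmetric] by blast
qed (use assms lm_md in \<open>auto simp: ses_def dest: mhom_closed\<close>)

lemma inj_hom:
 assumes "md A" "md E" "hom A E a" "!!x. x \<in> carrier A ==> a x = \<zero>[E] ==> x = \<zero>[A]"
 shows "inj_on a (carrier A)"
proof (rule inj_onI)
 interpret A: left_module R A by fact
 interpret E: left_module R E by fact
 fix x y assume xy: "x \<in> carrier A" "y \<in> carrier A" "a x = a y"
 have "a (x \<ominus>[A] y) = \<zero>[E]" using xy mhom_closed[OF assms(3)]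
  by (simp add: a_minus_def mhom_add[OF assms(3)] mhom_minus[OF assms(1-3)] E.M.r_neg)
 hence "x \<ominus>[A] y = \<zero>[A]" by (intro assms(4)) (use xy in auto)
 thus "x = y" using xy by (simp add: A.M.diff_eq_zero_iff)
qed

lemma ses_out:
 assumes s: "ses A E B a b" and T: "md T" "hom E T t" "!!x. x \<in> carrier A ==> t (a x) = \<zero>[T]"
 shows "\<exists>t'. hom B T t' & (\<forall>x\<in>carrier E. t' (b x) = t x)"
 using sesD(11)[OF s] T(3)
 by (intro factor_through_surjection[OF sesD(5,6)[OF s] T(1) sesD(8,12)[OF s] T(2)]) blast

lemma ses_in:
 assumes s: "ses A E B a b" and T: "md T" "hom T E t" "!!x. x \<in> carrier T ==> b (t x) = \<zero>[B]"
 shows "\<exists>t'. hom T A t' & (\<forall>x\<in>carrier T. a (t' x) = t x)"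
 using sesD(11)[OF s] T(3) mhom_closed[OF T(2)]
 by (intro factor_through_injection[OF sesD(4,5)[OF s] T(1) sesD(7,9)[OF s] T(2)]) blast

lemma kernel_ses:
 assumes E: "lm E" and B: "lm B" and b: "hom E B b" "b ` carrier E = carrier B"
 shows "ses (E\<lparr>carrier := {x\<in>carrier E. b x = \<zero>[B]}\<rparr>) E B (%x. x) b"
proof -
 interpret E: left_module R E by (rule lm_md[OF E])
 interpret B: left_module R B by (rule lm_md[OF B])
 have "submod E {x\<in>carrier E. b x = \<zero>[B]}"
  using mhom_zero[OF lm_md[OF E] lm_md[OF B] b(1)]
  by (auto simp: submod_def mhom_add[OF b(1)] mhom_smult[OF b(1)] E.smult_closed B.smult_zero_r)
 thus ?thesis
  using lm_submod[OF E] submod_md(2)[OF lm_md[OF E]] E B b by (auto simp: ses_def)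
qed

lemma cokernel_ses:
 fixes A E :: "('g => 'k, 'u) module"
 assumes A: "lm A" and E: "lm E" and a: "hom A E a" "inj_on a (carrier A)"
 shows "\<exists>B b. ses A E B a b"
proof -
 interpret A: left_module R A by (rule lm_md[OF A])
 have "submod E (a ` carrier A)" unfolding submod_def
 proof (intro conjI ballI)
  show "a ` carrier A \<subseteq> carrier E" using mhom_closed[OF a(1)] by blast
  show "\<zero>[E] \<in> a ` carrier A" using mhom_zero[OF lm_md[OF A] lm_md[OF E] a(1)] by (metis A.M.zero_closed imageI)
 next
  fix x y assume "x \<in> a ` carrier A" "y \<in> a ` carrier A"
  then obtain u v where "x = a u" "y = a v" "u \<in> carrier A" "v \<in> carrier A" by blast
  thus "x \<oplus>[E] y \<in> a ` carrier A" by (auto simp: mhom_add[OF a(1), symmetric])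
 next
  fix c x assume "c \<in> carrier R" "x \<in> a ` carrier A"
  then obtain u where "x = a u" "u \<in> carrier A" by blast
  thus "c \<odot>[E] x \<in> a ` carrier A" using \<open>c \<in> carrier R\<close> by (auto simp: mhom_smult[OF a(1), symmetric] A.smult_closed)
 qed
 from quotient_exists[OF E this] obtain Q :: "('g => 'k, 'u) module" and q where "lm Q" "hom E Q q" "q ` carrier E = carrier Q"
  "\<forall>x\<in>carrier E. q x = \<zero>[Q] \<longleftrightarrow> x \<in> a ` carrier A" by blast
 hence "ses A E Q a q" using A E a mhom_closed[OF a(1)] by (auto simp: ses_def)
 thus ?thesis by blast
qed

subsection \<open>Splitting\<close>

definition split_ses :: "('g => 'k, 'u) module => ('g => 'k, 'u) module => ('u => 'u) => bool" where
 "split_ses E B b \<longleftrightarrow> (\<exists>s. hom B E s & (\<forall>y\<in>carrier B. b (s y) = y))"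

text \<open>A lift up to stable equality can be corrected to a strict one, because the error is a trace
  and traces lift along surjections.\<close>

lemma stably_equal_lift:
 assumes s: "ses A E B a b" and T: "md T" "hom T E s" "hom T B f" and eq: "st T B (%y. b (s y)) f"
 shows "\<exists>s'. hom T E s' & st T E s' s & (\<forall>y\<in>carrier T. b (s' y) = f y)"
proof -
 note d = sesD[OF s]
 interpret E: left_module R E by (rule d(5))
 interpret B: left_module R B by (rule d(6))
 have "st T B f (%y. b (s y))" by (rule st_sym[OF T(1) d(6) T(3) eq])
 then obtain t where t: "sz T B t" "!!y. y \<in> carrier T ==> f y = b (s y) \<oplus>[B] t y" by (auto simp: st_def)
 obtain t' where t': "hom T E t'" "sz T E t'" "!!y. y \<in> carrier T ==> b (t' y) = t y"
  using sz_lift[OF d(5,6) T(1) d(8,12) t(1)] by blast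
 have "hom T E (%y. s y \<oplus>[E] t' y)" by (rule mhom_sum[OF d(5) T(2) t'(1)])
 moreover have "b (s y \<oplus>[E] t' y) = f y" if "y \<in> carrier T" for y
  using that t(2) t'(3) mhom_closed[OF T(2)] mhom_closed[OF t'(1)] by (simp add: mhom_add[OF d(8)])
 moreover have "st T E (%y. s y \<oplus>[E] t' y) s" using t'(2) by (auto simp: st_def)
 ultimately show ?thesis by blast
qed

lemma stably_equal_extend:
 assumes s: "ses A E B a b" and T: "md T" "hom E T s" "hom A T f" and eq: "st A T (%y. s (a y)) f"
 shows "\<exists>s'. hom E T s' & st E T s' s & (\<forall>y\<in>carrier A. s' (a y) = f y)"
proof -
 note d = sesD[OF s]
 interpret T: left_module R T by (rule T(1))
 have "st A T f (%y. s (a y))" by (rule st_sym[OF d(4) T(1) T(3) eq])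
 then obtain t where t: "sz A T t" "!!y. y \<in> carrier A ==> f y = s (a y) \<oplus>[T] t y" by (auto simp: st_def)
 obtain t' where t': "hom E T t'" "sz E T t'" "!!y. y \<in> carrier A ==> t' (a y) = t y"
  using sz_extend[OF d(4,5) T(1) d(7,9) t(1)] by blast
 have "hom E T (%y. s y \<oplus>[T] t' y)" by (rule mhom_sum[OF T(1) T(2) t'(1)])
 moreover have "s (a y) \<oplus>[T] t' (a y) = f y" if "y \<in> carrier A" for y
  using that t(2) t'(3) by simp
 moreover have "st E T (%y. s y \<oplus>[T] t' y) s" using t'(2) by (auto simp: st_def)
 ultimately show ?thesis by blast
qed

lemma split_if_stable_section:
 assumes s: "ses A E B a b" and "hom B E s" "st B B (%y. b (s y)) (%y. y)"
 shows "split_ses E B b"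
 using stably_equal_lift[OF s sesD(6)[OF s] assms(2) mhom_id assms(3)] by (auto simp: split_ses_def)

lemma split_if_retraction:
 assumes s: "ses A E B a b" and r: "hom E A r" "!!x. x \<in> carrier A ==> r (a x) = x"
 shows "split_ses E B b"
proof -
 note d = sesD[OF s]
 interpret A: left_module R A by (rule d(4))
 interpret E: left_module R E by (rule d(5))
 interpret B: left_module R B by (rule d(6))
 have h: "hom E E (%x. x \<oplus>[E] (\<ominus>[E] a (r x)))"
  by (intro mhom_sum mhom_neg mhom_id d(5) mhom_comp[OF r(1) d(7)])
 have "a x \<oplus>[E] (\<ominus>[E] a (r (a x))) = \<zero>[E]" if "x \<in> carrier A" for x
  using that d(14) by (simp add: r(2) E.M.r_neg)
 then obtain t where t: "hom B E t" "!!x. x \<in> carrier E ==> t (b x) = x \<oplus>[E] (\<ominus>[E] a (r x))"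
  using ses_out[OF s d(5) h] by blast
 have "b (t y) = y" if "y \<in> carrier B" for y
 proof -
  obtain x where x: "x \<in> carrier E" "b x = y" using d(13)[OF \<open>y \<in> carrier B\<close>] by blast
  have rx: "r x \<in> carrier A" "a (r x) \<in> carrier E" using mhom_closed[OF r(1) x(1)] d(14) by auto
  have "b (t y) = b x \<oplus>[B] b (\<ominus>[E] a (r x))"
   using x rx t(2) by (simp add: mhom_add[OF d(8)] flip: x(2))
  also have "... = y" using x rx d(10) d(15)[OF x(1)] by (simp add: mhom_minus[OF d(5,6,8)] B.M.neg_zero)
  finally show ?thesis .
 qed
 thus ?thesis using t(1) by (auto simp: split_ses_def)
qed

lemma split_if_stable_retraction:
 assumes s: "ses A E B a b" and "hom E A r" "st A A (%y. r (a y)) (%y. y)"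
 shows "split_ses E B b"
 using stably_equal_extend[OF s sesD(4)[OF s] assms(2) mhom_id assms(3)] split_if_retraction[OF s] by blast

lemma split_decomposition:
 assumes s: "ses A E B a b" and "split_ses E B b"
 obtains r q where "hom E A r" "hom B E q" "!!x. x \<in> carrier A ==> r (a x) = x"
  "!!y. y \<in> carrier B ==> b (q y) = y" "!!y. y \<in> carrier B ==> r (q y) = \<zero>[A]"
  "!!x. x \<in> carrier E ==> a (r x) \<oplus>[E] q (b x) = x"
proof -
 note d = sesD[OF s]
 interpret A: left_module R A by (rule d(4))
 interpret E: left_module R E by (rule d(5))
 interpret B: left_module R B by (rule d(6))
 obtain q where q: "hom B E q" "!!y. y \<in> carrier B ==> b (q y) = y" using assms(2) by (auto simp: split_ses_def)
 have h: "hom E E (%x. x \<oplus>[E] (\<ominus>[E] q (b x)))"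
  by (intro mhom_sum mhom_neg mhom_id d(5) mhom_comp[OF d(8) q(1)])
 have "b (x \<oplus>[E] (\<ominus>[E] q (b x))) = \<zero>[B]" if "x \<in> carrier E" for x
  using that d(15) mhom_closed[OF q(1)] q(2)
  by (simp add: mhom_add[OF d(8)] mhom_minus[OF d(5,6,8)] B.M.r_neg)
 then obtain r where r: "hom E A r" "!!x. x \<in> carrier E ==> a (r x) = x \<oplus>[E] (\<ominus>[E] q (b x))"
  using ses_in[OF s d(5) h] by blast
 have ra: "r (a x) = x" if "x \<in> carrier A" for x
  by (rule inj_onD[OF d(9)])
   (use that r d(14) d(10) mhom_closed[OF r(1)] mhom_zero[OF d(6,5) q(1)] in \<open>auto simp: E.M.neg_zero\<close>)
 have rq: "r (q y) = \<zero>[A]" if "y \<in> carrier B" for y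
  by (rule inj_onD[OF d(9)])
   (use that r q mhom_closed[OF q(1)] mhom_closed[OF r(1)] mhom_zero[OF d(4,5,7)] in \<open>auto simp: E.M.r_neg\<close>)
 have "a (r x) \<oplus>[E] q (b x) = x" if x: "x \<in> carrier E" for x
  using r(2)[OF x] x mhom_closed[OF q(1) d(15)[OF x]] by (simp add: E.M.a_assoc E.M.l_neg)
 thus thesis using that[OF r(1) q(1) ra q(2) rq] by blast
qed

lemma not_split_no_retraction:
 assumes s: "ses A E B a b" and "~ split_ses E B b" and "hom E A r"
 shows "~ st A A (%x. r (a x)) (%x. x)"
 using split_if_stable_retraction[OF s assms(3)] assms(2) by blast

subsection \<open>Stable retracts and projective modules\<close>

text \<open>Retracts in the stable category.\<close>

definition sret :: "('g => 'k, 'u) module => ('g => 'k, 'u) module => bool" where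
 "sret X Y \<longleftrightarrow> lm X & lm Y & (\<exists>i r. hom X Y i & hom Y X r & st X X (%x. r (i x)) (%x. x))"

lemma sretI: "lm X ==> lm Y ==> hom X Y i ==> hom Y X r ==> st X X (%x. r (i x)) (%x. x) ==> sret X Y"
 by (auto simp: sret_def)

lemma sret_refl: "lm X ==> sret X X"
 by (rule sretI[OF _ _ mhom_id mhom_id]) (auto intro: st_refl lm_md mhom_id)

lemma sret_exact:
 assumes "lm X" "lm Y" "hom X Y i" "hom Y X r" "!!x. x \<in> carrier X ==> r (i x) = x" shows "sret X Y"
 by (rule sretI[OF assms(1-4)]) (rule st_cong[OF st_refl[OF lm_md lm_md mhom_id]], auto simp: assms)

lemma sret_trans:
 assumes "sret X Y" "sret Y Z" shows "sret X Z"
proof -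
 obtain i r where i: "lm X" "lm Y" "hom X Y i" "hom Y X r" "st X X (%x. r (i x)) (%x. x)" using assms(1) by (auto simp: sret_def)
 obtain j s where j: "lm Z" "hom Y Z j" "hom Z Y s" "st Y Y (%x. s (j x)) (%x. x)" using assms(2) by (auto simp: sret_def)
 note m = lm_md[OF i(1)] lm_md[OF i(2)]
 have "st X Y (%x. s (j (i x))) (%x. i x)" by (rule st_pre[OF m(1,2,2) i(3) j(4)])
 hence "st X X (%x. r (s (j (i x)))) (%x. r (i x))" by (rule st_post[OF m(1,2,1) i(3) _ i(4)])
 from st_trans[OF m(1,1) mhom_id this i(5)] show ?thesis
  by (rule sretI[OF i(1) j(1) mhom_comp[OF i(3) j(2)] mhom_comp[OF j(3) i(4)]])
qed

text \<open>Projectivity, in the form of Higman's criterion.\<close>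

definition pj :: "('g => 'k, 'u) module => bool" where "pj P \<longleftrightarrow> lm P & sz P P (%x. x)"

lemma pj_lm: "pj P ==> lm P" by (simp add: pj_def)

lemma pj_sz_out: "pj P ==> md N ==> hom P N f ==> sz P N f"
 using sz_post[of P P N "%x. x" f] by (simp add: pj_def lm_md)

lemma pj_sz_in: "pj P ==> md N ==> hom N P f ==> sz N P f"
 using sz_pre[of N P P f "%x. x"] by (simp add: pj_def lm_md)

lemma sz_through_pj:
 assumes "pj P" "md M" "md N" "hom M P f" "hom P N g" shows "sz M N (%x. g (f x))"
 by (rule sz_pre[OF assms(2) lm_md[OF pj_lm[OF assms(1)]] assms(3,4) pj_sz_out[OF assms(1,3,5)]])

lemma pj_sret:
 assumes "pj Y" "sret X Y" shows "pj X"
proof -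
 obtain i r where i: "lm X" "lm Y" "hom X Y i" "hom Y X r" "st X X (%x. r (i x)) (%x. x)" using assms(2) by (auto simp: sret_def)
 note m = lm_md[OF i(1)] lm_md[OF i(2)]
 have "st X X (%x. x) (%x. r (i x))" by (rule st_sym[OF m(1,1) mhom_id i(5)])
 from sz_st[OF m(1,1) this sz_through_pj[OF assms(1) m(1,1) i(3,4)]] show ?thesis using i(1) by (simp add: pj_def)
qed

text \<open>Projective modules are also injective: a sequence with a projective end splits.\<close>

lemma split_if_pj_right:
 assumes s: "ses A E B a b" and P: "pj B" shows "split_ses E B b"
proof -
 note d = sesD[OF s]
 have "sz B B (%x. x)" using P by (simp add: pj_def)
 from sz_lift[OF d(5,6,6,8,12) this] show ?thesis by (auto simp: split_ses_def)
qed

lemma split_if_pj_left: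
 assumes s: "ses A E B a b" and P: "pj A" shows "split_ses E B b"
proof -
 note d = sesD[OF s]
 have "sz A A (%x. x)" using P by (simp add: pj_def)
 from sz_extend[OF d(4,5,4,7,9) this] obtain r where "hom E A r" "\<forall>x\<in>carrier A. r (a x) = x" by blast
 thus ?thesis using split_if_retraction[OF s] by blast
qed

lemma sret_pj_left:
 assumes s: "ses A E B a b" and P: "pj A" shows "sret E B" "sret B E"
proof -
 note d = sesD[OF s]
 obtain r q where r: "hom E A r" "hom B E q" "!!x. x \<in> carrier A ==> r (a x) = x"
  "!!y. y \<in> carrier B ==> b (q y) = y" "!!x. x \<in> carrier E ==> a (r x) \<oplus>[E] q (b x) = x"
  using split_decomposition[OF s split_if_pj_left[OF s P]] by metis
 show "sret B E" by (rule sret_exact[OF d(3,2) r(2) d(8) r(4)])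
 interpret E: left_module R E by (rule d(5))
 have "sz E E (%x. a (r x))" by (rule sz_through_pj[OF P d(5,5) r(1) d(7)])
 moreover have "x = q (b x) \<oplus>[E] a (r x)" if x: "x \<in> carrier E" for x
  using r(5)[OF x] d(15)[OF x] d(14) mhom_closed[OF r(1) x] mhom_closed[OF r(2)] by (simp add: E.M.a_comm)
 ultimately have "st E E (%x. x) (%x. q (b x))" unfolding st_def by blast
 hence "st E E (%x. q (b x)) (%x. x)" by (rule st_sym[OF d(5,5) mhom_comp[OF d(8) r(2)]])
 thus "sret E B" by (rule sretI[OF d(2,3) d(8) r(2)])
qed

lemma sret_pj_right:
 assumes s: "ses A E B a b" and P: "pj B" shows "sret E A" "sret A E"
proof -
 note d = sesD[OF s]
 obtain r q where r: "hom E A r" "hom B E q" "!!x. x \<in> carrier A ==> r (a x) = x"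
  "!!y. y \<in> carrier B ==> b (q y) = y" "!!x. x \<in> carrier E ==> a (r x) \<oplus>[E] q (b x) = x"
  using split_decomposition[OF s split_if_pj_right[OF s P]] by metis
 show "sret A E" by (rule sret_exact[OF d(1,2) d(7) r(1) r(3)])
 have "sz E E (%x. q (b x))" by (rule sz_through_pj[OF P d(5,5) d(8) r(2)])
 hence "st E E (%x. x) (%x. a (r x))" unfolding st_def using r(5) by metis
 hence "st E E (%x. a (r x)) (%x. x)" by (rule st_sym[OF d(5,5) mhom_comp[OF r(1) d(7)]])
 thus "sret E A" by (rule sretI[OF d(2,1) r(1) d(7)])
qed

end

section \<open>Constructions inside the universe\<close>

lemma lesspoll_UNIV_Times:
 fixes A :: "'a set" and B :: "'b set"
 assumes inf: "infinite (UNIV :: 'u set)" and A: "A \<prec> (UNIV :: 'u set)" and B: "B \<prec> (UNIV :: 'u set)"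
 shows "A \<times> B \<prec> (UNIV :: 'u set)"
proof (cases "finite (A \<times> B)")
 case True
 thus ?thesis using inf by (rule finite_lesspoll_infinite[rotated])
next
 case False
 hence ne: "A ~= {}" "B ~= {}" by auto
 consider "(card_of A, card_of B) \<in> ordLeq" | "(card_of B, card_of A) \<in> ordLeq"
  using ordLeq_total[OF card_of_Well_order card_of_Well_order, of A B] by (elim disjE)
 thus ?thesis
 proof cases
  case 1
  have "infinite B" using False card_of_ordLeq_finite[OF 1] by blast
  hence "(card_of (A \<times> B), card_of B) \<in> ordIso" using card_of_Times_infinite[of B A] ne 1 by simp
  hence "A \<times> B \<approx> B" by (simp add: eqpoll_iff_card_of_ordIso)
  thus ?thesis using B by (rule eq_lesspoll_trans)
 next
  case 2
  have "infinite A" using False card_of_ordLeq_finite[OF 2] by blast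
  hence "(card_of (A \<times> B), card_of A) \<in> ordIso" using card_of_Times_infinite[of A B] ne 2 by simp
  hence "A \<times> B \<approx> A" by (simp add: eqpoll_iff_card_of_ordIso)
  thus ?thesis using A by (rule eq_lesspoll_trans)
 qed
qed

lemma lesspoll_UNIV_PiE:
 fixes A :: "'a set"
 assumes inf: "infinite (UNIV :: 'u set)" and A: "A \<prec> (UNIV :: 'u set)" and I: "finite I"
 shows "(I \<rightarrow>\<^sub>E A) \<prec> (UNIV :: 'u set)"
 using I
proof (induction I)
 case empty
 show ?case by (rule finite_lesspoll_infinite[OF inf]) simp
next
 case (insert i I)
 have "(insert i I \<rightarrow>\<^sub>E A) = (%(y, g). g(i := y)) ` (A \<times> (I \<rightarrow>\<^sub>E A))" by (rule PiE_insert_eq)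
 hence "(insert i I \<rightarrow>\<^sub>E A) \<lesssim> A \<times> (I \<rightarrow>\<^sub>E A)" by (simp add: image_lepoll)
 thus ?case using lesspoll_UNIV_Times[OF inf A insert.IH] by (rule lesspoll_trans1)
qed

context kGU begin

definition dsum :: "('g => 'k, 'u) module => ('g => 'k, 'u) module => ('g => 'k, 'u) module =>
  ('u => 'u) => ('u => 'u) => ('u => 'u) => ('u => 'u) => bool" where
 "dsum A B D i j p q \<longleftrightarrow> lm A & lm B & lm D & hom A D i & hom B D j & hom D A p & hom D B q &
   (\<forall>x\<in>carrier A. p (i x) = x & q (i x) = \<zero>[B]) & (\<forall>y\<in>carrier B. q (j y) = y & p (j y) = \<zero>[A]) &
   (\<forall>d\<in>carrier D. i (p d) \<oplus>[D] j (q d) = d)"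

lemma dsum_exists:
 fixes A B :: "('g => 'k, 'u) module"
 assumes A: "lm A" and B: "lm B"
 shows "\<exists>D i j p q. dsum A B D i j p q"
proof -
 note mA = lm_md[OF A] and mB = lm_md[OF B]
 interpret A: left_module R A by (rule mA)
 interpret B: left_module R B by (rule mB)
 have "carrier (dprod A B) \<prec> (UNIV :: 'u set)"
  using A B by (auto intro!: lesspoll_UNIV_Times[OF infU] simp: lmod_def)
 then obtain D :: "('g => 'k, 'u) module" and \<phi> \<psi> where D: "lm D" "hom (dprod A B) D \<phi>" "hom D (dprod A B) \<psi>"
  "!!x. x \<in> carrier (dprod A B) ==> \<psi> (\<phi> x) = x" "!!y. y \<in> carrier D ==> \<phi> (\<psi> y) = y"
  using transport[OF dprod_md[OF mA mB]] by blast
 have h: "hom A (dprod A B) (%x. (x, \<zero>[B]))" "hom B (dprod A B) (%y. (\<zero>[A], y))"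
  "hom (dprod A B) A fst" "hom (dprod A B) B snd"
  by (rule mhomI; auto simp: A.smult_zero_r B.smult_zero_r)+
 note hh = mhom_comp[OF h(1) D(2)] mhom_comp[OF h(2) D(2)] mhom_comp[OF D(3) h(3)] mhom_comp[OF D(3) h(4)]
 have "dsum A B D (%x. \<phi> (x, \<zero>[B])) (%y. \<phi> (\<zero>[A], y)) (%d. fst (\<psi> d)) (%d. snd (\<psi> d))"
  unfolding dsum_def
 proof (intro conjI ballI A B D(1) hh)
  fix d assume d: "d \<in> carrier D"
  have c: "fst (\<psi> d) \<in> carrier A" "snd (\<psi> d) \<in> carrier B" using mhom_closed[OF D(3) d] by auto
  have "\<phi> (fst (\<psi> d), \<zero>[B]) \<oplus>[D] \<phi> (\<zero>[A], snd (\<psi> d)) =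
   \<phi> ((fst (\<psi> d), \<zero>[B]) \<oplus>[dprod A B] (\<zero>[A], snd (\<psi> d)))"
   by (rule mhom_add[OF D(2), symmetric]) (use c in auto)
  also have "... = \<phi> (\<psi> d)" using c by simp
  finally show "\<phi> (fst (\<psi> d), \<zero>[B]) \<oplus>[D] \<phi> (\<zero>[A], snd (\<psi> d)) = d" using D(5)[OF d] by simp
 qed (simp_all add: D(4))
 thus ?thesis by blast
qed

lemma dsumD:
 assumes "dsum A B D i j p q"
 shows "lm A" "lm B" "lm D" "md A" "md B" "md D" "hom A D i" "hom B D j" "hom D A p" "hom D B q"
  "!!x. x \<in> carrier A ==> p (i x) = x" "!!x. x \<in> carrier A ==> q (i x) = \<zero>[B]"
  "!!y. y \<in> carrier B ==> q (j y) = y" "!!y. y \<in> carrier B ==> p (j y) = \<zero>[A]"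
  "!!d. d \<in> carrier D ==> i (p d) \<oplus>[D] j (q d) = d"
  "!!x. x \<in> carrier A ==> i x \<in> carrier D" "!!x. x \<in> carrier B ==> j x \<in> carrier D"
  "!!x. x \<in> carrier D ==> p x \<in> carrier A" "!!x. x \<in> carrier D ==> q x \<in> carrier B"
 using assms lm_md by (auto simp: dsum_def dest: mhom_closed)

text \<open>A linear map out of the group algebra is determined by its values at the group elements, and
  a finite power of a small set is small.\<close>

lemma coind_in_universe:
 fixes M :: "('g => 'k, 'u) module"
 assumes M: "lm M"
 obtains C :: "('g => 'k, 'u) module" and \<phi> \<psi> where "pj C" "hom (coind M) C \<phi>" "hom C (coind M) \<psi>"
  "!!x. x \<in> carrier (coind M) ==> \<psi> (\<phi> x) = x" "!!y. y \<in> carrier C ==> \<phi> (\<psi> y) = y"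
proof -
 note mM = lm_md[OF M]
 note mC = coind_md[OF mM]
 have inj: "inj_on (%\<phi>. \<lambda>g\<in>carrier G. \<phi> (dl g)) (carrier (coind M))"
 proof (rule inj_onI)
  interpret M: left_module R M by (rule mM)
  fix x y assume a: "x \<in> carrier (coind M)" "y \<in> carrier (coind M)" "(\<lambda>g\<in>carrier G. x (dl g)) = (\<lambda>g\<in>carrier G. y (dl g))"
  have e: "x (dl g) = y (dl g)" if "g \<in> carrier G" for g
   using fun_cong[OF a(3), of g] that by simp
  show "x = y"
  proof (rule coind_eqI[OF a(1,2)])
   fix r assume r: "r \<in> carrier R"
   have k: "kl reg M x" "kl reg M y" using a by (auto simp: coind_carrier)
   show "x r = y r" unfolding kl_eval[OF mM k(1) r] kl_eval[OF mM k(2) r]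
    by (rule M.M.finsum_cong') (use e R_eval[OF r] coind_eval[OF a(2)] mM in auto)
  qed
 qed
 have sub: "(%\<phi>. \<lambda>g\<in>carrier G. \<phi> (dl g)) ` carrier (coind M) \<subseteq> (carrier G \<rightarrow>\<^sub>E carrier M)"
  by (intro image_subsetI restrict_PiE[THEN iffD2]) (use coind_eval[of _ M] in auto)
 have "carrier (coind M) \<lesssim> (carrier G \<rightarrow>\<^sub>E carrier M)" using inj sub by (auto simp: lepoll_def)
 moreover have "(carrier G \<rightarrow>\<^sub>E carrier M) \<prec> (UNIV :: 'u set)"
  by (rule lesspoll_UNIV_PiE[OF infU _ finG]) (use M in \<open>simp add: lmod_def\<close>)
 ultimately have "carrier (coind M) \<prec> (UNIV :: 'u set)" by (rule lesspoll_trans1)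
 then obtain C :: "('g => 'k, 'u) module" and \<phi> \<psi> where C: "lm C" "hom (coind M) C \<phi>" "hom C (coind M) \<psi>"
  "!!x. x \<in> carrier (coind M) ==> \<psi> (\<phi> x) = x" "!!y. y \<in> carrier C ==> \<phi> (\<psi> y) = y"
  using transport[OF mC] by blast
 have u: "kl (coind M) (coind M) (%\<psi>. coeff_map M \<one>[G] (\<psi> \<one>[R]))"
  by (rule kl_comp[OF ev_kl[OF mM one_R_closed] coeff_map_kl[OF mM G.one_closed]])
 have "sz (coind M) (coind M) (%x. x)"
  by (rule sz_cong[OF sz_tr[OF u]]) (simp add: coind_id_trace[OF mM])
 from sz_post[OF mC mC lm_md[OF C(1)] this C(2)] have "sz (coind M) C \<phi>" .
 from sz_pre[OF lm_md[OF C(1)] mC lm_md[OF C(1)] C(3) this] have "sz C C (%x. \<phi> (\<psi> x))" .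
 hence "sz C C (%x. x)" by (rule sz_cong) (simp add: C(5))
 hence "pj C" using C(1) by (simp add: pj_def)
 thus thesis using that C by blast
qed

lemma enough_projectives:
 fixes M :: "('g => 'k, 'u) module"
 assumes M: "lm M"
 shows "\<exists>P A a b. pj P & ses A P M a b" and "\<exists>P S a b. pj P & ses M P S a b"
proof -
 note mM = lm_md[OF M]
 obtain C :: "('g => 'k, 'u) module" and \<phi> \<psi> where C: "pj C" "hom (coind M) C \<phi>" "hom C (coind M) \<psi>"
  "!!x. x \<in> carrier (coind M) ==> \<psi> (\<phi> x) = x" "!!y. y \<in> carrier C ==> \<phi> (\<psi> y) = y"
  using coind_in_universe[OF M] by blast
 have h1: "hom C M (%x. coind_counit M (\<psi> x))" by (rule mhom_comp[OF C(3) counit_hom[OF mM]])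
 have "(%x. coind_counit M (\<psi> x)) ` carrier C = carrier M"
 proof (intro equalityI subsetI)
  fix m assume m: "m \<in> carrier M"
  have c: "coeff_map M \<one>[G] m \<in> carrier (coind M)" by (rule coeff_map_closed[OF mM G.one_closed m])
  have "m = coind_counit M (\<psi> (\<phi> (coeff_map M \<one>[G] m)))" using C(4)[OF c] counit_surj[OF mM m] by simp
  thus "m \<in> (%x. coind_counit M (\<psi> x)) ` carrier C" using mhom_closed[OF C(2) c] by blast
 qed (use mhom_closed[OF h1] in blast)
 from kernel_ses[OF pj_lm[OF C(1)] M h1 this] C(1) show "\<exists>P A a b. pj P & ses A P M a b" by blast
 have h2: "hom M C (%x. \<phi> (coind_unit M x))" by (rule mhom_comp[OF unit_hom[OF mM] C(2)])
 have "inj_on (%x. \<phi> (coind_unit M x)) (carrier M)"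
  by (rule inj_on_inverseI[of _ "%y. \<psi> y \<one>[R]"]) (simp add: C(4) unit_closed[OF mM] unit_one[OF mM])
 from cokernel_ses[OF M pj_lm[OF C(1)] h2 this] C(1) show "\<exists>P S a b. pj P & ses M P S a b" by blast
qed

section \<open>Pullbacks, pushouts and iterated extensions\<close>

definition pullback_property :: "('g => 'k, 'u) module => ('g => 'k, 'u) module => ('u => 'u) => ('u => 'u) =>
  ('g => 'k, 'u) module => ('u => 'u) => ('u => 'u) => bool" where
 "pullback_property Y E b r V e b' \<longleftrightarrow> (\<forall>(T :: ('g => 'k, 'u) module) t t'.
   md T & hom T Y t & hom T E t' & (\<forall>x\<in>carrier T. b (t x) = r (t' x)) -->
   (\<exists>h. hom T V h & (\<forall>x\<in>carrier T. e (h x) = t x & b' (h x) = t' x)))"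

definition pushout_property :: "('g => 'k, 'u) module => ('g => 'k, 'u) module => ('g => 'k, 'u) module =>
  ('u => 'u) => ('u => 'u) => ('g => 'k, 'u) module => ('u => 'u) => ('u => 'u) => bool" where
 "pushout_property X Y E a r V e a' \<longleftrightarrow> (\<forall>(T :: ('g => 'k, 'u) module) t t'.
   md T & hom Y T t & hom E T t' & (\<forall>x\<in>carrier X. t (a x) = t' (r x)) -->
   (\<exists>h. hom V T h & (\<forall>x\<in>carrier Y. h (e x) = t x) & (\<forall>x\<in>carrier E. h (a' x) = t' x)))"

lemma pullback_propertyD:
 fixes T :: "('g => 'k, 'u) module"
 assumes "pullback_property Y E b r V e b'" "md T" "hom T Y t" "hom T E t'" "!!x. x \<in> carrier T ==> b (t x) = r (t' x)"
 obtains h where "hom T V h" "!!x. x \<in> carrier T ==> e (h x) = t x" "!!x. x \<in> carrier T ==> b' (h x) = t' x"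
 using assms unfolding pullback_property_def by blast

lemma pushout_propertyD:
 fixes T :: "('g => 'k, 'u) module"
 assumes "pushout_property X Y E a r V e a'" "md T" "hom Y T t" "hom E T t'" "!!x. x \<in> carrier X ==> t (a x) = t' (r x)"
 obtains h where "hom V T h" "!!x. x \<in> carrier Y ==> h (e x) = t x" "!!x. x \<in> carrier E ==> h (a' x) = t' x"
 using assms unfolding pushout_property_def by blast

lemma pullback:
 assumes s: "ses X Y Z a b" and E: "lm E" and r: "hom E Z r"
 obtains V a' b' e where "ses X V E a' b'" "hom V Y e" "!!v. v \<in> carrier V ==> b (e v) = r (b' v)"
  "!!x. x \<in> carrier X ==> e (a' x) = a x"
  "pullback_property Y E b r V e b'"
proof -
 note d = sesD[OF s]
 note mE = lm_md[OF E]
 interpret Y: left_module R Y by (rule d(5))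
 interpret Z: left_module R Z by (rule d(6))
 interpret E: left_module R E by (rule mE)
 obtain D i j p q where D: "dsum Y E D i j p q" using dsum_exists[OF d(2) E] by blast
 note dd = dsumD[OF D]
 interpret D: left_module R D by (rule dd(6))
 let ?V = "D\<lparr>carrier := {x\<in>carrier D. b (p x) = r (q x)}\<rparr>"
 have bp: "hom D Z (%x. b (p x))" by (rule mhom_comp[OF dd(9) d(8)])
 have rq: "hom D Z (%x. r (q x))" by (rule mhom_comp[OF dd(10) r])
 have sub: "submod D {x\<in>carrier D. b (p x) = r (q x)}"
  using mhom_zero[OF dd(6) d(6) bp] mhom_zero[OF dd(6) d(6) rq]
  by (auto simp: submod_def mhom_add[OF bp] mhom_add[OF rq] mhom_smult[OF bp] mhom_smult[OF rq] D.smult_closed)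
 have V: "lm ?V" by (rule lm_submod[OF dd(3) sub])
 note inc = submod_md(2)[OF dd(6) sub]
 have e: "hom ?V Y p" by (rule mhom_comp[OF inc dd(9)])
 have b': "hom ?V E q" by (rule mhom_comp[OF inc dd(10)])
 have univ: "\<exists>h. hom T ?V h & (\<forall>x\<in>carrier T. p (h x) = t x & q (h x) = t' x)"
  if T: "md T" "hom T Y t" "hom T E t'" "!!x. x \<in> carrier T ==> b (t x) = r (t' x)" for T t t'
 proof -
  have h: "hom T D (%x. i (t x) \<oplus>[D] j (t' x))"
   by (rule mhom_sum[OF dd(6) mhom_comp[OF T(2) dd(7)] mhom_comp[OF T(3) dd(8)]])
  have pq: "p (i (t x) \<oplus>[D] j (t' x)) = t x" "q (i (t x) \<oplus>[D] j (t' x)) = t' x" if "x \<in> carrier T" for x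
   using mhom_closed[OF T(2) that] mhom_closed[OF T(3) that]
   by (simp_all add: dd(11-14,16,17) mhom_add[OF dd(9)] mhom_add[OF dd(10)])
  have "\<exists>y\<in>carrier ?V. i (t x) \<oplus>[D] j (t' x) = y" if "x \<in> carrier T" for x
   using pq[OF that] mhom_closed[OF h that] T(4)[OF that] by simp
  from factor_through_injection[OF lm_md[OF V] dd(6) T(1) inc inj_on_id2 h this]
  obtain h' where "hom T ?V h'" "!!x. x \<in> carrier T ==> h' x = i (t x) \<oplus>[D] j (t' x)" by blast
  thus ?thesis using pq by (intro exI[of _ h']) simp
 qed
 have z: "hom X E (%x. \<zero>[E])" by (rule mhom_const_zero[OF mE])
 obtain a' where a': "hom X ?V a'" "!!x. x \<in> carrier X ==> p (a' x) = a x" "!!x. x \<in> carrier X ==> q (a' x) = \<zero>[E]"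
  using univ[OF d(4,7) z] d(10) mhom_zero[OF mE d(6) r] by auto
 have inj: "inj_on a' (carrier X)"
  by (rule inj_onI) (metis a'(2) d(9) inj_onD)
 have S: "ses X ?V E a' q"
  unfolding ses_def
 proof (intro conjI ballI impI d(1) V E a'(1) b' inj a'(3))
  fix x assume x: "x \<in> carrier ?V" "q x = \<zero>[E]"
  hence "b (p x) = \<zero>[Z]" using mhom_zero[OF mE d(6) r] by simp
  then obtain y where y: "y \<in> carrier X" "p x = a y" using d(11) dd(18) x by auto
  have xD: "x \<in> carrier D" and aD: "a' y \<in> carrier D" using x mhom_closed[OF a'(1) y(1)] by auto
  have "x = i (p x) \<oplus>[D] j (q x)" by (rule dd(15)[OF xD, symmetric])
  also have "... = i (p (a' y)) \<oplus>[D] j (q (a' y))" using x y a' by simp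
  also have "... = a' y" by (rule dd(15)[OF aD])
  finally have "x = a' y" .
  thus "\<exists>y\<in>carrier X. x = a' y" using y by blast
 next
  have "x \<in> q ` carrier ?V" if x: "x \<in> carrier E" for x
  proof -
   obtain y where y: "y \<in> carrier Y" "b y = r x" using d(13) mhom_closed[OF r x] by blast
   have "i y \<oplus>[D] j x \<in> carrier ?V" "q (i y \<oplus>[D] j x) = x"
    using x y by (auto simp: dd(11-14,16,17) mhom_add[OF dd(9)] mhom_add[OF dd(10)])
   thus ?thesis by force
  qed
  thus "q ` carrier ?V = carrier E" using mhom_closed[OF b'] by blast
 qed
 have comm: "b (p v) = r (q v)" if "v \<in> carrier ?V" for v using that by simp
 have P: "pullback_property Y E b r ?V p q" unfolding pullback_property_def using univ by blast
 show thesis by (rule that[OF S e comm a'(2) P])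
qed

lemma pushout:
 assumes s: "ses X Y Z a b" and E: "lm E" and r: "hom X E r"
 obtains V a' b' e where "ses E V Z a' b'" "hom Y V e" "!!v. v \<in> carrier Y ==> b' (e v) = b v"
  "!!x. x \<in> carrier X ==> e (a x) = a' (r x)"
  "pushout_property X Y E a r V e a'"
proof -
 note d = sesD[OF s]
 note mE = lm_md[OF E]
 interpret Y: left_module R Y by (rule d(5))
 interpret Z: left_module R Z by (rule d(6))
 interpret E: left_module R E by (rule mE)
 obtain D i j p q where D: "dsum Y E D i j p q" using dsum_exists[OF d(2) E] by blast
 note dd = dsumD[OF D]
 interpret D: left_module R D by (rule dd(6))
 define k where "k = (%x. i (a x) \<oplus>[D] (\<ominus>[D] j (r x)))"
 have k: "hom X D k" unfolding k_def
  by (intro mhom_sum mhom_neg dd(6) mhom_comp[OF d(7) dd(7)] mhom_comp[OF r dd(8)])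
 have pk: "p (k x) = a x" "q (k x) = \<ominus>[E] r x" if "x \<in> carrier X" for x
  using d(14)[OF that] mhom_closed[OF r that]
  by (simp_all add: k_def dd(11-14,16,17) mhom_add[OF dd(9)] mhom_add[OF dd(10)] mhom_minus[OF dd(6,4,9)] mhom_minus[OF dd(6,5,10)])
 have "inj_on k (carrier X)"
  by (rule inj_onI) (metis pk(1) d(9) inj_onD)
 then obtain V c where V: "ses X D V k c" using cokernel_ses[OF d(1) dd(3) k] by blast
 note v = sesD[OF V]
 interpret V: left_module R V by (rule v(6))
 have e: "hom Y V (%y. c (i y))" by (rule mhom_comp[OF dd(7) v(8)])
 have a': "hom E V (%y. c (j y))" by (rule mhom_comp[OF dd(8) v(8)])
 have eq: "c (i (a x)) = c (j (r x))" if "x \<in> carrier X" for x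
 proof -
  have cl: "i (a x) \<in> carrier D" "j (r x) \<in> carrier D" using d(14)[OF that] mhom_closed[OF r that] dd(16,17) by auto
  have "c (i (a x)) \<ominus>[V] c (j (r x)) = \<zero>[V]"
   using v(10)[OF that] cl by (simp add: k_def mhom_add[OF v(8)] mhom_minus[OF dd(6) v(6,8)] V.M.minus_eq)
  thus ?thesis using cl v(15) by (simp add: V.M.diff_eq_zero_iff)
 qed
 have univ: "\<exists>h. hom V T h & (\<forall>x\<in>carrier Y. h (c (i x)) = t x) & (\<forall>x\<in>carrier E. h (c (j x)) = t' x)"
  if T: "md T" "hom Y T t" "hom E T t'" "!!x. x \<in> carrier X ==> t (a x) = t' (r x)" for T t t'
 proof -
  interpret T: left_module R T by (rule T(1))
  have h: "hom D T (%x. t (p x) \<oplus>[T] t' (q x))"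
   by (rule mhom_sum[OF T(1) mhom_comp[OF dd(9) T(2)] mhom_comp[OF dd(10) T(3)]])
  have "t (p (k x)) \<oplus>[T] t' (q (k x)) = \<zero>[T]" if "x \<in> carrier X" for x
   using that pk[OF that] T(4)[OF that] mhom_closed[OF r that] mhom_closed[OF T(3)]
   by (simp add: mhom_minus[OF mE T(1,3)] T.M.r_neg)
  from ses_out[OF V T(1) h this] obtain h' where h': "hom V T h'" "!!x. x \<in> carrier D ==> h' (c x) = t (p x) \<oplus>[T] t' (q x)" by blast
  have "h' (c (i x)) = t x" if "x \<in> carrier Y" for x
   using that h'(2)[OF dd(16)[OF that]] mhom_closed[OF T(2)] mhom_zero[OF mE T(1,3)] by (simp add: dd(11,12))
  moreover have "h' (c (j x)) = t' x" if "x \<in> carrier E" for x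
   using that h'(2)[OF dd(17)[OF that]] mhom_closed[OF T(3)] mhom_zero[OF d(5) T(1,2)] by (simp add: dd(13,14))
  ultimately show ?thesis using h'(1) by blast
 qed
 have "!!x. x \<in> carrier X ==> b (a x) = \<zero>[Z]" by (rule d(10))
 from univ[OF d(6,8) mhom_const_zero[OF d(6)] this] obtain b' where b': "hom V Z b'"
  "!!x. x \<in> carrier Y ==> b' (c (i x)) = b x" "!!x. x \<in> carrier E ==> b' (c (j x)) = \<zero>[Z]" by blast
 have S: "ses E V Z (%y. c (j y)) b'"
  unfolding ses_def
 proof (intro conjI ballI impI d(3) v(3) E a' b'(1,3))
  show "inj_on (%y. c (j y)) (carrier E)"
  proof (rule inj_hom[OF mE v(6) a'])
   fix x assume x: "x \<in> carrier E" "c (j x) = \<zero>[V]"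
   then obtain y where y: "y \<in> carrier X" "j x = k y" using v(11) dd(17) by blast
   have "a y = \<zero>[Y]" using pk(1)[OF y(1)] dd(14)[OF x(1)] y(2) by simp
   hence "a y = a \<zero>[X]" using mhom_zero[OF d(4,5,7)] by simp
   hence "y = \<zero>[X]" using d(9) y(1) d(4) by (auto dest: inj_onD)
   hence "j x = \<zero>[D]" using y(2) mhom_zero[OF d(4) dd(6) k] by simp
   thus "x = \<zero>[E]" using dd(13)[OF x(1)] mhom_zero[OF dd(6,5,10)] by simp
  qed
 next
  fix w assume w: "w \<in> carrier V" "b' w = \<zero>[Z]"
  obtain x where x: "x \<in> carrier D" "c x = w" using v(13)[OF w(1)] by blast
  have pqx: "p x \<in> carrier Y" "q x \<in> carrier E" using x dd(18,19) by auto
  have w': "w = c (i (p x)) \<oplus>[V] c (j (q x))"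
   using dd(15)[OF x(1)] pqx dd(16,17) x(2) mhom_add[OF v(8), of "i (p x)" "j (q x)"] by simp
  have cl: "c (i (p x)) \<in> carrier V" "c (j (q x)) \<in> carrier V" using pqx dd(16,17) v(15) by auto
  have "b' w = b (p x)" using w' cl pqx b' d(15) by (simp add: mhom_add[OF b'(1)])
  then obtain y where y: "y \<in> carrier X" "p x = a y" using w(2) d(11) pqx(1) by auto
  have ry: "r y \<in> carrier E" using mhom_closed[OF r y(1)] .
  have "w = c (j (r y \<oplus>[E] q x))" using w' y eq[OF y(1)] ry pqx
   by (simp add: mhom_add[OF a'])
  thus "\<exists>y\<in>carrier E. w = c (j y)" using ry pqx by blast
 next
  show "b' ` carrier V = carrier Z"
  proof (intro equalityI subsetI)
   fix z assume "z \<in> carrier Z"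
   then obtain y where y: "y \<in> carrier Y" "b y = z" using d(13) by blast
   hence "b' (c (i y)) = z" "c (i y) \<in> carrier V" using b'(2) mhom_closed[OF e] by auto
   thus "z \<in> b' ` carrier V" by blast
  qed (use mhom_closed[OF b'(1)] in blast)
 qed
 have P: "pushout_property X Y E a r V (%y. c (i y)) (%y. c (j y))"
  unfolding pushout_property_def using univ by blast
 show thesis by (rule that[OF S e b'(2) eq P])
qed

end

context kGU begin

lemma pullback_sret:
 assumes s: "ses X Y Z a b" and E: "lm E" and r: "hom E Z r"
  and i: "hom Z E i" "st Z Z (%z. r (i z)) (%z. z)"
  and V: "lm V" "hom V Y e"
  and univ: "pullback_property Y E b r V e b'"
 shows "sret Y V"
proof -
 note d = sesD[OF s]
 interpret Y: left_module R Y by (rule d(5))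
 obtain t where t: "sz Z Z t" "!!z. z \<in> carrier Z ==> r (i z) = z \<oplus>[Z] t z" using i(2) by (auto simp: st_def)
 obtain t' where t': "hom Z Y t'" "sz Z Y t'" "!!z. z \<in> carrier Z ==> b (t' z) = t z"
  using sz_lift[OF d(5,6,6,8,12) t(1)] by blast
 have s1: "sz Y Y (%y. t' (b y))" by (rule sz_pre[OF d(5,6,5,8) t'(2)])
 have h1: "hom Y Y (%y. y \<oplus>[Y] t' (b y))"
  by (rule mhom_sum[OF d(5) mhom_id sz_hom[OF d(5,5) s1]])
 have "b (y \<oplus>[Y] t' (b y)) = r (i (b y))" if y: "y \<in> carrier Y" for y
  using y d(15) t(2) t'(3) mhom_closed[OF t'(1)] by (simp add: mhom_add[OF d(8)])
 from pullback_propertyD[OF univ d(5) h1 mhom_comp[OF d(8) i(1)] this] obtain h where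
  h: "hom Y V h" "!!y. y \<in> carrier Y ==> e (h y) = y \<oplus>[Y] t' (b y)" by blast
 have "st Y Y (%y. e (h y)) (%y. y)" unfolding st_def using s1 h(2) by blast
 thus ?thesis by (rule sretI[OF d(2) V(1) h(1) V(2)])
qed

lemma pushout_sret:
 assumes s: "ses X Y Z a b" and E: "lm E" and i: "hom X E i"
  and r: "hom E X r" "st X X (%z. r (i z)) (%z. z)"
  and V: "lm V" "hom Y V e"
  and univ: "pushout_property X Y E a i V e a'"
 shows "sret Y V"
proof -
 note d = sesD[OF s]
 interpret Y: left_module R Y by (rule d(5))
 obtain t where t: "sz X X t" "!!z. z \<in> carrier X ==> r (i z) = z \<oplus>[X] t z" using r(2) by (auto simp: st_def)
 obtain t' where t': "hom Y X t'" "sz Y X t'" "!!z. z \<in> carrier X ==> t' (a z) = t z"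
  using sz_extend[OF d(4,5,4,7,9) t(1)] by blast
 have s1: "sz Y Y (%y. a (t' y))" by (rule sz_post[OF d(5,4,5) t'(2) d(7)])
 have h1: "hom Y Y (%y. y \<oplus>[Y] a (t' y))"
  by (rule mhom_sum[OF d(5) mhom_id sz_hom[OF d(5,5) s1]])
 have "a x \<oplus>[Y] a (t' (a x)) = a (r (i x))" if x: "x \<in> carrier X" for x
  using x st_closed[OF d(4,4) t(1) x] by (simp add: t(2) t'(3) mhom_add[OF d(7)])
 from pushout_propertyD[OF univ d(5) h1 mhom_comp[OF r(1) d(7)] this] obtain h where
  h: "hom V Y h" "!!y. y \<in> carrier Y ==> h (e y) = y \<oplus>[Y] a (t' y)" by blast
 have "st Y Y (%y. h (e y)) (%y. y)" unfolding st_def using s1 h(2) by blast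
 thus ?thesis by (rule sretI[OF d(2) V(1) V(2) h(1)])
qed

text \<open>The isomorphism theorems for iterated extensions.\<close>

lemma ses_preimage:
 assumes s: "ses A E D a q" and t: "ses B D C b p"
 obtains F c f a' where "ses F E C c (%x. p (q x))" "ses A F B a' f"
  "!!x. x \<in> carrier A ==> c (a' x) = a x" "!!y. y \<in> carrier F ==> b (f y) = q (c y)"
proof -
 note d = sesD[OF s] and e = sesD[OF t]
 have pq: "hom E C (%x. p (q x))" by (rule mhom_comp[OF d(8) e(8)])
 have im: "(%x. p (q x)) ` carrier E = carrier C"
  using d(12) e(12) by (metis image_image)
 let ?F = "E\<lparr>carrier := {x \<in> carrier E. p (q x) = \<zero>[C]}\<rparr>"
 have F: "ses ?F E C (%x. x) (%x. p (q x))" by (rule kernel_ses[OF d(2) e(3) pq im])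
 note f = sesD[OF F]
 have qF: "hom ?F D q" by (rule mhom_comp[OF f(7) d(8)])
 obtain g where g: "hom ?F B g" "!!x. x \<in> carrier ?F ==> b (g x) = q x"
  using ses_in[OF t f(4) qF] by auto
 have "p (q (a x)) = \<zero>[C]" if "x \<in> carrier A" for x using d(10)[OF that] mhom_zero[OF e(5,6,8)] by simp
 then obtain a' where a': "hom A ?F a'" "!!x. x \<in> carrier A ==> a' x = a x"
  using ses_in[OF F d(4,7)] by auto
 have "ses A ?F B a' g"
  unfolding ses_def
 proof (intro conjI ballI impI d(1) f(1) e(1) a'(1) g(1))
  show "inj_on a' (carrier A)" by (rule inj_onI) (metis a'(2) d(9) inj_onD)
 next
  fix x assume x: "x \<in> carrier A"
  have "b (g (a' x)) = b \<zero>[B]"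
   using g(2)[OF mhom_closed[OF a'(1) x]] a'(2)[OF x] d(10)[OF x] mhom_zero[OF e(4,5,7)] by simp
  thus "g (a' x) = \<zero>[B]" using mhom_closed[OF g(1) mhom_closed[OF a'(1) x]] e(4) by (auto intro: inj_onD[OF e(9)])
 next
  fix x assume x: "x \<in> carrier ?F" "g x = \<zero>[B]"
  hence "q x = \<zero>[D]" using g(2)[OF x(1)] mhom_zero[OF e(4,5,7)] by simp
  thus "\<exists>y\<in>carrier A. x = a' y" using d(11)[of x] x(1) a'(2) by auto
 next
  have "y \<in> g ` carrier ?F" if y: "y \<in> carrier B" for y
  proof -
   obtain x where x: "x \<in> carrier E" "q x = b y" using d(13) e(14)[OF y] by blast
   hence xF: "x \<in> carrier ?F" using e(10)[OF y] by simp
   have "b (g x) = b y" using g(2)[OF xF] x by simp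
   hence "g x = y" using e(9) y mhom_closed[OF g(1) xF] by (auto dest: inj_onD)
   thus ?thesis using xF by blast
  qed
  thus "g ` carrier ?F = carrier B" using mhom_closed[OF g(1)] by blast
 qed
 from that[OF F this a'(2) g(2)] show thesis .
qed

lemma ses_quotient:
 assumes s: "ses D E C d c" and t: "ses A D B a b"
 obtains X x y z where "ses A E X (%\<alpha>. d (a \<alpha>)) x" "ses B X C y z"
  "!!e. e \<in> carrier E ==> z (x e) = c e" "!!\<delta>. \<delta> \<in> carrier D ==> y (b \<delta>) = x (d \<delta>)"
proof -
 note e = sesD[OF s] and f = sesD[OF t]
 have da: "hom A E (%\<alpha>. d (a \<alpha>))" by (rule mhom_comp[OF f(7) e(7)])
 have "inj_on (%\<alpha>. d (a \<alpha>)) (carrier A)"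
  by (rule inj_onI) (metis e(9) f(9) f(14) inj_onD)
 then obtain X x where X: "ses A E X (%\<alpha>. d (a \<alpha>)) x" using cokernel_ses[OF f(1) e(2) da] by blast
 note g = sesD[OF X]
 obtain z where z: "hom X C z" "!!w. w \<in> carrier E ==> z (x w) = c w"
  using ses_out[OF X e(6,8)] e(10) f(14) by auto
 have xd: "hom D X (%\<delta>. x (d \<delta>))" by (rule mhom_comp[OF e(7) g(8)])
 obtain y where y: "hom B X y" "!!\<delta>. \<delta> \<in> carrier D ==> y (b \<delta>) = x (d \<delta>)"
  using ses_out[OF t g(6) xd] g(10) by auto
 have "ses B X C y z"
  unfolding ses_def
 proof (intro conjI ballI impI f(3) g(3) e(3) y(1) z(1))
  show "inj_on y (carrier B)"
  proof (rule inj_hom[OF f(6) g(6) y(1)])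
   fix \<beta> assume be: "\<beta> \<in> carrier B" "y \<beta> = \<zero>[X]"
   obtain \<delta> where de: "\<delta> \<in> carrier D" "b \<delta> = \<beta>" using f(13)[OF be(1)] by blast
   hence "x (d \<delta>) = \<zero>[X]" using be y(2) by metis
   then obtain \<alpha> where "\<alpha> \<in> carrier A" "d \<delta> = d (a \<alpha>)" using g(11) e(14)[OF de(1)] by blast
   hence "\<delta> = a \<alpha>" using de(1) f(14) e(9) by (auto dest: inj_onD)
   thus "\<beta> = \<zero>[B]" using de(2) f(10) \<open>\<alpha> \<in> carrier A\<close> by auto
  qed
 next
  fix \<beta> assume "\<beta> \<in> carrier B"
  then obtain \<delta> where de: "\<delta> \<in> carrier D" "b \<delta> = \<beta>" using f(13) by blast
  thus "z (y \<beta>) = \<zero>[C]" using y(2) z(2) e(10,14) by metis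
 next
  fix \<xi> assume xi: "\<xi> \<in> carrier X" "z \<xi> = \<zero>[C]"
  obtain w where w: "w \<in> carrier E" "x w = \<xi>" using g(13)[OF xi(1)] by blast
  hence "c w = \<zero>[C]" using z(2) xi(2) by metis
  then obtain \<delta> where "\<delta> \<in> carrier D" "w = d \<delta>" using e(11)[OF w(1)] by blast
  hence "\<xi> = y (b \<delta>)" "b \<delta> \<in> carrier B" using w y(2) f(15) by auto
  thus "\<exists>\<beta>\<in>carrier B. \<xi> = y \<beta>" by blast
 next
  have "w \<in> z ` carrier X" if w: "w \<in> carrier C" for w
  proof -
   obtain v where v: "v \<in> carrier E" "c v = w" using e(13)[OF w] by blast
   thus ?thesis using z(2)[OF v(1)] g(15)[OF v(1)] by force
  qed
  thus "z ` carrier X = carrier C" using mhom_closed[OF z(1)] by blast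
 qed
 from that[OF X this z(2) y(2)] show thesis .
qed

section \<open>Suspensions\<close>

lemma suspend_hom:
 assumes s: "ses X P S i q" and t: "ses Y P' S' i' q'" and P': "pj P'" and f: "hom X Y f"
 obtains g h where "hom P P' g" "hom S S' h" "!!x. x \<in> carrier X ==> g (i x) = i' (f x)"
  "!!x. x \<in> carrier P ==> h (q x) = q' (g x)"
proof -
 note d = sesD[OF s] and e = sesD[OF t]
 have "sz X P' (%x. i' (f x))" by (rule pj_sz_in[OF P' d(4) mhom_comp[OF f e(7)]])
 then obtain g where g: "hom P P' g" "!!x. x \<in> carrier X ==> g (i x) = i' (f x)"
  using sz_extend[OF d(4,5) e(5) d(7,9)] by blast
 have qg: "hom P S' (%x. q' (g x))" by (rule mhom_comp[OF g(1) e(8)])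
 have "q' (g (i x)) = \<zero>[S']" if "x \<in> carrier X" for x
  using g(2)[OF that] e(10) mhom_closed[OF f that] by simp
 then obtain h where "hom S S' h" "!!x. x \<in> carrier P ==> h (q x) = q' (g x)"
  using ses_out[OF s e(6) qg] by blast
 thus thesis using that g by blast
qed

lemma suspend_sz:
 assumes s: "ses X P S i q" and t: "ses Y P' S' i' q'" and P': "pj P'" and f: "sz X Y f"
  and g: "hom P P' g" and h: "hom S S' h" and gi: "!!x. x \<in> carrier X ==> g (i x) = i' (f x)"
  and hq: "!!x. x \<in> carrier P ==> h (q x) = q' (g x)"
 shows "sz S S' h"
proof -
 note d = sesD[OF s] and e = sesD[OF t]
 interpret P': left_module R P' by (rule e(5))
 interpret S': left_module R S' by (rule e(6))
 obtain f' where f': "hom P Y f'" "!!x. x \<in> carrier X ==> f' (i x) = f x"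
  using sz_extend[OF d(4,5) e(4) d(7,9) f] by blast
 have k: "hom P P' (%x. g x \<oplus>[P'] (\<ominus>[P'] i' (f' x)))"
  by (intro mhom_sum mhom_neg g e(5) mhom_comp[OF f'(1) e(7)])
 have "g (i x) \<oplus>[P'] (\<ominus>[P'] i' (f' (i x))) = \<zero>[P']" if x: "x \<in> carrier X" for x
  using gi[OF x] f'(2)[OF x] e(14)[OF mhom_closed[OF sz_hom[OF d(4) e(4) f] x]] by (simp add: P'.M.r_neg)
 then obtain m where m: "hom S P' m" "!!x. x \<in> carrier P ==> m (q x) = g x \<oplus>[P'] (\<ominus>[P'] i' (f' x))"
  using ses_out[OF s e(5) k] by blast
 have "sz S S' (%x. q' (m x))" by (rule sz_through_pj[OF P' d(6) e(6) m(1) e(8)])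
 moreover have "h x = q' (m x)" if xS: "x \<in> carrier S" for x
 proof -
  obtain y where y: "y \<in> carrier P" "q y = x" using d(13)[OF xS] by blast
  have cl: "g y \<in> carrier P'" "f' y \<in> carrier Y" "i' (f' y) \<in> carrier P'"
   using mhom_closed[OF g y(1)] mhom_closed[OF f'(1) y(1)] e(14) by auto
  have "q' (m (q y)) = q' (g y)" using m(2)[OF y(1)] cl e(10,15)
   by (simp add: mhom_add[OF e(8)] mhom_minus[OF e(5,6,8)])
  thus ?thesis using hq[OF y(1)] y(2) by simp
 qed
 ultimately show ?thesis by (rule sz_cong)
qed

lemma desuspend_hom:
 assumes s: "ses X P S i q" and t: "ses Y P' S' i' q'" and P: "pj P" and h: "hom S S' h"
 obtains g f where "hom P P' g" "hom X Y f" "!!x. x \<in> carrier X ==> g (i x) = i' (f x)"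
  "!!x. x \<in> carrier P ==> h (q x) = q' (g x)"
proof -
 note d = sesD[OF s] and e = sesD[OF t]
 have "sz P S' (%x. h (q x))" by (rule pj_sz_out[OF P e(6) mhom_comp[OF d(8) h]])
 then obtain g where g: "hom P P' g" "!!x. x \<in> carrier P ==> q' (g x) = h (q x)"
  using sz_lift[OF e(5,6) d(5) e(8,12)] by blast
 have gi: "hom X P' (%x. g (i x))" by (rule mhom_comp[OF d(7) g(1)])
 have "q' (g (i x)) = \<zero>[S']" if "x \<in> carrier X" for x
  using g(2)[OF d(14)[OF that]] d(10)[OF that] mhom_zero[OF d(6) e(6) h] by simp
 then obtain f where "hom X Y f" "!!x. x \<in> carrier X ==> i' (f x) = g (i x)"
  using ses_in[OF t d(4) gi] by blast
 thus thesis using that[OF g(1)] g(2) by metis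
qed

lemma desuspend_sz:
 assumes s: "ses X P S i q" and t: "ses Y P' S' i' q'" and P: "pj P" and h: "sz S S' h"
  and g: "hom P P' g" and f: "hom X Y f" and gi: "!!x. x \<in> carrier X ==> g (i x) = i' (f x)"
  and hq: "!!x. x \<in> carrier P ==> h (q x) = q' (g x)"
 shows "sz X Y f"
proof -
 note d = sesD[OF s] and e = sesD[OF t]
 interpret P': left_module R P' by (rule e(5))
 interpret S': left_module R S' by (rule e(6))
 obtain k where k: "hom S P' k" "!!x. x \<in> carrier S ==> q' (k x) = h x"
  using sz_lift[OF e(5,6) d(6) e(8,12) h] by blast
 have m: "hom P P' (%x. g x \<oplus>[P'] (\<ominus>[P'] k (q x)))"
  by (intro mhom_sum mhom_neg g e(5) mhom_comp[OF d(8) k(1)])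
 have "q' (g x \<oplus>[P'] (\<ominus>[P'] k (q x))) = \<zero>[S']" if x: "x \<in> carrier P" for x
  using hq[OF x] k(2)[OF d(15)[OF x]] mhom_closed[OF g x] mhom_closed[OF k(1) d(15)[OF x]] e(15)
  by (simp add: mhom_add[OF e(8)] mhom_minus[OF e(5,6,8)] S'.M.r_neg)
 then obtain l where l: "hom P Y l" "!!x. x \<in> carrier P ==> i' (l x) = g x \<oplus>[P'] (\<ominus>[P'] k (q x))"
  using ses_in[OF t d(5) m] by blast
 have "sz X Y (%x. l (i x))" by (rule sz_through_pj[OF P d(4) e(4) d(7) l(1)])
 moreover have "f x = l (i x)" if x: "x \<in> carrier X" for x
 proof (rule inj_onD[OF e(9)])
  have "i' (l (i x)) = g (i x)"
   using l(2)[OF d(14)[OF x]] d(10)[OF x] mhom_zero[OF d(6) e(5) k(1)] mhom_closed[OF g d(14)[OF x]] by simp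
  thus "i' (f x) = i' (l (i x))" using gi[OF x] by simp
 qed (use x mhom_closed[OF f] mhom_closed[OF l(1)] d(14) in auto)
 ultimately show ?thesis by (rule sz_cong)
qed

lemma sret_suspension:
 assumes s: "ses X P S i q" and t: "ses Y P' S' i' q'" and P: "pj P" and P': "pj P'" and r: "sret X Y"
 shows "sret S S'"
proof -
 note d = sesD[OF s] and e = sesD[OF t]
 interpret X: left_module R X by (rule d(4))
 interpret P: left_module R P by (rule d(5))
 interpret S: left_module R S by (rule d(6))
 obtain j r where j: "hom X Y j" "hom Y X r" "st X X (%x. r (j x)) (%x. x)" using r by (auto simp: sret_def)
 obtain g h where g: "hom P P' g" "hom S S' h" "!!x. x \<in> carrier X ==> g (i x) = i' (j x)"
  "!!x. x \<in> carrier P ==> h (q x) = q' (g x)" using suspend_hom[OF s t P' j(1)] by blast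
 obtain g' h' where g': "hom P' P g'" "hom S' S h'" "!!x. x \<in> carrier Y ==> g' (i' x) = i (r x)"
  "!!x. x \<in> carrier P' ==> h' (q' x) = q (g' x)" using suspend_hom[OF t s P j(2)] by blast
 note rj = mhom_comp[OF j(1,2)] and gg = mhom_comp[OF g(1) g'(1)] and hh = mhom_comp[OF g(2) g'(2)]
 have "sz S S (%x. h' (h x) \<ominus>[S] x)"
 proof (rule suspend_sz[OF s s P])
  show "sz X X (%x. r (j x) \<ominus>[X] x)" using st_diff[OF d(4,4) rj mhom_id] j(3) by simp
  show "hom P P (%x. g' (g x) \<ominus>[P] x)" unfolding a_minus_def by (intro mhom_sum mhom_neg mhom_id gg d(5))
  show "hom S S (%x. h' (h x) \<ominus>[S] x)" unfolding a_minus_def by (intro mhom_sum mhom_neg mhom_id hh d(6))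
  show "g' (g (i x)) \<ominus>[P] i x = i (r (j x) \<ominus>[X] x)" if x: "x \<in> carrier X" for x
   using x mhom_closed[OF rj x] g(3) g'(3) mhom_closed[OF j(1) x]
   by (simp add: a_minus_def mhom_add[OF d(7)] mhom_minus[OF d(4,5,7)])
  show "h' (h (q x)) \<ominus>[S] q x = q (g' (g x) \<ominus>[P] x)" if x: "x \<in> carrier P" for x
   using x mhom_closed[OF gg x] g(4) g'(4) mhom_closed[OF g(1) x]
   by (simp add: a_minus_def mhom_add[OF d(8)] mhom_minus[OF d(5,6,8)])
 qed
 hence "st S S (%x. h' (h x)) (%x. x)" using st_diff[OF d(6,6) hh mhom_id] by simp
 thus ?thesis by (rule sretI[OF d(3) e(3) g(2) g'(2)])
qed

lemma sret_desuspension: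
 assumes s: "ses X P S i q" and t: "ses Y P' S' i' q'" and P: "pj P" and P': "pj P'" and r: "sret S S'"
 shows "sret X Y"
proof -
 note d = sesD[OF s] and e = sesD[OF t]
 interpret X: left_module R X by (rule d(4))
 interpret P: left_module R P by (rule d(5))
 interpret S: left_module R S by (rule d(6))
 obtain j r where j: "hom S S' j" "hom S' S r" "st S S (%x. r (j x)) (%x. x)" using r by (auto simp: sret_def)
 obtain g h where g: "hom P P' g" "hom X Y h" "!!x. x \<in> carrier X ==> g (i x) = i' (h x)"
  "!!x. x \<in> carrier P ==> j (q x) = q' (g x)" using desuspend_hom[OF s t P j(1)] by blast
 obtain g' h' where g': "hom P' P g'" "hom Y X h'" "!!x. x \<in> carrier Y ==> g' (i' x) = i (h' x)"
  "!!x. x \<in> carrier P' ==> r (q' x) = q (g' x)" using desuspend_hom[OF t s P' j(2)] by blast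
 note rj = mhom_comp[OF j(1,2)] and gg = mhom_comp[OF g(1) g'(1)] and hh = mhom_comp[OF g(2) g'(2)]
 have "sz X X (%x. h' (h x) \<ominus>[X] x)"
 proof (rule desuspend_sz[OF s s P])
  show "sz S S (%x. r (j x) \<ominus>[S] x)" using st_diff[OF d(6,6) rj mhom_id] j(3) by simp
  show "hom P P (%x. g' (g x) \<ominus>[P] x)" unfolding a_minus_def by (intro mhom_sum mhom_neg mhom_id gg d(5))
  show "hom X X (%x. h' (h x) \<ominus>[X] x)" unfolding a_minus_def by (intro mhom_sum mhom_neg mhom_id hh d(4))
  show "g' (g (i x)) \<ominus>[P] i x = i (h' (h x) \<ominus>[X] x)" if x: "x \<in> carrier X" for x
   using x mhom_closed[OF hh x] g(3) g'(3) mhom_closed[OF g(2) x]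
   by (simp add: a_minus_def mhom_add[OF d(7)] mhom_minus[OF d(4,5,7)])
  show "r (j (q x)) \<ominus>[S] q x = q (g' (g x) \<ominus>[P] x)" if x: "x \<in> carrier P" for x
   using x mhom_closed[OF gg x] g(4) g'(4) mhom_closed[OF g(1) x]
   by (simp add: a_minus_def mhom_add[OF d(8)] mhom_minus[OF d(5,6,8)])
 qed
 hence "st X X (%x. h' (h x)) (%x. x)" using st_diff[OF d(4,4) hh mhom_id] by simp
 thus ?thesis by (rule sretI[OF d(1) e(1) g(2) g'(2)])
qed

end

context kGU begin

section \<open>Classes of modules and their products\<close>

text \<open>The closure properties shared by the projective class and all its levels. Closure
  under isomorphism and under direct summands both come from stable retracts.\<close>

definition good :: "('g => 'k, 'u) module set => bool" where
 "good \<C> \<longleftrightarrow> (\<forall>X\<in>\<C>. lm X) & (\<forall>X Y. Y \<in> \<C> & sret X Y --> X \<in> \<C>) & (\<forall>P. pj P --> P \<in> \<C>) &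
   (\<forall>X P S i q. pj P & ses X P S i q --> (X \<in> \<C> \<longleftrightarrow> S \<in> \<C>)) &
   (\<forall>A B D i j p q. dsum A B D i j p q & A \<in> \<C> & B \<in> \<C> --> D \<in> \<C>)"

text \<open>Stable retracts of extensions of a module in \<open>\<B>\<close> by a module in \<open>\<A>\<close>.\<close>

definition ext :: "('g => 'k, 'u) module set => ('g => 'k, 'u) module set => ('g => 'k, 'u) module set" where
 "ext \<A> \<B> = {X. \<exists>Y A B a b. A \<in> \<A> & B \<in> \<B> & ses A Y B a b & sret X Y}"

lemma goodD:
 assumes "good \<C>"
 shows "X \<in> \<C> ==> lm X" "Y \<in> \<C> ==> sret X Y ==> X \<in> \<C>" "pj P ==> P \<in> \<C>"
  "pj P ==> ses X P S i q ==> X \<in> \<C> ==> S \<in> \<C>" "pj P ==> ses X P S i q ==> S \<in> \<C> ==> X \<in> \<C>"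
  "dsum A B D i j p q ==> A \<in> \<C> ==> B \<in> \<C> ==> D \<in> \<C>"
 using assms unfolding good_def by blast+

lemma extI: "ses A Y B a b ==> A \<in> \<A> ==> B \<in> \<B> ==> sret X Y ==> X \<in> ext \<A> \<B>"
 unfolding ext_def by blast

lemma ses_extI: "ses A Y B a b ==> A \<in> \<A> ==> B \<in> \<B> ==> Y \<in> ext \<A> \<B>"
 by (rule extI[OF _ _ _ sret_refl]) (auto dest: sesD)

lemma extE:
 assumes "X \<in> ext \<A> \<B>"
 obtains Y A B a b where "A \<in> \<A>" "B \<in> \<B>" "ses A Y B a b" "sret X Y"
 using assms unfolding ext_def by blast

lemma split_dsum:
 assumes s: "ses A E B a b" and "split_ses E B b"
 shows "\<exists>j p. dsum A B E a j p b"
proof -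
 note d = sesD[OF s]
 obtain r q where r: "hom E A r" "hom B E q" "!!x. x \<in> carrier A ==> r (a x) = x"
  "!!y. y \<in> carrier B ==> b (q y) = y" "!!y. y \<in> carrier B ==> r (q y) = \<zero>[A]"
  "!!x. x \<in> carrier E ==> a (r x) \<oplus>[E] q (b x) = x"
  using split_decomposition[OF s assms(2)] by blast
 show ?thesis by (rule exI[of _ q], rule exI[of _ r]) (use d r in \<open>simp add: dsum_def\<close>)
qed

lemma trivial_pj:
 assumes B: "lm B" and z: "!!x. x \<in> carrier B ==> x = \<zero>[B]"
 shows "pj B"
 unfolding pj_def using sz_cong[OF sz_zero[OF lm_md[OF B] lm_md[OF B]], of "%x. x"] z B by simp

lemma ext_upper:
 assumes "good \<A>" "good \<B>" shows "\<A> \<subseteq> ext \<A> \<B>" "\<B> \<subseteq> ext \<A> \<B>"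
proof -
 show "\<A> \<subseteq> ext \<A> \<B>"
 proof
  fix X assume X: "X \<in> \<A>"
  note l = goodD(1)[OF assms(1) X]
  obtain B b where s: "ses X X B (%x. x) b" using cokernel_ses[OF l l mhom_id] by (auto simp: inj_on_def)
  have "pj B"
  proof (rule trivial_pj[OF sesD(3)[OF s]])
   fix y assume "y \<in> carrier B"
   then obtain x where "x \<in> carrier X" "b x = y" using sesD(13)[OF s] by blast
   thus "y = \<zero>[B]" using sesD(10)[OF s] by auto
  qed
  thus "X \<in> ext \<A> \<B>" using ses_extI[OF s X goodD(3)[OF assms(2)]] by blast
 qed
 show "\<B> \<subseteq> ext \<A> \<B>"
 proof
  fix X assume X: "X \<in> \<B>"
  note l = goodD(1)[OF assms(2) X]
  let ?K = "X\<lparr>carrier := {x \<in> carrier X. x = \<zero>[X]}\<rparr>"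
  have s: "ses ?K X X (%x. x) (%x. x)" using kernel_ses[OF l l mhom_id] by simp
  have "pj ?K" by (rule trivial_pj[OF sesD(1)[OF s]]) auto
  thus "X \<in> ext \<A> \<B>" using ses_extI[OF s goodD(3)[OF assms(1)] X] by blast
 qed
qed

text \<open>An extension whose quotient is itself an extension is filtered in three steps; taking the
  preimage of the submodule of the quotient regroups the filtration.\<close>

lemma ext_assoc1: "ext \<A> (ext \<B> \<C>) \<subseteq> ext (ext \<A> \<B>) \<C>"
proof
 fix X assume "X \<in> ext \<A> (ext \<B> \<C>)"
 then obtain E A D a q where 1: "A \<in> \<A>" "D \<in> ext \<B> \<C>" "ses A E D a q" "sret X E" by (rule extE)
 from 1(2) obtain D' B C b p where 2: "B \<in> \<B>" "C \<in> \<C>" "ses B D' C b p" "sret D D'" by (rule extE)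
 obtain i r where r: "hom D D' i" "hom D' D r" "st D D (%x. r (i x)) (%x. x)" using 2(4) by (auto simp: sret_def)
 note lD' = sesD(2)[OF 2(3)]
 obtain V a' b' e where V: "ses A V D' a' b'" "hom V E e" "!!v. v \<in> carrier V ==> q (e v) = r (b' v)"
  "!!x. x \<in> carrier A ==> e (a' x) = a x"
  "pullback_property E D' q r V e b'"
  using pullback[OF 1(3) lD' r(2)] by blast
 have EV: "sret E V" by (rule pullback_sret[OF 1(3) lD' r(2) r(1,3) sesD(2)[OF V(1)] V(2,5)])
 obtain F c f a'' where F: "ses F V C c (%x. p (b' x))" "ses A F B a'' f"
  by (rule ses_preimage[OF V(1) 2(3)]) (rule that)
 show "X \<in> ext (ext \<A> \<B>) \<C>"
  by (rule extI[OF F(1) ses_extI[OF F(2) 1(1) 2(1)] 2(2) sret_trans[OF 1(4) EV]])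
qed

lemma ext_assoc2: "ext (ext \<A> \<B>) \<C> \<subseteq> ext \<A> (ext \<B> \<C>)"
proof
 fix X assume "X \<in> ext (ext \<A> \<B>) \<C>"
 then obtain E D C d c where 1: "D \<in> ext \<A> \<B>" "C \<in> \<C>" "ses D E C d c" "sret X E" by (rule extE)
 from 1(1) obtain D' A B a b where 2: "A \<in> \<A>" "B \<in> \<B>" "ses A D' B a b" "sret D D'" by (rule extE)
 obtain i r where r: "hom D D' i" "hom D' D r" "st D D (%x. r (i x)) (%x. x)" using 2(4) by (auto simp: sret_def)
 note lD' = sesD(2)[OF 2(3)]
 obtain V a' b' e where V: "ses D' V C a' b'" "hom E V e" "!!v. v \<in> carrier E ==> b' (e v) = c v"
  "!!x. x \<in> carrier D ==> e (d x) = a' (i x)"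
  "pushout_property D E D' d i V e a'"
  using pushout[OF 1(3) lD' r(1)] by blast
 have EV: "sret E V" by (rule pushout_sret[OF 1(3) lD' r(1) r(2,3) sesD(2)[OF V(1)] V(2,5)])
 obtain X' x y z where F: "ses A V X' (%\<alpha>. a' (a \<alpha>)) x" "ses B X' C y z"
  by (rule ses_quotient[OF V(1) 2(3)]) (rule that)
 show "X \<in> ext \<A> (ext \<B> \<C>)"
  by (rule extI[OF F(1) 2(1) ses_extI[OF F(2) 2(2) 1(2)] sret_trans[OF 1(4) EV]])
qed

lemma ext_assoc: "ext (ext \<A> \<B>) \<C> = ext \<A> (ext \<B> \<C>)"
 using ext_assoc1 ext_assoc2 by (rule equalityI[rotated])

text \<open>Two sequences with the same left end can be pushed out along each other, and dually.\<close>

lemma pushout_two_monos: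
 assumes s: "ses X Y Z a b" and t: "ses X E T i j"
 obtains V a' b' e h where "ses E V Z a' b'" "ses Y V T e h"
proof -
 note d = sesD[OF s] and f = sesD[OF t]
 obtain V a' b' e where V: "ses E V Z a' b'" "hom Y V e" "!!v. v \<in> carrier Y ==> b' (e v) = b v"
  "!!x. x \<in> carrier X ==> e (a x) = a' (i x)"
  "pushout_property X Y E a i V e a'"
  using pushout[OF s f(2,7)] by blast
 note v = sesD[OF V(1)]
 interpret V: left_module R V by (rule v(5))
 have "!!x. x \<in> carrier X ==> \<zero>[T] = j (i x)" using f(10) by simp
 from pushout_propertyD[OF V(5) f(6) mhom_const_zero[OF f(6)] f(8) this] obtain h where
  h: "hom V T h" "!!x. x \<in> carrier Y ==> h (e x) = \<zero>[T]" "!!x. x \<in> carrier E ==> h (a' x) = j x" by blast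
 have "ses Y V T e h"
  unfolding ses_def
 proof (intro conjI ballI impI d(2) v(2) f(3) V(2) h(1,2))
  show "inj_on e (carrier Y)"
  proof (rule inj_hom[OF d(5) v(5) V(2)])
   fix y assume y: "y \<in> carrier Y" "e y = \<zero>[V]"
   hence "b y = \<zero>[Z]" using V(3)[OF y(1)] mhom_zero[OF v(5,6,8)] by simp
   then obtain x where x: "x \<in> carrier X" "y = a x" using d(11) y(1) by blast
   hence "a' (i x) = a' \<zero>[E]" using V(4) y(2) mhom_zero[OF v(4,5,7)] by simp
   hence "i x = i \<zero>[X]" using inj_onD[OF v(9)] f(14)[OF x(1)] f(5) mhom_zero[OF f(4,5,7)] by simp
   hence "x = \<zero>[X]" using inj_onD[OF f(9)] x(1) f(4) by simp
   thus "y = \<zero>[Y]" using x(2) mhom_zero[OF d(4,5,7)] by simp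
  qed
 next
  fix w assume w: "w \<in> carrier V" "h w = \<zero>[T]"
  obtain y where y: "y \<in> carrier Y" "b y = b' w" using d(13) v(15)[OF w(1)] by blast
  have ey: "e y \<in> carrier V" using mhom_closed[OF V(2) y(1)] .
  have "b' (w \<ominus>[V] e y) = \<zero>[Z]" using w(1) ey y V(3)[OF y(1)] v(15)[OF w(1)]
   by (simp add: a_minus_def mhom_add[OF v(8)] mhom_minus[OF v(5,6,8)] abelian_group.r_neg[OF md_ab[OF v(6)]])
  then obtain z where z: "z \<in> carrier E" "w \<ominus>[V] e y = a' z" using v(11)[of "w \<ominus>[V] e y"] w(1) ey by auto
  hence w': "w = a' z \<oplus>[V] e y" using w(1) ey v(14)[OF z(1)] V.M.diff_eq_iff by blast
  hence "h w = j z" using h v(14)[OF z(1)] ey y z f(15) f(6)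
   by (simp add: mhom_add[OF h(1)] abelian_monoid.r_zero[OF abelian_group.axioms(1)[OF md_ab[OF f(6)]]])
  then obtain x where x: "x \<in> carrier X" "z = i x" using w(2) f(11) z(1) by auto
  have "w = e (a x \<oplus>[Y] y)" using w' x V(4) d(14) y(1) by (simp add: mhom_add[OF V(2)])
  thus "\<exists>y\<in>carrier Y. w = e y" using x(1) y(1) d(5,14) by blast
 next
  have "z \<in> h ` carrier V" if z: "z \<in> carrier T" for z
  proof -
   obtain x where "x \<in> carrier E" "j x = z" using f(13)[OF z] by blast
   thus ?thesis using h(3) v(14) by force
  qed
  thus "h ` carrier V = carrier T" using mhom_closed[OF h(1)] by blast
 qed
 from that[OF V(1) this] show thesis .
qed

lemma pullback_two_epis:
 assumes s: "ses X Y Z a b" and t: "ses T E Z i j"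
 obtains V a' b' e h where "ses X V E a' b'" "ses T V Y h e"
proof -
 note d = sesD[OF s] and f = sesD[OF t]
 obtain V a' b' e where V: "ses X V E a' b'" "hom V Y e" "!!v. v \<in> carrier V ==> b (e v) = j (b' v)"
  "!!x. x \<in> carrier X ==> e (a' x) = a x"
  "pullback_property Y E b j V e b'"
  using pullback[OF s f(2,8)] by blast
 note v = sesD[OF V(1)]
 interpret V: left_module R V by (rule v(5))
 have "!!x. x \<in> carrier T ==> b \<zero>[Y] = j (i x)" using f(10) mhom_zero[OF d(5,6,8)] by simp
 from pullback_propertyD[OF V(5) f(4) mhom_const_zero[OF d(5)] f(7) this] obtain h where
  h: "hom T V h" "!!x. x \<in> carrier T ==> e (h x) = \<zero>[Y]" "!!x. x \<in> carrier T ==> b' (h x) = i x" by blast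
 \<comment> \<open>an element of the pullback is determined by its two coordinates\<close>
 have zero: "w = \<zero>[V]" if w: "w \<in> carrier V" "e w = \<zero>[Y]" "b' w = \<zero>[E]" for w
 proof -
  obtain x where x: "x \<in> carrier X" "w = a' x" using v(11)[OF w(1,3)] by blast
  hence "a x = a \<zero>[X]" using V(4) w(2) mhom_zero[OF d(4,5,7)] by simp
  hence "x = \<zero>[X]" using inj_onD[OF d(9)] x(1) d(4) by simp
  thus ?thesis using x(2) mhom_zero[OF v(4,5,7)] by simp
 qed
 have "ses T V Y h e"
  unfolding ses_def
 proof (intro conjI ballI impI f(1) v(2) d(2) h(1,2) V(2))
  show "inj_on h (carrier T)"
   by (rule inj_onI) (metis h(3) f(9) inj_onD)
 next
  fix w assume w: "w \<in> carrier V" "e w = \<zero>[Y]"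
  have "j (b' w) = \<zero>[Z]" using V(3)[OF w(1)] w(2) mhom_zero[OF d(5,6,8)] by simp
  then obtain x where x: "x \<in> carrier T" "b' w = i x" using f(11) v(15)[OF w(1)] by blast
  have hx: "h x \<in> carrier V" using mhom_closed[OF h(1) x(1)] .
  have "w \<ominus>[V] h x = \<zero>[V]"
  proof (rule zero)
   show "w \<ominus>[V] h x \<in> carrier V" using w hx by simp
   show "e (w \<ominus>[V] h x) = \<zero>[Y]" using w hx h(2)[OF x(1)] d(5)
    by (simp add: a_minus_def mhom_add[OF V(2)] mhom_minus[OF v(5) d(5) V(2)] abelian_group.r_neg[OF md_ab[OF d(5)] md_zero[OF d(5)]])
   show "b' (w \<ominus>[V] h x) = \<zero>[E]" using w hx h(3)[OF x(1)] x f(14)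
    by (simp add: a_minus_def mhom_add[OF v(8)] mhom_minus[OF v(5,6,8)] abelian_group.r_neg[OF md_ab[OF v(6)]])
  qed
  thus "\<exists>y\<in>carrier T. w = h y" using x(1) w(1) hx V.M.diff_eq_zero_iff by blast
 next
  have "y \<in> e ` carrier V" if y: "y \<in> carrier Y" for y
  proof -
   obtain z where z: "z \<in> carrier E" "j z = b y" using f(13) d(15)[OF y] by blast
   obtain w where w: "w \<in> carrier V" "b' w = z" using v(13)[OF z(1)] by blast
   have ew: "e w \<in> carrier Y" using mhom_closed[OF V(2) w(1)] .
   have "b (y \<ominus>[Y] e w) = \<zero>[Z]" using y ew V(3)[OF w(1)] w(2) z(2) d(5) d(15)[OF y]
    by (simp add: a_minus_def mhom_add[OF d(8)] mhom_minus[OF d(5,6,8)] abelian_group.r_neg[OF md_ab[OF d(6)]])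
   then obtain x where x: "x \<in> carrier X" "y \<ominus>[Y] e w = a x" using d(11)[of "y \<ominus>[Y] e w"] y ew d(5) by auto
   hence "y = a x \<oplus>[Y] e w" using abelian_group.diff_eq_iff[OF md_ab[OF d(5)] y ew d(14)[OF x(1)]] by simp
   hence "y = e (a' x \<oplus>[V] w)" using V(4)[OF x(1)] v(14)[OF x(1)] w(1) by (simp add: mhom_add[OF V(2)])
   thus ?thesis using v(14)[OF x(1)] w(1) v(5) by blast
  qed
  thus "e ` carrier V = carrier Y" using mhom_closed[OF V(2)] by blast
 qed
 from that[OF V(1) this] show thesis .
qed

end

context kGU begin

lemma ext_suspension:
 assumes gA: "good \<A>" and gB: "good \<B>" and P: "pj P" and s: "ses X P S i q" and X: "X \<in> ext \<A> \<B>"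
 shows "S \<in> ext \<A> \<B>"
proof -
 obtain Y A B a b where Y: "A \<in> \<A>" "B \<in> \<B>" "ses A Y B a b" "sret X Y" using X by (rule extE)
 note d = sesD[OF Y(3)]
 obtain I SY j p where I: "pj I" "ses Y I SY j p" using enough_projectives(2)[OF d(2)] by blast
 have SS: "sret S SY" by (rule sret_suspension[OF s I(2) P I(1) Y(4)])
 obtain X1 x y z where q: "ses A I X1 (%\<alpha>. j (a \<alpha>)) x" "ses B X1 SY y z"
  by (rule ses_quotient[OF I(2) Y(3)]) (rule that)
 have X1: "X1 \<in> \<A>" by (rule goodD(4)[OF gA I(1) q(1) Y(1)])
 obtain J T k l where J: "pj J" "ses B J T k l" using enough_projectives(2)[OF d(3)] by blast
 have T: "T \<in> \<B>" by (rule goodD(4)[OF gB J Y(2)])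
 obtain V a' b' e h where V: "ses J V SY a' b'" "ses X1 V T e h" by (rule pushout_two_monos[OF q(2) J(2)])
 show ?thesis by (rule extI[OF V(2) X1 T sret_trans[OF SS sret_pj_left(2)[OF V(1) J(1)]]])
qed

lemma ext_desuspension:
 assumes gA: "good \<A>" and gB: "good \<B>" and P: "pj P" and s: "ses S P X i q" and X: "X \<in> ext \<A> \<B>"
 shows "S \<in> ext \<A> \<B>"
proof -
 obtain Y A B a b where Y: "A \<in> \<A>" "B \<in> \<B>" "ses A Y B a b" "sret X Y" using X by (rule extE)
 note d = sesD[OF Y(3)]
 obtain I SY j p where I: "pj I" "ses SY I Y j p" using enough_projectives(1)[OF d(2)] by blast
 have SS: "sret S SY" by (rule sret_desuspension[OF s I(2) P I(1) Y(4)])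
 obtain F c f a' where q: "ses F I B c (%x. b (p x))" "ses SY F A a' f"
  by (rule ses_preimage[OF I(2) Y(3)]) (rule that)
 have F: "F \<in> \<B>" by (rule goodD(5)[OF gB I(1) q(1) Y(2)])
 obtain J T k l where J: "pj J" "ses T J A k l" using enough_projectives(1)[OF d(1)] by blast
 have T: "T \<in> \<A>" by (rule goodD(5)[OF gA J Y(1)])
 obtain V a' b' e h where V: "ses SY V J a' b'" "ses T V F h e" by (rule pullback_two_epis[OF q(2) J(2)])
 show ?thesis by (rule extI[OF V(2) T F sret_trans[OF SS sret_pj_right(2)[OF V(1) J(1)]]])
qed

lemma dsum_map:
 assumes D: "dsum A B D i j p q" and D': "dsum A' B' D' i' j' p' q'" and f: "hom A A' f" and g: "hom B B' g"
 obtains h where "hom D D' h" "!!x. x \<in> carrier D ==> h x = i' (f (p x)) \<oplus>[D'] j' (g (q x))"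
  "!!x. x \<in> carrier A ==> h (i x) = i' (f x)" "!!x. x \<in> carrier B ==> h (j x) = j' (g x)"
  "!!x. x \<in> carrier D ==> p' (h x) = f (p x)" "!!x. x \<in> carrier D ==> q' (h x) = g (q x)"
proof -
 note d = dsumD[OF D] and e = dsumD[OF D']
 interpret A': left_module R A' by (rule e(4))
 interpret B': left_module R B' by (rule e(5))
 interpret D': left_module R D' by (rule e(6))
 define h where "h = (%x. i' (f (p x)) \<oplus>[D'] j' (g (q x)))"
 note fp = mhom_comp[OF d(9) f] and gq = mhom_comp[OF d(10) g]
 have h: "hom D D' h" unfolding h_def
  by (rule mhom_sum[OF e(6) mhom_comp[OF fp e(7)] mhom_comp[OF gq e(8)]])
 show thesis
 proof (rule that[OF h])
  fix x assume x: "x \<in> carrier D"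
  show "h x = i' (f (p x)) \<oplus>[D'] j' (g (q x))" by (simp add: h_def)
  show "p' (h x) = f (p x)" "q' (h x) = g (q x)"
   using mhom_closed[OF fp x] mhom_closed[OF gq x] e(11-14,16,17)
   by (simp_all add: h_def mhom_add[OF e(9)] mhom_add[OF e(10)])
 next
  fix x assume x: "x \<in> carrier A"
  show "h (i x) = i' (f x)"
   using x d(11,12)[OF x] mhom_closed[OF f x] mhom_zero[OF d(5) e(5) g] mhom_zero[OF e(5,6,8)] e(16) by (simp add: h_def)
 next
  fix x assume x: "x \<in> carrier B"
  show "h (j x) = j' (g x)"
   using x d(13,14)[OF x] mhom_closed[OF g x] mhom_zero[OF d(4) e(4) f] mhom_zero[OF e(4,6,7)] e(17) by (simp add: h_def)
 qed
qed

lemma dsum_sret: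
 assumes D: "dsum A B D i j p q" and D': "dsum A' B' D' i' j' p' q'" and A: "sret A A'" and B: "sret B B'"
 shows "sret D D'"
proof -
 note d = dsumD[OF D] and e = dsumD[OF D']
 interpret D: left_module R D by (rule d(6))
 obtain f r where f: "hom A A' f" "hom A' A r" "st A A (%x. r (f x)) (%x. x)" using A by (auto simp: sret_def)
 obtain g s where g: "hom B B' g" "hom B' B s" "st B B (%x. s (g x)) (%x. x)" using B by (auto simp: sret_def)
 obtain h where h: "hom D D' h" "!!x. x \<in> carrier D ==> p' (h x) = f (p x)" "!!x. x \<in> carrier D ==> q' (h x) = g (q x)"
  by (rule dsum_map[OF D D' f(1) g(1)]) (rule that)
 obtain k where k: "hom D' D k" "!!x. x \<in> carrier D' ==> k x = i (r (p' x)) \<oplus>[D] j (s (q' x))"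
  by (rule dsum_map[OF D' D f(2) g(2)]) (rule that)
 note rf = mhom_comp[OF f(1,2)] and sg = mhom_comp[OF g(1,2)]
 have s1: "st D D (%x. i (r (f (p x)))) (%x. i (p x))"
  by (rule st_pre[OF d(6,4,6,9) st_post[OF d(4,4,6) mhom_id f(3) d(7)]])
 have s2: "st D D (%x. j (s (g (q x)))) (%x. j (q x))"
  by (rule st_pre[OF d(6,5,6,10) st_post[OF d(5,5,6) mhom_id g(3) d(8)]])
 have "st D D (%x. k (h x)) (%x. x)"
  by (rule st_cong[OF st_add[OF d(6,6) mhom_comp[OF d(9,7)] mhom_comp[OF d(10,8)] s1 s2]])
   (simp_all add: k(2) h(2,3) mhom_closed[OF h(1)] d(15))
 thus ?thesis by (rule sretI[OF d(3) e(3) h(1) k(1)])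
qed

lemma dsum_ses:
 assumes s: "ses A1 Y1 B1 a1 b1" and t: "ses A2 Y2 B2 a2 b2"
  and A: "dsum A1 A2 A iA jA pA qA" and Y: "dsum Y1 Y2 Y iY jY pY qY" and B: "dsum B1 B2 B iB jB pB qB"
 obtains a b where "ses A Y B a b"
proof -
 note d = sesD[OF s] and e = sesD[OF t] and dA = dsumD[OF A] and dY = dsumD[OF Y] and dB = dsumD[OF B]
 obtain a where a: "hom A Y a" "!!x. x \<in> carrier A ==> a x = iY (a1 (pA x)) \<oplus>[Y] jY (a2 (qA x))"
  "!!x. x \<in> carrier A ==> pY (a x) = a1 (pA x)" "!!x. x \<in> carrier A ==> qY (a x) = a2 (qA x)"
  by (rule dsum_map[OF A Y d(7) e(7)]) (rule that)
 obtain b where b: "hom Y B b" "!!x. x \<in> carrier Y ==> b x = iB (b1 (pY x)) \<oplus>[B] jB (b2 (qY x))"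
  "!!x. x \<in> carrier Y ==> pB (b x) = b1 (pY x)" "!!x. x \<in> carrier Y ==> qB (b x) = b2 (qY x)"
  by (rule dsum_map[OF Y B d(8) e(8)]) (rule that)
 interpret A: left_module R A by (rule dA(6))
 interpret B: left_module R B by (rule dB(6))
 have "ses A Y B a b"
  unfolding ses_def
 proof (intro conjI ballI impI dA(3) dY(3) dB(3) a(1) b(1))
  show "inj_on a (carrier A)"
  proof (rule inj_onI)
   fix x y assume xy: "x \<in> carrier A" "y \<in> carrier A" "a x = a y"
   have "a1 (pA x) = a1 (pA y)" "a2 (qA x) = a2 (qA y)" using xy(3) a(3,4) xy(1,2) by metis+
   hence "pA x = pA y" "qA x = qA y" using d(9) e(9) dA(18,19) xy(1,2) by (auto dest: inj_onD)
   thus "x = y" using dA(15)[OF xy(1)] dA(15)[OF xy(2)] by metis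
  qed
 next
  fix x assume x: "x \<in> carrier A"
  have "b (a x) = iB \<zero>[B1] \<oplus>[B] jB \<zero>[B2]"
   using b(2)[OF mhom_closed[OF a(1) x]] a(3,4)[OF x] d(10) e(10) dA(18,19)[OF x] by simp
  thus "b (a x) = \<zero>[B]" using mhom_zero[OF d(6) dB(6,7)] mhom_zero[OF e(6) dB(6,8)] by simp
 next
  fix y assume y: "y \<in> carrier Y" "b y = \<zero>[B]"
  have "b1 (pY y) = \<zero>[B1]" "b2 (qY y) = \<zero>[B2]"
   using b(3,4)[OF y(1)] y(2) mhom_zero[OF dB(6) d(6) dB(9)] mhom_zero[OF dB(6) e(6) dB(10)] by simp_all
  then obtain u v where uv: "u \<in> carrier A1" "pY y = a1 u" "v \<in> carrier A2" "qY y = a2 v"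
   using d(11) e(11) dY(18,19)[OF y(1)] by blast
  let ?w = "iA u \<oplus>[A] jA v"
  have w: "?w \<in> carrier A" using uv dA(16,17) by simp
  have pw: "pA ?w = u" "qA ?w = v" using uv dA(11-14,16,17) d(4) e(4)
   by (simp_all add: mhom_add[OF dA(9)] mhom_add[OF dA(10)]
    abelian_monoid.r_zero[OF abelian_group.axioms(1)[OF md_ab[OF d(4)]]]
    abelian_monoid.l_zero[OF abelian_group.axioms(1)[OF md_ab[OF e(4)]]])
  have "a ?w = y" using a(2)[OF w] pw uv dY(15)[OF y(1)] by simp
  thus "\<exists>x\<in>carrier A. y = a x" using w by blast
 next
  have "z \<in> b ` carrier Y" if z: "z \<in> carrier B" for z
  proof -
   obtain u v where uv: "u \<in> carrier Y1" "b1 u = pB z" "v \<in> carrier Y2" "b2 v = qB z"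
    using d(13)[OF dB(18)[OF z]] e(13)[OF dB(19)[OF z]] by blast
   let ?w = "iY u \<oplus>[Y] jY v"
   have w: "?w \<in> carrier Y" using uv dY(16,17) dY(6) by simp
   have pw: "pY ?w = u" "qY ?w = v" using uv dY(11-14,16,17) d(5) e(5)
    by (simp_all add: mhom_add[OF dY(9)] mhom_add[OF dY(10)]
     abelian_monoid.r_zero[OF abelian_group.axioms(1)[OF md_ab[OF d(5)]]]
     abelian_monoid.l_zero[OF abelian_group.axioms(1)[OF md_ab[OF e(5)]]])
   have "b ?w = z" using b(2)[OF w] pw uv dB(15)[OF z] by simp
   thus ?thesis using w by blast
  qed
  thus "b ` carrier Y = carrier B" using mhom_closed[OF b(1)] by blast
 qed
 thus thesis by (rule that)
qed

lemma ext_good: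
 assumes gA: "good \<A>" and gB: "good \<B>" shows "good (ext \<A> \<B>)"
 unfolding good_def
proof (intro conjI allI impI ballI)
 fix X assume "X \<in> ext \<A> \<B>" thus "lm X" by (auto simp: ext_def sret_def)
next
 fix X Y assume "Y \<in> ext \<A> \<B> & sret X Y"
 thus "X \<in> ext \<A> \<B>" unfolding ext_def using sret_trans by blast
next
 fix P assume "pj P" thus "P \<in> ext \<A> \<B>" using ext_upper(1)[OF gA gB] goodD(3)[OF gA] by blast
next
 fix X P S i q assume "pj P & ses X P S i q"
 thus "X \<in> ext \<A> \<B> \<longleftrightarrow> S \<in> ext \<A> \<B>"
  using ext_suspension[OF gA gB, of P X S i q] ext_desuspension[OF gA gB, of P X S i q] by blast
next
 fix X1 X2 D i j p q assume a: "dsum X1 X2 D i j p q & X1 \<in> ext \<A> \<B> & X2 \<in> ext \<A> \<B>"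
 from a obtain Y1 A1 B1 a1 b1 where 1: "A1 \<in> \<A>" "B1 \<in> \<B>" "ses A1 Y1 B1 a1 b1" "sret X1 Y1" by (blast elim: extE)
 from a obtain Y2 A2 B2 a2 b2 where 2: "A2 \<in> \<A>" "B2 \<in> \<B>" "ses A2 Y2 B2 a2 b2" "sret X2 Y2" by (blast elim: extE)
 note d = sesD[OF 1(3)] and e = sesD[OF 2(3)]
 obtain A iA jA pA qA where A: "dsum A1 A2 A iA jA pA qA" using dsum_exists[OF d(1) e(1)] by blast
 obtain Y iY jY pY qY where Y: "dsum Y1 Y2 Y iY jY pY qY" using dsum_exists[OF d(2) e(2)] by blast
 obtain B iB jB pB qB where B: "dsum B1 B2 B iB jB pB qB" using dsum_exists[OF d(3) e(3)] by blast
 obtain a' b' where s: "ses A Y B a' b'" by (rule dsum_ses[OF 1(3) 2(3) A Y B])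
 have "sret D Y" using dsum_sret[OF _ Y 1(4) 2(4)] a by blast
 thus "D \<in> ext \<A> \<B>" by (rule extI[OF s goodD(6)[OF gA A 1(1) 2(1)] goodD(6)[OF gB B 1(2) 2(2)]])
qed

section \<open>Levels\<close>

text \<open>Level one comes out as \<open>\<P>\<close> itself, up to stable retracts, so these agree with the levels
  defined by triangles.\<close>

fun lev :: "('g => 'k, 'u) module set => nat => ('g => 'k, 'u) module set" where
 "lev \<P> 0 = {X. pj X}"
| "lev \<P> (Suc n) = ext \<P> (lev \<P> n)"

lemma good_pj: "good {X. pj X}"
proof -
 have 1: "X \<in> {X. pj X} \<longleftrightarrow> S \<in> {X. pj X}" if "pj P" "ses X P S i q" for X P S i q
  using pj_sret[OF that(1)] sret_pj_left(2)[OF that(2)] sret_pj_right(2)[OF that(2)] by auto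
 have 2: "D \<in> {X. pj X}" if D: "dsum A B D i j p q" and pA: "pj A" and pB: "pj B" for A B D i j p q
 proof -
  note d = dsumD[OF D]
  have "sz D D (%x. i (p x) \<oplus>[D] j (q x))"
   by (rule sz_sum[OF d(6,6) sz_through_pj[OF pA d(6,6,9,7)] sz_through_pj[OF pB d(6,6,10,8)]])
  hence "sz D D (%x. x)" by (rule sz_cong) (simp add: d(15))
  thus "D \<in> {X. pj X}" using d(3) by (simp add: pj_def)
 qed
 show ?thesis unfolding good_def using 1 2 pj_lm pj_sret by blast
qed

lemma ext_pj:
 assumes "good \<P>" shows "ext \<P> {X. pj X} = \<P>" "ext {X. pj X} \<P> = \<P>"
proof -
 have "ext \<P> {X. pj X} \<subseteq> \<P>"
 proof
  fix X assume "X \<in> ext \<P> {X. pj X}"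
  then obtain Y A B a b where "A \<in> \<P>" "pj B" "ses A Y B a b" "sret X Y" by (auto elim: extE)
  thus "X \<in> \<P>" using goodD(2)[OF assms] sret_trans sret_pj_right(1) by blast
 qed
 thus "ext \<P> {X. pj X} = \<P>" using ext_upper(1)[OF assms good_pj] by blast
 have "ext {X. pj X} \<P> \<subseteq> \<P>"
 proof
  fix X assume "X \<in> ext {X. pj X} \<P>"
  then obtain Y A B a b where "pj A" "B \<in> \<P>" "ses A Y B a b" "sret X Y" by (auto elim: extE)
  thus "X \<in> \<P>" using goodD(2)[OF assms] sret_trans sret_pj_left(1) by blast
 qed
 thus "ext {X. pj X} \<P> = \<P>" using ext_upper(2)[OF good_pj assms] by blast
qed

lemma lev_good: "good \<P> ==> good (lev \<P> n)"
 by (induction n) (simp_all add: good_pj ext_good)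

lemma lev_Suc_mono: "good \<P> ==> lev \<P> n \<subseteq> lev \<P> (Suc n)"
 using ext_upper(2)[OF _ lev_good] by simp

lemma lev_mono: "good \<P> ==> m \<le> n ==> lev \<P> m \<subseteq> lev \<P> n"
 by (rule lift_Suc_mono_le[where f = "lev \<P>", OF lev_Suc_mono])

lemma lev_Suc': "good \<P> ==> lev \<P> (Suc n) = ext (lev \<P> n) \<P>"
proof (induction n)
 case 0 thus ?case using ext_pj by simp
next
 case (Suc n)
 have "lev \<P> (Suc (Suc n)) = ext \<P> (ext (lev \<P> n) \<P>)" using Suc by simp
 also have "... = ext (lev \<P> (Suc n)) \<P>" by (simp add: ext_assoc)
 finally show ?case .
qed

end

context kGU begin

text \<open>Over \<open>F\<close> the sequence splits, so the preimage of \<open>F\<close> in \<open>W\<close> is a sum of \<open>M\<close> and \<open>F\<close>; only \<open>Q\<close> is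
  added on top of it.\<close>

lemma middle_in_ext_if_liftable:
 assumes gC: "good \<C>" and s: "ses M W E a b" and t: "ses F E Q i q"
  and l: "hom F W l" "!!x. x \<in> carrier F ==> b (l x) = i x" and M: "M \<in> \<C>" and F: "F \<in> \<C>" and Q: "Q \<in> \<Q>"
 shows "W \<in> ext \<C> \<Q>"
proof -
 note d = sesD[OF s] and e = sesD[OF t]
 obtain K' c f a' where K': "ses K' W Q c (%x. q (b x))" "ses M K' F a' f" "!!y. y \<in> carrier K' ==> i (f y) = b (c y)"
  by (rule ses_preimage[OF s t]) (rule that, blast+)
 note k = sesD[OF K'(1)] and m = sesD[OF K'(2)]
 have "q (b (l x)) = \<zero>[Q]" if "x \<in> carrier F" for x using l(2)[OF that] e(10)[OF that] by simp
 from ses_in[OF K'(1) e(4) l(1) this] obtain s' where s': "hom F K' s'" "!!x. x \<in> carrier F ==> c (s' x) = l x" by blast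
 have "f (s' y) = y" if y: "y \<in> carrier F" for y
 proof (rule inj_onD[OF e(9)])
  show "i (f (s' y)) = i y" using K'(3)[OF mhom_closed[OF s'(1) y]] s'(2)[OF y] l(2)[OF y] by simp
 qed (use y mhom_closed[OF s'(1) y] m(15) in auto)
 hence "split_ses K' F f" using s'(1) by (auto simp: split_ses_def)
 then obtain j p where "dsum M F K' a' j p f" using split_dsum[OF K'(2)] by blast
 hence "K' \<in> \<C>" by (rule goodD(6)[OF gC _ M F])
 thus ?thesis using ses_extI[OF K'(1) _ Q] by blast
qed

text \<open>Write \<open>X\<close> as a stable retract of an extension of a layer in \<open>\<P>\<close> by a module of level one less. If the
  sequence splits over that module, the middle term has one layer on top of a sum of modules of level
  \<open>m\<close>, hence level \<open>m + 1\<close>. Otherwise restrict the sequence to that module and repeat.\<close>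

lemma factorization_through_higher_level_out:
 assumes gP: "good \<P>" and M: "M \<in> lev \<P> m" and dm: "d \<le> m" and X: "X \<in> lev \<P> d"
  and s: "ses M W X a b" and ns: "~ split_ses W X b" and nu: "hom W N \<nu>"
 shows "\<exists>W' \<mu> \<nu>'. W' \<in> lev \<P> (Suc m) & hom M W' \<mu> & hom W' N \<nu>' & (\<forall>x\<in>carrier M. \<nu>' (\<mu> x) = \<nu> (a x)) &
  ~ (\<exists>r. hom W' M r & st M M (%x. r (\<mu> x)) (%x. x))"
 using dm X s ns nu
proof (induction d arbitrary: X W a b \<nu>)
 case 0
 thus ?case using split_if_pj_right[OF 0(3)] by simp
next
 case (Suc d)
 have "X \<in> ext (lev \<P> d) \<P>" using Suc.prems(2) lev_Suc'[OF gP] by simp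
 then obtain E F Q i q where E: "F \<in> lev \<P> d" "Q \<in> \<P>" "ses F E Q i q" "sret X E" by (rule extE)
 obtain j r where r: "hom X E j" "hom E X r" "st X X (%x. r (j x)) (%x. x)" using E(4) by (auto simp: sret_def)
 note s = Suc.prems(3) and d = sesD[OF Suc.prems(3)] and e = sesD[OF E(3)]
 obtain V a' b' h where V: "ses M V E a' b'" "hom V W h" "!!v. v \<in> carrier V ==> b (h v) = r (b' v)"
  "!!x. x \<in> carrier M ==> h (a' x) = a x" "pullback_property W E b r V h b'"
  using pullback[OF s e(2) r(2)] by blast
 note v = sesD[OF V(1)]
 have nsV: "~ split_ses V E b'"
 proof
  assume "split_ses V E b'"
  then obtain t where t: "hom E V t" "!!y. y \<in> carrier E ==> b' (t y) = y" by (auto simp: split_ses_def)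
  have "hom X W (%x. h (t (j x)))" by (rule mhom_comp[OF mhom_comp[OF r(1) t(1)] V(2)])
  moreover have "st X X (%x. b (h (t (j x)))) (%x. x)"
   by (rule st_cong[OF r(3)]) (use V(3) t mhom_closed[OF r(1)] mhom_closed[OF t(1)] in auto)
  ultimately have "split_ses W X b" by (rule split_if_stable_section[OF s])
  thus False using Suc.prems(4) by simp
 qed
 have nuV: "hom V N (%x. \<nu> (h x))" by (rule mhom_comp[OF V(2) Suc.prems(5)])
 obtain K' c f a'' where K': "ses K' V Q c (%x. q (b' x))" "ses M K' F a'' f"
  "!!x. x \<in> carrier M ==> c (a'' x) = a' x" "!!y. y \<in> carrier K' ==> i (f y) = b' (c y)"
  using ses_preimage[OF V(1) E(3)] by metis
 note k = sesD[OF K'(1)]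
 show ?case
 proof (cases "split_ses K' F f")
  case True
  then obtain t where t: "hom F K' t" "!!y. y \<in> carrier F ==> f (t y) = y" by (auto simp: split_ses_def)
  have "b' (c (t x)) = i x" if x: "x \<in> carrier F" for x
   using K'(4)[OF mhom_closed[OF t(1) x]] t(2)[OF x] by simp
  hence "V \<in> ext (lev \<P> m) \<P>"
   using middle_in_ext_if_liftable[OF lev_good[OF gP] V(1) E(3) mhom_comp[OF t(1) k(7)] _ M _ E(2)]
    E(1) lev_mono[OF gP, of d m] Suc.prems(1) by auto
  hence "V \<in> lev \<P> (Suc m)" using lev_Suc'[OF gP] by simp
  moreover have "~ (\<exists>r. hom V M r & st M M (%x. r (a' x)) (%x. x))"
   using not_split_no_retraction[OF V(1) nsV] by blast
  ultimately show ?thesis using v(7) nuV V(4)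
   by (intro exI[of _ V] exI[of _ a'] exI[of _ "%x. \<nu> (h x)"]) simp
 next
  case False
  have nuK: "hom K' N (%x. \<nu> (h (c x)))" by (rule mhom_comp[OF k(7) nuV])
  have "d \<le> m" using Suc.prems(1) by simp
  from Suc.IH[OF this E(1) K'(2) False nuK] show ?thesis using K'(3) V(4) by auto
 qed
qed

lemma factorization_through_higher_level_in:
 assumes gP: "good \<P>" and N: "N \<in> lev \<P> n" and dn: "d \<le> n" and X: "X \<in> lev \<P> d"
  and s: "ses X W N a b" and ns: "~ split_ses W N b" and mu: "hom M W \<mu>" and mM: "md M"
 shows "\<exists>W' \<mu>' \<nu>. W' \<in> lev \<P> (Suc n) & hom M W' \<mu>' & hom W' N \<nu> & (\<forall>x\<in>carrier M. \<nu> (\<mu>' x) = b (\<mu> x)) &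
  ~ (\<exists>s. hom N W' s & st N N (%x. \<nu> (s x)) (%x. x))"
 using dn X s ns mu
proof (induction d arbitrary: X W a b \<mu>)
 case 0
 thus ?case using split_if_pj_left[OF 0(3)] by simp
next
 case (Suc d)
 have "X \<in> ext \<P> (lev \<P> d)" using Suc.prems(2) by simp
 then obtain E A Q c q where E: "A \<in> \<P>" "Q \<in> lev \<P> d" "ses A E Q c q" "sret X E" by (rule extE)
 obtain i r where r: "hom X E i" "hom E X r" "st X X (%x. r (i x)) (%x. x)" using E(4) by (auto simp: sret_def)
 note s = Suc.prems(3) and d = sesD[OF Suc.prems(3)] and e = sesD[OF E(3)]
 obtain V a' b' h where V: "ses E V N a' b'" "hom W V h" "!!v. v \<in> carrier W ==> b' (h v) = b v"
  "!!x. x \<in> carrier X ==> h (a x) = a' (i x)" "pushout_property X W E a i V h a'"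
  using pushout[OF s e(2) r(1)] by blast
 note v = sesD[OF V(1)]
 have nsV: "~ split_ses V N b'"
 proof
  assume "split_ses V N b'"
  then obtain \<rho> where t: "hom V E \<rho>" "!!y. y \<in> carrier E ==> \<rho> (a' y) = y"
   using split_decomposition[OF V(1)] by metis
  have "hom W X (%x. r (\<rho> (h x)))" by (rule mhom_comp[OF mhom_comp[OF V(2) t(1)] r(2)])
  moreover have "st X X (%x. r (\<rho> (h (a x)))) (%x. x)"
   by (rule st_cong[OF r(3)]) (use V(4) t mhom_closed[OF r(1)] in auto)
  ultimately have "split_ses W N b" by (rule split_if_stable_retraction[OF s])
  thus False using Suc.prems(4) by simp
 qed
 have muV: "hom M V (%x. h (\<mu> x))" by (rule mhom_comp[OF Suc.prems(5) V(2)])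
 obtain X' x y z where X': "ses A V X' (%\<alpha>. a' (c \<alpha>)) x" "ses Q X' N y z"
  "!!e. e \<in> carrier V ==> z (x e) = b' e"
  using ses_quotient[OF V(1) E(3)] by metis
 note k = sesD[OF X'(1)]
 show ?case
 proof (cases "split_ses X' N z")
  case True
  then obtain j p where D: "dsum Q N X' y j p z" using split_dsum[OF X'(2)] by blast
  have "Q \<in> lev \<P> n" using E(2) lev_mono[OF gP, of d n] Suc.prems(1) by auto
  hence "X' \<in> lev \<P> n" by (rule goodD(6)[OF lev_good[OF gP] D _ N])
  hence "V \<in> lev \<P> (Suc n)" using ses_extI[OF X'(1) E(1)] by simp
  moreover have "~ (\<exists>s. hom N V s & st N N (%x. b' (s x)) (%x. x))"
   using split_if_stable_section[OF V(1)] nsV by blast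
  ultimately show ?thesis using v(8) muV V(3) mhom_closed[OF Suc.prems(5)]
   by (intro exI[of _ V] exI[of _ "%x. h (\<mu> x)"] exI[of _ b']) simp
 next
  case False
  have muX: "hom M X' (%w. x (h (\<mu> w)))" by (rule mhom_comp[OF muV k(8)])
  have "d \<le> n" using Suc.prems(1) by simp
  from Suc.IH[OF this E(2) X'(2) False muX] show ?thesis
   using X'(3) V(3) mhom_closed[OF Suc.prems(5)] mhom_closed[OF muV] by auto
 qed
qed

text \<open>Write \<open>Z\<close> as a stable retract of an extension with a sub of lower level. As \<open>Z\<close> is not of that lower level,
  the sub does not map split epically to \<open>Z\<close>, so it lifts to the middle term.\<close>

lemma almost_split_middle_level:
 assumes gP: "good \<P>" and s: "ses X Y Z a b" and X: "X \<in> lev \<P> (Suc k)" and Z: "Z \<in> lev \<P> (Suc k)" and Zk: "Z \<notin> lev \<P> k"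
  and lift: "!!T t. lm T ==> hom T Z t ==> ~ (\<exists>s. hom Z T s & st Z Z (%x. t (s x)) (%x. x)) ==>
   \<exists>h. hom T Y h & (\<forall>x\<in>carrier T. b (h x) = t x)"
 shows "Y \<in> lev \<P> (Suc (Suc k))"
proof -
 note d = sesD[OF s]
 have "Z \<in> ext (lev \<P> k) \<P>" using Z lev_Suc'[OF gP] by simp
 then obtain E F Q i q where E: "F \<in> lev \<P> k" "Q \<in> \<P>" "ses F E Q i q" "sret Z E" by (rule extE)
 obtain j r where r: "hom Z E j" "hom E Z r" "st Z Z (%x. r (j x)) (%x. x)" using E(4) by (auto simp: sret_def)
 note e = sesD[OF E(3)]
 obtain V a' b' h where V: "ses X V E a' b'" "hom V Y h" "!!v. v \<in> carrier V ==> b (h v) = r (b' v)"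
  "!!x. x \<in> carrier X ==> h (a' x) = a x" "pullback_property Y E b r V h b'"
  using pullback[OF s e(2) r(2)] by blast
 note v = sesD[OF V(1)]
 have YV: "sret Y V" by (rule pullback_sret[OF s e(2) r(2,1,3) v(2) V(2,5)])
 have ri: "hom F Z (%x. r (i x))" by (rule mhom_comp[OF e(7) r(2)])
 have "~ (\<exists>s. hom Z F s & st Z Z (%x. r (i (s x))) (%x. x))"
 proof
  assume "\<exists>s. hom Z F s & st Z Z (%x. r (i (s x))) (%x. x)"
  hence "sret Z F" using sretI[OF d(3) e(1) _ ri] by blast
  thus False using goodD(2)[OF lev_good[OF gP] E(1)] Zk by blast
 qed
 from lift[OF e(1) ri this] obtain l where l: "hom F Y l" "!!x. x \<in> carrier F ==> b (l x) = r (i x)" by blast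
 obtain l' where l': "hom F V l'" "!!x. x \<in> carrier F ==> b' (l' x) = i x"
  using V(5) e(4,7) l unfolding pullback_property_def by blast
 have "F \<in> lev \<P> (Suc k)" using E(1) lev_Suc_mono[OF gP] by blast
 from middle_in_ext_if_liftable[OF lev_good[OF gP] V(1) E(3) l' X this E(2)]
 have "V \<in> lev \<P> (Suc (Suc k))" using lev_Suc'[OF gP, of "Suc k"] by simp
 thus ?thesis using YV goodD(2)[OF lev_good[OF gP]] by blast
qed

end

section \<open>Finite dimensional modules and the trace form\<close>

lemma (in abelian_monoid) finsum_swap:
 assumes "finite A" "finite B" "!!x y. x \<in> A ==> y \<in> B ==> f x y \<in> carrier G"
 shows "finsum G (%x. finsum G (%y. f x y) B) A = finsum G (%y. finsum G (%x. f x y) A) B"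
 using assms(1,3)
proof (induction A rule: finite_induct)
 case empty
 show ?case by (simp add: finsum_zero)
next
 case (insert a A)
 have "finsum G (%x. finsum G (%y. f x y) B) (insert a A) =
   finsum G (%y. f a y) B \<oplus> finsum G (%x. finsum G (%y. f x y) B) A"
  using insert by (intro finsum_insert) (auto intro!: finsum_closed)
 also have "... = finsum G (%y. f a y) B \<oplus> finsum G (%y. finsum G (%x. f x y) A) B"
  using insert by simp
 also have "... = finsum G (%y. f a y \<oplus> finsum G (%x. f x y) A) B"
  using insert by (intro finsum_addf[symmetric]) (auto intro!: finsum_closed)
 also have "... = finsum G (%y. finsum G (%x. f x y) (insert a A)) B"
  using insert by (intro finsum_cong' refl) (auto intro!: finsum_closed finsum_insert[symmetric])
 finally show ?case .
qed

context kG begin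

lemma inv_image: "(%g. inv[G] g) ` carrier G = carrier G"
proof (intro equalityI subsetI)
 fix x assume "x \<in> carrier G"
 thus "x \<in> (%g. inv[G] g) ` carrier G" by (intro image_eqI[of _ _ "inv[G] x"]) simp_all
qed auto

lemma inj_inv: "inj_on (%g. inv[G] g) (carrier G)"
 by (rule inj_onI) (metis G.inv_inv)

lemma scal_md: "left_module K (scalars K)"
 by (rule left_module_scalars) unfold_locales

abbreviation functional :: "('g => 'k, 'a) module => ('a => 'k) => bool" where
 "functional Y l \<equiv> mhom K (vs Y) (scalars K) l"

lemma finsum_scalars: "finsum (scalars K) = finsum K"
 by (intro ext) (simp add: finsum_def finprod_def)

lemma functional_closed: "functional Y l ==> y \<in> carrier Y ==> l y \<in> carrier K"
 using mhom_closed[of K "vs Y" "scalars K"] by simp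

lemma functional_sm: "functional Y l ==> c \<in> carrier K ==> y \<in> carrier Y ==> l (sm Y c y) = c \<otimes>[K] l y"
 using mhom_smult[of K "vs Y" "scalars K"] by simp

lemma functional_finsum:
 assumes "md Y" "functional Y l" "f \<in> A \<rightarrow> carrier Y"
 shows "l (finsum Y f A) = finsum K (%i. l (f i)) A"
 using mhom_finsum[OF left_module_vs[OF assms(1)] scal_md assms(2), of f A] assms(3)
 by (simp add: finsum_scalars)

definition dbasis :: "('g => 'k, 'a) module => 'a set => ('a => 'a => 'k) => bool" where
 "dbasis Y E \<epsilon> \<longleftrightarrow> finite E & E \<subseteq> carrier Y & (\<forall>e\<in>E. functional Y (\<epsilon> e)) &
   (\<forall>y\<in>carrier Y. y = finsum Y (%e. sm Y (\<epsilon> e y) e) E)"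

lemma dbasisD:
 assumes "dbasis Y E \<epsilon>"
 shows "finite E" "!!e. e \<in> E ==> e \<in> carrier Y" "!!e. e \<in> E ==> functional Y (\<epsilon> e)"
  "!!y. y \<in> carrier Y ==> finsum Y (%e. sm Y (\<epsilon> e y) e) E = y"
  "!!e y. e \<in> E ==> y \<in> carrier Y ==> \<epsilon> e y \<in> carrier K"
proof -
 show "finite E" "!!e. e \<in> E ==> e \<in> carrier Y" "!!e. e \<in> E ==> functional Y (\<epsilon> e)"
  using assms by (auto simp: dbasis_def)
 thus "!!e y. e \<in> E ==> y \<in> carrier Y ==> \<epsilon> e y \<in> carrier K" by (auto intro: functional_closed)
 show "!!y. y \<in> carrier Y ==> finsum Y (%e. sm Y (\<epsilon> e y) e) E = y" using assms unfolding dbasis_def by metis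
qed

definition fd :: "('g => 'k, 'a) module => bool" where
 "fd Y \<longleftrightarrow> (\<exists>E. finite E & E \<subseteq> carrier Y & (\<forall>U. subsp K (vs Y) U & E \<subseteq> U --> U = carrier Y))"

lemma partial_dual_basis:
 assumes Y: "md Y" and "finite E" "E \<subseteq> carrier Y"
 shows "\<exists>U \<epsilon>. subsp K (vs Y) U & E \<subseteq> U & (\<forall>e\<in>E. functional Y (\<epsilon> e)) &
   (\<forall>y\<in>U. y = finsum Y (%e. sm Y (\<epsilon> e y) e) E)"
 using assms(2,3)
proof (induction E rule: finite_induct)
 case empty
 interpret V: left_module K "vs Y" by (rule left_module_vs[OF Y])
 interpret Y: left_module R Y by (rule Y)
 show ?case using Y by (intro exI[of _ "{\<zero>[Y]}"]) (auto simp: subsp_def)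
next
 case (insert e E)
 interpret V: left_module K "vs Y" by (rule left_module_vs[OF Y])
 interpret Y: left_module R Y by (rule Y)
 have "E \<subseteq> carrier Y" using insert.prems by simp
 from insert.IH[OF this] obtain U \<epsilon> where U': "subsp K (vs Y) U" "E \<subseteq> U" "\<forall>e\<in>E. functional Y (\<epsilon> e)"
  "\<forall>y\<in>U. y = finsum Y (%e. sm Y (\<epsilon> e y) e) E" by (elim exE conjE)
 have U: "subsp K (vs Y) U" "E \<subseteq> U" "!!e. e \<in> E ==> functional Y (\<epsilon> e)" using U'(1-3) by auto
 have dec: "finsum Y (%e. sm Y (\<epsilon> e y) e) E = y" if "y \<in> U" for y
  using bspec[OF U'(4) that] by (rule sym)
 have e: "e \<in> carrier Y" and E: "E \<subseteq> carrier Y" using insert by auto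
 have Uc: "U \<subseteq> carrier Y" using U(1) by (auto simp: subsp_def)
 have ec: "\<epsilon> i y \<in> carrier K" if "i \<in> E" "y \<in> carrier Y" for i y using functional_closed[OF U(3)] that by blast
 show ?case
 proof (cases "e \<in> U")
  case True
  have z: "functional Y (%y. \<zero>[K])" using mhom_const_zero[OF scal_md, of "vs Y"] by simp
  have "y = finsum Y (%i. sm Y ((\<epsilon>(e := %y. \<zero>[K])) i y) i) (insert e E)" if y: "y \<in> U" for y
  proof -
   have yc: "y \<in> carrier Y" using y Uc by auto
   have "finsum Y (%i. sm Y ((\<epsilon>(e := %y. \<zero>[K])) i y) i) (insert e E)
    = sm Y \<zero>[K] e \<oplus>[Y] finsum Y (%i. sm Y ((\<epsilon>(e := %y. \<zero>[K])) i y) i) E"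
    using insert(1,2) e E Y yc by (subst Y.M.finsum_insert) (auto simp: ec)
   also have "finsum Y (%i. sm Y ((\<epsilon>(e := %y. \<zero>[K])) i y) i) E = finsum Y (%i. sm Y (\<epsilon> i y) i) E"
    by (rule Y.M.finsum_cong'[OF refl]) (use insert(2) E Y yc ec in auto)
   also have "... = y" using dec[OF y] by simp
   finally show ?thesis using Y e yc by simp
  qed
  thus ?thesis using U True z by (intro exI[of _ U] exI[of _ "\<epsilon>(e := %y. \<zero>[K])"]) auto
 next
  case False
  obtain l where l: "functional Y l" "!!u. u \<in> U ==> l u = \<zero>[K]" "l e = \<one>[K]"
   using separating_functional_exists[OF K.field_axioms left_module_vs[OF Y] U(1), of e] e False by auto
  let ?U = "{u \<oplus>[vs Y] c \<odot>[vs Y] e | u c. u \<in> U & c \<in> carrier K}"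
  have e': "e \<in> carrier (vs Y)" using e by simp
  note L = subsp_add_line[OF left_module_vs[OF Y] U(1) e']
  define \<epsilon>' where "\<epsilon>' = (%i y. if i = e then l y else \<epsilon> i (y \<oplus>[Y] (\<ominus>[Y] sm Y (l y) e)))"
  have le: "kl Y Y (%y. sm Y (l y) e)"
  proof (rule klI)
   fix x y assume "x \<in> carrier Y" "y \<in> carrier Y"
   thus "sm Y (l (x \<oplus>[Y] y)) e = sm Y (l x) e \<oplus>[Y] sm Y (l y) e"
    using mhom_add[OF l(1), of x y] V.smult_l_distr[of "l x" "l y" e] e functional_closed[OF l(1)] by simp
  next
   fix a x assume "a \<in> carrier K" "x \<in> carrier Y"
   thus "sm Y (l (sm Y a x)) e = sm Y a (sm Y (l x) e)"
    using functional_sm[OF l(1)] V.smult_assoc[of a "l x" e] e functional_closed[OF l(1)] by simp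
  qed (use functional_closed[OF l(1)] e Y in auto)
  have diff: "kl Y Y (%y. y \<oplus>[Y] (\<ominus>[Y] sm Y (l y) e))" by (intro kl_sum kl_neg mhom_id le Y)
  have fn: "functional Y (\<epsilon>' i)" if "i \<in> insert e E" for i
  proof (cases "i = e")
   case True thus ?thesis using l(1) by (simp add: \<epsilon>'_def)
  next
   case False
   hence "\<epsilon>' i = (%y. \<epsilon> i (y \<oplus>[Y] (\<ominus>[Y] sm Y (l y) e)))" by (simp add: \<epsilon>'_def fun_eq_iff)
   thus ?thesis using mhom_comp[OF diff U(3)] that False by simp
  qed
  have "y = finsum Y (%i. sm Y (\<epsilon>' i y) i) (insert e E)" if y: "y \<in> ?U" for y
  proof -
   obtain u c where uc: "u \<in> U" "c \<in> carrier K" "y = u \<oplus>[Y] sm Y c e" using y by auto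
   have cl: "u \<in> carrier Y" "sm Y c e \<in> carrier Y" "y \<in> carrier Y" using uc Uc e Y by auto
   have ly: "l y = c" using uc cl mhom_add[OF l(1), of u "sm Y c e"] functional_sm[OF l(1) uc(2) e] l(2)[OF uc(1)] l(3) by simp
   have yu: "y \<oplus>[Y] (\<ominus>[Y] sm Y (l y) e) = u" unfolding ly using uc(3) cl by (simp add: Y.M.a_assoc Y.M.r_neg)
   have "finsum Y (%i. sm Y (\<epsilon>' i y) i) (insert e E) = sm Y c e \<oplus>[Y] finsum Y (%i. sm Y (\<epsilon>' i y) i) E"
    using insert(1,2) cl e E Y ly functional_closed[OF fn]
    by (subst Y.M.finsum_insert) (auto simp: \<epsilon>'_def)
   also have "finsum Y (%i. sm Y (\<epsilon>' i y) i) E = finsum Y (%i. sm Y (\<epsilon> i u) i) E"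
    by (rule Y.M.finsum_cong'[OF refl]) (use insert(2) E Y cl ec in \<open>auto simp: \<epsilon>'_def yu\<close>)
   also have "... = u" using dec[OF uc(1)] by simp
   finally show ?thesis using uc cl by (simp add: Y.M.a_comm)
  qed
  thus ?thesis using L fn U(2) by (intro exI[of _ ?U] exI[of _ \<epsilon>']) blast
 qed
qed

text \<open>Only the reproducing formula is kept; the vectors need not be independent.\<close>

lemma fd_dual_basis:
 assumes Y: "md Y" and "fd Y" shows "\<exists>E \<epsilon>. dbasis Y E \<epsilon>"
proof -
 obtain E where E: "finite E" "E \<subseteq> carrier Y" "\<forall>U. subsp K (vs Y) U & E \<subseteq> U --> U = carrier Y"
  using assms(2) unfolding fd_def by (elim exE conjE)
 obtain U \<epsilon> where U: "subsp K (vs Y) U" "E \<subseteq> U" "\<forall>e\<in>E. functional Y (\<epsilon> e)"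
   "\<forall>y\<in>U. y = finsum Y (%e. sm Y (\<epsilon> e y) e) E"
  using partial_dual_basis[OF Y E(1,2)] by (elim exE conjE)
 have eq: "U = carrier Y" using E(3) U(1,2) by simp
 have "dbasis Y E \<epsilon>" unfolding dbasis_def by (intro conjI E(1,2) U(3) U(4)[unfolded eq])
 thus ?thesis by blast
qed

text \<open>The trace of an endomorphism, computed with a dual basis.\<close>

definition trc :: "'a set => ('a => 'a => 'k) => ('a => 'a) => 'k" where
 "trc E \<epsilon> A = finsum K (%e. \<epsilon> e (A e)) E"

lemma trc_cong:
 assumes "dbasis Y E \<epsilon>" "kl Y Y A" "!!y. y \<in> carrier Y ==> A y = B y"
 shows "trc E \<epsilon> A = trc E \<epsilon> B"
 unfolding trc_def using dbasisD[OF assms(1)] kl_closed[OF assms(2)]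
 by (intro K.finsum_cong') (auto simp flip: assms(3))

lemma trc_product:
 assumes Y: "md Y" and N: "md N" and D: "dbasis Y E \<epsilon>" and z: "kl Y N z"
  and F: "finite F" "F \<subseteq> carrier Y" and mu: "!!e. e \<in> F ==> functional N (\<mu> e)"
 shows "trc E \<epsilon> (%y. finsum Y (%e. sm Y (\<mu> e (z y)) e) F) = finsum K (%e. \<mu> e (z e)) F"
proof -
 note d = dbasisD[OF D]
 have mc: "\<mu> e (z y) \<in> carrier K" if "e \<in> F" "y \<in> carrier Y" for e y
  using functional_closed[OF mu[OF that(1)] kl_closed[OF z that(2)]] .
 have "trc E \<epsilon> (%y. finsum Y (%e. sm Y (\<mu> e (z y)) e) F) =
   finsum K (%i. finsum K (%e. \<mu> e (z i) \<otimes>[K] \<epsilon> i e) F) E"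
  unfolding trc_def
 proof (rule K.finsum_cong'[OF refl])
  show "(%i. finsum K (%e. \<mu> e (z i) \<otimes>[K] \<epsilon> i e) F) \<in> E \<rightarrow> carrier K"
   using mc d F by (auto intro!: K.finsum_closed)
  fix i assume i: "i \<in> E"
  have "\<epsilon> i (finsum Y (%e. sm Y (\<mu> e (z i)) e) F) = finsum K (%e. \<epsilon> i (sm Y (\<mu> e (z i)) e)) F"
   by (rule functional_finsum[OF Y d(3)[OF i]]) (use i d(2) mc F Y in auto)
  also have "... = finsum K (%e. \<mu> e (z i) \<otimes>[K] \<epsilon> i e) F"
   by (rule K.finsum_cong'[OF refl]) (use i d mc F in \<open>auto simp: functional_sm\<close>)
  finally show "\<epsilon> i (finsum Y (%e. sm Y (\<mu> e (z i)) e) F) = finsum K (%e. \<mu> e (z i) \<otimes>[K] \<epsilon> i e) F" .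
 qed
 also have "... = finsum K (%e. finsum K (%i. \<mu> e (z i) \<otimes>[K] \<epsilon> i e) E) F"
  by (rule K.finsum_swap) (use mc d F in auto)
 also have "... = finsum K (%e. \<mu> e (z e)) F"
 proof (rule K.finsum_cong'[OF refl])
  show "(%e. \<mu> e (z e)) \<in> F \<rightarrow> carrier K" using mc F by auto
  fix e assume e: "e \<in> F"
  hence ec: "e \<in> carrier Y" using F by auto
  have muz: "functional Y (%y. \<mu> e (z y))" by (rule mhom_comp[OF z mu[OF e]])
  have "\<mu> e (z e) = \<mu> e (z (finsum Y (%i. sm Y (\<epsilon> i e) i) E))" using d(4)[OF ec] by simp
  also have "... = finsum K (%i. \<mu> e (z (sm Y (\<epsilon> i e) i))) E"
   by (rule functional_finsum[OF Y muz]) (use ec d Y in auto)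
  also have "... = finsum K (%i. \<mu> e (z i) \<otimes>[K] \<epsilon> i e) E"
   by (rule K.finsum_cong'[OF refl]) (use ec d mc[OF e] in \<open>auto simp: functional_sm[OF muz] K.m_comm\<close>)
  finally show "finsum K (%i. \<mu> e (z i) \<otimes>[K] \<epsilon> i e) E = \<mu> e (z e)" by simp
 qed
 finally show ?thesis .
qed

lemma trc_commute:
 assumes Y: "md Y" and N: "md N" and D: "dbasis Y E \<epsilon>" and D': "dbasis N F \<delta>" and A: "kl Y N A" and B: "kl N Y B"
 shows "trc E \<epsilon> (%y. B (A y)) = trc F \<delta> (%n. A (B n))"
proof -
 note d = dbasisD[OF D] and f = dbasisD[OF D']
 \<comment> \<open>expand both sides as a double sum\<close>
 have AB: "kl N N (%n. A (B n))" by (rule kl_comp[OF B A])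
 have Bc: "!!n. n \<in> carrier N ==> B n \<in> carrier Y" using kl_closed[OF B] .
 have Ac: "!!n. n \<in> carrier Y ==> A n \<in> carrier N" using kl_closed[OF A] .
 have "trc E \<epsilon> (%y. B (A y)) = finsum K (%e. finsum K (%i. \<delta> i (A e) \<otimes>[K] \<epsilon> e (B i)) F) E"
  unfolding trc_def
 proof (rule K.finsum_cong'[OF refl])
  show "(%e. finsum K (%i. \<delta> i (A e) \<otimes>[K] \<epsilon> e (B i)) F) \<in> E \<rightarrow> carrier K"
   using d f Ac Bc by (auto intro!: K.finsum_closed)
  fix e assume e: "e \<in> E"
  have eB: "functional N (%n. \<epsilon> e (B n))" by (rule mhom_comp[OF B d(3)[OF e]])
  have "\<epsilon> e (B (A e)) = \<epsilon> e (B (finsum N (%i. sm N (\<delta> i (A e)) i) F))" using f(4) Ac d(2)[OF e] by simp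
  also have "... = finsum K (%i. \<epsilon> e (B (sm N (\<delta> i (A e)) i))) F"
   by (rule functional_finsum[OF N eB]) (use e d f N Ac in auto)
  also have "... = finsum K (%i. \<delta> i (A e) \<otimes>[K] \<epsilon> e (B i)) F"
   by (rule K.finsum_cong'[OF refl]) (use e d f Ac Bc in \<open>auto simp: functional_sm[OF eB]\<close>)
  finally show "\<epsilon> e (B (A e)) = finsum K (%i. \<delta> i (A e) \<otimes>[K] \<epsilon> e (B i)) F" .
 qed
 also have "... = finsum K (%i. finsum K (%e. \<delta> i (A e) \<otimes>[K] \<epsilon> e (B i)) E) F"
  by (rule K.finsum_swap) (use d f Ac Bc in auto)
 also have "... = trc F \<delta> (%n. A (B n))"
  unfolding trc_def
 proof (rule K.finsum_cong'[OF refl])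
  show "(%e. \<delta> e (A (B e))) \<in> F \<rightarrow> carrier K" using f Ac Bc by auto
  fix i assume i: "i \<in> F"
  have dA: "functional Y (%n. \<delta> i (A n))" by (rule mhom_comp[OF A f(3)[OF i]])
  have "\<delta> i (A (B i)) = \<delta> i (A (finsum Y (%e. sm Y (\<epsilon> e (B i)) e) E))" using d(4) Bc f(2)[OF i] by simp
  also have "... = finsum K (%e. \<delta> i (A (sm Y (\<epsilon> e (B i)) e))) E"
   by (rule functional_finsum[OF Y dA]) (use i d f Y Bc in auto)
  also have "... = finsum K (%e. \<delta> i (A e) \<otimes>[K] \<epsilon> e (B i)) E"
   by (rule K.finsum_cong'[OF refl]) (use i d f Ac Bc in \<open>auto simp: functional_sm[OF dA] K.m_comm\<close>)
  finally show "finsum K (%e. \<delta> i (A e) \<otimes>[K] \<epsilon> e (B i)) E = \<delta> i (A (B i))" by simp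
 qed
 finally show ?thesis .
qed

lemma trc_add:
 assumes D: "dbasis Y E \<epsilon>" and A: "kl Y Y A" and B: "kl Y Y B"
 shows "trc E \<epsilon> (%y. A y \<oplus>[Y] B y) = trc E \<epsilon> A \<oplus>[K] trc E \<epsilon> B"
proof -
 note d = dbasisD[OF D]
 have "trc E \<epsilon> (%y. A y \<oplus>[Y] B y) = finsum K (%e. \<epsilon> e (A e) \<oplus>[K] \<epsilon> e (B e)) E"
  unfolding trc_def
  by (rule K.finsum_cong'[OF refl])
   (use d kl_closed[OF A] kl_closed[OF B] mhom_add[OF d(3)] in auto)
 also have "... = trc E \<epsilon> A \<oplus>[K] trc E \<epsilon> B" unfolding trc_def
  by (rule K.finsum_addf) (use d kl_closed[OF A] kl_closed[OF B] in auto)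
 finally show ?thesis .
qed

lemma trc_finsum:
 assumes Y: "md Y" and D: "dbasis Y E \<epsilon>" and S: "finite S" and A: "!!g. g \<in> S ==> kl Y Y (A g)"
 shows "trc E \<epsilon> (%y. finsum Y (%g. A g y) S) = finsum K (%g. trc E \<epsilon> (A g)) S"
proof -
 note d = dbasisD[OF D]
 have "trc E \<epsilon> (%y. finsum Y (%g. A g y) S) = finsum K (%e. finsum K (%g. \<epsilon> e (A g e)) S) E"
  unfolding trc_def
  by (rule K.finsum_cong'[OF refl], (use d kl_closed[OF A] in \<open>auto intro!: K.finsum_closed\<close>)[1])
   (rule functional_finsum[OF Y d(3)], use d(2) kl_closed[OF A] in auto)
 also have "... = finsum K (%g. trc E \<epsilon> (A g)) S"
  unfolding trc_def by (rule K.finsum_swap) (use d S kl_closed[OF A] in auto)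
 finally show ?thesis .
qed

lemma trc_zero:
 assumes "md Y" "dbasis Y E \<epsilon>" shows "trc E \<epsilon> (%y. \<zero>[Y]) = \<zero>[K]"
proof -
 note d = dbasisD[OF assms(2)]
 have "\<epsilon> e \<zero>[Y] = \<zero>[K]" if "e \<in> E" for e
  using mhom_zero[OF left_module_vs[OF assms(1)] scal_md d(3)[OF that]] by simp
 thus ?thesis unfolding trc_def by (subst K.finsum_cong'[OF refl, of "%_. \<zero>[K]"]) auto
qed

text \<open>The trace form is non-degenerate.\<close>

definition tensor :: "('g => 'k, 'a) module => ('g => 'k, 'b) module => 'b => ('a => 'k) => 'a => 'b" where
 "tensor Y N n l = (%y. sm N (l y) n)"

lemma tensor_kl:
 assumes N: "md N" and n: "n \<in> carrier N" and l: "functional Y l"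
 shows "kl Y N (tensor Y N n l)"
proof (rule klI)
 interpret V: left_module K "vs N" by (rule left_module_vs[OF N])
 fix x y assume "x \<in> carrier Y" "y \<in> carrier Y"
 thus "tensor Y N n l (x \<oplus>[Y] y) = tensor Y N n l x \<oplus>[N] tensor Y N n l y"
  using mhom_add[OF l, of x y] V.smult_l_distr[of "l x" "l y" n] n functional_closed[OF l] by (simp add: tensor_def)
next
 interpret V: left_module K "vs N" by (rule left_module_vs[OF N])
 fix a x assume "a \<in> carrier K" "x \<in> carrier Y"
 thus "tensor Y N n l (sm Y a x) = sm N a (tensor Y N n l x)"
  using functional_sm[OF l] V.smult_assoc[of a "l x" n] n functional_closed[OF l] by (simp add: tensor_def)
qed (use functional_closed[OF l] n N in \<open>auto simp: tensor_def\<close>)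

lemma trc_tensor:
 assumes Y: "md Y" and N: "md N" and D: "dbasis Y E \<epsilon>" and v: "kl N Y v" and n: "n \<in> carrier N" and l: "functional Y l"
 shows "trc E \<epsilon> (%y. v (tensor Y N n l y)) = l (v n)"
proof -
 note d = dbasisD[OF D]
 have vn: "v n \<in> carrier Y" using kl_closed[OF v n] .
 have "trc E \<epsilon> (%y. v (tensor Y N n l y)) = finsum K (%e. l (sm Y (\<epsilon> e (v n)) e)) E"
  unfolding trc_def tensor_def
  by (rule K.finsum_cong'[OF refl])
   (use d vn n functional_closed[OF l] Y in \<open>auto simp: kl_sm[OF v] functional_sm[OF d(3)] functional_sm[OF l] K.m_comm\<close>)
 also have "... = l (finsum Y (%e. sm Y (\<epsilon> e (v n)) e) E)"
  by (rule functional_finsum[OF Y l, symmetric]) (use d vn Y in auto)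
 finally show ?thesis using d(4)[OF vn] by simp
qed

text \<open>Test with rank one maps, for which the trace is an evaluation.\<close>

lemma trc_nondegenerate:
 assumes Y: "md Y" and N: "md N" and D: "dbasis Y E \<epsilon>" and v: "kl N Y v"
  and z: "!!\<phi>. kl Y N \<phi> ==> trc E \<epsilon> (%y. v (\<phi> y)) = \<zero>[K]" and n: "n \<in> carrier N"
 shows "v n = \<zero>[Y]"
proof -
 note d = dbasisD[OF D]
 interpret Y: left_module R Y by (rule Y)
 have vn: "v n \<in> carrier Y" using kl_closed[OF v n] .
 have "\<epsilon> e (v n) = \<zero>[K]" if "e \<in> E" for e
  using trc_tensor[OF Y N D v n d(3)[OF that]] z[OF tensor_kl[OF N n d(3)[OF that]]] by simp
 hence "finsum Y (%e. sm Y (\<epsilon> e (v n)) e) E = finsum Y (%e. \<zero>[Y]) E"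
  by (intro Y.M.finsum_cong' refl) (use d(2) Y in auto)
 thus ?thesis using d(4)[OF vn] by simp
qed

text \<open>Taking the trace over the group is self-adjoint for the trace form, since the form is
  invariant under conjugation.\<close>

lemma trc_adjoint:
 assumes Y: "md Y" and D: "dbasis Y E \<epsilon>" and w: "kl Y Y w" and u: "kl Y Y u"
 shows "trc E \<epsilon> (%y. w (tr Y Y u y)) = trc E \<epsilon> (%y. tr Y Y w (u y))"
proof -
 interpret Y: left_module R Y by (rule Y)
 have uc: "!!y. y \<in> carrier Y ==> u y \<in> carrier Y" using kl_closed[OF u] .
 have wc: "!!y. y \<in> carrier Y ==> w y \<in> carrier Y" using kl_closed[OF w] .
 let ?A = "%g y. w (ga Y g (u (ga Y (inv[G] g) y)))"
 let ?B = "%g y. ga Y (inv[G] g) (w (ga Y g (u y)))"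
 have kA: "kl Y Y (?A g)" for g
  by (rule kl_comp[OF kl_comp[OF kl_comp[OF kl_ga[OF Y] u] kl_ga[OF Y]] w])
 have kB: "kl Y Y (?B g)" for g
  by (rule kl_comp[OF kl_comp[OF kl_comp[OF u kl_ga[OF Y]] w] kl_ga[OF Y]])
 have "trc E \<epsilon> (%y. w (tr Y Y u y)) = trc E \<epsilon> (%y. finsum Y (%g. ?A g y) (carrier G))"
 proof (rule trc_cong[OF D kl_comp[OF hom_kl[OF tr_hom[OF Y Y u]] w]])
  fix y assume "y \<in> carrier Y"
  thus "w (tr Y Y u y) = finsum Y (%g. ?A g y) (carrier G)"
   unfolding tr_def by (intro kl_finsum[OF Y Y w]) (use Y uc in auto)
 qed
 also have "... = finsum K (%g. trc E \<epsilon> (?A g)) (carrier G)"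
  by (rule trc_finsum[OF Y D finG kA])
 also have "... = finsum K (%g. trc E \<epsilon> (?B g)) (carrier G)"
  using trc_commute[OF Y Y D D kl_ga[OF Y] kl_comp[OF kl_comp[OF u kl_ga[OF Y]] w]] by simp
 also have "... = trc E \<epsilon> (%y. finsum Y (%g. ?B g y) (carrier G))"
  by (rule trc_finsum[OF Y D finG kB, symmetric])
 also have "... = trc E \<epsilon> (%y. tr Y Y w (u y))"
 proof (rule trc_cong[OF D])
  show "kl Y Y (%y. finsum Y (%g. ?B g y) (carrier G))" by (rule kl_fin_sum[OF Y kB Y])
  fix y assume y: "y \<in> carrier Y"
  note im = inv_image
  have "tr Y Y w (u y) = finsum Y (%g. ga Y g (w (ga Y (inv[G] g) (u y)))) ((%g. inv[G] g) ` carrier G)"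
   unfolding tr_def im ..
  also have "... = finsum Y (%g. ga Y (inv[G] g) (w (ga Y (inv[G] (inv[G] g)) (u y)))) (carrier G)"
   by (rule Y.M.finsum_reindex[OF _ inj_inv], unfold im) (simp add: y Y uc wc Pi_iff)
  also have "... = finsum Y (%g. ?B g y) (carrier G)"
   by (rule Y.M.finsum_cong'[OF refl]) (use y Y uc wc in auto)
  finally show "finsum Y (%g. ?B g y) (carrier G) = tr Y Y w (u y)" by simp
 qed
 finally show ?thesis .
qed

end

context kG begin

section \<open>Negative Tate classes\<close>

text \<open>A generator of the kernel of the augmentation acting by conjugation on linear maps.\<close>

definition igb :: "('g => 'k, 'a) module => ('g => 'k, 'b) module => 'g => ('a => 'b) => 'a => 'b" where
 "igb X N g \<phi> x = ga N g (\<phi> (ga X (inv[G] g) x)) \<oplus>[N] (\<ominus>[N] \<phi> x)"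

text \<open>The submodule generated by all \<open>g \<phi> - \<phi>\<close>. Modulo these, the linear maps of vanishing group trace
  form the Tate cohomology group in degree minus one of the module of linear maps.\<close>

definition ig :: "('g => 'k, 'a) module => ('g => 'k, 'b) module => ('a => 'b) => bool" where
 "ig X N z \<longleftrightarrow> (\<exists>\<phi>. (\<forall>g\<in>carrier G. kl X N (\<phi> g)) &
   (\<forall>x\<in>carrier X. z x = finsum N (%g. igb X N g (\<phi> g) x) (carrier G)))"

lemma igE:
 assumes "ig X N z"
 obtains \<phi> where "\<forall>g\<in>carrier G. kl X N (\<phi> g)"
  "\<forall>x\<in>carrier X. z x = finsum N (%g. igb X N g (\<phi> g) x) (carrier G)"
 using assms unfolding ig_def by (elim exE conjE)

lemma igI:
 assumes "!!g. g \<in> carrier G ==> kl X N (\<phi> g)"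
  "!!x. x \<in> carrier X ==> z x = finsum N (%g. igb X N g (\<phi> g) x) (carrier G)"
 shows "ig X N z"
 unfolding ig_def using assms by (intro exI[of _ \<phi>]) simp

lemma kl_conj: "md X ==> md N ==> kl X N \<phi> ==> kl X N (%x. ga N g (\<phi> (ga X h x)))"
 by (rule kl_comp[OF kl_comp[OF kl_ga] kl_ga])

lemma igb_kl: "md X ==> md N ==> kl X N \<phi> ==> kl X N (igb X N g \<phi>)"
 unfolding igb_def[abs_def] by (intro kl_sum kl_neg kl_conj)

lemma igb_closed: "md X ==> md N ==> kl X N \<phi> ==> x \<in> carrier X ==> igb X N g \<phi> x \<in> carrier N"
 using kl_closed[OF igb_kl] .

lemma ig_kl:
 assumes "md X" "md N" "ig X N z" shows "kl X N z"
 using assms(3)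
proof (rule igE)
 fix \<phi> assume p': "\<forall>g\<in>carrier G. kl X N (\<phi> g)"
  "\<forall>x\<in>carrier X. z x = finsum N (%g. igb X N g (\<phi> g) x) (carrier G)"
 note p = bspec[OF p'(1)] bspec[OF p'(2)]
 show ?thesis
  by (rule kl_cong[OF assms(1) kl_fin_sum[OF assms(2) igb_kl[OF assms(1,2) p(1)] assms(1)]]) (simp_all add: p(2))
qed

lemma ig_cong: "ig X N z ==> (!!x. x \<in> carrier X ==> z' x = z x) ==> ig X N z'"
 unfolding ig_def by simp

lemma ig_sum:
 assumes X: "md X" and N: "md N" and z: "ig X N z" and y: "ig X N y"
 shows "ig X N (%x. z x \<oplus>[N] y x)"
proof -
 interpret N: left_module R N by (rule N)
 obtain \<phi> where p': "\<forall>g\<in>carrier G. kl X N (\<phi> g)"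
  "\<forall>x\<in>carrier X. z x = finsum N (%g. igb X N g (\<phi> g) x) (carrier G)" by (rule igE[OF z])
 note p = bspec[OF p'(1)] bspec[OF p'(2)]
 obtain \<psi> where q': "\<forall>g\<in>carrier G. kl X N (\<psi> g)"
  "\<forall>x\<in>carrier X. y x = finsum N (%g. igb X N g (\<psi> g) x) (carrier G)" by (rule igE[OF y])
 note q = bspec[OF q'(1)] bspec[OF q'(2)]
 show ?thesis
 proof (rule igI[of X N "%g x. \<phi> g x \<oplus>[N] \<psi> g x"])
  show "kl X N (%x. \<phi> g x \<oplus>[N] \<psi> g x)" if "g \<in> carrier G" for g by (rule kl_sum[OF N p(1)[OF that] q(1)[OF that]])
  fix x assume x: "x \<in> carrier X"
  have "z x \<oplus>[N] y x = finsum N (%g. igb X N g (\<phi> g) x \<oplus>[N] igb X N g (\<psi> g) x) (carrier G)"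
   unfolding p(2)[OF x] q(2)[OF x]
   by (rule N.M.finsum_addf[symmetric]) (use igb_closed[OF X N p(1) x] igb_closed[OF X N q(1) x] in auto)
  also have "... = finsum N (%g. igb X N g (%x. \<phi> g x \<oplus>[N] \<psi> g x) x) (carrier G)"
  proof (rule N.M.finsum_cong'[OF refl])
   show "(%g. igb X N g (%x. \<phi> g x \<oplus>[N] \<psi> g x) x) \<in> carrier G \<rightarrow> carrier N"
    using igb_closed[OF X N kl_sum[OF N p(1) q(1)] x] by auto
   fix g assume g: "g \<in> carrier G"
   have c: "ga X (inv[G] g) x \<in> carrier X" using X x by simp
   have "ga N g (\<phi> g (ga X (inv[G] g) x)) \<in> carrier N" "ga N g (\<psi> g (ga X (inv[G] g) x)) \<in> carrier N"
    "\<phi> g x \<in> carrier N" "\<psi> g x \<in> carrier N"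
    using kl_closed[OF p(1)[OF g]] kl_closed[OF q(1)[OF g]] c x N by auto
   thus "igb X N g (\<phi> g) x \<oplus>[N] igb X N g (\<psi> g) x = igb X N g (%x. \<phi> g x \<oplus>[N] \<psi> g x) x"
    using kl_closed[OF p(1)[OF g] c] kl_closed[OF q(1)[OF g] c]
    by (simp add: igb_def ga_add[OF N] N.M.minus_add N.M.a_ac)
  qed
  finally show "z x \<oplus>[N] y x = finsum N (%g. igb X N g (%x. \<phi> g x \<oplus>[N] \<psi> g x) x) (carrier G)" .
 qed
qed

lemma igb_post:
 assumes "md N" "md L" "hom N L h" "kl X N \<phi>" "x \<in> carrier X" "md X"
 shows "h (igb X N g \<phi> x) = igb X L g (%x. h (\<phi> x)) x"
proof -
 have c: "\<phi> x \<in> carrier N" "\<phi> (ga X (inv[G] g) x) \<in> carrier N" using kl_closed[OF assms(4)] assms(5,6) by auto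
 thus ?thesis using assms(1) by (simp add: igb_def mhom_add[OF assms(3)] mhom_minus[OF assms(1-3)] hom_ga[OF assms(3)])
qed

lemma igb_pre: "hom X' X h ==> x \<in> carrier X' ==> igb X N g \<phi> (h x) = igb X' N g (%x. \<phi> (h x)) x"
 by (simp add: igb_def hom_ga)

lemma ig_post:
 assumes X: "md X" and N: "md N" and L: "md L" and h: "hom N L h" and z: "ig X N z"
 shows "ig X L (%x. h (z x))"
proof -
 interpret L: left_module R L by (rule L)
 obtain \<phi> where p': "\<forall>g\<in>carrier G. kl X N (\<phi> g)"
  "\<forall>x\<in>carrier X. z x = finsum N (%g. igb X N g (\<phi> g) x) (carrier G)" by (rule igE[OF z])
 note p = bspec[OF p'(1)] bspec[OF p'(2)]
 show ?thesis
 proof (rule igI[of X L "%g x. h (\<phi> g x)"])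
  show k: "kl X L (%x. h (\<phi> g x))" if "g \<in> carrier G" for g by (rule kl_comp[OF p(1)[OF that] hom_kl[OF h]])
  fix x assume x: "x \<in> carrier X"
  have "h (z x) = finsum L (%g. h (igb X N g (\<phi> g) x)) (carrier G)"
   unfolding p(2)[OF x] by (rule mhom_finsum[OF N L h]) (use igb_closed[OF X N p(1) x] in auto)
  also have "... = finsum L (%g. igb X L g (%x. h (\<phi> g x)) x) (carrier G)"
   by (rule L.M.finsum_cong'[OF refl])
    (use igb_closed[OF X L k x] igb_post[OF N L h p(1) x X] in auto)
  finally show "h (z x) = finsum L (%g. igb X L g (%x. h (\<phi> g x)) x) (carrier G)" .
 qed
qed

lemma ig_pre:
 assumes X': "md X'" and X: "md X" and N: "md N" and h: "hom X' X h" and z: "ig X N z"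
 shows "ig X' N (%x. z (h x))"
proof -
 obtain \<phi> where p': "\<forall>g\<in>carrier G. kl X N (\<phi> g)"
  "\<forall>x\<in>carrier X. z x = finsum N (%g. igb X N g (\<phi> g) x) (carrier G)" by (rule igE[OF z])
 note p = bspec[OF p'(1)] bspec[OF p'(2)]
 show ?thesis
 proof (rule igI[of X' N "%g x. \<phi> g (h x)"])
  show "kl X' N (%x. \<phi> g (h x))" if "g \<in> carrier G" for g by (rule kl_comp[OF hom_kl[OF h] p(1)[OF that]])
  fix x assume x: "x \<in> carrier X'"
  show "z (h x) = finsum N (%g. igb X' N g (%x. \<phi> g (h x)) x) (carrier G)"
   unfolding p(2)[OF mhom_closed[OF h x]] igb_pre[OF h x] ..
 qed
qed

lemma ig_basic:
 assumes X: "md X" and N: "md N" and h: "h \<in> carrier G" and f: "kl X N \<phi>"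
 shows "ig X N (igb X N h \<phi>)"
proof -
 interpret N: left_module R N by (rule N)
 let ?f = "%g. if g = h then \<phi> else (%x. \<zero>[N])"
 have k: "kl X N (?f g)" for g by (simp add: f kl_const_zero[OF N])
 show ?thesis
 proof (rule igI[of X N ?f])
  fix x assume x: "x \<in> carrier X"
  have "finsum N (%g. igb X N g (?f g) x) (carrier G) = finsum N (%g. if h = g then (%_. igb X N h \<phi> x) g else \<zero>[N]) (carrier G)"
   by (rule N.M.finsum_cong'[OF refl])
    (use igb_closed[OF X N f x] N in \<open>auto simp: igb_def\<close>)
  also have "... = igb X N h \<phi> x"
   by (rule N.M.finsum_singleton[OF h finG]) (use igb_closed[OF X N f x] in auto)
  finally show "igb X N h \<phi> x = finsum N (%g. igb X N g (?f g) x) (carrier G)" by simp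
 qed (rule k)
qed

lemma trc_ig:
 assumes X: "md X" and N: "md N" and D: "dbasis X E \<epsilon>" and z: "ig X N z" and v: "hom N X v"
 shows "trc E \<epsilon> (%x. v (z x)) = \<zero>[K]"
proof -
 interpret X: left_module R X by (rule X)
 have "ig X X (%x. v (z x))" by (rule ig_post[OF X N X v z])
 then obtain \<phi> where p': "\<forall>g\<in>carrier G. kl X X (\<phi> g)"
  "\<forall>x\<in>carrier X. v (z x) = finsum X (%g. igb X X g (\<phi> g) x) (carrier G)" by (rule igE)
 note p = bspec[OF p'(1)] bspec[OF p'(2)]
 have t: "trc E \<epsilon> (igb X X g (\<phi> g)) = \<zero>[K]" if g: "g \<in> carrier G" for g
 proof -
  have "trc E \<epsilon> (%x. ga X g (\<phi> g (ga X (inv[G] g) x))) = trc E \<epsilon> (%x. ga X (inv[G] g) (ga X g (\<phi> g x)))"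
   using trc_commute[OF X X D D kl_ga[OF X] kl_comp[OF p(1)[OF g] kl_ga[OF X]]] by simp
  also have "... = trc E \<epsilon> (\<phi> g)"
   by (rule trc_cong[OF D kl_comp[OF kl_comp[OF p(1)[OF g] kl_ga[OF X]] kl_ga[OF X]]])
    (use g kl_closed[OF p(1)[OF g]] X in \<open>simp add: ga_ga ga_one\<close>)
  finally have e: "trc E \<epsilon> (%x. ga X g (\<phi> g (ga X (inv[G] g) x))) = trc E \<epsilon> (\<phi> g)" .
  have "trc E \<epsilon> (\<phi> g) \<oplus>[K] trc E \<epsilon> (%x. \<ominus>[X] \<phi> g x) = trc E \<epsilon> (%x. \<phi> g x \<oplus>[X] (\<ominus>[X] \<phi> g x))"
   by (rule trc_add[OF D p(1)[OF g] kl_neg[OF X p(1)[OF g]], symmetric])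
  also have "... = trc E \<epsilon> (%x. \<zero>[X])"
   by (rule trc_cong[OF D kl_sum[OF X p(1)[OF g] kl_neg[OF X p(1)[OF g]]]]) (simp add: X.M.r_neg kl_closed[OF p(1)[OF g]])
  finally have e2: "trc E \<epsilon> (\<phi> g) \<oplus>[K] trc E \<epsilon> (%x. \<ominus>[X] \<phi> g x) = \<zero>[K]" using trc_zero[OF X D] by simp
  have "trc E \<epsilon> (igb X X g (\<phi> g)) = trc E \<epsilon> (%x. ga X g (\<phi> g (ga X (inv[G] g) x))) \<oplus>[K] trc E \<epsilon> (%x. \<ominus>[X] \<phi> g x)"
   unfolding igb_def[abs_def] by (rule trc_add[OF D kl_conj[OF X X p(1)[OF g]] kl_neg[OF X p(1)[OF g]]])
  thus ?thesis using e e2 by simp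
 qed
 have "trc E \<epsilon> (%x. v (z x)) = trc E \<epsilon> (%x. finsum X (%g. igb X X g (\<phi> g) x) (carrier G))"
  by (rule trc_cong[OF D kl_comp[OF ig_kl[OF X N z] hom_kl[OF v]] p(2)])
 also have "... = finsum K (%g. trc E \<epsilon> (igb X X g (\<phi> g))) (carrier G)"
  by (rule trc_finsum[OF X D finG igb_kl[OF X X p(1)]])
 also have "... = finsum K (%g. \<zero>[K]) (carrier G)" by (rule K.finsum_cong') (simp_all add: t)
 finally show ?thesis by simp
qed

section \<open>Separation in spaces of linear maps\<close>

text \<open>Functions on a carrier, so that linear functionals on linear maps can be separated.\<close>

definition funsp :: "'a set => ('g => 'k, 'b) module => ('k, 'a => 'b) module" where
 "funsp S N = \<lparr> carrier = S \<rightarrow>\<^sub>E carrier N, mult = undefined, one = undefined, zero = (\<lambda>x\<in>S. \<zero>[N]),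
   add = (%f g. \<lambda>x\<in>S. f x \<oplus>[N] g x), smult = (%c f. \<lambda>x\<in>S. sm N c (f x)) \<rparr>"

lemma funsp_simps: "carrier (funsp S N) = S \<rightarrow>\<^sub>E carrier N" "\<zero>[funsp S N] = (\<lambda>x\<in>S. \<zero>[N])"
 "f \<oplus>[funsp S N] g = (\<lambda>x\<in>S. f x \<oplus>[N] g x)" "c \<odot>[funsp S N] f = (\<lambda>x\<in>S. sm N c (f x))"
 by (simp_all add: funsp_def)

lemma funsp_module:
 assumes N: "md N" shows "left_module K (funsp S N)"
proof -
 interpret N: left_module R N by (rule N)
 interpret V: left_module K "vs N" by (rule left_module_vs[OF N])
 have ev: "f x \<in> carrier N" if "f \<in> S \<rightarrow>\<^sub>E carrier N" "x \<in> S" for f x using that by auto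
 have ab: "abelian_group (funsp S N)"
 proof (rule abelian_groupI, unfold funsp_simps)
  fix f assume f: "f \<in> S \<rightarrow>\<^sub>E carrier N"
  show "(\<lambda>x\<in>S. (\<lambda>x\<in>S. \<zero>[N]) x \<oplus>[N] f x) = f"
   by (rule PiE_ext[OF _ f]) (use ev[OF f] N in auto)
  show "\<exists>g\<in>S \<rightarrow>\<^sub>E carrier N. (\<lambda>x\<in>S. g x \<oplus>[N] f x) = (\<lambda>x\<in>S. \<zero>[N])"
   by (rule bexI[of _ "\<lambda>x\<in>S. \<ominus>[N] f x"]) (use ev[OF f] N in \<open>auto simp: N.M.l_neg intro!: restrict_ext\<close>)
 next
  fix f g h assume f: "f \<in> S \<rightarrow>\<^sub>E carrier N" "g \<in> S \<rightarrow>\<^sub>E carrier N" "h \<in> S \<rightarrow>\<^sub>E carrier N"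
  show "(\<lambda>x\<in>S. (\<lambda>x\<in>S. f x \<oplus>[N] g x) x \<oplus>[N] h x) = (\<lambda>x\<in>S. f x \<oplus>[N] (\<lambda>x\<in>S. g x \<oplus>[N] h x) x)"
   by (rule restrict_ext) (simp add: ev[OF f(1)] ev[OF f(2)] ev[OF f(3)] N.M.a_assoc)
 next
  fix f g assume f: "f \<in> S \<rightarrow>\<^sub>E carrier N" "g \<in> S \<rightarrow>\<^sub>E carrier N"
  show "(\<lambda>x\<in>S. f x \<oplus>[N] g x) = (\<lambda>x\<in>S. g x \<oplus>[N] f x)"
   by (rule restrict_ext) (simp add: ev[OF f(1)] ev[OF f(2)] N.M.a_comm)
  show "(\<lambda>x\<in>S. f x \<oplus>[N] g x) \<in> S \<rightarrow>\<^sub>E carrier N" using ev[OF f(1)] ev[OF f(2)] by auto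
 qed auto
 have vl: "!!a b x. a \<in> carrier K ==> b \<in> carrier K ==> x \<in> carrier N ==> sm N (a \<oplus>[K] b) x = sm N a x \<oplus>[N] sm N b x"
  "!!a x y. a \<in> carrier K ==> x \<in> carrier N ==> y \<in> carrier N ==> sm N a (x \<oplus>[N] y) = sm N a x \<oplus>[N] sm N a y"
  "!!a b x. a \<in> carrier K ==> b \<in> carrier K ==> x \<in> carrier N ==> sm N (a \<otimes>[K] b) x = sm N a (sm N b x)"
  using V.smult_l_distr V.smult_r_distr V.smult_assoc by simp_all
 show ?thesis
 proof (rule left_moduleI[OF K.ring_axioms ab], unfold funsp_simps)
  fix a f assume f: "a \<in> carrier K" "f \<in> S \<rightarrow>\<^sub>E carrier N"
  show "(\<lambda>x\<in>S. sm N a (f x)) \<in> S \<rightarrow>\<^sub>E carrier N" using ev[OF f(2)] f(1) N by auto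
 next
  fix a b f assume f: "a \<in> carrier K" "b \<in> carrier K" "f \<in> S \<rightarrow>\<^sub>E carrier N"
  show "(\<lambda>x\<in>S. sm N (a \<oplus>[K] b) (f x)) = (\<lambda>x\<in>S. (\<lambda>x\<in>S. sm N a (f x)) x \<oplus>[N] (\<lambda>x\<in>S. sm N b (f x)) x)"
   by (rule restrict_ext) (simp add: ev[OF f(3)] f vl)
  show "(\<lambda>x\<in>S. sm N (a \<otimes>[K] b) (f x)) = (\<lambda>x\<in>S. sm N a ((\<lambda>x\<in>S. sm N b (f x)) x))"
   by (rule restrict_ext) (simp add: ev[OF f(3)] f vl)
 next
  fix a f g assume f: "a \<in> carrier K" "f \<in> S \<rightarrow>\<^sub>E carrier N" "g \<in> S \<rightarrow>\<^sub>E carrier N"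
  show "(\<lambda>x\<in>S. sm N a ((\<lambda>x\<in>S. f x \<oplus>[N] g x) x)) = (\<lambda>x\<in>S. (\<lambda>x\<in>S. sm N a (f x)) x \<oplus>[N] (\<lambda>x\<in>S. sm N a (g x)) x)"
   by (rule restrict_ext) (simp add: ev[OF f(2)] ev[OF f(3)] f vl)
 next
  fix f assume f: "f \<in> S \<rightarrow>\<^sub>E carrier N"
  show "(\<lambda>x\<in>S. sm N \<one>[K] (f x)) = f"
   by (rule PiE_ext[OF _ f]) (use ev[OF f] N in auto)
 qed
qed

lemma funsp_finsum:
 assumes N: "md N" and f: "f \<in> A \<rightarrow> carrier (funsp S N)" and x: "x \<in> S"
 shows "finsum (funsp S N) f A x = finsum N (%i. f i x) A"
proof -
 interpret N: left_module R N by (rule N)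
 interpret F: left_module K "funsp S N" by (rule funsp_module[OF N])
 have ev: "\<phi> x \<in> carrier N" if "\<phi> \<in> carrier (funsp S N)" for \<phi> using that x by (auto simp: funsp_simps)
 show ?thesis using f
 proof (induct A rule: infinite_finite_induct)
  case (insert i A)
  have "finsum (funsp S N) f (insert i A) x = f i x \<oplus>[N] finsum (funsp S N) f A x"
   using insert x by (subst F.M.finsum_insert) (auto simp: funsp_simps)
  also have "... = finsum N (%i. f i x) (insert i A)"
   using insert ev by (subst N.M.finsum_insert) auto
  finally show ?case .
 qed (use x in \<open>auto simp: funsp_simps\<close>)
qed

text \<open>A linear functional on the linear maps out of a finite dimensional module is the trace
 against a linear map in the opposite direction.\<close>

text \<open>A functional on linear maps is determined by its values on rank one maps, and these are
  collected into a single linear map in the other direction.\<close>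

lemma represent_functional:
 assumes X: "md X" and N: "md N" and D: "dbasis X E \<epsilon>"
  and L: "mhom K (funsp (carrier X) N) (scalars K) \<Lambda>"
 obtains v where "kl N X v" "!!z. kl X N z ==> trc E \<epsilon> (%x. v (z x)) = \<Lambda> (restrict z (carrier X))"
proof -
 note d = dbasisD[OF D]
 interpret X: left_module R X by (rule X)
 interpret N: left_module R N by (rule N)
 interpret V: left_module K "vs N" by (rule left_module_vs[OF N])
 interpret VX: left_module K "vs X" by (rule left_module_vs[OF X])
 let ?F = "funsp (carrier X) N"
 interpret F: left_module K ?F by (rule funsp_module[OF N])
 define T where "T = (%n e. restrict (tensor X N n (\<epsilon> e)) (carrier X))"
 have T: "T n e \<in> carrier ?F" if "n \<in> carrier N" "e \<in> E" for n e
  using that d(5) N by (auto simp: T_def tensor_def funsp_simps)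
 define \<mu> where "\<mu> = (%e n. \<Lambda> (T n e))"
 have mu: "functional N (\<mu> e)" if e: "e \<in> E" for e
 proof (rule mhomI)
  fix n assume n: "n \<in> carrier (vs N)" thus "\<mu> e n \<in> carrier (scalars K)" using mhom_closed[OF L T[of n e]] e by (simp add: \<mu>_def)
 next
  fix n m assume nm: "n \<in> carrier (vs N)" "m \<in> carrier (vs N)"
  have "T (n \<oplus>[N] m) e = T n e \<oplus>[?F] T m e"
   unfolding T_def tensor_def funsp_simps
   by (rule restrict_ext) (use nm d(5)[OF e] V.smult_r_distr in auto)
  thus "\<mu> e (n \<oplus>[vs N] m) = \<mu> e n \<oplus>[scalars K] \<mu> e m" using nm e by (simp add: \<mu>_def mhom_add[OF L] T)
 next
  fix a n assume an: "a \<in> carrier K" "n \<in> carrier (vs N)"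
  have "T (sm N a n) e = a \<odot>[?F] T n e"
   unfolding T_def tensor_def funsp_simps
  proof (rule restrict_ext)
   fix x assume x: "x \<in> carrier X"
   have "sm N (\<epsilon> e x) (sm N a n) = sm N (\<epsilon> e x \<otimes>[K] a) n" using V.smult_assoc[of "\<epsilon> e x" a n] an d(5)[OF e x] by simp
   also have "... = sm N a (sm N (\<epsilon> e x) n)" using V.smult_assoc[of a "\<epsilon> e x" n] an d(5)[OF e x] by (simp add: K.m_comm)
   finally show "sm N (\<epsilon> e x) (sm N a n) = sm N a ((\<lambda>x\<in>carrier X. sm N (\<epsilon> e x) n) x)" using x by simp
  qed
  thus "\<mu> e (a \<odot>[vs N] n) = a \<odot>[scalars K] \<mu> e n" using an e by (simp add: \<mu>_def mhom_smult[OF L] T)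
 qed
 define v where "v = (%n. finsum X (%e. sm X (\<mu> e n) e) E)"
 have v: "kl N X v" unfolding v_def
 proof (rule kl_fin_sum[OF X _ N])
  fix e assume e: "e \<in> E"
  show "kl N X (%n. sm X (\<mu> e n) e)"
   using tensor_kl[OF X d(2)[OF e] mu[OF e]] by (simp add: tensor_def)
 qed
 have "trc E \<epsilon> (%x. v (z x)) = \<Lambda> (restrict z (carrier X))" if z: "kl X N z" for z
 proof -
  have "trc E \<epsilon> (%x. v (z x)) = finsum K (%e. \<mu> e (z e)) E"
   unfolding v_def by (rule trc_product[OF X N D z d(1)]) (use d(2) mu in auto)
  also have "... = \<Lambda> (finsum ?F (%e. T (z e) e) E)"
   using mhom_finsum[OF F.left_module_axioms scal_md L, of "%e. T (z e) e" E] T kl_closed[OF z] d(2)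
   by (simp add: \<mu>_def finsum_scalars)
  also have "finsum ?F (%e. T (z e) e) E = restrict z (carrier X)"
  proof (rule PiE_ext[of _ "carrier X" "%_. carrier N"])
   have c: "(%e. T (z e) e) \<in> E \<rightarrow> carrier ?F" using T kl_closed[OF z] d(2) by auto
   show "finsum ?F (%e. T (z e) e) E \<in> carrier X \<rightarrow>\<^sub>E carrier N"
    using F.M.finsum_closed[OF c] by (simp add: funsp_simps)
   show "restrict z (carrier X) \<in> carrier X \<rightarrow>\<^sub>E carrier N" using kl_closed[OF z] by auto
   fix x assume x: "x \<in> carrier X"
   have "finsum ?F (%e. T (z e) e) E x = finsum N (%e. T (z e) e x) E" by (rule funsp_finsum[OF N c x])
   also have "... = finsum N (%e. z (sm X (\<epsilon> e x) e)) E"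
    by (rule N.M.finsum_cong'[OF refl]) (use x d kl_closed[OF z] X N in \<open>auto simp: T_def tensor_def kl_sm[OF z]\<close>)
   also have "... = z (finsum X (%e. sm X (\<epsilon> e x) e) E)"
    by (rule kl_finsum[OF X N z, symmetric]) (use x d X in auto)
   finally show "finsum ?F (%e. T (z e) e) E x = restrict z (carrier X) x" using d(4)[OF x] x by simp
  qed
  finally show ?thesis .
 qed
 thus thesis using that[OF v] by blast
qed

lemma hom_sm: "md N ==> c \<in> carrier K ==> hom N N (sm N c)"
proof (rule mhomI)
 assume N: "md N" and c: "c \<in> carrier K"
 interpret V: left_module K "vs N" by (rule left_module_vs[OF N])
 fix x y assume "x \<in> carrier N" "y \<in> carrier N"
 thus "sm N c (x \<oplus>[N] y) = sm N c x \<oplus>[N] sm N c y" using V.smult_r_distr[OF c] by simp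
qed (auto simp: smult_sm)

lemma ig_zero: "md X ==> md N ==> ig X N (%x. \<zero>[N])"
proof (rule ig_cong[OF ig_basic[OF _ _ G.one_closed kl_const_zero[of N]]])
 assume N: "md N"
 interpret N: left_module R N by (rule N)
 show "\<zero>[N] = igb X N \<one>[G] (%x. \<zero>[N]) x" for x using N by (simp add: igb_def)
qed auto

text \<open>A functional that kills all \<open>g \<phi> - \<phi>\<close> is represented by an equivariant map, by
  invariance of the trace form. So orthogonality to equivariant maps suffices.\<close>

lemma ig_if_trace_orthogonal:
 assumes X: "md X" and N: "md N" and D: "dbasis X E \<epsilon>" and z: "kl X N z"
  and orth: "!!v. hom N X v ==> trc E \<epsilon> (%x. v (z x)) = \<zero>[K]"
 shows "ig X N z"
proof (rule ccontr)
 assume no: "~ ig X N z"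
 interpret X: left_module R X by (rule X)
 interpret N: left_module R N by (rule N)
 let ?F = "funsp (carrier X) N"
 define U where "U = {restrict z (carrier X) | z. ig X N z}"
 have sub: "subsp K ?F U" unfolding subsp_def
 proof (intro conjI ballI)
  show "U \<subseteq> carrier ?F" using kl_closed[OF ig_kl[OF X N]] by (auto simp: U_def funsp_simps)
  show "\<zero>[?F] \<in> U" using ig_zero[OF X N] by (auto simp: U_def funsp_simps)
 next
  fix a b assume "a \<in> U" "b \<in> U"
  then obtain y y' where y: "ig X N y" "a = restrict y (carrier X)" "ig X N y'" "b = restrict y' (carrier X)" by (auto simp: U_def)
  have "a \<oplus>[?F] b = restrict (%x. y x \<oplus>[N] y' x) (carrier X)"
   unfolding funsp_simps y by (rule restrict_ext) simp
  thus "a \<oplus>[?F] b \<in> U" using ig_sum[OF X N y(1,3)] by (auto simp: U_def)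
 next
  fix c a assume "c \<in> carrier K" "a \<in> U"
  then obtain y where y: "ig X N y" "a = restrict y (carrier X)" and c: "c \<in> carrier K" by (auto simp: U_def)
  have "c \<odot>[?F] a = restrict (%x. sm N c (y x)) (carrier X)"
   unfolding funsp_simps y by (rule restrict_ext) simp
  thus "c \<odot>[?F] a \<in> U" using ig_post[OF X N N hom_sm[OF N c] y(1)] by (auto simp: U_def)
 qed
 have zF: "restrict z (carrier X) \<in> carrier ?F" using kl_closed[OF z] by (auto simp: funsp_simps)
 have zU: "restrict z (carrier X) \<notin> U"
 proof
  assume "restrict z (carrier X) \<in> U"
  then obtain y where y: "ig X N y" "restrict z (carrier X) = restrict y (carrier X)" by (auto simp: U_def)
  have "ig X N z" by (rule ig_cong[OF y(1)]) (use fun_cong[OF y(2)] in \<open>simp add: restrict_def split: if_splits\<close>, metis)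
  thus False using no by simp
 qed
 obtain \<Lambda> where L: "mhom K ?F (scalars K) \<Lambda>" "\<forall>u\<in>U. \<Lambda> u = \<zero>[K]" "\<Lambda> (restrict z (carrier X)) = \<one>[K]"
  using separating_functional_exists[OF K.field_axioms funsp_module[OF N] sub zF zU] by blast
 obtain v where v: "kl N X v" and vt: "!!z. kl X N z ==> trc E \<epsilon> (%x. v (z x)) = \<Lambda> (restrict z (carrier X))"
  using represent_functional[OF X N D L(1)] by metis
 have vc: "!!n. n \<in> carrier N ==> v n \<in> carrier X" using kl_closed[OF v] .
 have "hom N X v"
 proof (rule homI_kl[OF N X v])
  fix g n assume g: "g \<in> carrier G" and n: "n \<in> carrier N"
  let ?w = "%n. ga X (inv[G] g) (v (ga N g n))"
  have kw: "kl N X ?w" by (rule kl_comp[OF kl_comp[OF kl_ga[OF N] v] kl_ga[OF X]])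
  have kv: "kl N X (%n. \<ominus>[X] v n)" by (rule kl_neg[OF X v])
  have "trc E \<epsilon> (%x. ?w (\<phi> x) \<oplus>[X] (\<ominus>[X] v (\<phi> x))) = \<zero>[K]" if p: "kl X N \<phi>" for \<phi>
  proof -
   have pc: "!!x. x \<in> carrier X ==> \<phi> x \<in> carrier N" using kl_closed[OF p] .
   have c: "kl X N (%x. ga N g (\<phi> (ga X (inv[G] g) x)))" by (rule kl_conj[OF X N p])
   have "trc E \<epsilon> (%x. ?w (\<phi> x)) = trc E \<epsilon> (%x. v (ga N g (\<phi> (ga X (inv[G] g) x))))"
    by (rule trc_commute[OF X X D D kl_comp[OF kl_comp[OF p kl_ga[OF N]] v] kl_ga[OF X]])
   hence "trc E \<epsilon> (%x. ?w (\<phi> x) \<oplus>[X] (\<ominus>[X] v (\<phi> x))) =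
     trc E \<epsilon> (%x. v (ga N g (\<phi> (ga X (inv[G] g) x)))) \<oplus>[K] trc E \<epsilon> (%x. \<ominus>[X] v (\<phi> x))"
    using trc_add[OF D kl_comp[OF p kw] kl_comp[OF p kv]] by simp
   also have "... = trc E \<epsilon> (%x. v (ga N g (\<phi> (ga X (inv[G] g) x))) \<oplus>[X] (\<ominus>[X] v (\<phi> x)))"
    by (rule trc_add[OF D kl_comp[OF c v] kl_comp[OF p kv], symmetric])
   also have "... = trc E \<epsilon> (%x. v (igb X N g \<phi> x))"
    by (rule trc_cong[OF D kl_sum[OF X kl_comp[OF c v] kl_comp[OF p kv]]])
     (use X N pc in \<open>simp add: igb_def kl_add[OF v] kl_minus[OF N X v]\<close>)
   also have "... = \<zero>[K]"
    unfolding vt[OF igb_kl[OF X N p]] using L(2) ig_basic[OF X N g p] by (auto simp: U_def)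
   finally show ?thesis .
  qed
  from trc_nondegenerate[OF X N D kl_sum[OF X kw kv] this n]
  have "?w n \<ominus>[X] v n = \<zero>[X]" by (simp add: a_minus_def)
  hence "?w n = v n" using X.M.diff_eq_zero_iff N X n vc by simp
  hence "ga X g (?w n) = ga X g (v n)" by simp
  thus "v (ga N g n) = ga X g (v n)" using X N g n vc by (simp add: ga_ga ga_one)
 qed
 hence "trc E \<epsilon> (%x. v (z x)) = \<zero>[K]" by (rule orth)
 thus False using vt[OF z] L(3) by simp
qed

text \<open>A functional that kills all traces is represented by a map of vanishing trace, because taking
  traces is self-adjoint.\<close>

lemma trace_zero_separation:
 assumes Y: "md Y" and D: "dbasis Y E \<epsilon>" and x: "kl Y Y x"
  and V: "!!v. v \<in> \<V> ==> hom Y Y v" "!!v v'. v \<in> \<V> ==> v' \<in> \<V> ==> (%y. v y \<oplus>[Y] v' y) \<in> \<V>"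
   "!!c v. c \<in> carrier K ==> v \<in> \<V> ==> (%y. sm Y c (v y)) \<in> \<V>" "v0 \<in> \<V>"
  and no: "!!u v. kl Y Y u ==> v \<in> \<V> ==> \<exists>y\<in>carrier Y. x y ~= tr Y Y u y \<oplus>[Y] v y"
 obtains w where "kl Y Y w" "\<forall>y\<in>carrier Y. tr Y Y w y = \<zero>[Y]" "trc E \<epsilon> (%y. w (x y)) = \<one>[K]"
  "\<forall>v\<in>\<V>. trc E \<epsilon> (%y. w (v y)) = \<zero>[K]"
proof -
 interpret Y: left_module R Y by (rule Y)
 let ?F = "funsp (carrier Y) Y"
 define U where "U = {\<lambda>y\<in>carrier Y. tr Y Y u y \<oplus>[Y] v y | u v. kl Y Y u & v \<in> \<V>}"
 have trk: "kl Y Y (tr Y Y u)" if "kl Y Y u" for u by (rule hom_kl[OF tr_hom[OF Y Y that]])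
 have mem: "(\<lambda>y\<in>carrier Y. tr Y Y u y \<oplus>[Y] v y) \<in> U" if "kl Y Y u" "v \<in> \<V>" for u v
  unfolding U_def by (rule CollectI, rule exI[of _ u], rule exI[of _ v]) (use that in simp)
 have sub: "subsp K ?F U" unfolding subsp_def
 proof (intro conjI ballI)
  show "U \<subseteq> carrier ?F" using kl_closed[OF trk] mhom_closed[OF V(1)] Y by (auto simp: U_def funsp_simps)
  have z: "\<zero>[?F] = (\<lambda>y\<in>carrier Y. tr Y Y (%y. \<zero>[Y]) y \<oplus>[Y] sm Y \<zero>[K] (v0 y))"
   unfolding funsp_simps by (rule restrict_ext) (use mhom_closed[OF V(1)[OF V(4)]] Y in \<open>simp add: tr_def Y.M.finsum_zero\<close>)
  show "\<zero>[?F] \<in> U" unfolding z by (rule mem[OF kl_const_zero[OF Y] V(3)[OF K.zero_closed V(4)]])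
 next
  fix a b assume "a \<in> U" "b \<in> U"
  then obtain u v u' v' where y: "kl Y Y u" "v \<in> \<V>" "a = (\<lambda>y\<in>carrier Y. tr Y Y u y \<oplus>[Y] v y)"
   "kl Y Y u'" "v' \<in> \<V>" "b = (\<lambda>y\<in>carrier Y. tr Y Y u' y \<oplus>[Y] v' y)" by (auto simp: U_def)
  have "a \<oplus>[?F] b = (\<lambda>y\<in>carrier Y. tr Y Y (%y. u y \<oplus>[Y] u' y) y \<oplus>[Y] (v y \<oplus>[Y] v' y))"
   unfolding funsp_simps y(3,6)
   by (rule restrict_ext)
    (use kl_closed[OF trk[OF y(1)]] kl_closed[OF trk[OF y(4)]] mhom_closed[OF V(1)[OF y(2)]] mhom_closed[OF V(1)[OF y(5)]] in
     \<open>simp add: tr_sum[OF Y Y y(1,4)] Y.M.a_ac\<close>)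
  thus "a \<oplus>[?F] b \<in> U" using mem[OF kl_sum[OF Y y(1,4)] V(2)[OF y(2,5)]] by simp
 next
  fix c a assume c: "c \<in> carrier K" and "a \<in> U"
  then obtain u v where y: "kl Y Y u" "v \<in> \<V>" "a = (\<lambda>y\<in>carrier Y. tr Y Y u y \<oplus>[Y] v y)" by (auto simp: U_def)
  have "c \<odot>[?F] a = (\<lambda>y\<in>carrier Y. tr Y Y (%y. sm Y c (u y)) y \<oplus>[Y] sm Y c (v y))"
   unfolding funsp_simps y(3)
   by (rule restrict_ext)
    (use kl_closed[OF trk[OF y(1)]] mhom_closed[OF V(1)[OF y(2)]] in
     \<open>simp add: mhom_add[OF hom_sm[OF Y c]] hom_tr[OF Y Y Y y(1) hom_sm[OF Y c]]\<close>)
  thus "c \<odot>[?F] a \<in> U" using mem[OF kl_comp[OF y(1) hom_kl[OF hom_sm[OF Y c]]] V(3)[OF c y(2)]] by simp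
 qed
 have xF: "restrict x (carrier Y) \<in> carrier ?F" using kl_closed[OF x] by (auto simp: funsp_simps)
 have xU: "restrict x (carrier Y) \<notin> U"
 proof
  assume "restrict x (carrier Y) \<in> U"
  then obtain u v where y: "kl Y Y u" "v \<in> \<V>" "restrict x (carrier Y) = (\<lambda>y\<in>carrier Y. tr Y Y u y \<oplus>[Y] v y)" by (auto simp: U_def)
  have "x y = tr Y Y u y \<oplus>[Y] v y" if yY: "y \<in> carrier Y" for y using fun_cong[OF y(3), of y] yY by simp
  thus False using no[OF y(1,2)] by blast
 qed
 obtain \<Lambda> where L: "mhom K ?F (scalars K) \<Lambda>" "\<forall>u\<in>U. \<Lambda> u = \<zero>[K]" "\<Lambda> (restrict x (carrier Y)) = \<one>[K]"
  using separating_functional_exists[OF K.field_axioms funsp_module[OF Y] sub xF xU] by blast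
 obtain w where w: "kl Y Y w" and wt: "!!z. kl Y Y z ==> trc E \<epsilon> (%x. w (z x)) = \<Lambda> (restrict z (carrier Y))"
  using represent_functional[OF Y Y D L(1)] by metis
 have "tr Y Y w y = \<zero>[Y]" if yY: "y \<in> carrier Y" for y
 proof (rule trc_nondegenerate[OF Y Y D trk[OF w] _ yY])
  fix u assume u: "kl Y Y u"
  have e: "restrict (tr Y Y u) (carrier Y) = (\<lambda>y\<in>carrier Y. tr Y Y u y \<oplus>[Y] sm Y \<zero>[K] (v0 y))"
   by (rule restrict_ext) (use kl_closed[OF trk[OF u]] mhom_closed[OF V(1)[OF V(4)]] Y in simp)
  have "restrict (tr Y Y u) (carrier Y) \<in> U" unfolding e by (rule mem[OF u V(3)[OF K.zero_closed V(4)]])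
  thus "trc E \<epsilon> (%y. tr Y Y w (u y)) = \<zero>[K]"
   using trc_adjoint[OF Y D w u] wt[OF trk[OF u]] L(2) by simp
 qed
 moreover have "trc E \<epsilon> (%y. w (v y)) = \<zero>[K]" if v: "v \<in> \<V>" for v
 proof -
  have e: "restrict v (carrier Y) = (\<lambda>y\<in>carrier Y. tr Y Y (%y. \<zero>[Y]) y \<oplus>[Y] v y)"
   by (rule restrict_ext) (use mhom_closed[OF V(1)[OF v]] Y in \<open>simp add: tr_def Y.M.finsum_zero\<close>)
  have "restrict v (carrier Y) \<in> U" unfolding e by (rule mem[OF kl_const_zero[OF Y] v])
  thus ?thesis using wt[OF hom_kl[OF V(1)[OF v]]] L(2) by simp
 qed
 moreover have "trc E \<epsilon> (%y. w (x y)) = \<one>[K]" using wt[OF x] L(3) by simp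
 ultimately show thesis using that[OF w] by blast
qed

lemma tr_inverse:
 assumes M: "md M" and N: "md N" and u: "kl M N u" and x: "x \<in> carrier M"
 shows "tr M N u x = finsum N (%g. ga N (inv[G] g) (u (ga M g x))) (carrier G)"
proof -
 interpret N: left_module R N by (rule N)
 let ?f = "%g. ga N g (u (ga M (inv[G] g) x))"
 have c: "?f \<in> A \<rightarrow> carrier N" for A using kl_closed[OF u] M N x by auto
 have "tr M N u x = finsum N ?f ((%g. inv[G] g) ` carrier G)" unfolding tr_def inv_image ..
 also have "... = finsum N (%g. ?f (inv[G] g)) (carrier G)" by (rule N.M.finsum_reindex[OF c inj_inv])
 also have "... = finsum N (%g. ga N (inv[G] g) (u (ga M g x))) (carrier G)"
  by (rule N.M.finsum_cong'[OF refl]) (use kl_closed[OF u] M N x in auto)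
 finally show ?thesis .
qed

text \<open>This is the vanishing of the action of stably trivial maps on Tate cohomology.\<close>

lemma ig_through_trace:
 assumes M: "md M" and N: "md N" and z: "kl M N z" and z0: "!!x. x \<in> carrier M ==> tr M N z x = \<zero>[N]" and t: "sz M M t"
 shows "ig M N (%x. z (t x))"
proof -
 interpret N: left_module R N by (rule N)
 interpret M: left_module R M by (rule M)
 obtain u where u: "kl M M u" "\<forall>x\<in>carrier M. t x = tr M M u x" using t by (auto simp: sz_def)
 let ?p = "%g m. ga N (inv[G] g) (z (ga M g (u m)))"
 have uc: "!!x. x \<in> carrier M ==> u x \<in> carrier M" using kl_closed[OF u(1)] .
 have zc: "!!x. x \<in> carrier M ==> z x \<in> carrier N" using kl_closed[OF z] .
 have k: "kl M N (?p g)" for g by (rule kl_comp[OF kl_comp[OF kl_comp[OF u(1) kl_ga[OF M]] z] kl_ga[OF N]])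
 show ?thesis
 proof (rule igI[OF k])
  fix x assume x: "x \<in> carrier M"
  have c1: "(%g. z (ga M g (u (ga M (inv[G] g) x)))) \<in> carrier G \<rightarrow> carrier N" using M N x uc zc by auto
  have c2: "(%g. ?p g x) \<in> carrier G \<rightarrow> carrier N" using M N x uc zc by auto
  have "z (t x) = z (finsum M (%g. ga M g (u (ga M (inv[G] g) x))) (carrier G))" using u(2) x by (simp add: tr_def)
  also have "... = finsum N (%g. z (ga M g (u (ga M (inv[G] g) x)))) (carrier G)"
   by (rule kl_finsum[OF M N z]) (use M x uc in auto)
  finally have 1: "z (t x) = finsum N (%g. z (ga M g (u (ga M (inv[G] g) x)))) (carrier G)" .
  have 2: "finsum N (%g. ?p g x) (carrier G) = \<zero>[N]"
   using tr_inverse[OF M N z uc[OF x]] z0[OF uc[OF x]] by simp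
  have "finsum N (%g. igb M N g (?p g) x) (carrier G) \<oplus>[N] finsum N (%g. ?p g x) (carrier G) =
   finsum N (%g. igb M N g (?p g) x \<oplus>[N] ?p g x) (carrier G)"
   by (rule N.M.finsum_addf[symmetric]) (use c2 igb_closed[OF M N k x] in auto)
  also have "... = finsum N (%g. z (ga M g (u (ga M (inv[G] g) x)))) (carrier G)"
  proof (rule N.M.finsum_cong'[OF refl c1])
   fix g assume g: "g \<in> carrier G"
   have a: "z (ga M g (u (ga M (inv[G] g) x))) \<in> carrier N" "?p g x \<in> carrier N" using M N x uc zc by auto
   have "ga N g (?p g (ga M (inv[G] g) x)) = z (ga M g (u (ga M (inv[G] g) x)))"
    using ga_ga[OF N g G.inv_closed[OF g] a(1)] ga_one[OF N a(1)] g by simp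
   thus "igb M N g (?p g) x \<oplus>[N] ?p g x = z (ga M g (u (ga M (inv[G] g) x)))"
    using a by (simp add: igb_def N.M.a_assoc N.M.l_neg)
  qed
  finally show "z (t x) = finsum N (%g. igb M N g (?p g) x) (carrier G)"
   unfolding 1 2 using N.M.finsum_closed[of "%g. igb M N g (?p g) x" "carrier G"] igb_closed[OF M N k x] by simp
 qed
qed

text \<open>The stable idempotent \<open>i p\<close> acts as a projection up to traces, which \<open>w\<close> cannot
  see; so the form pairs the class of the compression with the identity to one.\<close>

lemma trc_split_idempotent:
 assumes S: "md S" and Y: "md Y" and D: "dbasis Y E \<epsilon>" and i: "hom S Y i" and p: "hom Y S p"
  and e: "st S S (%x. p (i x)) (%x. x)" and w: "kl Y Y w" and w0: "\<forall>y\<in>carrier Y. tr Y Y w y = \<zero>[Y]"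
  and w1: "trc E \<epsilon> (%y. w (i (p y))) = \<one>[K]"
 shows "~ ig S S (%s. p (w (i s)))"
proof
 assume "ig S S (%s. p (w (i s)))"
 from ig_post[OF Y S Y i ig_pre[OF Y S S p this]] have "ig Y Y (%y. i (p (w (i (p y)))))" .
 from trc_ig[OF Y Y D this mhom_id] have 0: "trc E \<epsilon> (%y. i (p (w (i (p y))))) = \<zero>[K]" .
 obtain t where t: "sz S S t" "\<forall>x\<in>carrier S. p (i x) = x \<oplus>[S] t x" using e by (auto simp: st_def)
 have "sz Y Y (%y. i (t (p y)))" by (rule sz_post[OF Y S Y sz_pre[OF Y S S p t(1)] i])
 then obtain u where u: "kl Y Y u" "\<forall>x\<in>carrier Y. i (t (p x)) = tr Y Y u x" by (auto simp: sz_def)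
 have ip: "kl Y Y (%y. i (p y))" by (rule hom_kl[OF mhom_comp[OF p i]])
 have tru: "kl Y Y (tr Y Y u)" by (rule hom_kl[OF tr_hom[OF Y Y u(1)]])
 have "trc E \<epsilon> (%y. i (p (w (i (p y))))) = trc E \<epsilon> (%y. w (i (p (i (p y)))))"
  by (rule trc_commute[OF Y Y D D kl_comp[OF ip w] ip])
 also have "... = trc E \<epsilon> (%y. w (i (p y)) \<oplus>[Y] w (tr Y Y u y))"
 proof (rule trc_cong[OF D kl_comp[OF kl_comp[OF ip ip] w]])
  fix y assume y: "y \<in> carrier Y"
  have c: "p y \<in> carrier S" "i (p y) \<in> carrier Y" using mhom_closed[OF p y] mhom_closed[OF i] by auto
  have tc: "t (p y) \<in> carrier S" by (rule st_closed[OF S S t(1) c(1)])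
  have "i (p (i (p y))) = i (p y) \<oplus>[Y] tr Y Y u y"
   using bspec[OF t(2) c(1)] bspec[OF u(2) y] by (simp add: mhom_add[OF i c(1) tc])
  thus "w (i (p (i (p y)))) = w (i (p y)) \<oplus>[Y] w (tr Y Y u y)"
   using kl_add[OF w c(2) kl_closed[OF tru y]] by simp
 qed
 also have "... = trc E \<epsilon> (%y. w (i (p y))) \<oplus>[K] trc E \<epsilon> (%y. w (tr Y Y u y))"
  by (rule trc_add[OF D kl_comp[OF ip w] kl_comp[OF tru w]])
 also have "trc E \<epsilon> (%y. w (tr Y Y u y)) = trc E \<epsilon> (%y. tr Y Y w (u y))" by (rule trc_adjoint[OF Y D w u(1)])
 also have "... = trc E \<epsilon> (%y. \<zero>[Y])"
  by (rule trc_cong[OF D kl_comp[OF u(1) hom_kl[OF tr_hom[OF Y Y w]]]]) (use w0 kl_closed[OF u(1)] in auto)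
 finally show False using 0 w1 trc_zero[OF Y D] by simp
qed

lemma tr_conjugate_zero:
 assumes S: "md S" and Y: "md Y" and i: "hom S Y i" and p: "hom Y S p" and w: "kl Y Y w"
  and w0: "\<forall>y\<in>carrier Y. tr Y Y w y = \<zero>[Y]" and s: "s \<in> carrier S"
 shows "tr S S (%s. p (w (i s))) s = \<zero>[S]"
 using hom_tr[OF S Y S kl_comp[OF hom_kl[OF i] w] p s] tr_comp_hom[OF S Y Y i w s] w0 mhom_closed[OF i s] mhom_zero[OF Y S p] by simp

lemma stable_identity_if_idempotent_eq:
 assumes S: "md S" and Y: "md Y" and i: "hom S Y i" and p: "hom Y S p" and e: "st S S (%x. p (i x)) (%x. x)"
  and u: "kl Y Y u" and v: "hom Y Y v" and eq: "\<forall>y\<in>carrier Y. i (p y) = tr Y Y u y \<oplus>[Y] v y"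
 shows "st S S (%x. p (v (i x))) (%x. x)"
proof -
 have pi: "hom S S (%x. p (i x))" by (rule mhom_comp[OF i p])
 have pvi: "hom S S (%x. p (v (i x)))" by (rule mhom_comp[OF mhom_comp[OF i v] p])
 have pipi: "hom S S (%x. p (i (p (i x))))" by (rule mhom_comp[OF pi pi])
 have t: "sz S S (%x. p (tr Y Y u (i x)))" by (rule sz_post[OF S Y S sz_pre[OF S Y Y i sz_tr[OF u]] p])
 have "st S S (%x. p (i (p (i x)))) (%x. p (v (i x)))" unfolding st_def
 proof (intro exI[of _ "%x. p (tr Y Y u (i x))"] conjI ballI t)
  fix x assume x: "x \<in> carrier S"
  have c: "i x \<in> carrier Y" "tr Y Y u (i x) \<in> carrier Y" "v (i x) \<in> carrier Y"
   using mhom_closed[OF i x] kl_closed[OF hom_kl[OF tr_hom[OF Y Y u]]] mhom_closed[OF v] by auto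
  interpret Ss: left_module R S by (rule S)
  show "p (i (p (i x))) = p (v (i x)) \<oplus>[S] p (tr Y Y u (i x))"
   unfolding bspec[OF eq c(1)] mhom_add[OF p c(2,3)] using mhom_closed[OF p] c by (simp add: Ss.M.a_comm)
 qed
 hence 1: "st S S (%x. p (v (i x))) (%x. p (i (p (i x))))" by (rule st_sym[OF S S pvi])
 have 2: "st S S (%x. p (i (p (i x)))) (%x. p (i x))" by (rule st_pre[OF S S S pi e])
 show ?thesis by (rule st_trans[OF S S mhom_id 1 st_trans[OF S S mhom_id 2 e]])
qed

text \<open>Tate duality, applied to the identity of \<open>S\<close>: since the identity does not stably factor through \<open>f\<close>, some class in
  degree minus one pairs to one with the identity and to zero with all maps through \<open>f\<close>. The latter
  says that \<open>f\<close> kills the class. The class is built on the finite dimensional \<open>Y\<close> and compressed to \<open>S\<close>.\<close>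

lemma not_split_mono_detected:
 assumes S: "md S" and N: "md N" and Y: "md Y" and D: "dbasis Y E \<epsilon>" and i: "hom S Y i" and p: "hom Y S p"
  and e: "st S S (%x. p (i x)) (%x. x)" and f: "hom S N f"
  and no: "~ (\<exists>v. hom N S v & st S S (%x. v (f x)) (%x. x))"
 shows "\<exists>w. kl S S w & (\<forall>x\<in>carrier S. tr S S w x = \<zero>[S]) & ~ ig S S w & ig S N (%x. f (w x))"
proof -
 interpret N: left_module R N by (rule N)
 define \<V> where "\<V> = {h. hom Y Y h & (\<exists>v. hom N Y v & (\<forall>y\<in>carrier Y. h y = v (f (p y))))}"
 have fp: "hom Y N (%y. f (p y))" by (rule mhom_comp[OF p f])
 have fpc: "!!y. y \<in> carrier Y ==> f (p y) \<in> carrier N" using mhom_closed[OF fp] .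
 have in_V: "(%y. v (f (p y))) \<in> \<V>" if "hom N Y v" for v
  using that mhom_comp[OF fp that] by (auto simp: \<V>_def)
 have V1: "hom Y Y h" if "h \<in> \<V>" for h using that by (simp add: \<V>_def)
 have V2: "(%y. h y \<oplus>[Y] h' y) \<in> \<V>" if a: "h \<in> \<V>" "h' \<in> \<V>" for h h'
 proof -
  obtain v v' where v: "hom N Y v" "\<forall>y\<in>carrier Y. h y = v (f (p y))" "hom N Y v'" "\<forall>y\<in>carrier Y. h' y = v' (f (p y))"
   using a by (auto simp: \<V>_def)
  show ?thesis unfolding \<V>_def using mhom_sum[OF Y V1[OF a(1)] V1[OF a(2)]] mhom_sum[OF Y v(1,3)] v(2,4)
   by (auto intro!: exI[of _ "%n. v n \<oplus>[Y] v' n"])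
 qed
 have V3: "(%y. sm Y c (h y)) \<in> \<V>" if c: "c \<in> carrier K" and a: "h \<in> \<V>" for c h
 proof -
  obtain v where v: "hom N Y v" "\<forall>y\<in>carrier Y. h y = v (f (p y))" using a by (auto simp: \<V>_def)
  show ?thesis unfolding \<V>_def using mhom_comp[OF V1[OF a] hom_sm[OF Y c]] mhom_comp[OF v(1) hom_sm[OF Y c]] v(2)
   by (auto intro!: exI[of _ "%n. sm Y c (v n)"])
 qed
 have V4: "(%y. \<zero>[Y]) \<in> \<V>" using in_V[OF mhom_const_zero[OF Y]] .
 have V5: "\<exists>y\<in>carrier Y. i (p y) ~= tr Y Y u y \<oplus>[Y] h y" if u: "kl Y Y u" and h: "h \<in> \<V>" for u h
 proof (rule ccontr)
  assume "~ (\<exists>y\<in>carrier Y. i (p y) ~= tr Y Y u y \<oplus>[Y] h y)"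
  hence "st S S (%x. p (h (i x))) (%x. x)"
   by (intro stable_identity_if_idempotent_eq[OF S Y i p e u V1[OF h]]) simp
  moreover obtain v where v: "hom N Y v" "\<forall>y\<in>carrier Y. h y = v (f (p y))" using h by (auto simp: \<V>_def)
  ultimately have 1: "st S S (%x. p (v (f (p (i x))))) (%x. x)"
   by (elim st_cong) (use mhom_closed[OF i] in auto)
  have pvf: "hom S S (%x. p (v (f x)))" by (rule mhom_comp[OF mhom_comp[OF f v(1)] p])
  have pi: "hom S S (%x. p (i x))" by (rule mhom_comp[OF i p])
  have "st S S (%x. p (v (f (p (i x))))) (%x. p (v (f x)))" by (rule st_post[OF S S S mhom_id e pvf])
  hence "st S S (%x. p (v (f x))) (%x. p (v (f (p (i x)))))" by (rule st_sym[OF S S pvf])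
  from st_trans[OF S S mhom_id this 1] mhom_comp[OF v(1) p] show False using no by blast
 qed
 show ?thesis
 proof (rule trace_zero_separation[OF Y D hom_kl[OF mhom_comp[OF p i]] V1 V2 V3 V4 V5])
  fix w assume w: "kl Y Y w" "\<forall>y\<in>carrier Y. tr Y Y w y = \<zero>[Y]" "trc E \<epsilon> (%y. w (i (p y))) = \<one>[K]"
   "\<forall>v\<in>\<V>. trc E \<epsilon> (%y. w (v y)) = \<zero>[K]"
  have "ig Y N (%y. f (p (w y)))"
  proof (rule ig_if_trace_orthogonal[OF Y N D kl_comp[OF w(1) hom_kl[OF fp]]])
   fix v assume v: "hom N Y v"
   have "trc E \<epsilon> (%y. v (f (p (w y)))) = trc E \<epsilon> (%y. w (v (f (p y))))"
    by (rule trc_commute[OF Y Y D D w(1) hom_kl[OF mhom_comp[OF fp v]]])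
   thus "trc E \<epsilon> (%y. v (f (p (w y)))) = \<zero>[K]" using bspec[OF w(4) in_V[OF v]] by simp
  qed
  hence "ig S N (%x. f (p (w (i x))))" by (rule ig_pre[OF S Y N i])
  thus ?thesis
   using kl_comp[OF kl_comp[OF hom_kl[OF i] w(1)] hom_kl[OF p]] tr_conjugate_zero[OF S Y i p w(1,2)]
    trc_split_idempotent[OF S Y D i p e w(1-3)]
   by (intro exI[of _ "%x. p (w (i x))"]) simp
 qed
qed

text \<open>The dual statement. Orthogonality is tested between \<open>X\<close> and \<open>Y\<close>, so that the trace form is available,
  and then transported to \<open>M\<close> at the cost of a stably trivial correction.\<close>

lemma not_split_epi_detected:
 assumes M: "md M" and N: "md N" and Y: "md Y" and D: "dbasis Y E \<epsilon>" and i: "hom N Y i" and p: "hom Y N p"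
  and e: "st N N (%x. p (i x)) (%x. x)"
  and X: "md X" and D': "dbasis X F \<delta>" and j: "hom M X j" and q: "hom X M q"
  and e': "st M M (%x. q (j x)) (%x. x)" and f: "hom M N f"
  and no: "~ (\<exists>v. hom N M v & st N N (%x. f (v x)) (%x. x))"
 shows "\<exists>w. kl N N w & (\<forall>x\<in>carrier N. tr N N w x = \<zero>[N]) & ~ ig N N w & ig M N (%x. w (f x))"
proof -
 interpret N: left_module R N by (rule N)
 define \<V> where "\<V> = {h. hom Y Y h & (\<exists>v. hom Y M v & (\<forall>y\<in>carrier Y. h y = i (f (v y))))}"
 have jf: "hom M Y (%y. i (f y))" by (rule mhom_comp[OF f i])
 have in_V: "(%y. i (f (v y))) \<in> \<V>" if "hom Y M v" for v
  using that mhom_comp[OF that jf] by (auto simp: \<V>_def)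
 have V1: "hom Y Y h" if "h \<in> \<V>" for h using that by (simp add: \<V>_def)
 have V2: "(%y. h y \<oplus>[Y] h' y) \<in> \<V>" if a: "h \<in> \<V>" "h' \<in> \<V>" for h h'
 proof -
  obtain v v' where v: "hom Y M v" "\<forall>y\<in>carrier Y. h y = i (f (v y))" "hom Y M v'" "\<forall>y\<in>carrier Y. h' y = i (f (v' y))"
   using a by (auto simp: \<V>_def)
  show ?thesis unfolding \<V>_def using mhom_sum[OF Y V1[OF a(1)] V1[OF a(2)]] mhom_sum[OF M v(1,3)] v(2,4)
   by (auto intro!: exI[of _ "%n. v n \<oplus>[M] v' n"] simp: mhom_add[OF jf mhom_closed[OF v(1)] mhom_closed[OF v(3)]])
 qed
 have V3: "(%y. sm Y c (h y)) \<in> \<V>" if c: "c \<in> carrier K" and a: "h \<in> \<V>" for c h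
 proof -
  obtain v where v: "hom Y M v" "\<forall>y\<in>carrier Y. h y = i (f (v y))" using a by (auto simp: \<V>_def)
  show ?thesis unfolding \<V>_def using mhom_comp[OF V1[OF a] hom_sm[OF Y c]] mhom_comp[OF v(1) hom_sm[OF M c]] v(2)
   by (auto intro!: exI[of _ "%n. sm M c (v n)"] simp: kl_sm[OF hom_kl[OF jf] c mhom_closed[OF v(1)]])
 qed
 have V4: "(%y. i (f \<zero>[M])) \<in> \<V>" using in_V[OF mhom_const_zero[OF M]] .
 have V5: "\<exists>y\<in>carrier Y. i (p y) ~= tr Y Y u y \<oplus>[Y] h y" if u: "kl Y Y u" and h: "h \<in> \<V>" for u h
 proof (rule ccontr)
  assume "~ (\<exists>y\<in>carrier Y. i (p y) ~= tr Y Y u y \<oplus>[Y] h y)"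
  hence "st N N (%x. p (h (i x))) (%x. x)"
   by (intro stable_identity_if_idempotent_eq[OF N Y i p e u V1[OF h]]) simp
  moreover obtain v where v: "hom Y M v" "\<forall>y\<in>carrier Y. h y = i (f (v y))" using h by (auto simp: \<V>_def)
  ultimately have 1: "st N N (%x. p (i (f (v (i x))))) (%x. x)"
   by (elim st_cong) (use mhom_closed[OF i] in auto)
  have fvi: "hom N N (%x. f (v (i x)))" by (rule mhom_comp[OF mhom_comp[OF i v(1)] f])
  have "st N N (%x. p (i (f (v (i x))))) (%x. f (v (i x)))" by (rule st_pre[OF N N N fvi e])
  hence "st N N (%x. f (v (i x))) (%x. p (i (f (v (i x)))))" by (rule st_sym[OF N N fvi])
  from st_trans[OF N N mhom_id this 1] mhom_comp[OF i v(1)] show False using no by blast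
 qed
 show ?thesis
 proof (rule trace_zero_separation[OF Y D hom_kl[OF mhom_comp[OF p i]] V1 V2 V3 V4 V5])
  fix w assume w: "kl Y Y w" "\<forall>y\<in>carrier Y. tr Y Y w y = \<zero>[Y]" "trc E \<epsilon> (%y. w (i (p y))) = \<one>[K]"
   "\<forall>v\<in>\<V>. trc E \<epsilon> (%y. w (v y)) = \<zero>[K]"
  let ?w = "%x. p (w (i x))"
  have kw: "kl N N ?w" by (rule kl_comp[OF kl_comp[OF hom_kl[OF i] w(1)] hom_kl[OF p]])
  have kz: "kl X Y (%x. w (i (f (q x))))" by (rule kl_comp[OF hom_kl[OF mhom_comp[OF q jf]] w(1)])
  have "ig X Y (%x. w (i (f (q x))))"
  proof (rule ig_if_trace_orthogonal[OF X Y D' kz])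
   fix v assume v: "hom Y X v"
   have "trc F \<delta> (%x. v (w (i (f (q x))))) = trc E \<epsilon> (%y. w (i (f (q (v y)))))"
    by (rule trc_commute[OF X Y D' D kz hom_kl[OF v]])
   thus "trc F \<delta> (%x. v (w (i (f (q x))))) = \<zero>[K]" using bspec[OF w(4) in_V[OF mhom_comp[OF v q]]] by simp
  qed
  from ig_post[OF M Y N p ig_pre[OF M X Y j this]] have 1: "ig M N (%x. ?w (f (q (j x))))" .
  obtain t where t: "sz M M t" "\<forall>x\<in>carrier M. q (j x) = x \<oplus>[M] t x" using e' by (auto simp: st_def)
  have kwf: "kl M N (%x. ?w (f x))" by (rule kl_comp[OF hom_kl[OF f] kw])
  have "ig M N (%x. ?w (f (t x)))"
  proof (rule ig_through_trace[OF M N kwf _ t(1)])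
   fix x assume x: "x \<in> carrier M"
   show "tr M N (%x. ?w (f x)) x = \<zero>[N]"
    using tr_comp_hom[OF M N N f kw x] tr_conjugate_zero[OF N Y i p w(1,2) mhom_closed[OF f x]] by simp
  qed
  from ig_sum[OF M N 1 ig_post[OF M N N mhom_neg[OF N mhom_id] this]]
  have "ig M N (%x. ?w (f x))"
  proof (rule ig_cong)
   fix x assume x: "x \<in> carrier M"
   have tc: "t x \<in> carrier M" by (rule st_closed[OF M M t(1) x])
   have "?w (f (q (j x))) = ?w (f x) \<oplus>[N] ?w (f (t x))" using bspec[OF t(2) x] kl_add[OF kwf x tc] by simp
   thus "?w (f x) = ?w (f (q (j x))) \<oplus>[N] \<ominus>[N] ?w (f (t x))"
    using kl_closed[OF kwf x] kl_closed[OF kwf tc] by (simp add: N.M.a_assoc N.M.r_neg)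
  qed
  thus ?thesis
   using kw tr_conjugate_zero[OF N Y i p w(1,2)] trc_split_idempotent[OF N Y D i p e w(1-3)]
   by (intro exI[of _ ?w]) simp
 qed
qed

end

context kG begin

section \<open>Classes in negative Tate cohomology and double (de)suspensions\<close>

text \<open>With \<open>\<phi>\<close> at \<open>g\<close> equal to the translate of \<open>\<psi>\<close> at \<open>g\<close> by the inverse of \<open>g\<close>, the two sums are the two parts of the definition.\<close>

lemma ig_conjugates:
 assumes M: "md M" and N: "md N" and k: "!!g. g \<in> carrier G ==> kl M N (\<psi> g)"
  and z: "!!x. x \<in> carrier M ==> z x = finsum N (%g. \<psi> g (ga M (inv[G] g) x)) (carrier G)"
  and z0: "!!x. x \<in> carrier M ==> finsum N (%g. ga N (inv[G] g) (\<psi> g x)) (carrier G) = \<zero>[N]"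
 shows "ig M N z"
proof -
 interpret N: left_module R N by (rule N)
 let ?p = "%g x. ga N (inv[G] g) (\<psi> g x)"
 have kp: "kl M N (?p g)" if "g \<in> carrier G" for g by (rule kl_comp[OF k[OF that] kl_ga[OF N]])
 show ?thesis
 proof (rule igI[OF kp])
  fix x assume x: "x \<in> carrier M"
  have c: "\<psi> g (ga M h x) \<in> carrier N" "\<psi> g x \<in> carrier N" if "g \<in> carrier G" for g h
   using kl_closed[OF k[OF that]] M x by auto
  have "finsum N (%g. igb M N g (?p g) x) (carrier G) \<oplus>[N] finsum N (%g. ?p g x) (carrier G) =
   finsum N (%g. igb M N g (?p g) x \<oplus>[N] ?p g x) (carrier G)"
   by (rule N.M.finsum_addf[symmetric]) (use c N igb_closed[OF M N kp x] in auto)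
  also have "... = finsum N (%g. \<psi> g (ga M (inv[G] g) x)) (carrier G)"
  proof (rule N.M.finsum_cong'[OF refl])
   show "(%g. \<psi> g (ga M (inv[G] g) x)) \<in> carrier G \<rightarrow> carrier N" using c by auto
   fix g assume g: "g \<in> carrier G"
   note a = c[OF g]
   have "ga N g (?p g (ga M (inv[G] g) x)) = \<psi> g (ga M (inv[G] g) x)"
    using ga_ga[OF N g G.inv_closed[OF g] a(1)] ga_one[OF N a(1)] g by simp
   thus "igb M N g (?p g) x \<oplus>[N] ?p g x = \<psi> g (ga M (inv[G] g) x)"
    using a N by (simp add: igb_def N.M.a_assoc N.M.l_neg)
  qed
  finally show "z x = finsum N (%g. igb M N g (?p g) x) (carrier G)"
   unfolding z0[OF x] z[OF x] using N.M.finsum_closed[of "%g. igb M N g (?p g) x" "carrier G"] igb_closed[OF M N kp x] by simp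
 qed
qed

lemma tr_finsum:
 assumes M: "md M" and N: "md N" and A: "finite A" and k: "!!i. i \<in> A ==> kl M N (u i)" and x: "x \<in> carrier M"
 shows "tr M N (%x. finsum N (%i. u i x) A) x = finsum N (%i. tr M N (u i) x) A"
proof -
 interpret N: left_module R N by (rule N)
 have c: "u i (ga M h x) \<in> carrier N" if "i \<in> A" for i h using kl_closed[OF k[OF that]] M x by auto
 have "tr M N (%x. finsum N (%i. u i x) A) x =
   finsum N (%h. finsum N (%i. ga N h (u i (ga M (inv[G] h) x))) A) (carrier G)"
  unfolding tr_def
  by (rule N.M.finsum_cong'[OF refl])
   (use c N kl_finsum[OF N N kl_ga[OF N], of "%i. u i (ga M (inv[G] h) x)" A for h] in \<open>auto intro!: N.M.finsum_closed\<close>)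
 also have "... = finsum N (%i. tr M N (u i) x) A"
  unfolding tr_def by (rule N.M.finsum_swap[OF finG A]) (use c N in auto)
 finally show ?thesis .
qed

lemma coind_map_unit: "hom M N f ==> x \<in> carrier M ==> coind_map N w (coind_unit N (f x)) = coind_map M (%x. w (f x)) (coind_unit M x)"
 by (auto simp: coind_map_def coind_unit_def mhom_smult)

lemma ig_if_trace_into_coind:
 assumes N: "md N" and w: "kl N N w" and V: "kl N (coind N) V" and V0: "!!n. n \<in> carrier N ==> coind_counit N (V n) = \<zero>[N]"
  and t: "!!n. n \<in> carrier N ==> coind_map N w (coind_unit N n) = tr N (coind N) V n"
 shows "ig N N w"
proof (rule ig_conjugates[OF N N, of "%g n. V n (dl g)"])
 interpret N: left_module R N by (rule N)
 note C = coind_md[OF N]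
 have Vc: "!!n. n \<in> carrier N ==> V n \<in> carrier (coind N)" using kl_closed[OF V] .
 show k: "kl N N (%n. V n (dl g))" if "g \<in> carrier G" for g by (rule kl_comp[OF V ev_kl[OF N]]) simp
 fix n assume n: "n \<in> carrier N"
 have "w n = coind_map N w (coind_unit N n) \<one>[R]" by (simp add: coind_map_def unit_one[OF N n])
 also have "... = finsum N (%g. ga (coind N) g (V (ga N (inv[G] g) n)) \<one>[R]) (carrier G)"
  unfolding t[OF n] tr_def by (rule coind_finsum[OF N _ one_R_closed]) (use C Vc N n in auto)
 also have "... = finsum N (%g. V (ga N (inv[G] g) n) (dl g)) (carrier G)"
 proof (rule N.M.finsum_cong'[OF refl])
  show "(%g. V (ga N (inv[G] g) n) (dl g)) \<in> carrier G \<rightarrow> carrier N"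
   using kl_closed[OF k] N n by auto
  show "ga (coind N) g (V (ga N (inv[G] g) n)) \<one>[R] = V (ga N (inv[G] g) n) (dl g)" if "g \<in> carrier G" for g
   using that by (simp add: ga_coind R_one dl_mult_dl)
 qed
 finally show "w n = finsum N (%g. V (ga N (inv[G] g) n) (dl g)) (carrier G)" .
 let ?f = "%g. ga N g (V n (dl (inv[G] g)))"
 have c: "?f \<in> A \<rightarrow> carrier N" if "A \<subseteq> carrier G" for A using coind_eval[OF Vc[OF n]] N by auto
 have "\<zero>[N] = finsum N ?f ((%g. inv[G] g) ` carrier G)"
  using V0[OF n] counit_eq[OF N Vc[OF n]] unfolding inv_image by simp
 also have "... = finsum N (%g. ?f (inv[G] g)) (carrier G)"
  by (rule N.M.finsum_reindex[OF _ inj_inv]) (use c in \<open>simp add: inv_image\<close>)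
 also have "... = finsum N (%g. ga N (inv[G] g) (V n (dl g))) (carrier G)"
  by (rule N.M.finsum_cong'[OF refl]) (use coind_eval[OF Vc[OF n]] N in auto)
 finally show "finsum N (%g. ga N (inv[G] g) (V n (dl g))) (carrier G) = \<zero>[N]" ..
qed

text \<open>The linear map is the difference of the coefficient map at \<open>g\<close>, after the action of \<open>g\<close>, and the one at
  the identity; its group trace is \<open>g \<phi> - \<phi>\<close> followed by the unit, and the counit cancels the two terms.\<close>

lemma trace_into_coind_if_ig:
 assumes M: "md M" and N: "md N" and z: "ig M N z"
 shows "\<exists>U. kl M (coind N) U & (\<forall>m\<in>carrier M. coind_counit N (U m) = \<zero>[N]) &
  (\<forall>m\<in>carrier M. tr M (coind N) U m = coind_map M z (coind_unit M m))"
proof -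
 interpret N: left_module R N by (rule N)
 note C = coind_md[OF N]
 interpret C: left_module R "coind N" by (rule C)
 obtain \<phi> where p': "\<forall>g\<in>carrier G. kl M N (\<phi> g)"
  "\<forall>x\<in>carrier M. z x = finsum N (%g. igb M N g (\<phi> g) x) (carrier G)" by (rule igE[OF z])
 note p = bspec[OF p'(1)] bspec[OF p'(2)]
 define u v where "u = (%g x. coeff_map N g (ga N g (\<phi> g x)))" and "v = (%g x. coeff_map N \<one>[G] (\<phi> g x))"
 have ku: "kl M (coind N) (u g)" and kv: "kl M (coind N) (v g)" if g: "g \<in> carrier G" for g
  unfolding u_def v_def by (rule kl_comp[OF kl_comp[OF p(1)[OF g] kl_ga[OF N]] coeff_map_kl[OF N g]],
   rule kl_comp[OF p(1)[OF g] coeff_map_kl[OF N G.one_closed]])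
 let ?U = "%g x. u g x \<oplus>[coind N] \<ominus>[coind N] v g x"
 have kU: "kl M (coind N) (?U g)" if g: "g \<in> carrier G" for g by (rule kl_sum[OF C ku[OF g] kl_neg[OF C kv[OF g]]])
 have tU: "tr M (coind N) (?U g) m r = igb M N g (\<phi> g) (r \<odot>[M] m)"
  if g: "g \<in> carrier G" and m: "m \<in> carrier M" and r: "r \<in> carrier R" for g m r
 proof -
  have k: "kl M N (%x. ga N g (\<phi> g x))" by (rule kl_comp[OF p(1)[OF g] kl_ga[OF N]])
  have rm: "r \<odot>[M] m \<in> carrier M" using M m r by simp
  have "tr M (coind N) (?U g) m = tr M (coind N) (u g) m \<oplus>[coind N] tr M (coind N) (%x. \<ominus>[coind N] v g x) m"
   by (rule tr_sum[OF M C ku[OF g] kl_neg[OF C kv[OF g]] m])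
  moreover have "tr M (coind N) (%x. \<ominus>[coind N] v g x) m r = \<ominus>[N] \<phi> g (r \<odot>[M] m)"
  proof -
   have kn: "kl M N (%x. \<ominus>[N] \<phi> g x)" by (rule kl_neg[OF N p(1)[OF g]])
   have "tr M (coind N) (%x. \<ominus>[coind N] v g x) m = tr M (coind N) (%x. coeff_map N \<one>[G] (\<ominus>[N] \<phi> g x)) m"
    by (rule tr_cong[OF M C kl_neg[OF C kv[OF g]] _ m])
     (simp add: v_def kl_minus[OF N C coeff_map_kl[OF N G.one_closed]] kl_closed[OF p(1)[OF g]])
   thus ?thesis using tr_coeff_map[OF M N kn G.one_closed m r] ga_one[OF M rm] by simp
  qed
  moreover have "tr M (coind N) (u g) m r = ga N g (\<phi> g (ga M (inv[G] g) (r \<odot>[M] m)))"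
   unfolding u_def by (rule tr_coeff_map[OF M N k g m r])
  ultimately show ?thesis using r by (simp add: igb_def coind_add)
 qed
 have cU: "coind_counit N (?U g m) = \<zero>[N]" if g: "g \<in> carrier G" and m: "m \<in> carrier M" for g m
 proof -
  have a: "\<phi> g m \<in> carrier N" using kl_closed[OF p(1)[OF g] m] .
  have "coind_counit N (?U g m) = coind_counit N (u g m) \<oplus>[N] (\<ominus>[N] coind_counit N (v g m))"
   using mhom_add[OF counit_hom[OF N] kl_closed[OF ku[OF g] m] kl_closed[OF kl_neg[OF C kv[OF g]] m]]
    mhom_minus[OF C N counit_hom[OF N] kl_closed[OF kv[OF g] m]] by simp
  thus ?thesis unfolding u_def v_def using a N g by (simp add: counit_coeff_map ga_ga ga_one N.M.r_neg)
 qed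
 let ?V = "%x. finsum (coind N) (%g. ?U g x) (carrier G)"
 have kV: "kl M (coind N) ?V" by (rule kl_fin_sum[OF C kU M])
 have "coind_counit N (?V m) = \<zero>[N]" if m: "m \<in> carrier M" for m
 proof -
  have "coind_counit N (?V m) = finsum N (%g. coind_counit N (?U g m)) (carrier G)"
   by (rule mhom_finsum[OF C N counit_hom[OF N]]) (use kl_closed[OF kU m] in auto)
  also have "... = finsum N (%g. \<zero>[N]) (carrier G)" by (rule N.M.finsum_cong') (use cU m in auto)
  finally show ?thesis by simp
 qed
 moreover have "tr M (coind N) ?V m = coind_map M z (coind_unit M m)" if m: "m \<in> carrier M" for m
 proof (rule coind_eqI)
  have uc: "coind_unit M m \<in> carrier (coind M)" by (rule unit_closed[OF M m])
  show "coind_map M z (coind_unit M m) \<in> carrier (coind N)"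
   by (rule mhom_closed[OF coind_map_hom[OF M N ig_kl[OF M N z]] uc])
  show "tr M (coind N) ?V m \<in> carrier (coind N)" by (rule tr_closed[OF M C kV m])
  fix r assume r: "r \<in> carrier R"
  have rm: "r \<odot>[M] m \<in> carrier M" using M m r by simp
  have e: "tr M (coind N) ?V m = finsum (coind N) (%g. tr M (coind N) (?U g) m) (carrier G)"
   by (rule tr_finsum[OF M C finG _ m]) (rule kU)
  have "tr M (coind N) ?V m r = finsum N (%g. tr M (coind N) (?U g) m r) (carrier G)"
   unfolding e by (rule coind_finsum[OF N _ r]) (use tr_closed[OF M C kU m] in auto)
  also have "... = finsum N (%g. igb M N g (\<phi> g) (r \<odot>[M] m)) (carrier G)"
   by (rule N.M.finsum_cong'[OF refl]) (use tU m r igb_closed[OF M N p(1) rm] in auto)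
  finally show "tr M (coind N) ?V m r = coind_map M z (coind_unit M m) r"
   using p(2)[OF rm] r by (simp add: coind_map_def coind_unit_def)
 qed
 ultimately show ?thesis using kV by blast
qed

lemma ga_coeff_map:
 assumes M: "md M" and m: "m \<in> carrier M" and h: "h \<in> carrier G"
 shows "ga (coind M) (inv[G] h) (coeff_map M \<one>[G] m) = coeff_map M h m"
proof (rule coind_eqI)
 show "ga (coind M) (inv[G] h) (coeff_map M \<one>[G] m) \<in> carrier (coind M)"
  using coind_md[OF M] coeff_map_closed[OF M G.one_closed m] by auto
 show "coeff_map M h m \<in> carrier (coind M)" by (rule coeff_map_closed[OF M h m])
 fix r assume r: "r \<in> carrier R"
 show "ga (coind M) (inv[G] h) (coeff_map M \<one>[G] m) r = coeff_map M h m r"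
  unfolding ga_coind[OF r] coeff_map_def using r h mult_dl_eval[OF G.inv_closed[OF h] r G.one_closed] by simp
qed

lemma unit_eq_sum_coeff:
 assumes M: "md M" and m: "m \<in> carrier M"
 shows "coind_unit M m = finsum (coind M) (%h. coeff_map M h (ga M h m)) (carrier G)"
proof (rule coind_eqI)
 interpret C: left_module R "coind M" by (rule coind_md[OF M])
 have c: "(%h. coeff_map M h (ga M h m)) \<in> carrier G \<rightarrow> carrier (coind M)" using coeff_map_closed[OF M] M m by auto
 show "coind_unit M m \<in> carrier (coind M)" by (rule unit_closed[OF M m])
 show "finsum (coind M) (%h. coeff_map M h (ga M h m)) (carrier G) \<in> carrier (coind M)" by (rule C.M.finsum_closed[OF c])
 fix r assume r: "r \<in> carrier R"
 show "coind_unit M m r = finsum (coind M) (%h. coeff_map M h (ga M h m)) (carrier G) r"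
  unfolding coind_finsum[OF M c r] using r smult_decomp[OF M r m] by (simp add: coind_unit_def coeff_map_def)
qed

lemma ig_if_trace_out_of_coind:
 assumes M: "md M" and w: "kl M M w" and V: "kl (coind M) M V" and V0: "!!m. m \<in> carrier M ==> V (coind_unit M m) = \<zero>[M]"
  and t: "!!\<xi>. \<xi> \<in> carrier (coind M) ==> tr (coind M) M V \<xi> = coind_counit M (coind_map M w \<xi>)"
 shows "ig M M w"
proof (rule ig_conjugates[OF M M, of "%g m. ga M g (V (coeff_map M g (ga M g m)))"])
 interpret M: left_module R M by (rule M)
 note C = coind_md[OF M]
 have Vc: "V (coeff_map M g x) \<in> carrier M" if "g \<in> carrier G" "x \<in> carrier M" for g x
  using kl_closed[OF V coeff_map_closed[OF M that]] .
 show "kl M M (%m. ga M g (V (coeff_map M g (ga M g m))))" if "g \<in> carrier G" for g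
  by (rule kl_comp[OF kl_comp[OF kl_comp[OF kl_ga[OF M] coeff_map_kl[OF M that]] V] kl_ga[OF M]])
 fix m assume m: "m \<in> carrier M"
 have cm: "coind_map M w (coeff_map M \<one>[G] m) = coeff_map M \<one>[G] (w m)"
  unfolding coind_map_def coeff_map_def by (rule restrict_ext) (use kl_sm[OF w _ m] R_eval in auto)
 have "w m = tr (coind M) M V (coeff_map M \<one>[G] m)"
  unfolding t[OF coeff_map_closed[OF M G.one_closed m]] cm using counit_surj[OF M kl_closed[OF w m]] by simp
 also have "... = finsum M (%g. ga M g (V (coeff_map M g (ga M g (ga M (inv[G] g) m))))) (carrier G)"
  unfolding tr_def
  by (rule M.M.finsum_cong'[OF refl]) (use M m Vc in \<open>auto simp: ga_coeff_map[OF M m] ga_ga ga_one\<close>)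
 finally show "w m = finsum M (%g. ga M g (V (coeff_map M g (ga M g (ga M (inv[G] g) m))))) (carrier G)" .
 have "finsum M (%g. ga M (inv[G] g) (ga M g (V (coeff_map M g (ga M g m))))) (carrier G) =
   finsum M (%g. V (coeff_map M g (ga M g m))) (carrier G)"
  by (rule M.M.finsum_cong'[OF refl]) (use M m Vc in \<open>auto simp: ga_ga ga_one\<close>)
 also have "... = V (coind_unit M m)" unfolding unit_eq_sum_coeff[OF M m]
  by (rule kl_finsum[OF C M V, symmetric]) (use coeff_map_closed[OF M] M m in auto)
 finally show "finsum M (%g. ga M (inv[G] g) (ga M g (V (coeff_map M g (ga M g m))))) (carrier G) = \<zero>[M]"
  using V0[OF m] by simp
qed

lemma tr_evaluation:
 assumes M: "md M" and N: "md N" and v: "kl M N v" and g: "g \<in> carrier G" and xi: "\<xi> \<in> carrier (coind M)"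
 shows "tr (coind M) N (%\<xi>. v (\<xi> (dl g))) \<xi> = finsum N (%x. ga N (x \<cdot> g) (v (\<xi> (dl (inv[G] x))))) (carrier G)"
proof -
 interpret N: left_module R N by (rule N)
 let ?f = "%h. ga N h (v (\<xi> (dl (g \<cdot> inv[G] h))))"
 have c: "?f \<in> A \<rightarrow> carrier N" for A using N kl_closed[OF v coind_eval[OF xi dl_closed]] by auto
 have im: "(%x. x \<cdot> g) ` carrier G = carrier G"
 proof -
  have "x \<in> (%x. x \<cdot> g) ` carrier G" if "x \<in> carrier G" for x
   using that g by (intro image_eqI[of _ _ "x \<cdot> inv[G] g"]) (auto simp: G.m_assoc)
  thus ?thesis using g by auto
 qed
 have inj: "inj_on (%x. x \<cdot> g) (carrier G)" using g by (auto intro!: inj_onI)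
 have "tr (coind M) N (%\<xi>. v (\<xi> (dl g))) \<xi> = finsum N ?f (carrier G)"
  unfolding tr_def by (rule N.M.finsum_cong'[OF refl c]) (use g in \<open>simp add: ga_coind dl_mult_dl\<close>)
 also have "... = finsum N (%x. ?f (x \<cdot> g)) (carrier G)"
  by (subst im[symmetric]) (rule N.M.finsum_reindex[OF c inj])
 also have "... = finsum N (%x. ga N (x \<cdot> g) (v (\<xi> (dl (inv[G] x))))) (carrier G)"
 proof (rule N.M.finsum_cong'[OF refl])
  show "(%x. ga N (x \<cdot> g) (v (\<xi> (dl (inv[G] x))))) \<in> carrier G \<rightarrow> carrier N"
   using N kl_closed[OF v coind_eval[OF xi dl_closed]] by auto
  fix x assume x: "x \<in> carrier G"
  have "g \<cdot> inv[G] (x \<cdot> g) = inv[G] x" using x g by (simp add: G.inv_mult_group flip: G.m_assoc)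
  thus "?f (x \<cdot> g) = ga N (x \<cdot> g) (v (\<xi> (dl (inv[G] x))))" by simp
 qed
 finally show ?thesis .
qed

text \<open>Dually, use the difference of two evaluations; it vanishes on the image of the unit, and its
  group trace is the counit composed with \<open>g \<phi> - \<phi>\<close>.\<close>

lemma trace_out_of_coind_if_ig:
 assumes M: "md M" and N: "md N" and z: "ig M N z"
 shows "\<exists>U. kl (coind M) N U & (\<forall>m\<in>carrier M. U (coind_unit M m) = \<zero>[N]) &
  (\<forall>\<xi>\<in>carrier (coind M). tr (coind M) N U \<xi> = coind_counit N (coind_map M z \<xi>))"
proof -
 interpret N: left_module R N by (rule N)
 note C = coind_md[OF M]
 obtain \<phi> where p': "\<forall>g\<in>carrier G. kl M N (\<phi> g)"
  "\<forall>x\<in>carrier M. z x = finsum N (%g. igb M N g (\<phi> g) x) (carrier G)" by (rule igE[OF z])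
 note p = bspec[OF p'(1)] bspec[OF p'(2)]
 define u v where "u = (%g \<xi>. \<phi> g (ga M (inv[G] g) (\<xi> (dl g))))" and "v = (%g \<xi>. \<ominus>[N] \<phi> g (\<xi> (dl \<one>[G])))"
 have k1: "kl M N (%m. \<phi> g (ga M (inv[G] g) m))" and k2: "kl M N (%m. \<ominus>[N] \<phi> g m)" if g: "g \<in> carrier G" for g
  by (rule kl_comp[OF kl_ga[OF M] p(1)[OF g]], rule kl_neg[OF N p(1)[OF g]])
 have ku: "kl (coind M) N (u g)" and kv: "kl (coind M) N (v g)" if g: "g \<in> carrier G" for g
  unfolding u_def v_def by (rule kl_comp[OF ev_kl[OF M] k1[OF g]], simp, rule kl_comp[OF ev_kl[OF M] k2[OF g]], simp)
 let ?U = "%g x. u g x \<oplus>[N] v g x"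
 have kU: "kl (coind M) N (?U g)" if g: "g \<in> carrier G" for g by (rule kl_sum[OF N ku[OF g] kv[OF g]])
 have U0: "?U g (coind_unit M m) = \<zero>[N]" if g: "g \<in> carrier G" and m: "m \<in> carrier M" for g m
 proof -
  have "coind_unit M m (dl g) = ga M g m" "coind_unit M m (dl \<one>[G]) = m"
   using unit_one[OF M m] by (simp_all add: coind_unit_def ga_def R_one)
  thus ?thesis unfolding u_def v_def using g M m kl_closed[OF p(1)[OF g] m] by (simp add: ga_ga ga_one N.M.r_neg)
 qed
 have tU: "tr (coind M) N (?U g) \<xi> = finsum N (%x. ga N x (igb M N g (\<phi> g) (\<xi> (dl (inv[G] x))))) (carrier G)"
  if g: "g \<in> carrier G" and xi: "\<xi> \<in> carrier (coind M)" for g \<xi>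
 proof -
  let ?e = "%x. \<xi> (dl (inv[G] x))"
  have e: "?e x \<in> carrier M" for x using coind_eval[OF xi dl_closed] .
  have a: "\<phi> g (ga M (inv[G] g) (?e x)) \<in> carrier N" "\<phi> g (?e x) \<in> carrier N" for x
   using kl_closed[OF p(1)[OF g]] e M by auto
  have "tr (coind M) N (?U g) \<xi> = tr (coind M) N (u g) \<xi> \<oplus>[N] tr (coind M) N (v g) \<xi>"
   by (rule tr_sum[OF C N ku[OF g] kv[OF g] xi])
  also have "... = finsum N (%x. ga N (x \<cdot> g) (\<phi> g (ga M (inv[G] g) (?e x)))) (carrier G) \<oplus>[N]
    finsum N (%x. ga N (x \<cdot> \<one>[G]) (\<ominus>[N] \<phi> g (?e x))) (carrier G)"
   unfolding u_def v_def tr_evaluation[OF M N k1[OF g] g xi] tr_evaluation[OF M N k2[OF g] G.one_closed xi] ..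
  also have "... = finsum N (%x. ga N (x \<cdot> g) (\<phi> g (ga M (inv[G] g) (?e x))) \<oplus>[N] ga N (x \<cdot> \<one>[G]) (\<ominus>[N] \<phi> g (?e x))) (carrier G)"
   by (rule N.M.finsum_addf[symmetric]) (use a N in auto)
  also have "... = finsum N (%x. ga N x (igb M N g (\<phi> g) (?e x))) (carrier G)"
   by (rule N.M.finsum_cong'[OF refl])
    (use a N g igb_closed[OF M N p(1)[OF g] e] in \<open>auto simp: igb_def ga_add ga_ga\<close>)
  finally show ?thesis .
 qed
 let ?V = "%x. finsum N (%g. ?U g x) (carrier G)"
 have kV: "kl (coind M) N ?V" by (rule kl_fin_sum[OF N kU C])
 have "?V (coind_unit M m) = \<zero>[N]" if m: "m \<in> carrier M" for m
 proof -
  have "?V (coind_unit M m) = finsum N (%g. \<zero>[N]) (carrier G)" by (rule N.M.finsum_cong') (use U0 m in auto)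
  thus ?thesis by simp
 qed
 moreover have "tr (coind M) N ?V \<xi> = coind_counit N (coind_map M z \<xi>)" if xi: "\<xi> \<in> carrier (coind M)" for \<xi>
 proof -
  let ?e = "%x. \<xi> (dl (inv[G] x))"
  have e: "?e x \<in> carrier M" for x using coind_eval[OF xi dl_closed] .
  have c: "igb M N g (\<phi> g) (?e x) \<in> carrier N" if "g \<in> carrier G" for g x by (rule igb_closed[OF M N p(1)[OF that] e])
  have e': "tr (coind M) N ?V \<xi> = finsum N (%g. tr (coind M) N (?U g) \<xi>) (carrier G)"
   by (rule tr_finsum[OF C N finG _ xi]) (rule kU)
  have "tr (coind M) N ?V \<xi> = finsum N (%g. finsum N (%x. ga N x (igb M N g (\<phi> g) (?e x))) (carrier G)) (carrier G)"
   unfolding e' by (rule N.M.finsum_cong'[OF refl]) (use tU xi c N in \<open>auto intro!: N.M.finsum_closed\<close>)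
  also have "... = finsum N (%x. finsum N (%g. ga N x (igb M N g (\<phi> g) (?e x))) (carrier G)) (carrier G)"
   by (rule N.M.finsum_swap[OF finG finG]) (use c N in auto)
  also have "... = finsum N (%x. ga N x (z (?e x))) (carrier G)"
  proof (rule N.M.finsum_cong'[OF refl])
   show "(%x. ga N x (z (?e x))) \<in> carrier G \<rightarrow> carrier N" using kl_closed[OF ig_kl[OF M N z] e] N by auto
   fix x
   show "finsum N (%g. ga N x (igb M N g (\<phi> g) (?e x))) (carrier G) = ga N x (z (?e x))"
    unfolding p(2)[OF e] by (rule kl_finsum[OF N N kl_ga[OF N], symmetric]) (use c in auto)
  qed
  also have "... = coind_counit N (coind_map M z \<xi>)"
   unfolding counit_eq[OF N mhom_closed[OF coind_map_hom[OF M N ig_kl[OF M N z]] xi]]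
   by (rule N.M.finsum_cong'[OF refl]) (use kl_closed[OF ig_kl[OF M N z] coind_eval[OF xi dl_closed]] N in \<open>auto simp: coind_map_def\<close>)
  finally show ?thesis .
 qed
 ultimately show ?thesis using kV by blast
qed

end

context kGU begin

text \<open>Dimension shifting. The map of coinduced modules induced by \<open>w\<close> sends \<open>N\<close> into the kernel \<open>T\<close> of the
  counit, because \<open>w\<close> has vanishing trace; this gives a stable map from \<open>N\<close> to its desuspension \<open>T\<close>. Pulling back a projective cover of
  \<open>T\<close> along it gives the extension; it splits exactly when the map is a trace.\<close>

lemma extension_from_class_into:
 assumes N: "lm N" and M: "lm M" and f: "hom M N f" and w: "kl N N w" "!!x. x \<in> carrier N ==> tr N N w x = \<zero>[N]"
  and nig: "~ ig N N w" and g: "ig M N (%x. w (f x))"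
 shows "\<exists>X W a b \<mu>. (\<forall>\<C>. good \<C> --> N \<in> \<C> --> X \<in> \<C>) & ses X W N a b & ~ split_ses W N b & hom M W \<mu> &
  (\<forall>x\<in>carrier M. b (\<mu> x) = f x)"
proof -
 note mN = lm_md[OF N] and mM = lm_md[OF M]
 note Ci = coind_md[OF mN]
 obtain C :: "('g => 'k, 'u) module" and \<phi> \<psi> where C: "pj C" "hom (coind N) C \<phi>" "hom C (coind N) \<psi>"
  "!!x. x \<in> carrier (coind N) ==> \<psi> (\<phi> x) = x" "!!y. y \<in> carrier C ==> \<phi> (\<psi> y) = y"
  by (rule coind_in_universe[OF N]) blast
 note mC = lm_md[OF pj_lm[OF C(1)]]
 define \<epsilon> where "\<epsilon> = (%x. coind_counit N (\<psi> x))"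
 have eh: "hom C N \<epsilon>" unfolding \<epsilon>_def by (rule mhom_comp[OF C(3) counit_hom[OF mN]])
 have es: "\<epsilon> ` carrier C = carrier N"
 proof (intro equalityI subsetI)
  fix n assume n: "n \<in> carrier N"
  show "n \<in> \<epsilon> ` carrier C"
   by (rule image_eqI[of _ _ "\<phi> (coeff_map N \<one>[G] n)"])
    (use n C(4) mhom_closed[OF C(2)] coeff_map_closed[OF mN G.one_closed n] counit_surj[OF mN n] in \<open>auto simp: \<epsilon>_def\<close>)
 qed (use mhom_closed[OF eh] in auto)
 define T where "T = C\<lparr>carrier := {x\<in>carrier C. \<epsilon> x = \<zero>[N]}\<rparr>"
 have sT: "ses T C N (%x. x) \<epsilon>" unfolding T_def by (rule kernel_ses[OF pj_lm[OF C(1)] N eh es])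
 note T = sesD[OF sT]
 have Tc: "x \<in> carrier T ==> x \<in> carrier C & \<epsilon> x = \<zero>[N]" for x by (simp add: T_def)
 have TI: "x \<in> carrier C ==> \<epsilon> x = \<zero>[N] ==> x \<in> carrier T" for x by (simp add: T_def)
 have Tops: "x \<oplus>[T] y = x \<oplus>[C] y" "a \<odot>[T] x = a \<odot>[C] x" for x y a by (simp_all add: T_def)
 have mT: "md T" and inc: "hom T C (%x. x)" using sT by (auto simp: ses_def lmod_def)
 let ?k = "%n. coind_map N w (coind_unit N n)"
 have kh: "hom N (coind N) ?k" by (rule mhom_comp[OF unit_hom[OF mN] coind_map_hom[OF mN mN w(1)]])
 let ?\<gamma> = "%n. \<phi> (?k n)"
 have gC: "hom N C ?\<gamma>" by (rule mhom_comp[OF kh C(2)])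
 have gT: "?\<gamma> n \<in> carrier T" if n: "n \<in> carrier N" for n
  by (rule TI[OF mhom_closed[OF gC n]])
   (use C(4)[OF mhom_closed[OF kh n]] counit_coind_map_unit[OF mN mN w(1) n] w(2)[OF n] in \<open>simp add: \<epsilon>_def\<close>)
 have gh: "hom N T ?\<gamma>"
  by (rule mhomI) (use gT in \<open>auto simp: Tops mhom_add[OF gC] mhom_smult[OF gC]\<close>)
 have lT: "lm T" using sT by (simp add: ses_def)
 obtain D X a0 b0 where D: "pj D" and sD: "ses X D T a0 b0" using enough_projectives(1)[OF lT] by blast
 obtain W a b e where V: "ses X W N a b" "hom W D e" "!!v. v \<in> carrier W ==> b0 (e v) = ?\<gamma> (b v)"
  "pullback_property D N b0 ?\<gamma> W e b"
  by (rule pullback[OF sD N gh]) (rule that)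
 have X: "X \<in> \<C>" if "good \<C>" "N \<in> \<C>" for \<C>
  by (rule goodD(5)[OF that(1) D sD goodD(5)[OF that(1) C(1) sT that(2)]])
 have b0: "hom D T b0" and b0s: "b0 ` carrier D = carrier T" and mD: "md D" and mW: "md W"
  using sD V(1) by (auto simp: ses_def lmod_def)
 have "~ split_ses W N b"
 proof
  assume "split_ses W N b"
  then obtain s where s: "hom N W s" "\<forall>y\<in>carrier N. b (s y) = y" by (auto simp: split_ses_def)
  have "sz N T (%n. b0 (e (s n)))" by (rule sz_through_pj[OF D mN mT mhom_comp[OF s(1) V(2)] b0])
  hence "sz N T ?\<gamma>" by (rule sz_cong) (use s V(3) mhom_closed[OF s(1)] in auto)
  then obtain v where v: "kl N T v" "\<forall>x\<in>carrier N. ?\<gamma> x = tr N T v x" by (auto simp: sz_def)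
  have pT: "hom T (coind N) \<psi>" by (rule mhom_comp[OF inc C(3)])
  have "ig N N w"
  proof (rule ig_if_trace_into_coind[OF mN w(1) kl_comp[OF v(1) hom_kl[OF pT]]])
   fix n assume n: "n \<in> carrier N"
   show "coind_counit N (\<psi> (v n)) = \<zero>[N]" using Tc[OF kl_closed[OF v(1) n]] by (simp add: \<epsilon>_def)
   have "?k n = \<psi> (tr N T v n)" using bspec[OF v(2) n] C(4)[OF mhom_closed[OF kh n]] by simp
   also have "... = tr N (coind N) (%n. \<psi> (v n)) n" by (rule hom_tr[OF mN mT Ci v(1) pT n])
   finally show "?k n = tr N (coind N) (%n. \<psi> (v n)) n" .
  qed
  thus False using nig by simp
 qed
 moreover have "sz M T (%x. ?\<gamma> (f x))"
 proof -
  obtain U where U: "kl M (coind N) U" "\<forall>m\<in>carrier M. coind_counit N (U m) = \<zero>[N]"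
   "\<forall>m\<in>carrier M. tr M (coind N) U m = coind_map M (%x. w (f x)) (coind_unit M m)"
   using trace_into_coind_if_ig[OF mM mN g] by blast
  have kC: "kl M C (%m. \<phi> (U m))" by (rule kl_comp[OF U(1) hom_kl[OF C(2)]])
  have kT: "kl M T (%m. \<phi> (U m))"
  proof (rule klI)
   fix x assume x: "x \<in> carrier M"
   show "\<phi> (U x) \<in> carrier T"
    by (rule TI[OF kl_closed[OF kC x]]) (use C(4)[OF kl_closed[OF U(1) x]] bspec[OF U(2) x] in \<open>simp add: \<epsilon>_def\<close>)
  qed (simp_all add: Tops sm_def[of T] kl_add[OF kC] kl_sm[OF kC], simp add: sm_def)
  show ?thesis unfolding sz_def
  proof (intro exI[of _ "%m. \<phi> (U m)"] conjI ballI kT)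
   fix m assume m: "m \<in> carrier M"
   have "?\<gamma> (f m) = \<phi> (tr M (coind N) U m)" using bspec[OF U(3) m] coind_map_unit[OF f m, of w] by simp
   also have "... = tr M C (%m. \<phi> (U m)) m" by (rule hom_tr[OF mM Ci mC U(1) C(2) m])
   also have "... = tr M T (%m. \<phi> (U m)) m" by (rule hom_tr[OF mM mT mC kT inc m, symmetric])
   finally show "?\<gamma> (f m) = tr M T (%m. \<phi> (U m)) m" .
  qed
 qed
 from sz_lift[OF mD mT mM b0 b0s this] obtain t where t: "hom M D t" "\<forall>x\<in>carrier M. b0 (t x) = ?\<gamma> (f x)" by blast
 obtain \<mu> where "hom M W \<mu>" "!!x. x \<in> carrier M ==> b (\<mu> x) = f x"
  by (rule pullback_propertyD[OF V(4) mM t(1) f]) (use t(2) in auto)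
 ultimately show ?thesis using X V(1) by blast
qed

text \<open>Dually, \<open>w\<close> gives a map to \<open>M\<close> from the cokernel \<open>Q\<close> of the unit, and the extension is the
  pushout of an embedding of \<open>Q\<close> into a projective module.\<close>

lemma extension_from_class_out:
 assumes M: "lm M" and N: "lm N" and f: "hom M N f" and w: "kl M M w" "!!x. x \<in> carrier M ==> tr M M w x = \<zero>[M]"
  and nig: "~ ig M M w" and g: "ig M N (%x. f (w x))"
 shows "\<exists>X W a b \<nu>. (\<forall>\<C>. good \<C> --> M \<in> \<C> --> X \<in> \<C>) & ses M W X a b & ~ split_ses W X b & hom W N \<nu> &
  (\<forall>x\<in>carrier M. \<nu> (a x) = f x)"
proof -
 note mN = lm_md[OF N] and mM = lm_md[OF M]
 note Ci = coind_md[OF mM]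
 obtain C :: "('g => 'k, 'u) module" and \<phi> \<psi> where C: "pj C" "hom (coind M) C \<phi>" "hom C (coind M) \<psi>"
  "!!x. x \<in> carrier (coind M) ==> \<psi> (\<phi> x) = x" "!!y. y \<in> carrier C ==> \<phi> (\<psi> y) = y"
  by (rule coind_in_universe[OF M]) blast
 note mC = lm_md[OF pj_lm[OF C(1)]]
 define \<iota> where "\<iota> = (%m. \<phi> (coind_unit M m))"
 have ih: "hom M C \<iota>" unfolding \<iota>_def by (rule mhom_comp[OF unit_hom[OF mM] C(2)])
 have psi_i: "\<psi> (\<iota> m) = coind_unit M m" if "m \<in> carrier M" for m
  unfolding \<iota>_def using C(4)[OF unit_closed[OF mM that]] .
 have ii: "inj_on \<iota> (carrier M)"
  by (rule inj_onI) (use psi_i unit_one[OF mM] in metis)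
 obtain Q \<kappa> where sQ: "ses M C Q \<iota> \<kappa>" using cokernel_ses[OF M pj_lm[OF C(1)] ih ii] by blast
 have lQ: "lm Q" and mQ: "md Q" and kap: "hom C Q \<kappa>" "\<kappa> ` carrier C = carrier Q" "!!m. m \<in> carrier M ==> \<kappa> (\<iota> m) = \<zero>[Q]"
  "!!x. x \<in> carrier C ==> \<kappa> x = \<zero>[Q] ==> \<exists>y\<in>carrier M. x = \<iota> y"
  using sQ by (auto simp: ses_def lmod_def)
 let ?c = "%\<xi>. coind_counit M (coind_map M w \<xi>)"
 have ch: "hom (coind M) M ?c" by (rule mhom_comp[OF coind_map_hom[OF mM mM w(1)] counit_hom[OF mM]])
 have "?c (\<psi> (\<iota> m)) = \<zero>[M]" if m: "m \<in> carrier M" for m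
  unfolding psi_i[OF m] counit_coind_map_unit[OF mM mM w(1) m] by (rule w(2)[OF m])
 from ses_out[OF sQ mM mhom_comp[OF C(3) ch] this]
 obtain \<gamma> where gam: "hom Q M \<gamma>" "\<forall>x\<in>carrier C. \<gamma> (\<kappa> x) = ?c (\<psi> x)" by blast
 obtain D X a0 b0 where D: "pj D" and sD: "ses Q D X a0 b0" using enough_projectives(2)[OF lQ] by blast
 obtain W a b e where V: "ses M W X a b" "hom D W e" "!!x. x \<in> carrier Q ==> e (a0 x) = a (\<gamma> x)"
  "pushout_property Q D M a0 \<gamma> W e a"
  by (rule pushout[OF sD M gam(1)]) (rule that)
 have X: "X \<in> \<C>" if "good \<C>" "M \<in> \<C>" for \<C>
  by (rule goodD(4)[OF that(1) D sD goodD(4)[OF that(1) C(1) sQ that(2)]])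
 have a0: "hom Q D a0" and a0i: "inj_on a0 (carrier Q)" and mD: "md D" and mW: "md W"
  using sD V(1) by (auto simp: ses_def lmod_def)
 have "~ split_ses W X b"
 proof
  assume "split_ses W X b"
  then obtain r where r: "hom W M r" "!!x. x \<in> carrier M ==> r (a x) = x"
   by (rule split_decomposition[OF V(1)]) (rule that)
  have "sz Q M (%x. r (e (a0 x)))" by (rule sz_through_pj[OF D mQ mM a0 mhom_comp[OF V(2) r(1)]])
  hence "sz Q M \<gamma>" by (rule sz_cong) (use r(2) V(3) mhom_closed[OF gam(1)] in auto)
  then obtain v where v: "kl Q M v" "\<forall>x\<in>carrier Q. \<gamma> x = tr Q M v x" by (auto simp: sz_def)
  have kp: "hom (coind M) Q (%x. \<kappa> (\<phi> x))" by (rule mhom_comp[OF C(2) kap(1)])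
  have "ig M M w"
  proof (rule ig_if_trace_out_of_coind[OF mM w(1) kl_comp[OF hom_kl[OF kp] v(1)]])
   show "v (\<kappa> (\<phi> (coind_unit M m))) = \<zero>[M]" if m: "m \<in> carrier M" for m
    using kap(3)[OF m] kl_zero[OF mQ mM v(1)] by (simp add: \<iota>_def)
   fix \<xi> assume x: "\<xi> \<in> carrier (coind M)"
   have "?c \<xi> = \<gamma> (\<kappa> (\<phi> \<xi>))" using bspec[OF gam(2) mhom_closed[OF C(2) x]] C(4)[OF x] by simp
   also have "... = tr Q M v (\<kappa> (\<phi> \<xi>))" using bspec[OF v(2) mhom_closed[OF kp x]] .
   also have "... = tr (coind M) M (%x. v (\<kappa> (\<phi> x))) \<xi>" by (rule tr_comp_hom[OF Ci mQ mM kp v(1) x])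
   finally show "tr (coind M) M (%x. v (\<kappa> (\<phi> x))) \<xi> = ?c \<xi>" ..
  qed
  thus False using nig by simp
 qed
 moreover have "sz Q N (%x. f (\<gamma> x))"
 proof -
  obtain U where U: "kl (coind M) N U" "\<forall>m\<in>carrier M. U (coind_unit M m) = \<zero>[N]"
   "\<forall>\<xi>\<in>carrier (coind M). tr (coind M) N U \<xi> = coind_counit N (coind_map M (%x. f (w x)) \<xi>)"
   using trace_out_of_coind_if_ig[OF mM mN g] by blast
  have k0: "U (\<psi> x) = \<zero>[N]" if x: "x \<in> carrier C" "\<kappa> x = \<zero>[Q]" for x
   using kap(4)[OF x] psi_i U(2) by auto
  have "\<exists>u. kl Q N u & (\<forall>x\<in>carrier (vs C). u (\<kappa> x) = U (\<psi> x))"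
   by (rule factor_through_surjection[OF left_module_vs[OF mC] left_module_vs[OF mQ] left_module_vs[OF mN] hom_kl[OF kap(1)] _
    kl_comp[OF hom_kl[OF C(3)] U(1)]]) (use kap(2) k0 in auto)
  then obtain u where u: "kl Q N u" "\<forall>x\<in>carrier C. u (\<kappa> x) = U (\<psi> x)" by auto
  show ?thesis unfolding sz_def
  proof (intro exI[of _ u] conjI ballI u(1))
   fix q assume "q \<in> carrier Q"
   then obtain x where x: "x \<in> carrier C" "q = \<kappa> x" using kap(2) by auto
   have xi: "\<psi> x \<in> carrier (coind M)" by (rule mhom_closed[OF C(3) x(1)])
   let ?y = "coind_map M w (\<psi> x)"
   have y: "?y \<in> carrier (coind M)" by (rule mhom_closed[OF coind_map_hom[OF mM mM w(1)] xi])
   have "f (\<gamma> q) = f (coind_counit M ?y)" using bspec[OF gam(2) x(1)] x(2) by simp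
   also have "... = f (finsum M (%g. ga M g (?y (dl (inv[G] g)))) (carrier G))" unfolding counit_eq[OF mM y] ..
   also have "... = finsum N (%g. f (ga M g (?y (dl (inv[G] g))))) (carrier G)"
    by (rule mhom_finsum[OF mM mN f]) (use coind_eval[OF y dl_closed] mM in auto)
   also have "... = finsum N (%g. ga N g (coind_map M (%x. f (w x)) (\<psi> x) (dl (inv[G] g)))) (carrier G)"
   proof (rule abelian_monoid.finsum_cong'[OF _ refl])
    show "abelian_monoid N" using mN by (simp add: left_module_def abelian_group_def)
    have cc: "coind_map M (%x. f (w x)) (\<psi> x) (dl g) = f (?y (dl g))" for g by (simp add: coind_map_def)
    show "(%g. ga N g (coind_map M (%x. f (w x)) (\<psi> x) (dl (inv[G] g)))) \<in> carrier G \<rightarrow> carrier N"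
     unfolding cc using mhom_closed[OF f coind_eval[OF y dl_closed]] mN by auto
    show "f (ga M g (?y (dl (inv[G] g)))) = ga N g (coind_map M (%x. f (w x)) (\<psi> x) (dl (inv[G] g)))" for g
     unfolding cc by (rule hom_ga[OF f coind_eval[OF y dl_closed]])
   qed
   also have "... = coind_counit N (coind_map M (%x. f (w x)) (\<psi> x))"
    using counit_eq[OF mN mhom_closed[OF coind_map_hom[OF mM mN ig_kl[OF mM mN g]] xi]] by simp
   also have "... = tr (coind M) N U (\<psi> x)" using bspec[OF U(3) xi] by simp
   also have "... = tr C N (%x. U (\<psi> x)) x" by (rule tr_comp_hom[OF mC Ci mN C(3) U(1) x(1)])
   also have "... = tr C N (%x. u (\<kappa> x)) x"
    by (rule tr_cong[OF mC mN kl_comp[OF hom_kl[OF C(3)] U(1)] _ x(1)]) (use u(2) in simp)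
   also have "... = tr Q N u q" unfolding x(2) by (rule tr_comp_hom[OF mC mQ mN kap(1) u(1) x(1), symmetric])
   finally show "f (\<gamma> q) = tr Q N u q" .
  qed
 qed
 from sz_extend[OF mQ mD mN a0 a0i this] obtain t where t: "hom D N t" "\<forall>x\<in>carrier Q. t (a0 x) = f (\<gamma> x)" by blast
 obtain \<nu> where "hom W N \<nu>" "!!x. x \<in> carrier M ==> \<nu> (a x) = f x"
  by (rule pushout_propertyD[OF V(4) mN t(1) f]) (use t(2) in auto)
 ultimately show ?thesis using X V(1) by blast
qed

end

context kGU begin

section \<open>Levels of the ends of an irreducible homomorphism\<close>

text \<open>On modules of the small universe these are the ones stably isomorphic to a summand of a finite dimensional one;
  summands are included so that the class is visibly closed under retracts.\<close>

definition cpt :: "('g => 'k, 'u) module => bool" where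
 "cpt M \<longleftrightarrow> (\<exists>Y. fd Y & sret M Y)"

definition stable_mono :: "('g => 'k, 'u) module => ('g => 'k, 'u) module => ('u => 'u) => bool" where
 "stable_mono M N f \<longleftrightarrow> (\<exists>r. hom N M r & st M M (%x. r (f x)) (%x. x))"

definition stable_epi :: "('g => 'k, 'u) module => ('g => 'k, 'u) module => ('u => 'u) => bool" where
 "stable_epi M N f \<longleftrightarrow> (\<exists>s. hom N M s & st N N (%x. f (s x)) (%x. x))"

lemma cptE:
 assumes "cpt M"
 obtains Y E \<epsilon> i p where "lm M" "lm Y" "dbasis Y E \<epsilon>" "hom M Y i" "hom Y M p" "st M M (%x. p (i x)) (%x. x)"
proof -
 obtain Y where Y: "fd Y" "sret M Y" using assms by (auto simp: cpt_def)
 obtain i p where ip: "lm M" "lm Y" "hom M Y i" "hom Y M p" "st M M (%x. p (i x)) (%x. x)"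
  using Y(2) by (auto simp: sret_def)
 obtain E \<epsilon> where "dbasis Y E \<epsilon>" using fd_dual_basis[OF lm_md[OF ip(2)] Y(1)] by blast
 thus thesis by (rule that[OF ip(1,2) _ ip(3-5)])
qed

lemma not_mono_extension:
 assumes M: "cpt M" and N: "lm N" and f: "hom M N f" and no: "~ stable_mono M N f"
 shows "\<exists>X W a b \<nu>. (\<forall>\<C>. good \<C> --> M \<in> \<C> --> X \<in> \<C>) & ses M W X a b & ~ split_ses W X b & hom W N \<nu> &
  (\<forall>x\<in>carrier M. \<nu> (a x) = f x)"
proof (rule cptE[OF M])
 fix Y E \<epsilon> i p assume Y: "lm M" "lm Y" "dbasis Y E \<epsilon>" "hom M Y i" "hom Y M p" "st M M (%x. p (i x)) (%x. x)"
 obtain w where "kl M M w" "\<forall>x\<in>carrier M. tr M M w x = \<zero>[M]" "~ ig M M w" "ig M N (%x. f (w x))"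
  using not_split_mono_detected[OF lm_md[OF Y(1)] lm_md[OF N] lm_md[OF Y(2)] Y(3-6) f no[unfolded stable_mono_def]] by (elim exE conjE) (rule that)
 thus ?thesis by (intro extension_from_class_out[OF Y(1) N f]) auto
qed

lemma not_epi_extension:
 assumes M: "cpt M" and N: "cpt N" and f: "hom M N f" and no: "~ stable_epi M N f"
 shows "\<exists>X W a b \<mu>. (\<forall>\<C>. good \<C> --> N \<in> \<C> --> X \<in> \<C>) & ses X W N a b & ~ split_ses W N b & hom M W \<mu> &
  (\<forall>x\<in>carrier M. b (\<mu> x) = f x)"
proof (rule cptE[OF M])
 fix X F \<delta> j q assume X: "lm M" "lm X" "dbasis X F \<delta>" "hom M X j" "hom X M q" "st M M (%x. q (j x)) (%x. x)"
 show ?thesis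
 proof (rule cptE[OF N])
  fix Y E \<epsilon> i p assume Y: "lm N" "lm Y" "dbasis Y E \<epsilon>" "hom N Y i" "hom Y N p" "st N N (%x. p (i x)) (%x. x)"
  obtain w where "kl N N w" "\<forall>x\<in>carrier N. tr N N w x = \<zero>[N]" "~ ig N N w" "ig M N (%x. w (f x))"
   using not_split_epi_detected[OF lm_md[OF X(1)] lm_md[OF Y(1)] lm_md[OF Y(2)] Y(3-6) lm_md[OF X(2)] X(3-6) f no[unfolded stable_epi_def]] by (elim exE conjE) (rule that)
  thus ?thesis by (intro extension_from_class_into[OF Y(1) X(1) f]) auto
 qed
qed

lemma irreducible_target_level:
 assumes gP: "good \<P>" and M: "cpt M" and N: "lm N" and f: "hom M N f" and no: "~ stable_mono M N f"
  and irr: "!!W \<mu> \<nu>. lm W ==> hom M W \<mu> ==> hom W N \<nu> ==> (!!x. x \<in> carrier M ==> \<nu> (\<mu> x) = f x) ==>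
   stable_mono M W \<mu> \<or> stable_epi W N \<nu>"
  and m: "M \<in> lev \<P> m"
 shows "N \<in> lev \<P> (Suc m)"
proof -
 obtain X W a b \<nu> where s: "ses M W X a b" "~ split_ses W X b" "hom W N \<nu>" "\<forall>x\<in>carrier M. \<nu> (a x) = f x"
  and X: "\<forall>\<C>. good \<C> --> M \<in> \<C> --> X \<in> \<C>"
  using not_mono_extension[OF M N f no] by (elim exE conjE) (rule that)
 have X: "X \<in> lev \<P> m" by (rule X[rule_format, OF lev_good[OF gP] m])
 obtain W' \<mu> \<nu>' where W: "W' \<in> lev \<P> (Suc m)" "hom M W' \<mu>" "hom W' N \<nu>'" "\<forall>x\<in>carrier M. \<nu>' (\<mu> x) = \<nu> (a x)"
  "~ (\<exists>r. hom W' M r & st M M (%x. r (\<mu> x)) (%x. x))"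
  using factorization_through_higher_level_out[OF gP m le_refl X s(1-3)] by (elim exE conjE) (rule that)
 have lW: "lm W'" by (rule goodD(1)[OF lev_good[OF gP] W(1)])
 have "stable_mono M W' \<mu> \<or> stable_epi W' N \<nu>'" by (rule irr[OF lW W(2,3)]) (use W(4) s(4) in simp)
 hence "stable_epi W' N \<nu>'" using W(5)[folded stable_mono_def] by simp
 then obtain s where "hom N W' s" "st N N (%x. \<nu>' (s x)) (%x. x)" unfolding stable_epi_def by (elim exE conjE) (rule that)
 hence "sret N W'" by (intro sretI[OF N lW _ W(3)])
 thus ?thesis by (rule goodD(2)[OF lev_good[OF gP] W(1)])
qed

lemma irreducible_source_level:
 assumes gP: "good \<P>" and M: "cpt M" and N: "cpt N" and f: "hom M N f" and no: "~ stable_epi M N f"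
  and irr: "!!W \<mu> \<nu>. lm W ==> hom M W \<mu> ==> hom W N \<nu> ==> (!!x. x \<in> carrier M ==> \<nu> (\<mu> x) = f x) ==>
   stable_mono M W \<mu> \<or> stable_epi W N \<nu>"
  and n: "N \<in> lev \<P> n"
 shows "M \<in> lev \<P> (Suc n)"
proof -
 have lM: "lm M" using M by (rule cptE)
 obtain X W a b \<mu> where s: "ses X W N a b" "~ split_ses W N b" "hom M W \<mu>" "\<forall>x\<in>carrier M. b (\<mu> x) = f x"
  and X: "\<forall>\<C>. good \<C> --> N \<in> \<C> --> X \<in> \<C>"
  using not_epi_extension[OF M N f no] by (elim exE conjE) (rule that)
 have X: "X \<in> lev \<P> n" by (rule X[rule_format, OF lev_good[OF gP] n])
 obtain W' \<mu>' \<nu> where W: "W' \<in> lev \<P> (Suc n)" "hom M W' \<mu>'" "hom W' N \<nu>" "\<forall>x\<in>carrier M. \<nu> (\<mu>' x) = b (\<mu> x)"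
  "~ (\<exists>s. hom N W' s & st N N (%x. \<nu> (s x)) (%x. x))"
  using factorization_through_higher_level_in[OF gP n le_refl X s(1-3) lm_md[OF lM]] by (elim exE conjE) (rule that)
 have lW: "lm W'" by (rule goodD(1)[OF lev_good[OF gP] W(1)])
 have "stable_mono M W' \<mu>' \<or> stable_epi W' N \<nu>" by (rule irr[OF lW W(2,3)]) (use W(4) s(4) in simp)
 hence "stable_mono M W' \<mu>'" using W(5)[folded stable_epi_def] by simp
 then obtain r where "hom W' M r" "st M M (%x. r (\<mu>' x)) (%x. x)" unfolding stable_mono_def by (elim exE conjE) (rule that)
 hence "sret M W'" by (intro sretI[OF lM lW W(2)])
 thus ?thesis by (rule goodD(2)[OF lev_good[OF gP] W(1)])
qed

section \<open>Summands of the middle term of an almost split sequence\<close>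

text \<open>A stable retraction \<open>r\<close> would give an endomorphism \<open>e\<close> of \<open>Z\<close> through \<open>b\<close> that is
  stably idempotent. If \<open>1 - e\<close> is not split epic it also factors through \<open>b\<close>, so \<open>b\<close> splits. If it is,
  then \<open>r (1 - e) = 0\<close> stably gives \<open>r = 0\<close> and hence \<open>S = 0\<close>.\<close>

lemma summand_to_end_not_stable_mono:
 assumes s: "ses A B Z a b" and ns: "~ split_ses B Z b" and S: "lm S" "~ pj S" and i: "hom S B i"
  and lift: "!!T t. lm T ==> hom T Z t ==> ~ stable_epi T Z t ==> \<exists>h. hom T B h & (\<forall>x\<in>carrier T. b (h x) = t x)"
 shows "~ stable_mono S Z (%x. b (i x))"
proof
 assume "stable_mono S Z (%x. b (i x))"
 then obtain r where r: "hom Z S r" "st S S (%x. r (b (i x))) (%x. x)" by (auto simp: stable_mono_def)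
 have lZ: "lm Z" and mB: "md B" and b: "hom B Z b" using s by (auto simp: ses_def lmod_def)
 note mZ = lm_md[OF lZ] and mS = lm_md[OF S(1)]
 interpret Z: left_module R Z by (rule mZ)
 interpret S: left_module R S by (rule mS)
 let ?e = "%z. b (i (r z))"
 have e: "hom Z Z ?e" by (rule mhom_comp[OF mhom_comp[OF r(1) i] b])
 have ec: "!!x. x \<in> carrier Z ==> ?e x \<in> carrier Z" using mhom_closed[OF e] .
 let ?d = "%z. z \<oplus>[Z] \<ominus>[Z] ?e z"
 have d: "hom Z Z ?d" by (rule mhom_sum[OF mZ mhom_id mhom_neg[OF mZ e]])
 show False
 proof (cases "stable_epi Z Z ?d")
  case False
  obtain t where t: "hom Z B t" "\<forall>x\<in>carrier Z. b (t x) = ?d x" using lift[OF lZ d False] by (elim exE conjE) (rule that)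
  have ir: "hom Z B (%x. i (r x))" by (rule mhom_comp[OF r(1) i])
  have "split_ses B Z b" unfolding split_ses_def
  proof (intro exI[of _ "%x. t x \<oplus>[B] i (r x)"] conjI ballI mhom_sum[OF mB t(1) ir])
   fix x assume x: "x \<in> carrier Z"
   show "b (t x \<oplus>[B] i (r x)) = x"
    unfolding mhom_add[OF b mhom_closed[OF t(1) x] mhom_closed[OF ir x]] bspec[OF t(2) x] using x ec[OF x]
    by (simp add: Z.M.a_assoc Z.M.l_neg)
  qed
  thus False using ns by simp
 next
  case True
  then obtain c where c: "hom Z Z c" "st Z Z (%x. ?d (c x)) (%x. x)" by (auto simp: stable_epi_def)
  obtain t where t: "sz S S t" "\<forall>x\<in>carrier S. r (b (i x)) = x \<oplus>[S] t x" using r(2) unfolding st_def by (elim exE conjE) (rule that)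
  have rc: "!!x. x \<in> carrier Z ==> r x \<in> carrier S" using mhom_closed[OF r(1)] .
  have z: "sz Z S (%x. \<ominus>[S] t (r x))" by (rule sz_neg[OF mZ mS sz_pre[OF mZ mS mS r(1) t(1)]])
  have "sz Z S (%x. r (?d x))"
  proof (rule sz_cong[OF z])
   fix x assume x: "x \<in> carrier Z"
   have "r (?d x) = r x \<oplus>[S] \<ominus>[S] r (?e x)"
    using mhom_add[OF r(1) x Z.M.a_inv_closed[OF ec[OF x]]] mhom_minus[OF mZ mS r(1) ec[OF x]] by simp
   also have "... = r x \<oplus>[S] \<ominus>[S] (r x \<oplus>[S] t (r x))" using bspec[OF t(2) rc[OF x]] by simp
   also have "... = \<ominus>[S] t (r x)"
    using rc[OF x] st_closed[OF mS mS t(1) rc[OF x]] by (simp add: S.M.minus_add S.M.r_neg1 S.M.r_neg2)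
   finally show "r (?d x) = \<ominus>[S] t (r x)" .
  qed
  from sz_pre[OF mZ mZ mS c(1) this] have 1: "sz Z S (%x. r (?d (c x)))" .
  have "st Z S (%x. r (?d (c x))) (%x. r x)" by (rule st_post[OF mZ mZ mS mhom_id c(2) r(1)])
  hence "st Z S (%x. r x) (%x. r (?d (c x)))" by (rule st_sym[OF mZ mS r(1)])
  hence "sz Z S (%x. r x)" by (rule sz_st[OF mZ mS _ 1])
  hence 2: "sz S S (%x. r (b (i x)))" by (rule sz_pre[OF mS mZ mS mhom_comp[OF i b]])
  have "sz S S (%x. x)" by (rule sz_st[OF mS mS st_sym[OF mS mS mhom_id r(2)] 2])
  thus False using S by (simp add: pj_def)
 qed
qed

text \<open>If both failed, both would extend along \<open>a\<close>, and so would their sum, the identity.\<close>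

lemma almost_split_local_end:
 assumes s: "ses A B Z a b" and ns: "~ split_ses B Z b"
  and ext: "!!T t. lm T ==> hom A T t ==> ~ stable_mono A T t ==> \<exists>h. hom B T h & (\<forall>x\<in>carrier A. h (a x) = t x)"
  and u: "hom A A u"
 shows "stable_mono A A u \<or> stable_mono A A (%x. x \<oplus>[A] \<ominus>[A] u x)"
proof (rule ccontr)
 assume "~ (stable_mono A A u \<or> stable_mono A A (%x. x \<oplus>[A] \<ominus>[A] u x))"
 hence n: "~ stable_mono A A u" "~ stable_mono A A (%x. x \<oplus>[A] \<ominus>[A] u x)" by auto
 have lA: "lm A" and a: "hom A B a" using s by (auto simp: ses_def)
 note mA = lm_md[OF lA]
 interpret A: left_module R A by (rule mA)
 obtain h where h: "hom B A h" "\<forall>x\<in>carrier A. h (a x) = u x" using ext[OF lA u n(1)] by (elim exE conjE) (rule that)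
 obtain h' where h': "hom B A h'" "\<forall>x\<in>carrier A. h' (a x) = x \<oplus>[A] \<ominus>[A] u x"
  using ext[OF lA mhom_sum[OF mA mhom_id mhom_neg[OF mA u]] n(2)] by (elim exE conjE) (rule that)
 have "split_ses B Z b"
 proof (rule split_if_retraction[OF s mhom_sum[OF mA h'(1) h(1)]])
  fix x assume x: "x \<in> carrier A"
  show "h' (a x) \<oplus>[A] h (a x) = x"
   unfolding bspec[OF h(2) x] bspec[OF h'(2) x] using mhom_closed[OF u x] x by (simp add: A.M.a_assoc A.M.l_neg)
 qed
 thus False using ns by simp
qed

text \<open>Factor \<open>b i\<close> as \<open>\<nu>' \<mu>\<close> through \<open>W'\<close>. If \<open>\<nu>'\<close> were not split epic, it would lift to \<open>t\<close> with
  \<open>\<nu>' = b t\<close>, so that \<open>i = t \<mu> + a v\<close> and the identity of \<open>S\<close> is stably \<open>k + q v\<close> with \<open>k = p t \<mu>\<close> and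
  \<open>q = p a\<close>. One of \<open>u = v q\<close> and \<open>1 - u\<close> is split monic. If \<open>u\<close> is, then \<open>a\<close> splits. If \<open>r\<close> is a
  retraction of \<open>1 - u\<close>, then \<open>1 + q r v\<close> is a stable left inverse of \<open>1 - q v\<close>, hence of \<open>k\<close>,
  and \<open>\<mu>\<close> is split monic.\<close>

lemma almost_split_summand_level:
 assumes gP: "good \<P>" and s: "ses A B Z a b" and ns: "~ split_ses B Z b"
  and lift: "!!T t. lm T ==> hom T Z t ==> ~ stable_epi T Z t ==> \<exists>h. hom T B h & (\<forall>x\<in>carrier T. b (h x) = t x)"
  and ext: "!!T t. lm T ==> hom A T t ==> ~ stable_mono A T t ==> \<exists>h. hom B T h & (\<forall>x\<in>carrier A. h (a x) = t x)"
  and S: "cpt S" "~ pj S" and i: "hom S B i" and p: "hom B S p" and pi: "st S S (%x. p (i x)) (%x. x)"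
  and m: "S \<in> lev \<P> m"
 shows "Z \<in> lev \<P> (Suc m)"
proof -
 have lA: "lm A" and lB: "lm B" and lZ: "lm Z" and a: "hom A B a" and b: "hom B Z b"
  and ba: "!!x. x \<in> carrier A ==> b (a x) = \<zero>[Z]" using s by (auto simp: ses_def)
 have lS: "lm S" using S(1) by (rule cptE)
 note mA = lm_md[OF lA] and mB = lm_md[OF lB] and mZ = lm_md[OF lZ] and mS = lm_md[OF lS]
 interpret A: left_module R A by (rule mA)
 interpret B: left_module R B by (rule mB)
 interpret Z: left_module R Z by (rule mZ)
 interpret S: left_module R S by (rule mS)
 have f: "hom S Z (%x. b (i x))" by (rule mhom_comp[OF i b])
 have nm: "~ stable_mono S Z (%x. b (i x))"
  by (rule summand_to_end_not_stable_mono[OF s ns lS S(2) i]) (rule lift)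
 obtain X W c d \<nu> where s': "ses S W X c d" "~ split_ses W X d" "hom W Z \<nu>" "\<forall>x\<in>carrier S. \<nu> (c x) = b (i x)"
  and X: "\<forall>\<C>. good \<C> --> S \<in> \<C> --> X \<in> \<C>"
  using not_mono_extension[OF S(1) lZ f nm] by (elim exE conjE) (rule that)
 have X: "X \<in> lev \<P> m" by (rule X[rule_format, OF lev_good[OF gP] m])
 obtain W' \<mu> \<nu>' where W: "W' \<in> lev \<P> (Suc m)" "hom S W' \<mu>" "hom W' Z \<nu>'" "\<forall>x\<in>carrier S. \<nu>' (\<mu> x) = \<nu> (c x)"
  and nomono: "~ (\<exists>r. hom W' S r & st S S (%x. r (\<mu> x)) (%x. x))"
  using factorization_through_higher_level_out[OF gP m le_refl X s'(1-3)] by (elim exE conjE) (rule that)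
 have lW: "lm W'" by (rule goodD(1)[OF lev_good[OF gP] W(1)])
 note mW = lm_md[OF lW]
 have "stable_epi W' Z \<nu>'"
 proof (rule ccontr)
  assume ne: "~ stable_epi W' Z \<nu>'"
  obtain t where t: "hom W' B t" "\<forall>x\<in>carrier W'. b (t x) = \<nu>' x" using lift[OF lW W(3) ne] by (elim exE conjE) (rule that)
  have tm: "hom S B (%x. t (\<mu> x))" by (rule mhom_comp[OF W(2) t(1)])
  have j: "hom S B (%x. i x \<oplus>[B] \<ominus>[B] t (\<mu> x))" by (rule mhom_sum[OF mB i mhom_neg[OF mB tm]])
  have bz: "b (i x \<oplus>[B] \<ominus>[B] t (\<mu> x)) = \<zero>[Z]" if x: "x \<in> carrier S" for x
  proof -
   have c: "i x \<in> carrier B" "t (\<mu> x) \<in> carrier B" using mhom_closed[OF i x] mhom_closed[OF tm x] by auto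
   have "b (i x) \<oplus>[Z] \<ominus>[Z] b (t (\<mu> x)) = \<zero>[Z]"
    using bspec[OF t(2) mhom_closed[OF W(2) x]] bspec[OF W(4) x] bspec[OF s'(4) x] mhom_closed[OF b c(1)] by (simp add: Z.M.r_neg)
   thus ?thesis using mhom_add[OF b c(1) B.M.a_inv_closed[OF c(2)]] mhom_minus[OF mB mZ b c(2)] by simp
  qed
  have "\<exists>v. hom S A v & (\<forall>x\<in>carrier S. a (v x) = i x \<oplus>[B] \<ominus>[B] t (\<mu> x))"
   by (rule ses_in[OF s mS j]) (rule bz)
  then obtain v where v: "hom S A v"
   and av0: "\<forall>x\<in>carrier S. a (v x) = i x \<oplus>[B] \<ominus>[B] t (\<mu> x)" by (elim exE conjE) (rule that)
  have vc: "!!x. x \<in> carrier S ==> v x \<in> carrier A" using mhom_closed[OF v] .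
  define k where "k = (%x. p (t (\<mu> x)))"
  define q where "q = (%x. p (a x))"
  have k: "hom S S k" unfolding k_def by (rule mhom_comp[OF tm p])
  have q: "hom A S q" unfolding q_def by (rule mhom_comp[OF a p])
  have kc: "!!x. x \<in> carrier S ==> k x \<in> carrier S" and qc: "!!x. x \<in> carrier A ==> q x \<in> carrier S"
   by (erule mhom_closed[OF k], erule mhom_closed[OF q])
  have split: "p (i x) = k x \<oplus>[S] q (v x)" if x: "x \<in> carrier S" for x
  proof -
   have c: "i x \<in> carrier B" "t (\<mu> x) \<in> carrier B" "a (v x) \<in> carrier B"
    using mhom_closed[OF i x] mhom_closed[OF tm x] mhom_closed[OF a vc[OF x]] by auto
   have "t (\<mu> x) \<oplus>[B] a (v x) = i x" using bspec[OF av0 x] c by (simp add: B.M.a_lcomm B.M.r_neg)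
   thus ?thesis unfolding k_def q_def using mhom_add[OF p c(2,3)] by simp
  qed
  define u where "u = (%x. v (q x))"
  have u: "hom A A u" unfolding u_def by (rule mhom_comp[OF q v])
  have uc: "!!x. x \<in> carrier A ==> u x \<in> carrier A" using mhom_closed[OF u] .
  have "~ stable_mono A A u"
  proof
   assume "stable_mono A A u"
   then obtain r where r: "hom A A r" "st A A (%x. r (u x)) (%x. x)" unfolding stable_mono_def by (elim exE conjE) (rule that)
   have "split_ses B Z b"
    using split_if_stable_retraction[OF s mhom_comp[OF mhom_comp[OF p v] r(1)]] r(2) unfolding u_def q_def by simp
   thus False using ns by simp
  qed
  moreover have "stable_mono A A u \<or> stable_mono A A (%x. x \<oplus>[A] \<ominus>[A] u x)" by (rule almost_split_local_end[OF s ns ext u])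
  ultimately have "stable_mono A A (%x. x \<oplus>[A] \<ominus>[A] u x)" by simp
  then obtain r where r: "hom A A r" "st A A (%x. r (x \<oplus>[A] \<ominus>[A] u x)) (%x. x)" unfolding stable_mono_def by (elim exE conjE) (rule that)
  obtain t1 where t1: "sz A A t1" "\<forall>x\<in>carrier A. r (x \<oplus>[A] \<ominus>[A] u x) = x \<oplus>[A] t1 x" using r(2) unfolding st_def by (elim exE conjE) (rule that)
  obtain t2 where t2: "sz S S t2" "\<forall>x\<in>carrier S. p (i x) = x \<oplus>[S] t2 x" using pi unfolding st_def by (elim exE conjE) (rule that)
  have rv: "hom S A (%x. r (v x))" by (rule mhom_comp[OF v r(1)])
  have qrv: "hom S S (%x. q (r (v x)))" by (rule mhom_comp[OF rv q])
  define y where "y = (%x. x \<oplus>[S] q (r (v x)))"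
  have y: "hom S S y" unfolding y_def by (rule mhom_sum[OF mS mhom_id qrv])
  have z: "sz S S (%x. t2 x \<oplus>[S] (q (t1 (v x)) \<oplus>[S] q (r (v (t2 x)))))"
   by (rule sz_sum[OF mS mS t2(1) sz_sum[OF mS mS sz_post[OF mS mA mS sz_pre[OF mS mA mA v t1(1)] q] sz_post[OF mS mS mS t2(1) qrv]]])
  have "st S S (%x. y (k x)) (%x. x)" unfolding st_def
  proof (intro exI conjI ballI, rule z)
   fix x assume x: "x \<in> carrier S"
   have c2: "t2 x \<in> carrier S" by (rule st_closed[OF mS mS t2(1) x])
   have c1: "t1 (v x) \<in> carrier A" by (rule st_closed[OF mA mA t1(1) vc[OF x]])
   have qv: "q (v x) \<in> carrier S" using qc vc x by simp
   have rc: "!!x. x \<in> carrier A ==> r x \<in> carrier A" using mhom_closed[OF r(1)] .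
   have e1: "k x \<oplus>[S] q (v x) = x \<oplus>[S] t2 x" using split[OF x] bspec[OF t2(2) x] by simp
   have "v (k x) \<oplus>[A] u (v x) = v x \<oplus>[A] v (t2 x)"
    unfolding u_def mhom_add[OF v kc[OF x] qv, symmetric] e1 mhom_add[OF v x c2] ..
   moreover have "v (k x) = (v (k x) \<oplus>[A] u (v x)) \<oplus>[A] \<ominus>[A] u (v x)"
    using vc[OF kc[OF x]] uc[OF vc[OF x]] by (simp add: A.M.a_assoc A.M.r_neg)
   ultimately have "v (k x) = (v x \<oplus>[A] v (t2 x)) \<oplus>[A] \<ominus>[A] u (v x)" by simp
   also have "... = (v x \<oplus>[A] \<ominus>[A] u (v x)) \<oplus>[A] v (t2 x)"
    using vc[OF x] vc[OF c2] uc[OF vc[OF x]] by (simp add: A.M.a_ac)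
   finally have "v (k x) = (v x \<oplus>[A] \<ominus>[A] u (v x)) \<oplus>[A] v (t2 x)" .
   hence "r (v (k x)) = (v x \<oplus>[A] t1 (v x)) \<oplus>[A] r (v (t2 x))"
    using mhom_add[OF r(1) _ vc[OF c2], of "v x \<oplus>[A] \<ominus>[A] u (v x)"] bspec[OF t1(2) vc[OF x]] vc[OF x] uc[OF vc[OF x]] by simp
   hence "q (r (v (k x))) = (q (v x) \<oplus>[S] q (t1 (v x))) \<oplus>[S] q (r (v (t2 x)))"
    using mhom_add[OF q vc[OF x] c1] mhom_add[OF q A.M.a_closed[OF vc[OF x] c1] rc[OF vc[OF c2]]] by simp
   hence "y (k x) = (k x \<oplus>[S] q (v x)) \<oplus>[S] (q (t1 (v x)) \<oplus>[S] q (r (v (t2 x))))"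
    unfolding y_def using kc[OF x] qv qc[OF c1] qc[OF rc[OF vc[OF c2]]] by (simp add: S.M.a_assoc)
   thus "y (k x) = x \<oplus>[S] (t2 x \<oplus>[S] (q (t1 (v x)) \<oplus>[S] q (r (v (t2 x)))))"
    unfolding e1 using x c2 qc[OF c1] qc[OF rc[OF vc[OF c2]]] by (simp add: S.M.a_assoc)
  qed
  thus False using nomono mhom_comp[OF mhom_comp[OF t(1) p] y] unfolding k_def by (elim notE) (rule exI, rule conjI)
 qed
 then obtain s where "hom Z W' s" "st Z Z (%x. \<nu>' (s x)) (%x. x)" unfolding stable_epi_def by (elim exE conjE) (rule that)
 hence "sret Z W'" by (intro sretI[OF lZ lW _ W(3)])
 thus ?thesis by (rule goodD(2)[OF lev_good[OF gP] W(1)])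
qed

section \<open>Stably finite dimensional modules\<close>

lemma cpt_lm: "cpt M ==> lm M" by (rule cptE)

lemma cpt_sret: "cpt Y ==> sret X Y ==> cpt X"
 unfolding cpt_def using sret_trans by blast

lemma fd_image:
 assumes Y: "md Y" and Z: "md Z" and f: "kl Y Z f" and s: "f ` carrier Y = carrier Z" and "fd Y"
 shows "fd Z"
proof -
 obtain E where E: "finite E" "E \<subseteq> carrier Y" "\<forall>U. subsp K (vs Y) U & E \<subseteq> U --> U = carrier Y"
  using assms(5) by (auto simp: fd_def)
 have "V = carrier Z" if V: "subsp K (vs Z) V" "f ` E \<subseteq> V" for V
 proof -
  let ?U = "{y\<in>carrier Y. f y \<in> V}"
  have "subsp K (vs Y) ?U"
   using V(1) Y kl_closed[OF f] kl_zero[OF Y Z f] by (auto simp: subsp_def kl_add[OF f] kl_sm[OF f])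
  hence "?U = carrier Y" using E V(2) by blast
  hence "f ` carrier Y \<subseteq> V" by auto
  thus ?thesis using s V(1) by (auto simp: subsp_def)
 qed
 thus ?thesis unfolding fd_def using E kl_closed[OF f]
  by (intro exI[of _ "f ` E"]) auto
qed

lemma fd_extension:
 assumes s: "ses A E B a b" and "fd A" "fd B" shows "fd E"
proof -
 have mA: "md A" and mE: "md E" and mB: "md B" and a: "hom A E a" and b: "hom E B b" and bs: "b ` carrier E = carrier B"
  and ex: "!!x. x \<in> carrier E ==> b x = \<zero>[B] ==> \<exists>y\<in>carrier A. x = a y"
  using s by (auto simp: ses_def lmod_def)
 interpret E: left_module R E by (rule mE)
 obtain F where F: "finite F" "F \<subseteq> carrier A" "\<forall>U. subsp K (vs A) U & F \<subseteq> U --> U = carrier A"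
  using assms(2) by (auto simp: fd_def)
 obtain H where H: "finite H" "H \<subseteq> carrier B" "\<forall>U. subsp K (vs B) U & H \<subseteq> U --> U = carrier B"
  using assms(3) by (auto simp: fd_def)
 obtain l where l: "kl B E l" "\<forall>y\<in>carrier B. b (l y) = y"
  using linear_section_exists[OF K.field_axioms left_module_vs[OF mE] left_module_vs[OF mB] hom_kl[OF b]] bs by auto
 have "V = carrier E" if V: "subsp K (vs E) V" "a ` F \<union> l ` H \<subseteq> V" for V
 proof -
  have "subsp K (vs A) {y\<in>carrier A. a y \<in> V}"
   using V(1) mA mhom_zero[OF mA mE a] kl_sm[OF hom_kl[OF a]] by (auto simp: subsp_def mhom_add[OF a])
  hence aV: "{y\<in>carrier A. a y \<in> V} = carrier A" using F V(2) by blast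
  have "subsp K (vs B) {y\<in>carrier B. l y \<in> V}"
   using V(1) mB kl_zero[OF mB mE l(1)] by (auto simp: subsp_def kl_add[OF l(1)] kl_sm[OF l(1)])
  hence lV: "{y\<in>carrier B. l y \<in> V} = carrier B" using H V(2) by blast
  have "x \<in> V" if x: "x \<in> carrier E" for x
  proof -
   have bc: "b x \<in> carrier B" by (rule mhom_closed[OF b x])
   have lc: "l (b x) \<in> carrier E" by (rule kl_closed[OF l(1) bc])
   have "b (x \<oplus>[E] \<ominus>[E] l (b x)) = b x \<oplus>[B] \<ominus>[B] b (l (b x))"
    using mhom_add[OF b x E.M.a_inv_closed[OF lc]] mhom_minus[OF mE mB b lc] by simp
   also have "... = \<zero>[B]" using bspec[OF l(2) bc] bc md_ab[OF mB] by (simp add: abelian_group.r_neg)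
   finally have "\<exists>y\<in>carrier A. x \<oplus>[E] \<ominus>[E] l (b x) = a y" by (intro ex) (use x lc in simp_all)
   then obtain y where y: "y \<in> carrier A" "x \<oplus>[E] \<ominus>[E] l (b x) = a y" by blast
   have "x = a y \<oplus>[E] l (b x)" unfolding y(2)[symmetric] using x lc by (simp add: E.M.a_assoc E.M.l_neg)
   moreover have "a y \<in> V" "l (b x) \<in> V" using aV y(1) lV bc by auto
   ultimately show ?thesis using V(1) by (metis subsp_def vs_simps(2))
  qed
  thus ?thesis using V(1) by (auto simp: subsp_def)
 qed
 thus ?thesis unfolding fd_def using F H mhom_closed[OF a] kl_closed[OF l(1)]
  by (intro exI[of _ "a ` F \<union> l ` H"]) auto
qed

text \<open>A linear retraction maps a finite spanning set of the middle term onto one of the sub.\<close>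

lemma fd_kernel:
 assumes s: "ses A E B a b" and "fd E" shows "fd A"
proof -
 have mA: "md A" and mE: "md E" and a: "hom A E a" and ai: "inj_on a (carrier A)" using s by (auto simp: ses_def lmod_def)
 obtain r where r: "kl E A r" "\<forall>x\<in>carrier A. r (a x) = x"
  using linear_retraction_exists[OF K.field_axioms left_module_vs[OF mA] left_module_vs[OF mE] hom_kl[OF a]] ai by auto
 have "r ` carrier E = carrier A"
 proof (intro equalityI subsetI)
  fix x assume x: "x \<in> carrier A"
  show "x \<in> r ` carrier E" by (rule image_eqI[of _ _ "a x"]) (use r(2) x mhom_closed[OF a x] in auto)
 qed (use kl_closed[OF r(1)] in auto)
 thus ?thesis by (rule fd_image[OF mE mA r(1) _ assms(2)])
qed

lemma fd_coind:
 assumes M: "md M" and "fd M" shows "fd (coind M)"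
proof -
 interpret C: left_module R "coind M" by (rule coind_md[OF M])
 obtain E where E: "finite E" "E \<subseteq> carrier M" "\<forall>U. subsp K (vs M) U & E \<subseteq> U --> U = carrier M"
  using assms(2) by (auto simp: fd_def)
 let ?F = "(%(g, e). coeff_map M g e) ` (carrier G \<times> E)"
 have "V = carrier (coind M)" if V: "subsp K (vs (coind M)) V" "?F \<subseteq> V" for V
 proof -
  have mem: "coeff_map M g m \<in> V" if g: "g \<in> carrier G" and m: "m \<in> carrier M" for g m
  proof -
   note k = coeff_map_kl[OF M g]
   have "subsp K (vs M) {y\<in>carrier M. coeff_map M g y \<in> V}"
    using V(1) M kl_zero[OF M coind_md[OF M] k] by (auto simp: subsp_def kl_add[OF k] kl_sm[OF k])
   hence "{y\<in>carrier M. coeff_map M g y \<in> V} = carrier M" using E V(2) g by blast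
   thus ?thesis using m by blast
  qed
  have fin: "finsum (coind M) f A \<in> V" if "finite A" "f \<in> A \<rightarrow> V" for f A
   using that
  proof (induct A)
   case empty
   show ?case using V(1) by (simp add: subsp_def)
  next
   case (insert x A)
   have "f \<in> insert x A \<rightarrow> carrier (coind M)" using insert V(1) by (auto simp: subsp_def)
   thus ?case using insert V(1) by (auto simp: subsp_def C.M.finsum_insert)
  qed
  have "\<xi> \<in> V" if xi: "\<xi> \<in> carrier (coind M)" for \<xi>
  proof -
   have e: "\<xi> (dl g) \<in> carrier M" for g using coind_eval[OF xi dl_closed] .
   have c: "(%g. coeff_map M g (\<xi> (dl g))) \<in> carrier G \<rightarrow> carrier (coind M)" using coeff_map_closed[OF M] e by auto
   have "\<xi> = finsum (coind M) (%g. coeff_map M g (\<xi> (dl g))) (carrier G)"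
   proof (rule coind_eqI[OF xi C.M.finsum_closed[OF c]])
    fix r assume r: "r \<in> carrier R"
    show "\<xi> r = finsum (coind M) (%g. coeff_map M g (\<xi> (dl g))) (carrier G) r"
     unfolding coind_finsum[OF M c r] using r kl_eval[OF M _ r] xi by (simp add: coeff_map_def coind_carrier)
   qed
   also have "... \<in> V" by (rule fin[OF finG]) (use mem e in auto)
   finally show ?thesis .
  qed
  thus ?thesis using V(1) by (auto simp: subsp_def)
 qed
 thus ?thesis unfolding fd_def using E finG coeff_map_closed[OF M]
  by (intro exI[of _ ?F]) auto
qed

lemma fd_cover:
 assumes M: "lm M" "fd M"
 shows "\<exists>P A a b. pj P & ses A P M a b & fd P"
proof -
 note mM = lm_md[OF M(1)]
 obtain C :: "('g => 'k, 'u) module" and \<phi> \<psi> where C: "pj C" "hom (coind M) C \<phi>" "hom C (coind M) \<psi>"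
  "!!x. x \<in> carrier (coind M) ==> \<psi> (\<phi> x) = x" "!!y. y \<in> carrier C ==> \<phi> (\<psi> y) = y"
  by (rule coind_in_universe[OF M(1)]) blast
 have eh: "hom C M (%x. coind_counit M (\<psi> x))" by (rule mhom_comp[OF C(3) counit_hom[OF mM]])
 have "(%x. coind_counit M (\<psi> x)) ` carrier C = carrier M"
 proof (intro equalityI subsetI)
  fix n assume n: "n \<in> carrier M"
  show "n \<in> (%x. coind_counit M (\<psi> x)) ` carrier C"
   by (rule image_eqI[of _ _ "\<phi> (coeff_map M \<one>[G] n)"])
    (use n C(4) mhom_closed[OF C(2)] coeff_map_closed[OF mM G.one_closed n] counit_surj[OF mM n] in auto)
 qed (use mhom_closed[OF eh] in auto)
 from kernel_ses[OF pj_lm[OF C(1)] M(1) eh this] have 1: "\<exists>A a b. ses A C M a b" by blast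
 have "\<phi> ` carrier (coind M) = carrier C"
 proof (intro equalityI subsetI)
  fix y assume y: "y \<in> carrier C"
  show "y \<in> \<phi> ` carrier (coind M)" by (rule image_eqI[of _ _ "\<psi> y"]) (use C(5)[OF y] mhom_closed[OF C(3) y] in auto)
 qed (use mhom_closed[OF C(2)] in auto)
 hence "fd C" by (rule fd_image[OF coind_md[OF mM] lm_md[OF pj_lm[OF C(1)]] hom_kl[OF C(2)] _ fd_coind[OF mM M(2)]])
 thus ?thesis using 1 C(1) by blast
qed

lemma cpt_desuspension:
 assumes s: "ses X P M i q" and P: "pj P" and M: "cpt M" shows "cpt X"
proof -
 obtain Y where Y: "fd Y" "sret M Y" using M by (auto simp: cpt_def)
 have lY: "lm Y" using Y(2) by (simp add: sret_def)
 obtain Q A a b where Q: "pj Q" "ses A Q Y a b" "fd Q" using fd_cover[OF lY Y(1)] by blast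
 have "sret X A" by (rule sret_desuspension[OF s Q(2) P Q(1) Y(2)])
 thus ?thesis using fd_kernel[OF Q(2,3)] by (auto simp: cpt_def)
qed

text \<open>Replace the quotient by pulling back along the retraction, then the sub by pushing out; the
  middle term stays a stable retract.\<close>

lemma cpt_extension:
 assumes s: "ses X Y Z a b" and X: "cpt X" and Z: "cpt Z" shows "cpt Y"
proof -
 obtain Z0 where Z0: "fd Z0" "sret Z Z0" using Z by (auto simp: cpt_def)
 obtain j q where jq: "lm Z0" "hom Z Z0 j" "hom Z0 Z q" "st Z Z (%x. q (j x)) (%x. x)" using Z0(2) by (auto simp: sret_def)
 obtain V a' b' e where V: "ses X V Z0 a' b'" "hom V Y e" "pullback_property Y Z0 b q V e b'"
  by (rule pullback[OF s jq(1,3)]) (rule that)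
 have lV: "lm V" using V(1) by (simp add: ses_def)
 have 1: "sret Y V" by (rule pullback_sret[OF s jq(1,3) jq(2,4) lV V(2,3)])
 obtain X0 where X0: "fd X0" "sret X X0" using X by (auto simp: cpt_def)
 obtain i p where ip: "lm X0" "hom X X0 i" "hom X0 X p" "st X X (%x. p (i x)) (%x. x)" using X0(2) by (auto simp: sret_def)
 obtain W c d h where W: "ses X0 W Z0 c d" "hom V W h" "pushout_property X V X0 a' i W h c"
  by (rule pushout[OF V(1) ip(1,2)]) (rule that)
 have lW: "lm W" using W(1) by (simp add: ses_def)
 have 2: "sret V W" by (rule pushout_sret[OF V(1) ip(1,2,3,4) lW W(2,3)])
 show ?thesis unfolding cpt_def using sret_trans[OF 1 2] fd_extension[OF W(1) X0(1) Z0(1)] by blast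
qed

lemma fin_gen_fd:
 assumes N: "md N" and fg: "fin_gen R N" shows "fd N"
proof -
 interpret N: left_module R N by (rule N)
 obtain A where A: "A \<subseteq> carrier N" "finite A"
  "\<forall>m\<in>carrier N. \<exists>c\<in>A \<rightarrow> carrier R. m = finsum N (%a. c a \<odot>[N] a) A" using fg by (auto simp: fin_gen_def)
 let ?E = "(%(g, a). ga N g a) ` (carrier G \<times> A)"
 have "V = carrier N" if V: "subsp K (vs N) V" "?E \<subseteq> V" for V
 proof -
  have fin: "finsum N f B \<in> V" if "finite B" "f \<in> B \<rightarrow> V" for f and B :: "'c set"
   using that
  proof (induct B)
   case empty
   show ?case using V(1) by (simp add: subsp_def)
  next
   case (insert x B)
   have "f \<in> insert x B \<rightarrow> carrier N" using insert V(1) by (auto simp: subsp_def)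
   thus ?case using insert V(1) by (auto simp: subsp_def N.M.finsum_insert)
  qed
  have r: "r \<odot>[N] a \<in> V" if r: "r \<in> carrier R" and a: "a \<in> A" for r a
  proof -
   have aN: "a \<in> carrier N" using A(1) a by auto
   have "finsum N (%g. sm N (r g) (ga N g a)) (carrier G) \<in> V"
    by (rule fin[OF finG]) (use V a R_eval[OF r] in \<open>auto simp: subsp_def\<close>)
   thus ?thesis using smult_decomp[OF N r aN] by simp
  qed
  have "m \<in> V" if m: "m \<in> carrier N" for m
  proof -
   obtain c where c: "c \<in> A \<rightarrow> carrier R" "m = finsum N (%a. c a \<odot>[N] a) A" using A(3) m by blast
   show ?thesis unfolding c(2) by (rule fin[OF A(2)]) (use c(1) r in auto)
  qed
  thus ?thesis using V(1) by (auto simp: subsp_def)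
 qed
 thus ?thesis unfolding fd_def using A N finG by (intro exI[of _ ?E]) auto
qed

end

context kGU begin

section \<open>The stable module category in terms of homomorphisms\<close>

abbreviation T :: "(('g => 'k, 'u) module, ('g => 'k, 'u) stable_map) tri_cat" where "T \<equiv> StMod R"

lemma mod_hom_hom: "f \<in> mod_hom R M N ==> hom M N f"
 by (auto simp: mod_hom_def mhom_def)

lemma hom_mod_hom: "md M ==> hom M N f ==> restrict f (carrier M) \<in> mod_hom R M N"
 by (auto simp: mod_hom_def mhom_closed mhom_add mhom_smult)

lemma projective_iff_pj:
 fixes P :: "('g => 'k, 'u) module"
 shows "projective R P \<longleftrightarrow> pj P"
proof
 assume P: "projective R P"
 hence lP: "lm P" by (simp add: projective_def)
 obtain Q A a b where Q: "pj Q" "ses A Q P a b" using enough_projectives(1)[OF lP] by blast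
 have b: "hom Q P b" "b ` carrier Q = carrier P" and lQ: "lm Q" using Q(2) by (auto simp: ses_def)
 have q: "restrict b (carrier Q) \<in> mod_hom R Q P" by (rule hom_mod_hom[OF lm_md[OF lQ] b(1)])
 have qs: "restrict b (carrier Q) ` carrier Q = carrier P" using b(2) by simp
 have i: "restrict (%x. x) (carrier P) \<in> mod_hom R P P" by (rule hom_mod_hom[OF lm_md[OF lP] mhom_id])
 obtain g where g: "g \<in> mod_hom R P Q" "\<forall>x\<in>carrier P. restrict b (carrier Q) (g x) = restrict (%x. x) (carrier P) x"
  using P[unfolded projective_def, THEN conjunct2, rule_format, OF lQ lP q qs i] by blast
 have gh: "hom P Q g" by (rule mod_hom_hom[OF g(1)])
 have "sret P Q"
  by (rule sret_exact[OF lP lQ gh b(1)]) (use g(2) mhom_closed[OF gh] in auto)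
 thus "pj P" by (rule pj_sret[OF Q(1)])
next
 assume P: "pj P"
 show "projective R P" unfolding projective_def
 proof (intro conjI ballI impI pj_lm[OF P])
  fix M N :: "('g => 'k, 'u) module" and q f
  assume a: "lm M" "lm N" "q \<in> mod_hom R M N" "q ` carrier M = carrier N" "f \<in> mod_hom R P N"
  have "sz P N f" by (rule pj_sz_out[OF P lm_md[OF a(2)] mod_hom_hom[OF a(5)]])
  from sz_lift[OF lm_md[OF a(1)] lm_md[OF a(2)] lm_md[OF pj_lm[OF P]] mod_hom_hom[OF a(3)] a(4) this]
  obtain g where "hom P M g" "\<forall>x\<in>carrier P. q (g x) = f x" by blast
  thus "\<exists>g\<in>mod_hom R P M. \<forall>x\<in>carrier P. q (g x) = f x"
   by (intro bexI[OF _ hom_mod_hom[OF lm_md[OF pj_lm[OF P]]]]) auto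
 qed
qed

text \<open>A trace lifts to a projective module mapping onto the target, and a map that factors through a
  projective module is a trace.\<close>

lemma stably_equal_iff_st:
 assumes M: "lm M" and N: "lm N" and f: "!!x. x \<in> carrier M ==> f x \<in> carrier N" and g: "!!x. x \<in> carrier M ==> g x \<in> carrier N"
 shows "stably_equal R M N f g \<longleftrightarrow> st M N f g"
proof -
 note mM = lm_md[OF M] and mN = lm_md[OF N]
 interpret N: left_module R N by (rule mN)
 show ?thesis
 proof
  assume "stably_equal R M N f g"
  then obtain P a b where P: "projective R P" "a \<in> mod_hom R M P" "b \<in> mod_hom R P N"
   "\<forall>x\<in>carrier M. f x \<ominus>[N] g x = b (a x)" unfolding stably_equal_def by blast
  have z: "sz M N (%x. b (a x))"
   by (rule sz_through_pj[OF _ mM mN mod_hom_hom[OF P(2)] mod_hom_hom[OF P(3)]]) (use P(1) projective_iff_pj in blast)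
  show "st M N f g" unfolding st_def
  proof (intro exI[of _ "%x. b (a x)"] conjI z ballI)
   fix x assume x: "x \<in> carrier M"
   show "f x = g x \<oplus>[N] b (a x)"
    using bspec[OF P(4) x] N.M.diff_eq_iff[OF f[OF x] g[OF x] st_closed[OF mM mN z x]] f[OF x] g[OF x] st_closed[OF mM mN z x]
    by (simp add: N.M.a_comm)
  qed
 next
  assume "st M N f g"
  then obtain t where t: "sz M N t" "\<forall>x\<in>carrier M. f x = g x \<oplus>[N] t x" unfolding st_def by (elim exE conjE) (rule that)
  obtain P A a b where P: "pj P" "ses A P N a b" using enough_projectives(1)[OF N] by blast
  have b: "hom P N b" "b ` carrier P = carrier N" and mP: "md P" using P(2) by (auto simp: ses_def lmod_def)
  obtain t' where t': "hom M P t'" "\<forall>x\<in>carrier M. b (t' x) = t x" using sz_lift[OF mP mN mM b t(1)] by blast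
  show "stably_equal R M N f g" unfolding stably_equal_def
  proof (intro exI[of _ P] conjI bexI[OF _ hom_mod_hom[OF mM t'(1)]] bexI[OF _ hom_mod_hom[OF mP b(1)]] ballI)
   show "projective R P" using P(1) projective_iff_pj by blast
   fix x assume x: "x \<in> carrier M"
   have c: "t x \<in> carrier N" by (rule st_closed[OF mM mN t(1) x])
   have "f x \<ominus>[N] g x = t x"
    using bspec[OF t(2) x] N.M.diff_eq_iff[OF f[OF x] g[OF x] c] g[OF x] c by (simp add: N.M.a_comm)
   thus "f x \<ominus>[N] g x = restrict b (carrier P) (restrict t' (carrier M) x)"
    using bspec[OF t'(2) x] mhom_closed[OF t'(1) x] x by simp
  qed
 qed
qed

text \<open>The class of an unrestricted homomorphism.\<close>

definition cl :: "('g => 'k, 'u) module => ('g => 'k, 'u) module => ('u => 'u) => ('g => 'k, 'u) stable_map" where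
 "cl M N f = (M, N, {g \<in> mod_hom R M N. st M N f g})"

lemma stable_class_cl:
 assumes "lm M" "lm N" "hom M N f" shows "stable_class R M N f = cl M N f"
proof -
 have "stably_equal R M N f g \<longleftrightarrow> st M N f g" if "g \<in> mod_hom R M N" for g
  by (rule stably_equal_iff_st[OF assms(1,2)]) (use mhom_closed[OF assms(3)] mhom_closed[OF mod_hom_hom[OF that]] in auto)
 thus ?thesis by (auto simp: stable_class_def cl_def)
qed

lemma cl_cong:
 assumes "lm M" "lm N" "hom M N f" "hom M N g" "st M N f g" shows "cl M N f = cl M N g"
 unfolding cl_def using st_trans[OF lm_md[OF assms(1)] lm_md[OF assms(2)] mod_hom_hom] assms(5)
  st_sym[OF lm_md[OF assms(1)] lm_md[OF assms(2)] assms(4,5)] by auto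

lemma cl_eq_iff:
 assumes M: "lm M" and N: "lm N" and f: "hom M N f" and g: "hom M N g"
 shows "cl M N f = cl M N g \<longleftrightarrow> st M N f g"
proof
 note mM = lm_md[OF M] and mN = lm_md[OF N]
 assume e: "cl M N f = cl M N g"
 let ?g = "restrict g (carrier M)"
 have gg: "st M N g ?g" by (rule st_eqI[OF mM mN g]) simp
 have "?g \<in> {h \<in> mod_hom R M N. st M N g h}" using hom_mod_hom[OF mM g] gg by simp
 hence "st M N f ?g" using e by (auto simp: cl_def)
 thus "st M N f g" by (rule st_trans[OF mM mN g _ st_sym[OF mM mN mod_hom_hom[OF hom_mod_hom[OF mM g]] gg]])
qed (rule cl_cong[OF assms])

lemma T_simps: "Obj T = lmod R" "Dom T (M, N, F) = M" "Cod T (M, N, F) = N" "Dom T (cl M N f) = M" "Cod T (cl M N f) = N"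
 by (simp_all add: StMod_def StMod_pre_def cl_def)

lemma Hom_iff: "F \<in> Hom T M N \<longleftrightarrow> lm M & lm N & (\<exists>f. hom M N f & F = cl M N f)"
proof
 assume "F \<in> Hom T M N"
 then obtain f where f: "lm M" "lm N" "f \<in> mod_hom R M N" "F = stable_class R M N f"
  by (auto simp: Hom_def StMod_def StMod_pre_def stable_class_def)
 thus "lm M & lm N & (\<exists>f. hom M N f & F = cl M N f)" using stable_class_cl[OF f(1,2) mod_hom_hom[OF f(3)]] mod_hom_hom[OF f(3)] by blast
next
 assume "lm M & lm N & (\<exists>f. hom M N f & F = cl M N f)"
 then obtain f where f: "lm M" "lm N" "hom M N f" "F = cl M N f" by blast
 let ?f = "restrict f (carrier M)"
 have m: "?f \<in> mod_hom R M N" by (rule hom_mod_hom[OF lm_md[OF f(1)] f(3)])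
 have e: "F = stable_class R M N ?f"
  unfolding f(4) stable_class_cl[OF f(1,2) mod_hom_hom[OF m]]
  by (rule cl_cong[OF f(1-3) mod_hom_hom[OF m] st_eqI[OF lm_md[OF f(1)] lm_md[OF f(2)] f(3)]]) simp
 hence "F \<in> Arr T" using f(1,2) m by (auto simp: StMod_def StMod_pre_def)
 thus "F \<in> Hom T M N" by (simp add: Hom_def f(4) T_simps)
qed

lemma cl_Hom: "lm M ==> lm N ==> hom M N f ==> cl M N f \<in> Hom T M N"
 using Hom_iff by blast

lemma Arr_Hom: "F \<in> Arr T \<longleftrightarrow> F \<in> Hom T (Dom T F) (Cod T F)"
 by (simp add: Hom_def)

lemma cl_Arr: "lm M ==> lm N ==> hom M N f ==> cl M N f \<in> Arr T"
 using cl_Hom by (auto simp: Hom_def)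

lemma cl_Comp:
 assumes M: "lm M" and N: "lm N" and L: "lm L" and f: "hom M N f" and g: "hom N L g"
 shows "cl N L g \<bullet>[T] cl M N f = cl M L (%x. g (f x))"
proof -
 note mM = lm_md[OF M] and mN = lm_md[OF N] and mL = lm_md[OF L]
 have gf: "hom M L (%x. g (f x))" by (rule mhom_comp[OF f g])
 have se: "stably_equal R M L (compose (carrier M) g' f') h \<longleftrightarrow> st M L (%x. g' (f' x)) h"
  if "hom M N f'" "hom N L g'" "h \<in> mod_hom R M L" for f' g' h
 proof -
  have c: "compose (carrier M) g' f' x = g' (f' x)" if "x \<in> carrier M" for x using that by (simp add: compose_def)
  have "stably_equal R M L (compose (carrier M) g' f') h \<longleftrightarrow> st M L (compose (carrier M) g' f') h"
   by (rule stably_equal_iff_st[OF M L]) (use c mhom_closed[OF mhom_comp[OF that(1,2)]] mhom_closed[OF mod_hom_hom[OF that(3)]] in auto)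
  also have "... \<longleftrightarrow> st M L (%x. g' (f' x)) h" unfolding st_def using c by simp
  finally show ?thesis .
 qed
 have "{h \<in> mod_hom R M L. \<exists>f'\<in>{f' \<in> mod_hom R M N. st M N f f'}. \<exists>g'\<in>{g' \<in> mod_hom R N L. st N L g g'}.
   stably_equal R M L (compose (carrier M) g' f') h} = {h \<in> mod_hom R M L. st M L (%x. g (f x)) h}" (is "?A = ?B")
 proof (intro equalityI subsetI)
  fix h assume "h \<in> ?A"
  then obtain f' g' where h: "h \<in> mod_hom R M L" and f': "f' \<in> mod_hom R M N" "st M N f f'"
   and g': "g' \<in> mod_hom R N L" "st N L g g'" and e: "stably_equal R M L (compose (carrier M) g' f') h" by blast
  have "st M L (%x. g (f x)) (%x. g' (f' x))"
   by (rule st_comp[OF mM mN mL mod_hom_hom[OF f'(1)] g mod_hom_hom[OF g'(1)] f'(2) g'(2)])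
  hence "st M L (%x. g (f x)) h"
   by (rule st_trans[OF mM mL mod_hom_hom[OF h]]) (use e se[OF mod_hom_hom[OF f'(1)] mod_hom_hom[OF g'(1)] h] in simp)
  thus "h \<in> ?B" using h by simp
 next
  fix h assume "h \<in> ?B"
  hence h: "h \<in> mod_hom R M L" "st M L (%x. g (f x)) h" by auto
  let ?f = "restrict f (carrier M)" and ?g = "restrict g (carrier N)"
  have m: "?f \<in> mod_hom R M N" "?g \<in> mod_hom R N L" by (rule hom_mod_hom[OF mM f], rule hom_mod_hom[OF mN g])
  have s: "st M N f ?f" "st N L g ?g" by (rule st_eqI[OF mM mN f], simp, rule st_eqI[OF mN mL g], simp)
  have "st M L (%x. ?g (?f x)) h"
   by (rule st_cong[OF h(2)]) (use mhom_closed[OF f] in auto)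
  hence "stably_equal R M L (compose (carrier M) ?g ?f) h" using se[OF mod_hom_hom[OF m(1)] mod_hom_hom[OF m(2)] h(1)] by simp
  thus "h \<in> ?A" using h(1) m s by blast
 qed
 thus ?thesis by (simp add: cl_def StMod_def StMod_pre_def)
qed

lemma Ident_cl: "lm M ==> Ident T M = cl M M (%x. x)"
proof -
 assume M: "lm M"
 note i = mod_hom_hom[OF hom_mod_hom[OF lm_md[OF M] mhom_id]]
 have "Ident T M = stable_class R M M (\<lambda>x\<in>carrier M. x)" by (simp add: StMod_def StMod_pre_def)
 also have "... = cl M M (\<lambda>x\<in>carrier M. x)" by (rule stable_class_cl[OF M M i])
 also have "... = cl M M (%x. x)"
  by (rule cl_cong[OF M M i mhom_id st_eqI[OF lm_md[OF M] lm_md[OF M] i]]) simp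
 finally show ?thesis .
qed

lemma Zero_cl: "lm M ==> lm N ==> Zero T M N = cl M N (%x. \<zero>[N])"
proof -
 assume M: "lm M" and N: "lm N"
 note z = mhom_const_zero[OF lm_md[OF N], of M]
 note i = mod_hom_hom[OF hom_mod_hom[OF lm_md[OF M] z]]
 have "Zero T M N = stable_class R M N (\<lambda>x\<in>carrier M. \<zero>[N])" by (simp add: StMod_def StMod_pre_def)
 also have "... = cl M N (\<lambda>x\<in>carrier M. \<zero>[N])" by (rule stable_class_cl[OF M N i])
 also have "... = cl M N (%x. \<zero>[N])"
  by (rule cl_cong[OF M N i z st_eqI[OF lm_md[OF M] lm_md[OF N] i]]) simp
 finally show ?thesis .
qed

lemma cl_zero_iff: "lm M ==> lm N ==> hom M N f ==> cl M N f = Zero T M N \<longleftrightarrow> sz M N f"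
 using cl_eq_iff[OF _ _ _ mhom_const_zero[OF lm_md]] st_zero_iff[OF lm_md lm_md] by (simp add: Zero_cl)

lemma cl_ident_iff: "lm M ==> hom M M f ==> cl M M f = Ident T M \<longleftrightarrow> st M M f (%x. x)"
 using cl_eq_iff[OF _ _ _ mhom_id] by (simp add: Ident_cl)

lemma split_mono_cl:
 assumes "lm M" "lm N" "hom M N f" shows "split_mono T (cl M N f) \<longleftrightarrow> stable_mono M N f"
proof
 assume "split_mono T (cl M N f)"
 then obtain r where "hom N M r" "cl N M r \<bullet>[T] cl M N f = Ident T M"
  by (auto simp: split_mono_def T_simps Hom_iff)
 thus "stable_mono M N f" using cl_Comp[OF assms(1,2,1,3)] cl_ident_iff[OF assms(1) mhom_comp[OF assms(3)]]
  unfolding stable_mono_def by metis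
next
 assume "stable_mono M N f"
 then obtain r where r: "hom N M r" "st M M (%x. r (f x)) (%x. x)" unfolding stable_mono_def by (elim exE conjE) (rule that)
 have "cl N M r \<bullet>[T] cl M N f = Ident T M"
  unfolding cl_Comp[OF assms(1,2,1,3) r(1)] cl_ident_iff[OF assms(1) mhom_comp[OF assms(3) r(1)]] by (rule r(2))
 thus "split_mono T (cl M N f)" unfolding split_mono_def T_simps using cl_Hom[OF assms(2,1) r(1)] by blast
qed

lemma split_epi_cl:
 assumes "lm M" "lm N" "hom M N f" shows "split_epi T (cl M N f) \<longleftrightarrow> stable_epi M N f"
proof
 assume "split_epi T (cl M N f)"
 then obtain r where "hom N M r" "cl M N f \<bullet>[T] cl N M r = Ident T N"
  by (auto simp: split_epi_def T_simps Hom_iff)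
 thus "stable_epi M N f" using cl_Comp[OF assms(2,1,2) _ assms(3)] cl_ident_iff[OF assms(2) mhom_comp[OF _ assms(3)]]
  unfolding stable_epi_def by metis
next
 assume "stable_epi M N f"
 then obtain r where r: "hom N M r" "st N N (%x. f (r x)) (%x. x)" unfolding stable_epi_def by (elim exE conjE) (rule that)
 have "cl M N f \<bullet>[T] cl N M r = Ident T N"
  unfolding cl_Comp[OF assms(2,1,2) r(1) assms(3)] cl_ident_iff[OF assms(2) mhom_comp[OF r(1) assms(3)]] by (rule r(2))
 thus "split_epi T (cl M N f)" unfolding split_epi_def T_simps using cl_Hom[OF assms(2,1) r(1)] by blast
qed

lemma T_comp_closed: "F \<in> Hom T X Y ==> H \<in> Hom T Y Z ==> H \<bullet>[T] F \<in> Hom T X Z"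
proof -
 assume a: "F \<in> Hom T X Y" "H \<in> Hom T Y Z"
 obtain f where f: "lm X" "lm Y" "hom X Y f" "F = cl X Y f" using a(1) Hom_iff by blast
 obtain h where h: "lm Z" "hom Y Z h" "H = cl Y Z h" using a(2) Hom_iff by blast
 show ?thesis unfolding f(4) h(3) cl_Comp[OF f(1,2) h(1) f(3) h(2)] by (rule cl_Hom[OF f(1) h(1) mhom_comp[OF f(3) h(2)]])
qed

lemma T_assoc: "F \<in> Hom T X Y ==> H \<in> Hom T Y Z ==> J \<in> Hom T Z W ==> (J \<bullet>[T] H) \<bullet>[T] F = J \<bullet>[T] (H \<bullet>[T] F)"
 by (auto simp: Hom_iff cl_Comp mhom_comp)

lemma T_ident: "F \<in> Hom T X Y ==> F \<bullet>[T] Ident T X = F" "F \<in> Hom T X Y ==> Ident T Y \<bullet>[T] F = F"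
 by (auto simp: Hom_iff Ident_cl cl_Comp mhom_id)

lemma T_zero: "F \<in> Hom T X Y ==> lm Z ==> F \<bullet>[T] Zero T Z X = Zero T Z Y"
 by (auto simp: Hom_iff Zero_cl cl_Comp mhom_const_zero lm_md mhom_zero[OF lm_md lm_md])

lemma retract_sret: "retract_of T X Y \<longleftrightarrow> sret X Y"
proof
 assume "retract_of T X Y"
 then obtain i r where "lm X" "lm Y" "hom X Y i" "hom Y X r" "cl Y X r \<bullet>[T] cl X Y i = Ident T X"
  by (auto simp: retract_of_def T_simps Hom_iff)
 thus "sret X Y" using sretI cl_Comp[of X Y X i r] cl_ident_iff[OF _ mhom_comp] by metis
next
 assume "sret X Y"
 then obtain i r where s: "lm X" "lm Y" "hom X Y i" "hom Y X r" "st X X (%x. r (i x)) (%x. x)"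
  unfolding sret_def by (elim exE conjE) (rule that)
 have "cl Y X r \<bullet>[T] cl X Y i = Ident T X"
  unfolding cl_Comp[OF s(1,2,1,3,4)] cl_ident_iff[OF s(1) mhom_comp[OF s(3,4)]] by (rule s(5))
 thus "retract_of T X Y" unfolding retract_of_def T_simps using s(1,2) cl_Hom[OF s(1,2,3)] cl_Hom[OF s(2,1,4)] by blast
qed

lemma zero_object_pj: "zero_object T X \<longleftrightarrow> pj X"
proof
 assume z: "zero_object T X"
 hence X: "lm X" by (simp add: zero_object_def T_simps)
 have "\<exists>!f. f \<in> Hom T X X" using z X by (simp add: zero_object_def T_simps)
 moreover have "Ident T X \<in> Hom T X X" "Zero T X X \<in> Hom T X X"
  using cl_Hom[OF X X mhom_id] cl_Hom[OF X X mhom_const_zero[OF lm_md[OF X]]] X by (simp_all add: Ident_cl Zero_cl)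
 ultimately have "cl X X (%x. x) = Zero T X X" using Ident_cl[OF X] by metis
 thus "pj X" using cl_zero_iff[OF X X mhom_id] X by (simp add: pj_def)
next
 assume p: "pj X"
 have X: "lm X" by (rule pj_lm[OF p])
 have *: "F = Zero T X Y" if F: "F \<in> Hom T X Y" for F Y
 proof -
  obtain f where f: "lm Y" "hom X Y f" "F = cl X Y f" using F Hom_iff by blast
  show ?thesis unfolding f(3) cl_zero_iff[OF X f(1,2)] by (rule pj_sz_out[OF p lm_md[OF f(1)] f(2)])
 qed
 have **: "F = Zero T Y X" if F: "F \<in> Hom T Y X" for F Y
 proof -
  obtain f where f: "lm Y" "hom Y X f" "F = cl Y X f" using F Hom_iff by blast
  show ?thesis unfolding f(3) cl_zero_iff[OF f(1) X f(2)] by (rule pj_sz_in[OF p lm_md[OF f(1)] f(2)])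
 qed
 have ex: "Zero T Y Z \<in> Hom T Y Z" if "lm Y" "lm Z" for Y Z
  using cl_Hom[OF that mhom_const_zero[OF lm_md[OF that(2)]]] Zero_cl[OF that] by simp
 show "zero_object T X" unfolding zero_object_def T_simps
 proof (intro conjI ballI X)
  fix Y :: "('g => 'k, 'u) module" assume Y: "lm Y"
  show "\<exists>!f. f \<in> Hom T X Y" by (rule ex1I[of "%F. F \<in> Hom T X Y" "Zero T X Y"], rule ex[OF X Y], erule *)
  show "\<exists>!f. f \<in> Hom T Y X" by (rule ex1I[of "%F. F \<in> Hom T Y X" "Zero T Y X"], rule ex[OF Y X], erule **)
 qed
qed

section \<open>Suspension and triangles\<close>

lemma short_exact_ses:
 assumes "short_exact R X Y Z a b" "lm X" "lm Y" "lm Z" shows "ses X Y Z a b"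
proof -
 have a: "hom X Y a" and b: "hom Y Z b" and k: "a ` carrier X = {y\<in>carrier Y. b y = \<zero>[Z]}"
  using assms(1) mod_hom_hom by (auto simp: short_exact_def a_kernel_def')
 have "b (a x) = \<zero>[Z]" if "x \<in> carrier X" for x using k that by blast
 moreover have "\<exists>x\<in>carrier X. y = a x" if "y \<in> carrier Y" "b y = \<zero>[Z]" for y using k that by blast
 ultimately show ?thesis unfolding ses_def using assms a b by (auto simp: short_exact_def)
qed

lemma ses_short_exact:
 assumes "ses X Y Z a b"
 shows "short_exact R X Y Z (restrict a (carrier X)) (restrict b (carrier Y))"
proof -
 have l: "lm X" "lm Y" "lm Z" "hom X Y a" "hom Y Z b" "inj_on a (carrier X)" "b ` carrier Y = carrier Z"
  and k: "!!x. x \<in> carrier X ==> b (a x) = \<zero>[Z]" "!!y. y \<in> carrier Y ==> b y = \<zero>[Z] ==> \<exists>x\<in>carrier X. y = a x"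
  using assms by (auto simp: ses_def)
 have "a ` carrier X = {y\<in>carrier Y. restrict b (carrier Y) y = \<zero>[Z]}"
  using k mhom_closed[OF l(4)] by (auto simp: image_iff)
 thus ?thesis unfolding short_exact_def a_kernel_def'
  using l hom_mod_hom[OF lm_md[OF l(1)] l(4)] hom_mod_hom[OF lm_md[OF l(2)] l(5)] by (auto simp: inj_on_def)
qed

lemma ses_cong:
 assumes "ses X Y Z a b" "!!x. x \<in> carrier X ==> a' x = a x" "!!y. y \<in> carrier Y ==> b' y = b y"
 shows "ses X Y Z a' b'"
proof -
 have l: "lm X" "lm Y" "lm Z" "hom X Y a" "hom Y Z b" using assms(1) by (auto simp: ses_def)
 have 1: "hom X Y a'" by (rule mhom_cong[OF l(4) _ lm_md[OF l(1)]]) (simp add: assms(2))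
 have 2: "hom Y Z b'" by (rule mhom_cong[OF l(5) _ lm_md[OF l(2)]]) (simp add: assms(3))
 have i: "inj_on a' (carrier X)" using assms(1,2) by (simp add: ses_def inj_on_def)
 have im: "b' ` carrier Y = carrier Z" using assms(1,3) by (simp add: ses_def image_def)
 show ?thesis unfolding ses_def
  using assms l 1 2 i im mhom_closed[OF l(4)] by (simp add: ses_def)
qed

lemma susp_data_ses:
 assumes X: "lm X"
 obtains P S i q where "susp_data R X = (P, S, i, q)" "pj P" "ses X P S i q" "Susp T X = S"
proof -
 let ?Q = "%(P, S, i, q). projective R P & S \<in> lmod R & short_exact R X P S i q"
 obtain P S i q where P: "pj P" "ses X P S i q" using enough_projectives(2)[OF X] by blast
 have "lm S" using P(2) by (simp add: ses_def)
 hence "?Q (P, S, restrict i (carrier X), restrict q (carrier P))"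
  using P ses_short_exact projective_iff_pj by auto
 hence s: "?Q (susp_data R X)" unfolding susp_data_def by (rule someI)
 obtain P' S' i' q' where e: "susp_data R X = (P', S', i', q')" by (cases "susp_data R X") auto
 have p: "pj P'" "lm S'" "short_exact R X P' S' i' q'" using s e projective_iff_pj by auto
 show thesis
  by (rule that[OF e p(1) short_exact_ses[OF p(3) X pj_lm[OF p(1)] p(2)]])
   (simp add: StMod_def StMod_pre_def Sigma_mod_def e)
qed

lemma Desusp_ses:
 assumes M: "lm M"
 obtains P i q where "pj P" "ses (Desusp T M) P M i q"
proof -
 let ?Q = "%(P, q). projective R P & q \<in> mod_hom R P M & q ` carrier P = carrier M"
 obtain P A a b where P: "pj P" "ses A P M a b" using enough_projectives(1)[OF M] by blast
 have b: "hom P M b" "b ` carrier P = carrier M" and mP: "md P" using P(2) by (auto simp: ses_def lmod_def)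
 have "?Q (P, restrict b (carrier P))" using P(1) b hom_mod_hom[OF mP b(1)] projective_iff_pj by simp
 hence s: "?Q (proj_surj R M)" unfolding proj_surj_def by (rule someI)
 obtain P' q' where e: "proj_surj R M = (P', q')" by (cases "proj_surj R M")
 have p: "pj P'" "hom P' M q'" "q' ` carrier P' = carrier M" using s e projective_iff_pj mod_hom_hom by auto
 have "Desusp T M = P'\<lparr>carrier := {x \<in> carrier P'. q' x = \<zero>[M]}\<rparr>"
  by (simp add: StMod_def StMod_pre_def Omega_def e a_kernel_def')
 thus thesis using that[OF p(1)] kernel_ses[OF pj_lm[OF p(1)] M p(2,3)] by simp
qed

text \<open>A stably equal \<open>h'\<close> is reached with the same representative \<open>f\<close>: the difference of \<open>h'\<close> and \<open>h\<close> lifts to \<open>P'\<close>, and this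
  lift corrects \<open>g\<close> without changing it on \<open>X\<close>.\<close>

lemma SuspArr_cl:
 assumes X: "lm X" and Y: "lm Y" and f: "hom X Y f" and dX: "susp_data R X = (P, S, i, q)" and dY: "susp_data R Y = (P', S', i', q')"
  and s: "ses X P S i q" and s': "ses Y P' S' i' q'" and P: "pj P" and P': "pj P'"
  and g: "hom P P' g" and h: "hom S S' h" and gi: "!!x. x \<in> carrier X ==> g (i x) = i' (f x)"
  and hq: "!!x. x \<in> carrier P ==> h (q x) = q' (g x)"
 shows "SuspArr T (cl X Y f) = cl S S' h"
proof -
 have lS: "lm S" and lS': "lm S'" and mX: "md X" and mY: "md Y" and mP: "md P" and mP': "md P'" and mS: "md S" and mS': "md S'"
  and ih: "hom X P i" and qh: "hom P S q" and ih': "hom Y P' i'" and qh': "hom P' S' q'" and qs': "q' ` carrier P' = carrier S'"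
  and qi: "!!x. x \<in> carrier X ==> q (i x) = \<zero>[S]"
  using s s' by (auto simp: ses_def lmod_def)
 interpret P': left_module R P' by (rule mP')
 interpret S': left_module R S' by (rule mS')
 interpret Y: left_module R Y by (rule mY)
 have "{h' \<in> mod_hom R S S'. \<exists>f'\<in>{f' \<in> mod_hom R X Y. st X Y f f'}. \<exists>g'\<in>mod_hom R P P'.
   (\<forall>x\<in>carrier X. g' (i x) = i' (f' x)) & (\<forall>y\<in>carrier P. h' (q y) = q' (g' y))} =
  {h' \<in> mod_hom R S S'. st S S' h h'}" (is "?A = ?B")
 proof (intro equalityI subsetI)
  fix h' assume "h' \<in> ?A"
  then obtain f' g' where h': "h' \<in> mod_hom R S S'" and f': "f' \<in> mod_hom R X Y" "st X Y f f'" and g': "g' \<in> mod_hom R P P'"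
   and gi': "\<forall>x\<in>carrier X. g' (i x) = i' (f' x)" and hq': "\<forall>y\<in>carrier P. h' (q y) = q' (g' y)" by (elim CollectE conjE bexE) (rule that)
  note hh = mod_hom_hom[OF h'] and ff = mod_hom_hom[OF f'(1)] and gg = mod_hom_hom[OF g']
  have z: "sz X Y (%x. f x \<ominus>[Y] f' x)" using f'(2) st_diff[OF mX mY f ff] by simp
  have "sz S S' (%x. h x \<ominus>[S'] h' x)"
  proof (rule suspend_sz[OF s s' P' z])
   show "hom P P' (%x. g x \<ominus>[P'] g' x)" unfolding a_minus_def by (rule mhom_sum[OF mP' g mhom_neg[OF mP' gg]])
   show "hom S S' (%x. h x \<ominus>[S'] h' x)" unfolding a_minus_def by (rule mhom_sum[OF mS' h mhom_neg[OF mS' hh]])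
   show "g (i x) \<ominus>[P'] g' (i x) = i' (f x \<ominus>[Y] f' x)" if x: "x \<in> carrier X" for x
    unfolding gi[OF x] bspec[OF gi' x] a_minus_def
     mhom_add[OF ih' mhom_closed[OF f x] Y.M.a_inv_closed[OF mhom_closed[OF ff x]]] mhom_minus[OF mY mP' ih' mhom_closed[OF ff x]] ..
   show "h (q x) \<ominus>[S'] h' (q x) = q' (g x \<ominus>[P'] g' x)" if x: "x \<in> carrier P" for x
    unfolding hq[OF x] bspec[OF hq' x] a_minus_def
     mhom_add[OF qh' mhom_closed[OF g x] P'.M.a_inv_closed[OF mhom_closed[OF gg x]]] mhom_minus[OF mP' mS' qh' mhom_closed[OF gg x]] ..
  qed
  thus "h' \<in> ?B" using h' st_diff[OF mS mS' h hh] by simp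
 next
  fix h' assume "h' \<in> ?B"
  hence h': "h' \<in> mod_hom R S S'" "st S S' h h'" by auto
  note hh = mod_hom_hom[OF h'(1)]
  have "st S S' h' h" by (rule st_sym[OF mS mS' hh h'(2)])
  then obtain t where t: "sz S S' t" "\<forall>x\<in>carrier S. h' x = h x \<oplus>[S'] t x" unfolding st_def by (elim exE conjE) (rule that)
  obtain t' where t': "hom S P' t'" "\<forall>x\<in>carrier S. q' (t' x) = t x" using sz_lift[OF mP' mS' mS qh' qs' t(1)] by blast
  let ?f = "restrict f (carrier X)"
  let ?k = "%x. g x \<oplus>[P'] t' (q x)"
  have kh: "hom P P' ?k" by (rule mhom_sum[OF mP' g mhom_comp[OF qh t'(1)]])
  let ?g = "restrict ?k (carrier P)"
  have 1: "?f \<in> {f' \<in> mod_hom R X Y. st X Y f f'}" using hom_mod_hom[OF mX f] st_eqI[OF mX mY f, of ?f] by simp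
  have 2: "?g \<in> mod_hom R P P'" by (rule hom_mod_hom[OF mP kh])
  have 3: "\<forall>x\<in>carrier X. ?g (i x) = i' (?f x)"
   using mhom_closed[OF ih] gi qi mhom_zero[OF mS mP' t'(1)] mhom_closed[OF ih' mhom_closed[OF f]] by simp
  have 4: "\<forall>y\<in>carrier P. h' (q y) = q' (?g y)"
  proof
   fix y assume y: "y \<in> carrier P"
   note qy = mhom_closed[OF qh y]
   show "h' (q y) = q' (?g y)"
    using bspec[OF t(2) qy] hq[OF y] bspec[OF t'(2) qy] mhom_add[OF qh' mhom_closed[OF g y] mhom_closed[OF t'(1) qy]] y by simp
  qed
  show "h' \<in> ?A" using h'(1) 1 2 3 4 by (intro CollectI conjI bexI[OF _ 1] bexI[OF _ 2]) simp_all
 qed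
 thus ?thesis by (simp add: StMod_def StMod_pre_def Sigma_map_def cl_def dX dY)
qed

lemma connecting_map_cl:
 assumes s: "ses X Y Z a b" and d: "susp_data R X = (P, S, i, q)" and sX: "ses X P S i q" and P: "pj P"
 obtains g \<delta> where "hom Y P g" "hom Z S \<delta>" "!!x. x \<in> carrier X ==> g (a x) = i x" "!!y. y \<in> carrier Y ==> \<delta> (b y) = q (g y)"
  "connecting_map R X Y Z a b = cl Z S \<delta>"
proof -
 have mX: "md X" and mY: "md Y" and mZ: "md Z" and mP: "md P" and mS: "md S" and a: "hom X Y a" and ai: "inj_on a (carrier X)"
  and b: "hom Y Z b" and bs: "b ` carrier Y = carrier Z" and ba: "!!x. x \<in> carrier X ==> b (a x) = \<zero>[Z]"
  and ih: "hom X P i" and qh: "hom P S q" and qs: "q ` carrier P = carrier S" and qi: "!!x. x \<in> carrier X ==> q (i x) = \<zero>[S]"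
  using s sX by (auto simp: ses_def lmod_def)
 interpret P: left_module R P by (rule mP)
 interpret S: left_module R S by (rule mS)
 obtain g where g: "hom Y P g" "\<forall>x\<in>carrier X. g (a x) = i x"
  using sz_extend[OF mX mY mP a ai pj_sz_in[OF P mX ih]] by blast
 have "\<exists>\<delta>. hom Z S \<delta> & (\<forall>y\<in>carrier Y. \<delta> (b y) = q (g y))"
  by (rule ses_out[OF s mS mhom_comp[OF g(1) qh]]) (simp add: bspec[OF g(2)] qi)
 then obtain \<delta> where de: "hom Z S \<delta>" "\<forall>y\<in>carrier Y. \<delta> (b y) = q (g y)" by blast
 have "{h \<in> mod_hom R Z S. \<exists>g'\<in>mod_hom R Y P. (\<forall>x\<in>carrier X. g' (a x) = i x) & (\<forall>y\<in>carrier Y. h (b y) = q (g' y))} =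
  {h \<in> mod_hom R Z S. st Z S \<delta> h}" (is "?A = ?B")
 proof (intro equalityI subsetI)
  fix h assume "h \<in> ?A"
  then obtain g' where h: "h \<in> mod_hom R Z S" and g': "g' \<in> mod_hom R Y P" "\<forall>x\<in>carrier X. g' (a x) = i x" "\<forall>y\<in>carrier Y. h (b y) = q (g' y)"
   by (elim CollectE conjE bexE) (rule that)
  note hh = mod_hom_hom[OF h] and gg = mod_hom_hom[OF g'(1)]
  have dh: "hom Y P (%y. g y \<ominus>[P] g' y)" unfolding a_minus_def by (rule mhom_sum[OF mP g(1) mhom_neg[OF mP gg]])
  have "\<exists>k. hom Z P k & (\<forall>y\<in>carrier Y. k (b y) = g y \<ominus>[P] g' y)"
   by (rule ses_out[OF s mP dh]) (use mhom_closed[OF ih] in \<open>simp add: bspec[OF g(2)] bspec[OF g'(2)] a_minus_def P.M.r_neg\<close>)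
  then obtain k where k: "hom Z P k" "\<forall>y\<in>carrier Y. k (b y) = g y \<ominus>[P] g' y" by blast
  have "sz Z S (%z. \<delta> z \<ominus>[S] h z)"
  proof (rule sz_cong[OF sz_through_pj[OF P mZ mS k(1) qh]])
   fix z assume "z \<in> carrier Z"
   then obtain y where y: "y \<in> carrier Y" "z = b y" using bs by auto
   show "\<delta> z \<ominus>[S] h z = q (k z)"
    unfolding y(2) bspec[OF de(2) y(1)] bspec[OF g'(3) y(1)] bspec[OF k(2) y(1)] a_minus_def
     mhom_add[OF qh mhom_closed[OF g(1) y(1)] P.M.a_inv_closed[OF mhom_closed[OF gg y(1)]]] mhom_minus[OF mP mS qh mhom_closed[OF gg y(1)]] ..
  qed
  thus "h \<in> ?B" using h st_diff[OF mZ mS de(1) hh] by simp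
 next
  fix h assume "h \<in> ?B"
  hence h: "h \<in> mod_hom R Z S" "st Z S \<delta> h" by auto
  note hh = mod_hom_hom[OF h(1)]
  have "st Z S h \<delta>" by (rule st_sym[OF mZ mS hh h(2)])
  then obtain t where t: "sz Z S t" "\<forall>x\<in>carrier Z. h x = \<delta> x \<oplus>[S] t x" unfolding st_def by (elim exE conjE) (rule that)
  obtain t' where t': "hom Z P t'" "\<forall>x\<in>carrier Z. q (t' x) = t x" using sz_lift[OF mP mS mZ qh qs t(1)] by blast
  let ?k = "%y. g y \<oplus>[P] t' (b y)"
  have kh: "hom Y P ?k" by (rule mhom_sum[OF mP g(1) mhom_comp[OF b t'(1)]])
  let ?g = "restrict ?k (carrier Y)"
  have 1: "?g \<in> mod_hom R Y P" by (rule hom_mod_hom[OF mY kh])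
  have 2: "\<forall>x\<in>carrier X. ?g (a x) = i x"
   using mhom_closed[OF a] mhom_closed[OF ih] ba mhom_zero[OF mZ mP t'(1)] by (simp add: bspec[OF g(2)])
  have 3: "\<forall>y\<in>carrier Y. h (b y) = q (?g y)"
  proof
   fix y assume y: "y \<in> carrier Y"
   note qy = mhom_closed[OF b y]
   show "h (b y) = q (?g y)"
    using bspec[OF t(2) qy] bspec[OF de(2) y] bspec[OF t'(2) qy] mhom_add[OF qh mhom_closed[OF g(1) y] mhom_closed[OF t'(1) qy]] y by simp
  qed
  show "h \<in> ?A" using h(1) 2 3 by (intro CollectI conjI bexI[OF _ 1]) simp_all
 qed
 hence c: "connecting_map R X Y Z a b = cl Z S \<delta>" by (simp add: connecting_map_def cl_def d)
 show thesis by (rule that[OF g(1) de(1) _ _ c]) (simp_all add: bspec[OF g(2)] bspec[OF de(2)])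
qed

end

context kGU begin

lemma isos_retracts:
 assumes "F \<in> isos T X Y" shows "sret X Y" "sret Y X"
proof -
 obtain H where "F \<in> Hom T X Y" "H \<in> Hom T Y X" "H \<bullet>[T] F = Ident T X" "F \<bullet>[T] H = Ident T Y"
  using assms by (auto simp: isos_def)
 moreover from this have "lm X" "lm Y" using Hom_iff by blast+
 ultimately have "retract_of T X Y" "retract_of T Y X" unfolding retract_of_def T_simps by blast+
 thus "sret X Y" "sret Y X" unfolding retract_sret .
qed

lemma iso_triangles_Tri: "iso_triangles (r\<lparr>Tri := A\<rparr>) = iso_triangles r"
 by (intro ext) (simp add: iso_triangles_def triangle_shape_def isos_def Hom_def)

lemma iso_triangles_pre:
 fixes t t' :: "('g => 'k, 'u) stable_map \<times> ('g => 'k, 'u) stable_map \<times> ('g => 'k, 'u) stable_map"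
 shows "iso_triangles (StMod_pre R) t t' = iso_triangles T t t'"
 unfolding StMod_def iso_triangles_Tri ..

lemma ses_triangle:
 assumes s: "ses X Y Z a b"
 obtains \<gamma> where "(cl X Y a, cl Y Z b, \<gamma>) \<in> Tri T"
proof -
 have l: "lm X" "lm Y" "lm Z" "hom X Y a" "hom Y Z b" using s by (auto simp: ses_def)
 let ?a = "restrict a (carrier X)" and ?b = "restrict b (carrier Y)"
 have s': "ses X Y Z ?a ?b" by (rule ses_cong[OF s]) simp_all
 have h: "hom X Y ?a" "hom Y Z ?b" using s' by (auto simp: ses_def)
 have e: "cl X Y a = cl X Y ?a" "cl Y Z b = cl Y Z ?b"
  by (rule cl_cong[OF l(1,2,4) h(1) st_eqI[OF lm_md[OF l(1)] lm_md[OF l(2)] l(4)]], simp,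
   rule cl_cong[OF l(2,3,5) h(2) st_eqI[OF lm_md[OF l(2)] lm_md[OF l(3)] l(5)]], simp)
 obtain P S i q where P: "susp_data R X = (P, S, i, q)" "pj P" "ses X P S i q" "Susp T X = S" by (rule susp_data_ses[OF l(1)])
 have lS: "lm S" using P(3) by (simp add: ses_def)
 obtain g \<delta> where d: "hom Z S \<delta>" "connecting_map R X Y Z ?a ?b = cl Z S \<delta>"
  by (rule connecting_map_cl[OF s' P(1,3,2)])
 have id: "Ident T M \<in> isos T M M" if "lm M" for M
 proof -
  have "Ident T M \<in> Hom T M M" using Ident_cl[OF that] cl_Hom[OF that that mhom_id] by simp
  thus ?thesis using T_ident[of "Ident T M" M M] by (auto simp: isos_def)
 qed
 have A: "cl X Y ?a \<in> Hom T X Y" "cl Y Z ?b \<in> Hom T Y Z" "cl Z S \<delta> \<in> Hom T Z S"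
  by (rule cl_Hom[OF l(1,2) h(1)], rule cl_Hom[OF l(2,3) h(2)], rule cl_Hom[OF l(3) lS d(1)])
 have SA: "SuspArr T (Ident T X) = Ident T S"
  unfolding Ident_cl[OF l(1)] Ident_cl[OF lS]
  by (rule SuspArr_cl[OF l(1,1) mhom_id P(1,1,3,3,2,2) mhom_id mhom_id]) simp_all
 have sh: "triangle_shape T (cl X Y ?a, cl Y Z ?b, cl Z S \<delta>)"
  using A by (simp add: triangle_shape_def Hom_def T_simps P(4))
 have "iso_triangles T (cl X Y ?a, cl Y Z ?b, cl Z S \<delta>) (cl X Y ?a, cl Y Z ?b, cl Z S \<delta>)"
  unfolding iso_triangles_def prod.case T_simps
  by (intro conjI sh, rule bexI[OF _ id[OF l(1)]], rule bexI[OF _ id[OF l(2)]], rule bexI[OF _ id[OF l(3)]])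
   (simp add: SA T_ident[OF A(1)] T_ident[OF A(2)] T_ident[OF A(3)])
 hence "(cl X Y ?a, cl Y Z ?b, cl Z S \<delta>) \<in> Tri T"
  unfolding iso_triangles_pre[symmetric] using ses_short_exact[OF s] l(1-3) d(2) stable_class_cl[OF l(1,2) h(1)] stable_class_cl[OF l(2,3) h(2)]
  by (subst StMod_def) (simp, intro bexI[of _ X] bexI[of _ Y] bexI[of _ Z] exI[of _ ?a] exI[of _ ?b], simp_all)
 thus thesis using that e by metis
qed

lemma triangle_ses:
 assumes t: "(\<alpha>, \<beta>, \<gamma>) \<in> Tri T"
 obtains X Y Z a b u v w where "ses X Y Z a b" "u \<in> isos T (Dom T \<alpha>) X" "v \<in> isos T (Cod T \<alpha>) Y" "w \<in> isos T (Cod T \<beta>) Z"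
  "cl X Y a \<bullet>[T] u = v \<bullet>[T] \<alpha>" "cl Y Z b \<bullet>[T] v = w \<bullet>[T] \<beta>"
  "connecting_map R X Y Z a b \<bullet>[T] w = SuspArr T u \<bullet>[T] \<gamma>" "triangle_shape T (\<alpha>, \<beta>, \<gamma>)"
proof -
 obtain X Y Z a b where l: "lm X" "lm Y" "lm Z" and se: "short_exact R X Y Z a b"
  and it: "iso_triangles (StMod_pre R) (\<alpha>, \<beta>, \<gamma>) (stable_class R X Y a, stable_class R Y Z b, connecting_map R X Y Z a b)"
  using t unfolding StMod_def by auto
 have s: "ses X Y Z a b" by (rule short_exact_ses[OF se l])
 have h: "hom X Y a" "hom Y Z b" using s by (auto simp: ses_def)
 have it': "iso_triangles T (\<alpha>, \<beta>, \<gamma>) (cl X Y a, cl Y Z b, connecting_map R X Y Z a b)"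
  using it unfolding iso_triangles_pre stable_class_cl[OF l(1,2) h(1)] stable_class_cl[OF l(2,3) h(2)] .
 show thesis using it' unfolding iso_triangles_def prod.case T_simps
  by (elim conjE bexE) (rule that[OF s])
qed

section \<open>Projective classes and lengths\<close>

lemma projective_class_mem:
 assumes pc: "projective_class T \<P> \<I>" shows "X \<in> \<P> \<longleftrightarrow> lm X &
  (\<forall>A B g. lm A & lm B & hom A B g & cl A B g \<in> \<I> --> (\<forall>h. hom X A h --> sz X B (%x. g (h x))))"
proof -
 have P: "\<P> = {P \<in> Obj T. \<forall>g\<in>\<I>. \<forall>h\<in>Hom T P (Dom T g). g \<bullet>[T] h = Zero T P (Cod T g)}"
  and I: "\<I> \<subseteq> Arr T" using pc unfolding projective_class_def by blast+
 show ?thesis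
 proof (intro iffI conjI allI impI)
  assume X: "X \<in> \<P>"
  show lX: "lm X" using X P T_simps(1) by blast
  fix A B g h assume g: "lm A & lm B & hom A B g & cl A B g \<in> \<I>" and h: "hom X A h"
  have "\<forall>g\<in>\<I>. \<forall>h\<in>Hom T X (Dom T g). g \<bullet>[T] h = Zero T X (Cod T g)" using X P by blast
  moreover have "cl X A h \<in> Hom T X (Dom T (cl A B g))" using cl_Hom[OF lX _ h] g by (simp add: T_simps)
  ultimately have "cl A B g \<bullet>[T] cl X A h = Zero T X B" using g by (metis T_simps(5))
  thus "sz X B (%x. g (h x))" using cl_Comp[OF lX _ _ h] cl_zero_iff[OF lX _ mhom_comp[OF h]] g by simp
 next
  assume a: "lm X & (\<forall>A B g. lm A & lm B & hom A B g & cl A B g \<in> \<I> --> (\<forall>h. hom X A h --> sz X B (%x. g (h x))))"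
  hence lX: "lm X" by simp
  have "g \<bullet>[T] h = Zero T X (Cod T g)" if g: "g \<in> \<I>" and h: "h \<in> Hom T X (Dom T g)" for g h
  proof -
   have "g \<in> Hom T (Dom T g) (Cod T g)" using g I Arr_Hom by blast
   then obtain g0 where g0: "lm (Dom T g)" "lm (Cod T g)" "hom (Dom T g) (Cod T g) g0" "g = cl (Dom T g) (Cod T g) g0" unfolding Hom_iff by blast
   obtain h0 where h0: "hom X (Dom T g) h0" "h = cl X (Dom T g) h0" using h unfolding Hom_iff by blast
   have "sz X (Cod T g) (%x. g0 (h0 x))" using a g0 g h0(1) by metis
   hence "cl X (Cod T g) (%x. g0 (h0 x)) = Zero T X (Cod T g)" using cl_zero_iff[OF lX g0(2) mhom_comp[OF h0(1) g0(3)]] by simp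
   thus ?thesis using cl_Comp[OF lX g0(1,2) h0(1) g0(3)] g0(4) h0(2) by metis
  qed
  thus "X \<in> \<P>" using P lX T_simps(1) by blast
 qed
qed

text \<open>Membership is the vanishing of composites with \<open>\<I>\<close>, which passes to retracts and sums. Closure under the chosen
  suspension gives closure under all, since two suspensions of a module are stably isomorphic.\<close>

lemma projective_class_good:
 assumes pc: "projective_class T \<P> \<I>" shows "good \<P>"
proof -
 note mem = projective_class_mem[OF pc]
 have sz_mem: "sz X B (%x. g (h x))" if "X \<in> \<P>" "lm A" "lm B" "hom A B g" "cl A B g \<in> \<I>" "hom X A h" for X A B g h
  using that mem by blast
 have ret: "X \<in> \<P>" if Y: "Y \<in> \<P>" and r: "sret X Y" for X Y
  unfolding mem
 proof (intro conjI allI impI)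
  show lX: "lm X" using r by (simp add: sret_def)
  fix A B g h assume g: "lm A & lm B & hom A B g & cl A B g \<in> \<I>" and h: "hom X A h"
  obtain i p where ip: "lm Y" "hom X Y i" "hom Y X p" "st X X (%x. p (i x)) (%x. x)" using r unfolding sret_def by blast
  note mX = lm_md[OF lX]
  have gB: "md B" and gh: "hom X B (%x. g (h x))" using g lm_md mhom_comp[OF h] by auto
  have "sz Y B (%x. g (h (p x)))" by (rule sz_mem[OF Y]) (use g mhom_comp[OF ip(3) h] in auto)
  hence 1: "sz X B (%x. g (h (p (i x))))" by (rule sz_pre[OF mX lm_md[OF ip(1)] gB ip(2)])
  have "st X B (%x. g (h (p (i x)))) (%x. g (h x))" by (rule st_post[OF mX mX gB mhom_id ip(4) gh])
  hence "st X B (%x. g (h x)) (%x. g (h (p (i x))))" by (rule st_sym[OF mX gB gh])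
  thus "sz X B (%x. g (h x))" by (rule sz_st[OF mX gB _ 1])
 qed
 have sus: "Susp T X \<in> \<P>" "Desusp T X \<in> \<P>" if "X \<in> \<P>" for X using pc that unfolding projective_class_def by blast+
 have lmP: "lm X" if "X \<in> \<P>" for X using that mem by blast
 show ?thesis unfolding good_def
 proof (intro conjI ballI allI impI iffI)
  show "lm X" if "X \<in> \<P>" for X by (rule lmP[OF that])
  show "X \<in> \<P>" if "Y \<in> \<P> & sret X Y" for X Y using ret that by blast
  show "P \<in> \<P>" if P: "pj P" for P unfolding mem
  proof (intro conjI allI impI pj_lm[OF P])
   fix A B g h assume "lm A & lm B & hom A B g & cl A B g \<in> \<I>" "hom P A h"
   thus "sz P B (%x. g (h x))" using pj_sz_out[OF P _ mhom_comp[of R P A h B g]] lm_md by blast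
  qed
 next
  fix X P S i q assume a: "pj P & ses X P S i q" and X: "X \<in> \<P>"
  obtain P' S' i' q' where p: "pj P'" "ses X P' S' i' q'" "Susp T X = S'" by (rule susp_data_ses[OF lmP[OF X]])
  have "sret S S'" by (rule sret_suspension[OF _ p(2) _ p(1) sret_refl[OF lmP[OF X]]]) (use a in auto)
  thus "S \<in> \<P>" by (rule ret[rotated]) (use sus(1)[OF X] p(3) in simp)
 next
  fix X P S i q assume a: "pj P & ses X P S i q" and S: "S \<in> \<P>"
  obtain P' i' q' where p: "pj P'" "ses (Desusp T S) P' S i' q'" by (rule Desusp_ses[OF lmP[OF S]])
  have "sret X (Desusp T S)" by (rule sret_desuspension[OF _ p(2) _ p(1) sret_refl[OF lmP[OF S]]]) (use a in auto)
  thus "X \<in> \<P>" by (rule ret[OF sus(2)[OF S]])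
 next
  fix A B D i j p q assume a: "dsum A B D i j p q & A \<in> \<P> & B \<in> \<P>"
  have ds: "dsum A B D i j p q" and AP: "A \<in> \<P>" and BP: "B \<in> \<P>" using a by auto
  note d = dsumD[OF ds]
  show "D \<in> \<P>" unfolding mem
  proof (intro conjI allI impI d(3))
   fix A' B' g h assume g: "lm A' & lm B' & hom A' B' g & cl A' B' g \<in> \<I>" and h: "hom D A' h"
   have mB': "md B'" using g lm_md by blast
   have gh: "hom D B' (%x. g (h x))" using g mhom_comp[OF h] by blast
   have 1: "sz A B' (%x. g (h (i x)))" by (rule sz_mem[OF AP]) (use g mhom_comp[OF d(7) h] in auto)
   have 2: "sz B B' (%x. g (h (j x)))" by (rule sz_mem[OF BP]) (use g mhom_comp[OF d(8) h] in auto)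
   show "sz D B' (%x. g (h x))"
   proof (rule sz_cong[OF sz_sum[OF d(6) mB' sz_pre[OF d(6,4) mB' d(9) 1] sz_pre[OF d(6,5) mB' d(10) 2]]])
    fix x assume x: "x \<in> carrier D"
    have "g (h (i (p x) \<oplus>[D] j (q x))) = g (h (i (p x))) \<oplus>[B'] g (h (j (q x)))"
     by (rule mhom_add[OF gh d(16)[OF d(18)[OF x]] d(17)[OF d(19)[OF x]]])
    thus "g (h x) = g (h (i (p x))) \<oplus>[B'] g (h (j (q x)))" using d(15)[OF x] by simp
   qed
  qed
 qed
qed

lemma proj_level_step:
 assumes gP: "good \<P>" and gL: "good \<L>"
 shows "{X. \<exists>p q w. (p, q, w) \<in> Tri T & Dom T p \<in> \<P> & Cod T q \<in> \<L> & retract_of T X (Cod T p)} = ext \<P> \<L>"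
proof (intro equalityI subsetI)
 fix X assume "X \<in> {X. \<exists>p q w. (p, q, w) \<in> Tri T & Dom T p \<in> \<P> & Cod T q \<in> \<L> & retract_of T X (Cod T p)}"
 then obtain p q w where t: "(p, q, w) \<in> Tri T" "Dom T p \<in> \<P>" "Cod T q \<in> \<L>" "sret X (Cod T p)" unfolding retract_sret by blast
 obtain A Y B a b u v w where s: "ses A Y B a b" "u \<in> isos T (Dom T p) A" "v \<in> isos T (Cod T p) Y" "w \<in> isos T (Cod T q) B"
  by (rule triangle_ses[OF t(1)])
 show "X \<in> ext \<P> \<L>"
  by (rule extI[OF s(1) goodD(2)[OF gP t(2) isos_retracts(2)[OF s(2)]] goodD(2)[OF gL t(3) isos_retracts(2)[OF s(4)]]
   sret_trans[OF t(4) isos_retracts(1)[OF s(3)]]])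
next
 fix X assume "X \<in> ext \<P> \<L>"
 then obtain Y A B a b where s: "A \<in> \<P>" "B \<in> \<L>" "ses A Y B a b" "sret X Y" by (rule extE)
 obtain \<gamma> where "(cl A Y a, cl Y B b, \<gamma>) \<in> Tri T" by (rule ses_triangle[OF s(3)])
 thus "X \<in> {X. \<exists>p q w. (p, q, w) \<in> Tri T & Dom T p \<in> \<P> & Cod T q \<in> \<L> & retract_of T X (Cod T p)}"
  using s(1,2,4) unfolding retract_sret[symmetric]
  by (intro CollectI exI[of _ "cl A Y a"] exI[of _ "cl Y B b"] exI[of _ \<gamma>]) (simp add: T_simps)
qed

lemma proj_level_lev:
 assumes gP: "good \<P>" shows "proj_level T \<P> n = lev \<P> n"
proof -
 have "proj_level T \<P> n = lev \<P> n & proj_level T \<P> (Suc n) = lev \<P> (Suc n)"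
 proof (induction n)
  case 0
  have "zero_object T = pj" by (intro ext) (rule zero_object_pj)
  thus ?case by (simp add: ext_pj(1)[OF gP])
 next
  case (Suc n)
  thus ?case using proj_level_step[OF gP lev_good[OF gP, of "Suc n"]] by simp
 qed
 thus ?thesis by simp
qed

lemma lev_len:
 assumes gP: "good \<P>"
 shows "X \<in> lev \<P> n ==> len T \<P> X \<le> n" "X \<in> lev \<P> n ==> finite_len T \<P> X" "finite_len T \<P> X ==> X \<in> lev \<P> (len T \<P> X)"
 unfolding len_def finite_len_def proj_level_lev[OF gP] by (auto intro: Least_le LeastI)

lemma stmod_cpt:
 assumes "indecomposable (stmod R) M" shows "cpt M"
proof -
 obtain N F where "lm N" "fin_gen R N" "F \<in> isos T M N"
  using assms by (auto simp: indecomposable_def stmod_def full_subcat_def)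
 thus ?thesis using fin_gen_fd[OF lm_md] isos_retracts(1) unfolding cpt_def by blast
qed

section \<open>Irreducible maps and hearts\<close>

lemma irreducible_len:
 assumes pc: "projective_class T \<P> \<I>" and M: "cpt M" and N: "cpt N" and F: "F \<in> Hom T M N" and irr: "irreducible_map T F"
  and fM: "finite_len T \<P> M" and fN: "finite_len T \<P> N"
 shows "len T \<P> N \<le> Suc (len T \<P> M)" "len T \<P> M \<le> Suc (len T \<P> N)"
proof -
 note gP = projective_class_good[OF pc]
 note lM = cpt_lm[OF M] and lN = cpt_lm[OF N]
 obtain f where f: "hom M N f" "F = cl M N f" using F unfolding Hom_iff by blast
 have 1: "~ stable_mono M N f" "~ stable_epi M N f"
  using irr unfolding irreducible_map_def f(2) split_mono_cl[OF lM lN f(1)] split_epi_cl[OF lM lN f(1)] by blast+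
 have 2: "stable_mono M W \<mu> \<or> stable_epi W N \<nu>"
  if W: "lm W" "hom M W \<mu>" "hom W N \<nu>" "!!x. x \<in> carrier M ==> \<nu> (\<mu> x) = f x" for W \<mu> \<nu>
 proof -
  have "F = cl W N \<nu> \<bullet>[T] cl M W \<mu>" unfolding f(2) cl_Comp[OF lM W(1) lN W(2,3)]
   by (rule cl_cong[OF lM lN f(1) mhom_comp[OF W(2,3)] st_eqI[OF lm_md[OF lM] lm_md[OF lN] f(1)]]) (simp add: W(4))
  hence "split_mono T (cl M W \<mu>) \<or> split_epi T (cl W N \<nu>)"
   using irr[unfolded irreducible_map_def] cl_Arr[OF lM W(1,2)] cl_Arr[OF W(1) lN W(3)] f(2) T_simps(4,5) by metis
  thus ?thesis unfolding split_mono_cl[OF lM W(1,2)] split_epi_cl[OF W(1) lN W(3)] .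
 qed
 show "len T \<P> N \<le> Suc (len T \<P> M)"
  by (rule lev_len(1)[OF gP irreducible_target_level[OF gP M lN f(1) 1(1) 2 lev_len(3)[OF gP fM]]])
 show "len T \<P> M \<le> Suc (len T \<P> N)"
  by (rule lev_len(1)[OF gP irreducible_source_level[OF gP M N f(1) 1(2) 2 lev_len(3)[OF gP fN]]])
qed

text \<open>If the sequence splits, the connecting map factors through a projective module. Its comparison
  with \<open>\<gamma>\<close> involves the suspension of an isomorphism, which has a stable left inverse.\<close>

lemma nonzero_connecting_map_not_split:
 assumes t: "ses X Y Z a b" and u: "u \<in> isos T A X" and w: "w \<in> Hom T M Z" and g: "\<gamma> \<in> Hom T M (Susp T A)"
  and eq: "connecting_map R X Y Z a b \<bullet>[T] w = SuspArr T u \<bullet>[T] \<gamma>" and nz: "\<gamma> ~= Zero T M (Susp T A)"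
 shows "~ split_ses Y Z b"
proof
 assume "split_ses Y Z b"
 then obtain s where s: "hom Z Y s" "\<forall>z\<in>carrier Z. b (s z) = z" by (auto simp: split_ses_def)
 have l: "lm X" "lm Y" "lm Z" "hom Y Z b" using t by (auto simp: ses_def)
 have lM: "lm M" using w Hom_iff by blast
 obtain u0 u1 where u0: "lm A" "hom A X u0" "u = cl A X u0" "hom X A u1" "cl X A u1 \<bullet>[T] u = Ident T A"
  using u by (auto simp: isos_def Hom_iff)
 obtain P S i q where P: "susp_data R X = (P, S, i, q)" "pj P" "ses X P S i q" "Susp T X = S" by (rule susp_data_ses[OF l(1)])
 obtain P' S' i' q' where P': "susp_data R A = (P', S', i', q')" "pj P'" "ses A P' S' i' q'" "Susp T A = S'" by (rule susp_data_ses[OF u0(1)])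
 have lS: "lm S" "lm S'" and ih: "hom A P' i'" and qh: "hom P' S' q'" and qh0: "hom P S q" using P(3) P'(3) by (auto simp: ses_def)
 note mA = lm_md[OF u0(1)] and mP' = lm_md[OF pj_lm[OF P'(2)]] and mS' = lm_md[OF lS(2)]
 obtain k \<delta> where d: "hom Y P k" "hom Z S \<delta>" "!!y. y \<in> carrier Y ==> \<delta> (b y) = q (k y)" "connecting_map R X Y Z a b = cl Z S \<delta>"
  by (rule connecting_map_cl[OF t P(1,3,2)]) (rule that)
 have "sz Z S \<delta>"
 proof (rule sz_cong[OF sz_through_pj[OF P(2) lm_md[OF l(3)] lm_md[OF lS(1)] mhom_comp[OF s(1) d(1)] qh0]])
  fix z assume z: "z \<in> carrier Z"
  show "\<delta> z = q (k (s z))" using d(3)[OF mhom_closed[OF s(1) z]] bspec[OF s(2) z] by simp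
 qed
 hence "connecting_map R X Y Z a b = Zero T Z S" using cl_zero_iff[OF l(3) lS(1) d(2)] d(4) by simp
 moreover obtain w0 where w0: "hom M Z w0" "w = cl M Z w0" using w unfolding Hom_iff by blast
 ultimately have z: "SuspArr T u \<bullet>[T] \<gamma> = Zero T M S"
  using eq cl_Comp[OF lM l(3) lS(1) w0(1) mhom_const_zero[OF lm_md[OF lS(1)]]] Zero_cl[OF l(3) lS(1)] Zero_cl[OF lM lS(1)] by simp
 obtain g h where gh: "hom P' P g" "hom S' S h" "!!x. x \<in> carrier A ==> g (i' x) = i (u0 x)" "!!x. x \<in> carrier P' ==> h (q' x) = q (g x)"
  by (rule suspend_hom[OF P'(3) P(3,2) u0(2)]) (rule that)
 obtain g' h' where gh': "hom P P' g'" "hom S S' h'" "!!x. x \<in> carrier X ==> g' (i x) = i' (u1 x)" "!!x. x \<in> carrier P ==> h' (q x) = q' (g' x)"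
  by (rule suspend_hom[OF P(3) P'(3,2) u0(4)]) (rule that)
 have e: "SuspArr T u = cl S' S h" unfolding u0(3)
  by (rule SuspArr_cl[OF u0(1) l(1) u0(2) P'(1) P(1) P'(3) P(3) P'(2) P(2) gh(1,2) gh(3,4)])
 have hh: "hom S' S' (%x. h' (h x))" by (rule mhom_comp[OF gh(2) gh'(2)])
 have gg: "hom P' P' (%x. g' (g x))" by (rule mhom_comp[OF gh(1) gh'(1)])
 have uu: "hom A A (%x. u1 (u0 x))" by (rule mhom_comp[OF u0(2,4)])
 have "st A A (%x. u1 (u0 x)) (%x. x)"
  using u0(5) unfolding u0(3) cl_Comp[OF u0(1) l(1) u0(1,2,4)] cl_ident_iff[OF u0(1) uu] .
 hence z1: "sz A A (%x. u1 (u0 x) \<ominus>[A] x)" using st_diff[OF mA mA uu mhom_id] by simp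
 have "sz S' S' (%x. h' (h x) \<ominus>[S'] x)"
 proof (rule suspend_sz[OF P'(3) P'(3,2) z1])
  show "hom P' P' (%x. g' (g x) \<ominus>[P'] x)" unfolding a_minus_def by (rule mhom_sum[OF mP' gg mhom_neg[OF mP' mhom_id]])
  show "hom S' S' (%x. h' (h x) \<ominus>[S'] x)" unfolding a_minus_def by (rule mhom_sum[OF mS' hh mhom_neg[OF mS' mhom_id]])
  show "g' (g (i' x)) \<ominus>[P'] i' x = i' (u1 (u0 x) \<ominus>[A] x)" if x: "x \<in> carrier A" for x
   unfolding gh(3)[OF x] gh'(3)[OF mhom_closed[OF u0(2) x]] a_minus_def
    mhom_add[OF ih mhom_closed[OF uu x] md_neg[OF mA x]] mhom_minus[OF mA mP' ih x] ..
  show "h' (h (q' x)) \<ominus>[S'] q' x = q' (g' (g x) \<ominus>[P'] x)" if x: "x \<in> carrier P'" for x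
   unfolding gh(4)[OF x] gh'(4)[OF mhom_closed[OF gh(1) x]] a_minus_def
    mhom_add[OF qh mhom_closed[OF gg x] md_neg[OF mP' x]] mhom_minus[OF mP' mS' qh x] ..
 qed
 hence "st S' S' (%x. h' (h x)) (%x. x)" using st_diff[OF mS' mS' hh mhom_id] by simp
 hence "cl S S' h' \<bullet>[T] cl S' S h = Ident T S'"
  unfolding cl_Comp[OF lS(2,1,2) gh(2) gh'(2)] cl_ident_iff[OF lS(2) hh] .
 hence "\<gamma> = (cl S S' h' \<bullet>[T] cl S' S h) \<bullet>[T] \<gamma>" using T_ident(2)[OF g[unfolded P'(4)]] by simp
 also have "... = cl S S' h' \<bullet>[T] (cl S' S h \<bullet>[T] \<gamma>)"
  by (rule T_assoc[OF g[unfolded P'(4)] cl_Hom[OF lS(2,1) gh(2)] cl_Hom[OF lS gh'(2)]])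
 also have "... = Zero T M S'" using z e T_zero[OF cl_Hom[OF lS gh'(2)] lM] by simp
 finally show False using nz P'(4) by simp
qed

text \<open>The factorization properties transfer along the isomorphism of triangles, first up to
  stable equality; then strict lifts and extensions exist.\<close>

lemma AR_triangle_almost_split:
 assumes AR: "AR_triangle T (\<alpha>, \<beta>, \<gamma>)" and al: "\<alpha> \<in> Hom T A H" and be: "\<beta> \<in> Hom T H M"
 obtains X Y Z a b where "ses X Y Z a b" "~ split_ses Y Z b" "sret X A" "sret Y H" "sret H Y" "sret Z M" "sret M Z"
  "!!N t. lm N ==> hom N Z t ==> ~ stable_epi N Z t ==> \<exists>h. hom N Y h & (\<forall>x\<in>carrier N. b (h x) = t x)"
  "!!N t. lm N ==> hom X N t ==> ~ stable_mono X N t ==> \<exists>h. hom Y N h & (\<forall>x\<in>carrier X. h (a x) = t x)"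
proof -
 have dc: "Dom T \<alpha> = A" "Cod T \<alpha> = H" "Dom T \<beta> = H" "Cod T \<beta> = M" using al be by (auto simp: Hom_def)
 have tri: "(\<alpha>, \<beta>, \<gamma>) \<in> Tri T" and nz: "\<gamma> ~= Zero T (Dom T \<gamma>) (Cod T \<gamma>)"
  and left: "!!g. g \<in> Arr T ==> Dom T g = A ==> ~ split_mono T g ==> \<exists>h\<in>Hom T H (Cod T g). g = h \<bullet>[T] \<alpha>"
  and right: "!!g. g \<in> Arr T ==> Cod T g = M ==> ~ split_epi T g ==> \<exists>h\<in>Hom T (Dom T g) H. g = \<beta> \<bullet>[T] h"
  using AR unfolding AR_triangle_def prod.case dc by blast+
 obtain X Y Z a b u v w where s: "ses X Y Z a b" and i: "u \<in> isos T A X" "v \<in> isos T H Y" "w \<in> isos T M Z"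
  and sq: "cl X Y a \<bullet>[T] u = v \<bullet>[T] \<alpha>" "cl Y Z b \<bullet>[T] v = w \<bullet>[T] \<beta>" "connecting_map R X Y Z a b \<bullet>[T] w = SuspArr T u \<bullet>[T] \<gamma>"
  and sh: "triangle_shape T (\<alpha>, \<beta>, \<gamma>)" using triangle_ses[OF tri, unfolded dc] by metis
 have l: "lm X" "lm Y" "lm Z" "hom X Y a" "hom Y Z b" using s by (auto simp: ses_def)
 note mX = lm_md[OF l(1)] and mZ = lm_md[OF l(3)] and mY = lm_md[OF l(2)]
 have g: "\<gamma> \<in> Hom T M (Susp T A)" using sh by (simp add: triangle_shape_def Hom_def dc)
 hence nz': "\<gamma> ~= Zero T M (Susp T A)" using nz by (simp add: Hom_def)
 have U: "u \<in> Hom T A X" "v \<in> Hom T H Y" "w \<in> Hom T M Z" using i by (auto simp: isos_def)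
 obtain u' where u': "u' \<in> Hom T X A" "u' \<bullet>[T] u = Ident T A" "u \<bullet>[T] u' = Ident T X" using i(1) by (auto simp: isos_def)
 obtain v' where v': "v' \<in> Hom T Y H" "v' \<bullet>[T] v = Ident T H" "v \<bullet>[T] v' = Ident T Y" using i(2) by (auto simp: isos_def)
 obtain w' where w': "w' \<in> Hom T Z M" "w' \<bullet>[T] w = Ident T M" "w \<bullet>[T] w' = Ident T Z" using i(3) by (auto simp: isos_def)
 note ca = cl_Hom[OF l(1,2,4)] and cb = cl_Hom[OF l(2,3,5)]
 show thesis
 proof (rule that[OF s nonzero_connecting_map_not_split[OF s i(1) U(3) g sq(3) nz'] isos_retracts(2)[OF i(1)] isos_retracts(2)[OF i(2)]
   isos_retracts(1)[OF i(2)] isos_retracts(2)[OF i(3)] isos_retracts(1)[OF i(3)]])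
  fix N t assume N: "lm N" and t: "hom N Z t" and ne: "~ stable_epi N Z t"
  note ct = cl_Hom[OF N l(3) t]
  let ?F = "w' \<bullet>[T] cl N Z t"
  have F: "?F \<in> Hom T N M" by (rule T_comp_closed[OF ct w'(1)])
  have "~ split_epi T ?F"
  proof
   assume "split_epi T ?F"
   then obtain r where r: "r \<in> Hom T M N" "?F \<bullet>[T] r = Ident T M" using F by (auto simp: split_epi_def Hom_def)
   have tr: "cl N Z t \<bullet>[T] r \<in> Hom T M Z" by (rule T_comp_closed[OF r(1) ct])
   have "w' \<bullet>[T] (cl N Z t \<bullet>[T] r) = Ident T M" using r(2) T_assoc[OF r(1) ct w'(1)] by simp
   hence "w \<bullet>[T] (w' \<bullet>[T] (cl N Z t \<bullet>[T] r)) = w" using T_ident(1)[OF U(3)] by simp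
   hence "cl N Z t \<bullet>[T] r = w" using T_assoc[OF tr w'(1) U(3)] w'(3) T_ident(2)[OF tr] by simp
   hence "cl N Z t \<bullet>[T] (r \<bullet>[T] w') = Ident T Z" using T_assoc[OF w'(1) r(1) ct] w'(3) by simp
   hence "split_epi T (cl N Z t)" unfolding split_epi_def T_simps using T_comp_closed[OF w'(1) r(1)] by blast
   thus False using ne split_epi_cl[OF N l(3) t] by simp
  qed
  then obtain h where h: "h \<in> Hom T N H" "?F = \<beta> \<bullet>[T] h" using right[of ?F] F by (auto simp: Hom_def)
  obtain k where k: "hom N Y k" "v \<bullet>[T] h = cl N Y k" using T_comp_closed[OF h(1) U(2)] unfolding Hom_iff by blast
  have "cl Y Z b \<bullet>[T] (v \<bullet>[T] h) = (w \<bullet>[T] \<beta>) \<bullet>[T] h" using T_assoc[OF h(1) U(2) cb] sq(2) by simp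
  also have "... = w \<bullet>[T] ?F" using T_assoc[OF h(1) be U(3)] h(2) by simp
  also have "... = cl N Z t" using T_assoc[OF ct w'(1) U(3)] w'(3) T_ident(2)[OF ct] by simp
  finally have "cl N Z (%x. b (k x)) = cl N Z t" using k(2) cl_Comp[OF N l(2,3) k(1) l(5)] by simp
  hence "st N Z (%x. b (k x)) t" using cl_eq_iff[OF N l(3) mhom_comp[OF k(1) l(5)] t] by simp
  from stably_equal_lift[OF s lm_md[OF N] k(1) t this]
  show "\<exists>h. hom N Y h & (\<forall>x\<in>carrier N. b (h x) = t x)" by (elim exE conjE) (intro exI conjI)
 next
  fix N t assume N: "lm N" and t: "hom X N t" and nm: "~ stable_mono X N t"
  note ct = cl_Hom[OF l(1) N t]
  let ?F = "cl X N t \<bullet>[T] u"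
  have F: "?F \<in> Hom T A N" by (rule T_comp_closed[OF U(1) ct])
  have "~ split_mono T ?F"
  proof
   assume "split_mono T ?F"
   then obtain r where r: "r \<in> Hom T N A" "r \<bullet>[T] ?F = Ident T A" using F by (auto simp: split_mono_def Hom_def)
   have rt: "r \<bullet>[T] cl X N t \<in> Hom T X A" by (rule T_comp_closed[OF ct r(1)])
   have "(r \<bullet>[T] cl X N t) \<bullet>[T] u = Ident T A" using r(2) T_assoc[OF U(1) ct r(1)] by simp
   hence "((r \<bullet>[T] cl X N t) \<bullet>[T] u) \<bullet>[T] u' = u'" using T_ident(2)[OF u'(1)] by simp
   hence "r \<bullet>[T] cl X N t = u'" using T_assoc[OF u'(1) U(1) rt] u'(3) T_ident(1)[OF rt] by simp
   hence "(u \<bullet>[T] r) \<bullet>[T] cl X N t = Ident T X" using T_assoc[OF ct r(1) U(1)] u'(3) by simp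
   hence "split_mono T (cl X N t)" unfolding split_mono_def T_simps using T_comp_closed[OF r(1) U(1)] by blast
   thus False using nm split_mono_cl[OF l(1) N t] by simp
  qed
  then obtain h where h: "h \<in> Hom T H N" "?F = h \<bullet>[T] \<alpha>" using left[of ?F] F by (auto simp: Hom_def)
  obtain k where k: "hom Y N k" "h \<bullet>[T] v' = cl Y N k" using T_comp_closed[OF v'(1) h(1)] unfolding Hom_iff by blast
  note hv = T_comp_closed[OF v'(1) h(1)]
  have va: "v \<bullet>[T] \<alpha> \<in> Hom T A Y" by (rule T_comp_closed[OF al U(2)])
  have "((h \<bullet>[T] v') \<bullet>[T] cl X Y a) \<bullet>[T] u = (h \<bullet>[T] v') \<bullet>[T] (v \<bullet>[T] \<alpha>)" using T_assoc[OF U(1) ca hv] sq(1) by simp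
  also have "... = h \<bullet>[T] ((v' \<bullet>[T] v) \<bullet>[T] \<alpha>)" using T_assoc[OF va v'(1) h(1)] T_assoc[OF al U(2) v'(1)] by simp
  also have "... = cl X N t \<bullet>[T] u" using v'(2) T_ident(2)[OF al] h(2) by simp
  finally have "(cl X N (%x. k (a x)) \<bullet>[T] u) \<bullet>[T] u' = (cl X N t \<bullet>[T] u) \<bullet>[T] u'"
   using k(2) cl_Comp[OF l(1,2) N l(4) k(1)] by simp
  hence "cl X N (%x. k (a x)) = cl X N t"
   using T_assoc[OF u'(1) U(1) ct] T_assoc[OF u'(1) U(1) cl_Hom[OF l(1) N mhom_comp[OF l(4) k(1)]]] u'(3)
    T_ident(1)[OF ct] T_ident(1)[OF cl_Hom[OF l(1) N mhom_comp[OF l(4) k(1)]]] by simp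
  hence "st X N (%x. k (a x)) t" using cl_eq_iff[OF l(1) N mhom_comp[OF l(4) k(1)] t] by simp
  from stably_equal_extend[OF s lm_md[OF N] k(1) t this]
  show "\<exists>h. hom Y N h & (\<forall>x\<in>carrier X. h (a x) = t x)" by (elim exE conjE) (intro exI conjI)
 qed
qed

text \<open>The sub is a double desuspension of \<open>M\<close>, so it has at most the same length and is again
  stably finite dimensional.\<close>

lemma heart_len:
 assumes pc: "projective_class T \<P> \<I>" and M: "cpt M" "~ pj M" and fM: "finite_len T \<P> M"
  and H: "is_heart T M H" and S: "is_summand T S H" "~ zero_object T S"
 shows "finite_len T \<P> S" "len T \<P> S \<le> Suc (len T \<P> M)" "len T \<P> M \<le> Suc (len T \<P> S)"
proof -
 note gP = projective_class_good[OF pc]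
 note lM = cpt_lm[OF M(1)]
 let ?A = "Desusp T (Desusp T M)"
 obtain \<alpha> \<beta> \<gamma> where AR: "AR_triangle T (\<alpha>, \<beta>, \<gamma>)" and al: "\<alpha> \<in> Hom T ?A H" and be: "\<beta> \<in> Hom T H M"
  using H unfolding is_heart_def by blast
 obtain X Y Z a b where s: "ses X Y Z a b" and ns: "~ split_ses Y Z b" and r: "sret X ?A" "sret Y H" "sret H Y" "sret Z M" "sret M Z"
  and lift: "!!N t. lm N ==> hom N Z t ==> ~ stable_epi N Z t ==> \<exists>h. hom N Y h & (\<forall>x\<in>carrier N. b (h x) = t x)"
  and ext: "!!N t. lm N ==> hom X N t ==> ~ stable_mono X N t ==> \<exists>h. hom Y N h & (\<forall>x\<in>carrier X. h (a x) = t x)"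
  by (rule AR_triangle_almost_split[OF AR al be]) (rule that)
 obtain P i q where P: "pj P" "ses (Desusp T M) P M i q" by (rule Desusp_ses[OF lM])
 have lO: "lm (Desusp T M)" using P(2) by (simp add: ses_def)
 obtain P' i' q' where P': "pj P'" "ses ?A P' (Desusp T M) i' q'" by (rule Desusp_ses[OF lO])
 have Al: "?A \<in> lev \<P> n" if "M \<in> lev \<P> n" for n
  by (rule goodD(5)[OF lev_good[OF gP] P' goodD(5)[OF lev_good[OF gP] P that]])
 have cA: "cpt ?A" by (rule cpt_desuspension[OF P'(2,1) cpt_desuspension[OF P(2,1) M(1)]])
 have cY: "cpt Y" by (rule cpt_extension[OF s cpt_sret[OF cA r(1)] cpt_sret[OF M(1) r(4)]])
 have Mn: "M \<in> lev \<P> (len T \<P> M)" by (rule lev_len(3)[OF gP fM])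
 have "len T \<P> M ~= 0" using Mn M(2) by (intro notI) simp
 then obtain k where k: "len T \<P> M = Suc k" using not0_implies_Suc by blast
 have Mk: "M \<notin> lev \<P> k" using lev_len(1)[OF gP, of M k] k by auto
 have lv: "X \<in> lev \<P> (Suc k)" "Z \<in> lev \<P> (Suc k)" "Z \<notin> lev \<P> k"
  using goodD(2)[OF lev_good[OF gP] Al[OF Mn] r(1)] goodD(2)[OF lev_good[OF gP] Mn r(4)]
   goodD(2)[OF lev_good[OF gP] _ r(5)] Mk unfolding k by blast+
 have "Y \<in> lev \<P> (Suc (Suc k))"
  by (rule almost_split_middle_level[OF gP s lv]) (rule lift, assumption, assumption, simp add: stable_epi_def)
 moreover have "retract_of T S H" using S(1) unfolding is_summand_def is_biproduct_def retract_of_def by blast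
 hence SY: "sret S Y" using sret_trans[OF _ r(3)] unfolding retract_sret by blast
 ultimately have Sl: "S \<in> lev \<P> (Suc (Suc k))" by (intro goodD(2)[OF lev_good[OF gP] _ SY])
 show fS: "finite_len T \<P> S" by (rule lev_len(2)[OF gP Sl])
 show "len T \<P> S \<le> Suc (len T \<P> M)" using lev_len(1)[OF gP Sl] k by simp
 obtain j p where jp: "hom S Y j" "hom Y S p" "st S S (%x. p (j x)) (%x. x)" using SY unfolding sret_def by (elim exE conjE) (rule that)
 have nS: "~ pj S" using S(2) zero_object_pj by simp
 have "Z \<in> lev \<P> (Suc (len T \<P> S))"
  by (rule almost_split_summand_level[OF gP s ns lift ext cpt_sret[OF cY SY] nS jp lev_len(3)[OF gP fS]])
 hence "M \<in> lev \<P> (Suc (len T \<P> S))" by (rule goodD(2)[OF lev_good[OF gP] _ r(5)])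
 thus "len T \<P> M \<le> Suc (len T \<P> S)" by (rule lev_len(1)[OF gP])
qed

end

theorem corollary3p11:
  fixes K :: "('k, 'x) ring_scheme" and G :: "('g, 'y) monoid_scheme"
    and \<P> :: "('g \<Rightarrow> 'k, 'u) module set" and \<I> :: "('g \<Rightarrow> 'k, 'u) stable_map set"
  assumes "field K" and "group G" and "finite (carrier G)"
    and "ring_char K dvd order G"
    and "infinite (UNIV :: 'u set)" and "carrier K \<prec> (UNIV :: 'u set)"
    and "projective_class (StMod (group_algebra K G)) \<P> \<I>"
  shows "(\<forall>f M N.
            indecomposable (stmod (group_algebra K G)) M \<and> \<not> projective (group_algebra K G) M \<and>
            indecomposable (stmod (group_algebra K G)) N \<and> \<not> projective (group_algebra K G) N \<and>
            f \<in> Hom (StMod (group_algebra K G)) M N \<and>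
            irreducible_map (StMod (group_algebra K G)) f \<and>
            finite_len (StMod (group_algebra K G)) \<P> M \<and>
            finite_len (StMod (group_algebra K G)) \<P> N \<longrightarrow>
            int (len (StMod (group_algebra K G)) \<P> M) - 1
              \<le> int (len (StMod (group_algebra K G)) \<P> N) \<and>
            int (len (StMod (group_algebra K G)) \<P> N)
              \<le> int (len (StMod (group_algebra K G)) \<P> M) + 1) \<and>
         (\<forall>M H S.
            indecomposable (stmod (group_algebra K G)) M \<and> \<not> projective (group_algebra K G) M \<and>
            finite_len (StMod (group_algebra K G)) \<P> M \<and>
            is_heart (StMod (group_algebra K G)) M H \<and>
            is_summand (StMod (group_algebra K G)) S H \<and>
            \<not> zero_object (StMod (group_algebra K G)) S \<longrightarrow>
            finite_len (StMod (group_algebra K G)) \<P> S \<and>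
            int (len (StMod (group_algebra K G)) \<P> M) - 1
              \<le> int (len (StMod (group_algebra K G)) \<P> S) \<and>
            int (len (StMod (group_algebra K G)) \<P> S)
              \<le> int (len (StMod (group_algebra K G)) \<P> M) + 1)"
proof -
  interpret kGU K G "TYPE('u)"
    by (intro kGU.intro kG.intro kG_axioms.intro kGU_axioms.intro) (use assms in auto)
  note pc = assms(7)
  show ?thesis
  proof (intro conjI allI impI; elim conjE)
    fix f :: "('g \<Rightarrow> 'k, 'u) stable_map" and M N :: "('g \<Rightarrow> 'k, 'u) module"
    assume a: "indecomposable (stmod R) M" "indecomposable (stmod R) N" "f \<in> Hom T M N" "irreducible_map T f"
      "finite_len T \<P> M" "finite_len T \<P> N"
    note l = irreducible_len[OF pc stmod_cpt[OF a(1)] stmod_cpt[OF a(2)] a(3-6)]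
    show "int (len T \<P> M) - 1 \<le> int (len T \<P> N)" "int (len T \<P> N) \<le> int (len T \<P> M) + 1" using l by simp_all
  next
    fix M H S :: "('g \<Rightarrow> 'k, 'u) module"
    assume a: "indecomposable (stmod R) M" "\<not> projective R M" "finite_len T \<P> M" "is_heart T M H" "is_summand T S H"
      "\<not> zero_object T S"
    have "\<not> pj M" using a(2) projective_iff_pj by blast
    note l = heart_len[OF pc stmod_cpt[OF a(1)] this a(3-6)]
    show "finite_len T \<P> S" by (rule l(1))
    show "int (len T \<P> M) - 1 \<le> int (len T \<P> S)" "int (len T \<P> S) \<le> int (len T \<P> M) + 1" using l(2,3) by simp_all
  qed
qed

end
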